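(* Let $n\ge 1$ be an integer and $g>0$. For every partition $\lambda=(\lambda_1,\dots,\lambda_n)$, $\lambda_1\ge\dots\ge\lambda_n\ge 0$, the Jack polynomial $P_\lambda^{(1/g)}$ is an eigenfunction of the operator $Q_z$: $$[Q_z P_\lambda^{(1/g)}](\mathbf{x})=q_\lambda(z)\,P_\lambda^{(1/g)}(\mathbf{x}),\qquad z\in\mathbb{C},$$ where $q_\lambda(z)\in\mathbb{C}(g)[z]$, i.e. $q_\lambda(z)$ is a polynomial in $z$ with coefficients rational in $g$.
   Context: Notation: $\mathbb{N}=\{0,1,2,\dots\}$; $\Delta_n(\mathbf{x})=\prod_{1\le i<j\le n}(x_j-x_i)$; $\mathbb{C}[\mathbf{x}]^{S_n}$ is the ring of symmetric polynomials in $\mathbf{x}=(x_1,\dots,x_n)$. The operator $Q_z$. For $g>0$, real $z>1$, and reals $0<y_1<\dots<y_n$, and $p\in\mathbb{C}[\mathbf{x}]^{S_n}$ put $$[Q_zp](\mathbf{y})=\frac{\Gamma(ng)}{\Gamma(g)^n}\,\frac{(z-1)^{1-ng}}{\Delta_n(\mathbf{y})\prod_{i=1}^n y_i^{g-1}}\int_{\Omega_{\mathbf{x}}}d\mathbf{x}\;\delta(x_1\cdots x_n-z\,y_1\cdots y_n)\,\Delta_n(\mathbf{x})\Big[\prod_{i=1}^n\xi_i^{g-1}\Big]p(\mathbf{x}),$$ where $\Omega_{\mathbf{x}}=\{\mathbf{x}\in\mathbb{R}^n: 0<y_1<x_1<y_2<\dots<x_{n-1}<y_n<x_n<\infty\}$,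 $\xi_i=\prod_{k=1}^n(x_k-y_i)\big/\prod_{k\ne i}(y_k-y_i)>0$, and $\delta$ is the Dirac delta function (so $\int\delta(h(\mathbf x))F(\mathbf x)d\mathbf x=\int_{\{h=0\}}F\,dS/|\nabla h|$). The function $[Q_zp](\mathbf{y})$ is a polynomial in $z$ and a symmetric polynomial in $\mathbf{y}$; accordingly $Q_z$ is extended to all $z\in\mathbb{C}$ and (renaming $\mathbf{y}$ as $\mathbf{x}$) regarded as a linear operator on $\mathbb{C}[\mathbf{x}]^{S_n}$. Jack polynomials. For partitions $\mu,\lambda$ with $n$ parts (zeros allowed), $\mu\preceq\lambda$ means $\sum_{j=1}^n\mu_j=\sum_{j=1}^n\lambda_j$ and $\sum_{j=1}^k\mu_j\le\sum_{j=1}^k\lambda_j$ for $k=1,\dots,n-1$. $m_\lambda(\mathbf{x})$ is the sum of $x_1^{\nu_1}\cdots x_n^{\nu_n}$ over all distinct permutations $\nu$ of $\lambda$. The Jack polynomials $P_\lambda^{(1/g)}(\mathbf{x})\in\mathbb{C}(g)[\mathbf{x}]^{S_n}$ are the unique symmetric polynomials of the form $P_\lambda^{(1/g)}=m_\lambda+\sum_{\mu\prec\lambda}v_{\lambda\mu}(g)m_\mu$ such that $D(u;g)P_\lambda^{(1/g)}=\big[\prod_{i=1}^n(\lambda_i+(n-i)g+u)\big]P_\lambda^{(1/g)}$, where $$D(u;g)=\frac{(-1)^{n(n-1)/2}}{\Delta_n(\mathbf{x})}\det\Big[x_i^{n-j}\Big(x_i\frac{\partial}{\partial x_i}+(n-j)g+u\Big)\Big]_{i,j=1}^n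 .$$ *)

theory Defs
  imports
    "HOL-Analysis.Analysis"
    "HOL-Library.Poly_Mapping"
    "HOL-Combinatorics.Permutations"
    "HOL-Computational_Algebra.Computational_Algebra"
    "HOL-Computational_Algebra.Field_as_Ring"
begin

section \<open>Polynomials in the variables x_1, ..., x_n\<close>

text \<open>
  A polynomial is a finitely supported map from exponent vectors to coefficients; multiplication
  is the convolution product that \<^theory>\<open>HOL-Library.Poly_Mapping\<close> provides. The variables
  are indexed by \<open>{1..n}\<close>; predicates carrying the argument \<open>n\<close> say that no others occur.
\<close>

type_synonym expo = "nat \<Rightarrow>\<^sub>0 nat"
type_synonym 'a mpoly = "expo \<Rightarrow>\<^sub>0 'a"

definition mconst :: "'a::zero \<Rightarrow> 'a mpoly"
  where "mconst c = Poly_Mapping.single 0 c"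

definition mvar :: "nat \<Rightarrow> 'a::zero_neq_one mpoly"
  where "mvar i = Poly_Mapping.single (Poly_Mapping.single i 1) 1"

definition meval :: "(nat \<Rightarrow> 'a::comm_semiring_1) \<Rightarrow> 'a mpoly \<Rightarrow> 'a"
  where "meval x p = (\<Sum>\<nu>\<in>Poly_Mapping.keys p. Poly_Mapping.lookup p \<nu> *
           (\<Prod>i\<in>Poly_Mapping.keys \<nu>. x i ^ Poly_Mapping.lookup \<nu> i))"

definition mpderiv :: "nat \<Rightarrow> 'a::comm_semiring_1 mpoly \<Rightarrow> 'a mpoly"
  where "mpderiv i p = (\<Sum>\<nu>\<in>Poly_Mapping.keys p.
           Poly_Mapping.single (\<nu> - Poly_Mapping.single i 1)
             (of_nat (Poly_Mapping.lookup \<nu> i) * Poly_Mapping.lookup p \<nu>))"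

definition symmetric_mpoly :: "nat \<Rightarrow> 'a::zero mpoly \<Rightarrow> bool"
  where "symmetric_mpoly n p \<longleftrightarrow>
           (\<forall>\<nu>\<in>Poly_Mapping.keys p. Poly_Mapping.keys \<nu> \<subseteq> {1..n}) \<and>
           (\<forall>\<sigma>. \<sigma> permutes {1..n} \<longrightarrow>
              (\<forall>\<nu>. Poly_Mapping.lookup p (Poly_Mapping.map_key \<sigma> \<nu>) = Poly_Mapping.lookup p \<nu>))"


section \<open>Partitions with n parts\<close>

definition is_partition :: "nat \<Rightarrow> expo \<Rightarrow> bool"
  where "is_partition n lam \<longleftrightarrow> Poly_Mapping.keys lam \<subseteq> {1..n} \<and>
           antimono_on {1..n} (Poly_Mapping.lookup lam)"

definition dominated :: "nat \<Rightarrow> expo \<Rightarrow> expo \<Rightarrow> bool"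
  where "dominated n \<mu> lam \<longleftrightarrow>
           (\<Sum>j=1..n. Poly_Mapping.lookup \<mu> j) = (\<Sum>j=1..n. Poly_Mapping.lookup lam j) \<and>
           (\<forall>k\<in>{1..<n}. (\<Sum>j=1..k. Poly_Mapping.lookup \<mu> j) \<le> (\<Sum>j=1..k. Poly_Mapping.lookup lam j))"

definition strictly_below :: "nat \<Rightarrow> expo \<Rightarrow> expo set"
  where "strictly_below n lam = {\<mu>. is_partition n \<mu> \<and> dominated n \<mu> lam \<and> \<mu> \<noteq> lam}"

definition monomial_sym :: "nat \<Rightarrow> expo \<Rightarrow> 'a::comm_semiring_1 mpoly"
  where "monomial_sym n lam =
           (\<Sum>\<nu>\<in>{Poly_Mapping.map_key \<sigma> lam | \<sigma>. \<sigma> permutes {1..n}}. Poly_Mapping.single \<nu> 1)"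

text \<open>The sum over \<^const>\<open>strictly_below\<close> in the definition of Jack polynomials is a finite one.\<close>

lemma finite_strictly_below: "finite (strictly_below n lam)"
proof -
  define N where "N = (\<Sum>j=1..n. Poly_Mapping.lookup lam j)"
  let ?F = "{f :: nat \<Rightarrow> nat. \<forall>i. (i \<in> {1..n} \<longrightarrow> f i \<in> {0..N}) \<and> (i \<notin> {1..n} \<longrightarrow> f i = 0)}"
  have "Poly_Mapping.lookup ` strictly_below n lam \<subseteq> ?F"
  proof (rule image_subsetI)
    fix \<mu> assume mu: "\<mu> \<in> strictly_below n lam"
    have sum: "(\<Sum>j=1..n. Poly_Mapping.lookup \<mu> j) = N" and keys: "Poly_Mapping.keys \<mu> \<subseteq> {1..n}"
      using mu by (auto simp: strictly_below_def dominated_def is_partition_def N_def)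
    have "Poly_Mapping.lookup \<mu> i \<le> N" if "i \<in> {1..n}" for i
      using member_le_sum[of i "{1..n}" "Poly_Mapping.lookup \<mu>"] that sum by simp
    moreover have "Poly_Mapping.lookup \<mu> i = 0" if "i \<notin> {1..n}" for i
      using that keys by (meson in_keys_iff subsetD)
    ultimately show "Poly_Mapping.lookup \<mu> \<in> ?F" by auto
  qed
  moreover have "finite ?F" by (rule finite_set_of_finite_funs) auto
  ultimately have "finite (Poly_Mapping.lookup ` strictly_below n lam)"
    by (rule finite_subset)
  then show ?thesis
    by (rule finite_imageD) (simp add: inj_on_def)
qed


section \<open>The determinantal operator D(u; g)\<close>

definition mvandermonde :: "nat \<Rightarrow> 'a::comm_ring_1 mpoly"
  where "mvandermonde n = (\<Prod>j\<in>{1..n}. \<Prod>i\<in>{1..<j}. (mvar j - mvar i))"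

definition D_entry :: "nat \<Rightarrow> 'a \<Rightarrow> 'a \<Rightarrow> nat \<Rightarrow> nat \<Rightarrow> 'a::comm_ring_1 mpoly \<Rightarrow> 'a mpoly"
  where "D_entry n u g i j p =
           mvar i ^ (n - j) * (mvar i * mpderiv i p + mconst (of_nat (n - j) * g + u) * p)"

text \<open>
  Leibniz expansion of the determinant of the operator-valued matrix. The entries of different
  rows involve different variables and hence commute, so the order in which the factors of
  each term are composed (row 1 outermost) is immaterial.
\<close>

definition D_det :: "nat \<Rightarrow> 'a \<Rightarrow> 'a \<Rightarrow> 'a::comm_ring_1 mpoly \<Rightarrow> 'a mpoly"
  where "D_det n u g p =
           (\<Sum>\<sigma> | \<sigma> permutes {1..n}.
              of_int (sign \<sigma>) * foldr (\<lambda>i. D_entry n u g i (\<sigma> i)) [1..<Suc n] p)"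

text \<open>Because of the division by the Vandermonde product, values are formed in the field of fractions.\<close>

definition D_op :: "nat \<Rightarrow> 'a \<Rightarrow> 'a \<Rightarrow> 'a::idom mpoly \<Rightarrow> 'a mpoly fract"
  where "D_op n u g p = Fract ((-1) ^ (n * (n - 1) div 2) * D_det n u g p) (mvandermonde n)"


section \<open>Jack polynomials over C(g)\<close>

text \<open>
  The field \<open>C(g)\<close> is \<^typ>\<open>complex poly fract\<close>, and the parameter \<open>g\<close> is its generator.
  In the eigenvalue equation \<open>u\<close> runs through the infinite field \<open>C(g)\<close>, which amounts to
  treating it as an indeterminate.
\<close>

type_synonym ratfun = "complex poly fract"

definition g_param :: ratfun
  where "g_param = Fract [:0, 1:] 1"

definition is_jack :: "nat \<Rightarrow> expo \<Rightarrow> ratfun mpoly \<Rightarrow> bool"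
  where "is_jack n lam P \<longleftrightarrow>
           symmetric_mpoly n P \<and>
           (\<exists>v. P = monomial_sym n lam + (\<Sum>\<mu>\<in>strictly_below n lam. mconst (v \<mu>) * monomial_sym n \<mu>)) \<and>
           (\<forall>u. D_op n u g_param P =
              Fract (mconst (\<Prod>i=1..n. of_nat (Poly_Mapping.lookup lam i) + of_nat (n - i) * g_param + u) * P) 1)"


section \<open>Specialising the indeterminate g to a number\<close>

text \<open>
  \<^const>\<open>quot_of_fract\<close> gives numerator and denominator in lowest terms, so a rational function
  is regular at \<open>c\<close> iff its reduced denominator does not vanish there.
\<close>

definition ratfun_regular :: "complex \<Rightarrow> ratfun \<Rightarrow> bool"
  where "ratfun_regular c r \<longleftrightarrow> poly (snd (quot_of_fract r)) c \<noteq> 0"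

definition ratfun_at :: "complex \<Rightarrow> ratfun \<Rightarrow> complex"
  where "ratfun_at c r = poly (fst (quot_of_fract r)) c / poly (snd (quot_of_fract r)) c"

lemma ratfun_Fract:
  assumes "poly q c \<noteq> 0"
  shows "ratfun_regular c (Fract p q)" "ratfun_at c (Fract p q) = poly p c / poly q c"
proof -
  have q: "q \<noteq> 0" using assms by auto
  obtain d where d: "p = fst (normalize_quot (p, q)) * d" "q = snd (normalize_quot (p, q)) * d"
    using normalize_quotE[OF q, of p] by metis
  have *: "quot_of_fract (Fract p q) = normalize_quot (p, q)"
    using q by (metis quot_of_fract_quot_to_fract quot_to_fract_def split_conv)
  have pq: "poly p c = poly (fst (normalize_quot (p, q))) c * poly d c"
           "poly q c = poly (snd (normalize_quot (p, q))) c * poly d c"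
    using d by (metis poly_mult)+
  then show "ratfun_regular c (Fract p q)" "ratfun_at c (Fract p q) = poly p c / poly q c"
    using assms unfolding ratfun_regular_def ratfun_at_def * by auto
qed

definition specialize :: "real \<Rightarrow> ratfun mpoly \<Rightarrow> complex mpoly"
  where "specialize g = Poly_Mapping.map (ratfun_at (of_real g))"

definition specialize_poly :: "real \<Rightarrow> ratfun poly \<Rightarrow> complex poly"
  where "specialize_poly g = map_poly (ratfun_at (of_real g))"


section \<open>Integration against a delta function\<close>

text \<open>Points of real n-space are functions on \<open>nat\<close> of which only the values on \<open>{1..n}\<close> matter.\<close>

definition grad_norm :: "nat set \<Rightarrow> ((nat \<Rightarrow> real) \<Rightarrow> real) \<Rightarrow> (nat \<Rightarrow> real) \<Rightarrow> real"
  where "grad_norm I f x = L2_set (\<lambda>k. deriv (\<lambda>t. f (x(k := t))) (x k)) I"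

text \<open>
  Surface integral of \<open>F\<close> over the part in \<open>\<Omega>\<close> of the graph \<open>x_n = \<phi>(x_1, ..., x_(n-1))\<close>: the
  surface element is \<open>dS = sqrt (1 + |grad \<phi>|^2) dx_1 ... dx_(n-1)\<close>. For \<open>n = 1\<close> the measure on
  the empty product of lines is a unit point mass, so that the integral is the value of \<open>F\<close>.
\<close>

definition graph_integral ::
    "nat \<Rightarrow> ((nat \<Rightarrow> real) \<Rightarrow> real) \<Rightarrow> (nat \<Rightarrow> real) set \<Rightarrow> ((nat \<Rightarrow> real) \<Rightarrow> complex) \<Rightarrow> complex"
  where "graph_integral n \<phi> \<Omega> F =
           (LINT x : {x. x(n := \<phi> x) \<in> \<Omega>} | (\<Pi>\<^sub>M k\<in>{1..<n}. lborel).
              complex_of_real (sqrt (1 + (grad_norm {1..<n} \<phi> x)\<^sup>2)) * F (x(n := \<phi> x)))"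

text \<open>
  \<open>\<integral>\<^sub>\<Omega> \<delta>(h(x)) F(x) dx = \<integral>\<^bsub>{h = 0} \<inter> \<Omega>\<^esub> F dS / |grad h|\<close>, for \<open>h\<close> whose zero set in \<open>\<Omega>\<close> is
  the part in \<open>\<Omega>\<close> of the graph of \<open>\<phi>\<close>.
\<close>

definition delta_integral ::
    "nat \<Rightarrow> ((nat \<Rightarrow> real) \<Rightarrow> real) \<Rightarrow> ((nat \<Rightarrow> real) \<Rightarrow> real) \<Rightarrow> (nat \<Rightarrow> real) set \<Rightarrow>
       ((nat \<Rightarrow> real) \<Rightarrow> complex) \<Rightarrow> complex"
  where "delta_integral n h \<phi> \<Omega> F =
           graph_integral n \<phi> \<Omega> (\<lambda>x. F x / complex_of_real (grad_norm {1..n} h x))"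


section \<open>The operator Q_z\<close>

definition vandermonde :: "nat \<Rightarrow> (nat \<Rightarrow> real) \<Rightarrow> real"
  where "vandermonde n x = (\<Prod>j\<in>{1..n}. \<Prod>i\<in>{1..<j}. (x j - x i))"

definition chamber :: "nat \<Rightarrow> (nat \<Rightarrow> real) set"
  where "chamber n = {y. (\<forall>i\<in>{1..n}. 0 < y i) \<and> strict_mono_on {1..n} y}"

definition interlacing :: "nat \<Rightarrow> (nat \<Rightarrow> real) \<Rightarrow> (nat \<Rightarrow> real) set"
  where "interlacing n y = {x. (\<forall>i\<in>{1..n}. y i < x i) \<and> (\<forall>i\<in>{1..<n}. x i < y (Suc i))}"

definition xi :: "nat \<Rightarrow> (nat \<Rightarrow> real) \<Rightarrow> (nat \<Rightarrow> real) \<Rightarrow> nat \<Rightarrow> real"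
  where "xi n x y i = (\<Prod>k\<in>{1..n}. (x k - y i)) / (\<Prod>k\<in>{1..n} - {i}. (y k - y i))"

text \<open>
  On the interlacing region all coordinates are positive, so there \<open>x_1 \<cdots> x_n = z y_1 \<cdots> y_n\<close>
  can be solved for \<open>x_n\<close>.
\<close>

definition Q_integral :: "nat \<Rightarrow> real \<Rightarrow> real \<Rightarrow> complex mpoly \<Rightarrow> (nat \<Rightarrow> real) \<Rightarrow> complex"
  where "Q_integral n g z p y =
           complex_of_real (Gamma (real n * g) / Gamma g ^ n *
             ((z - 1) powr (1 - real n * g) / (vandermonde n y * (\<Prod>i=1..n. y i powr (g - 1))))) *
           delta_integral n
             (\<lambda>x. (\<Prod>i=1..n. x i) - z * (\<Prod>i=1..n. y i))
             (\<lambda>x. z * (\<Prod>i=1..n. y i) / (\<Prod>i\<in>{1..<n}. x i))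
             (interlacing n y)
             (\<lambda>x. complex_of_real (vandermonde n x * (\<Prod>i=1..n. xi n x y i powr (g - 1))) *
                  meval (\<lambda>i. complex_of_real (x i)) p)"

text \<open>
  The polynomial in \<open>z\<close>, with symmetric polynomials in \<open>x_1, ..., x_n\<close> as coefficients, that
  represents the integral for \<open>z > 1\<close> and \<open>0 < y_1 < ... < y_n\<close>. Its values define \<open>Q_z\<close> for
  all complex \<open>z\<close>.
\<close>

definition represents_Q :: "nat \<Rightarrow> real \<Rightarrow> complex mpoly \<Rightarrow> complex mpoly poly \<Rightarrow> bool"
  where "represents_Q n g p R \<longleftrightarrow>
           (\<forall>k. symmetric_mpoly n (coeff R k)) \<and>
           (\<forall>z>1. \<forall>y\<in>chamber n.
              meval (\<lambda>i. complex_of_real (y i)) (poly R (mconst (complex_of_real z))) = Q_integral n g z p y)"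

definition Q_op :: "nat \<Rightarrow> real \<Rightarrow> complex \<Rightarrow> complex mpoly \<Rightarrow> complex mpoly"
  where "Q_op n g z p = poly (THE R. represents_Q n g p R) (mconst z)"

end

theory Submission
  imports Defs
begin

text \<open>
  Write \<open>\<Prod>\<^sub>k (1 + w x_k) = \<Prod>\<^sub>k (1 + w y_k) (1 + \<Sum>\<^sub>i \<tau>_i w y_i / (1 + w y_i))\<close>. On the surface
  \<open>x_1 \<cdots> x_n = z y_1 \<cdots> y_n\<close> the residues \<open>\<tau>_i > 0\<close> are coordinates with sum \<open>z - 1\<close>, and they turn the
  kernel of \<open>Q_z\<close> into a Dirichlet distribution with parameters \<open>(g, ..., g)\<close>. Hence \<open>Q_z\<close> sends a
  product of elementary symmetric polynomials \<open>e_r\<close> to the Dirichlet mean of the same product of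
  \<open>\<Sum>\<^bsub>|S| = r\<^esub> (\<Prod>\<^bsub>i \<in> S\<^esub> y_i) (1 + \<Sum>\<^bsub>i \<in> S\<^esub> \<tau>_i)\<close>, which is triangular for the dominance order.

  The coefficient of \<open>u^(n - 2)\<close> in \<open>D(u; g)\<close> amounts to the Sutherland operator \<open>H\<close>. It commutes with \<open>Q_z\<close>:
  the operator \<open>H\<close> in \<open>x\<close> equals \<open>H\<close> in \<open>y\<close> plus operators in \<open>\<tau>\<close> whose Dirichlet mean vanishes.
  Since both sides are second-order differential operators, this needs checking only on the \<open>e_r\<close> and on
  pairs of them. The eigenvalues of \<open>H\<close> strictly decrease below \<open>\<lambda>\<close>, so a polynomial dominated by \<open>\<lambda>\<close>
  that has the eigenvalue of \<open>P_\<lambda>\<close> is a multiple of \<open>P_\<lambda>\<close>, and \<open>q_\<lambda>(z)\<close> is its leading coefficient.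
\<close>

section \<open>Substitution rules for integrals\<close>

lemma nn_integral_substitution_Ioo:
  fixes f :: "real \<Rightarrow> ennreal" and \<psi> \<psi>' :: "real \<Rightarrow> real"
  assumes f [measurable]: "f \<in> borel_measurable borel"
    and [measurable]: "\<psi> \<in> borel_measurable borel" "\<psi>' \<in> borel_measurable borel"
    and ab: "a < b"
    and cont: "continuous_on {a..b} \<psi>"
    and deriv: "\<And>x. a < x \<Longrightarrow> x < b \<Longrightarrow> (\<psi> has_real_derivative \<psi>' x) (at x)"
    and cont': "continuous_on {a<..<b} \<psi>'"
    and pos: "\<And>x. a < x \<Longrightarrow> x < b \<Longrightarrow> \<psi>' x > 0"
  shows "(\<integral>\<^sup>+x. f (\<psi> x) * ennreal (\<psi>' x) * indicator {a<..<b} x \<partial>lborel) =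
         (\<integral>\<^sup>+x. f x * indicator {\<psi> a<..<\<psi> b} x \<partial>lborel)"
proof -
  have mono: "\<psi> x < \<psi> y" if "a \<le> x" "x < y" "y \<le> b" for x y
  proof (rule DERIV_pos_imp_increasing_open[OF that(2)])
    fix t assume "x < t" "t < y"
    then show "\<exists>D. (\<psi> has_real_derivative D) (at t) \<and> D > 0"
      using deriv[of t] pos[of t] that by auto
  next
    show "continuous_on {x..y} \<psi>" using cont by (rule continuous_on_subset) (use that in auto)
  qed
  define h where "h k = (b - a) / (3 + real k)" for k
  have h0: "0 < h k" for k using ab by (simp add: h_def)
  have h3: "h k \<le> (b - a) / 3" for k unfolding h_def by (rule divide_left_mono) (use ab in auto)
  have hdec: "h (Suc k) \<le> h k" for k unfolding h_def by (rule divide_left_mono) (use ab in auto)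
  have hmono: "decseq h" by (rule decseq_SucI) (rule hdec)
  have hlim: "\<exists>k. h k < e" if "e > 0" for e
  proof -
    obtain k where k: "(b - a) / e < real k" using reals_Archimedean2 by blast
    have "b - a < e * real k" using k that by (simp add: field_simps)
    also have "\<dots> \<le> e * (3 + real k)" using that by simp
    finally have "h k < e" unfolding h_def by (simp add: field_simps)
    then show ?thesis ..
  qed
  have lt: "a + h k < b - h k" for k using h3[of k] ab by argo
  have in_ab: "{a + h k..b - h k} \<subseteq> {a<..<b}" for k using h0[of k] by auto
  have step: "(\<integral>\<^sup>+x. f x * indicator {\<psi> (a + h k)..\<psi> (b - h k)} x \<partial>lborel) =
      (\<integral>\<^sup>+x. f (\<psi> x) * ennreal (\<psi>' x) * indicator {a + h k..b - h k} x \<partial>lborel)" for k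
  proof (rule nn_integral_substitution_aux)
    show "continuous_on {a + h k..b - h k} \<psi>'"
      using cont' in_ab by (rule continuous_on_subset)
  qed (use in_ab[of k] lt[of k] deriv pos in \<open>auto intro: less_imp_le simp: subset_eq\<close>)
  have SUP1: "(SUP k. f x * indicator {\<psi> (a + h k)..\<psi> (b - h k)} x) = f x * indicator {\<psi> a<..<\<psi> b} x" for x
  proof -
    have "(SUP k. indicator {\<psi> (a + h k)..\<psi> (b - h k)} x :: ennreal) = indicator {\<psi> a<..<\<psi> b} x"
    proof (cases "x \<in> {\<psi> a<..<\<psi> b}")
      case True
      then obtain t where t: "a \<le> t" "t \<le> b" "\<psi> t = x"
        using IVT'[of \<psi> a x b] cont ab by (auto intro: less_imp_le)
      then have t': "a < t" "t < b" using True by (auto intro: le_neq_trans)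
      obtain k where k: "h k < min (t - a) (b - t)" using hlim[of "min (t - a) (b - t)"] t' by auto
      have "\<psi> (a + h k) \<le> x \<and> x \<le> \<psi> (b - h k)"
        using mono[of "a + h k" t] mono[of t "b - h k"] k h0[of k] t t' by auto
      then have "(1::ennreal) \<le> (SUP k. indicator {\<psi> (a + h k)..\<psi> (b - h k)} x)"
        by (intro SUP_upper2[of k]) auto
      moreover have "(SUP k. indicator {\<psi> (a + h k)..\<psi> (b - h k)} x) \<le> (1::ennreal)"
        by (intro SUP_least) (auto simp: indicator_def)
      ultimately show ?thesis using True by (auto intro: antisym)
    next
      case False
      have "x \<notin> {\<psi> (a + h k)..\<psi> (b - h k)}" for k
        using mono[of a "a + h k"] mono[of "b - h k" b] h0[of k] lt[of k] False by auto
      then show ?thesis using False by simp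
    qed
    then show ?thesis by (simp add: SUP_mult_left_ennreal[symmetric])
  qed
  have SUP2: "(SUP k. f (\<psi> x) * ennreal (\<psi>' x) * indicator {a + h k..b - h k} x) =
       f (\<psi> x) * ennreal (\<psi>' x) * indicator {a<..<b} x" for x
  proof -
    have "(SUP k. indicator {a + h k..b - h k} x :: ennreal) = indicator {a<..<b} x"
    proof (cases "x \<in> {a<..<b}")
      case True
      obtain k where k: "h k < min (x - a) (b - x)" using hlim[of "min (x - a) (b - x)"] True by auto
      then have "(1::ennreal) \<le> (SUP k. indicator {a + h k..b - h k} x)"
        by (intro SUP_upper2[of k]) auto
      moreover have "(SUP k. indicator {a + h k..b - h k} x) \<le> (1::ennreal)"
        by (intro SUP_least) (auto simp: indicator_def)
      ultimately show ?thesis using True by (auto intro: antisym)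
    next
      case False
      have "x \<notin> {a + h k..b - h k}" for k using h0[of k] False by auto
      then show ?thesis using False by simp
    qed
    then show ?thesis by (simp add: SUP_mult_left_ennreal[symmetric])
  qed
  have le: "{\<psi> (a + h k)..\<psi> (b - h k)} \<subseteq> {\<psi> (a + h (Suc k))..\<psi> (b - h (Suc k))}" for k
  proof -
    have mono': "\<psi> x \<le> \<psi> y" if "a \<le> x" "x \<le> y" "y \<le> b" for x y
      using mono[OF that(1) _ that(3)] that(2) by (cases "x = y") auto
    have "a \<le> a + h (Suc k)" "a + h (Suc k) \<le> a + h k" "a + h k \<le> b"
      "a \<le> b - h k" "b - h k \<le> b - h (Suc k)" "b - h (Suc k) \<le> b"
      using hdec[of k] h0[of k] h0[of "Suc k"] lt[of k] lt[of "Suc k"] by argo+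
    then have "\<psi> (a + h (Suc k)) \<le> \<psi> (a + h k)" "\<psi> (b - h k) \<le> \<psi> (b - h (Suc k))"
      by (blast intro: mono')+
    then show ?thesis by (simp add: subset_eq)
  qed
  have "(\<integral>\<^sup>+x. f (\<psi> x) * ennreal (\<psi>' x) * indicator {a<..<b} x \<partial>lborel) =
      (\<integral>\<^sup>+x. (SUP k. f (\<psi> x) * ennreal (\<psi>' x) * indicator {a + h k..b - h k} x) \<partial>lborel)"
    by (simp add: SUP2)
  also have "\<dots> = (SUP k. \<integral>\<^sup>+x. f (\<psi> x) * ennreal (\<psi>' x) * indicator {a + h k..b - h k} x \<partial>lborel)"
  proof (rule nn_integral_monotone_convergence_SUP)
    show "incseq (\<lambda>k x. f (\<psi> x) * ennreal (\<psi>' x) * indicator {a + h k..b - h k} x)"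
    proof (intro incseq_SucI le_funI mult_left_mono)
      fix k x
      have "{a + h k..b - h k} \<subseteq> {a + h (Suc k)..b - h (Suc k)}" using hdec[of k] by auto
      then show "(indicator {a + h k..b - h k} x::ennreal) \<le> indicator {a + h (Suc k)..b - h (Suc k)} x"
        by (auto simp: indicator_def)
    qed auto
  qed auto
  also have "\<dots> = (SUP k. \<integral>\<^sup>+x. f x * indicator {\<psi> (a + h k)..\<psi> (b - h k)} x \<partial>lborel)"
    by (simp add: step)
  also have "\<dots> = (\<integral>\<^sup>+x. (SUP k. f x * indicator {\<psi> (a + h k)..\<psi> (b - h k)} x) \<partial>lborel)"
  proof (rule nn_integral_monotone_convergence_SUP[symmetric])
    show "incseq (\<lambda>k x. f x * indicator {\<psi> (a + h k)..\<psi> (b - h k)} x)"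
    proof (intro incseq_SucI le_funI mult_left_mono)
      fix k x
      show "(indicator {\<psi> (a + h k)..\<psi> (b - h k)} x::ennreal) \<le> indicator {\<psi> (a + h (Suc k))..\<psi> (b - h (Suc k))} x"
        using le[of k] by (auto simp: indicator_def)
    qed auto
  qed auto
  also have "\<dots> = (\<integral>\<^sup>+x. f x * indicator {\<psi> a<..<\<psi> b} x \<partial>lborel)"
    by (simp add: SUP1)
  finally show ?thesis .
qed

lemma measurable_into_PiM_UNIV:
  assumes "\<And>i. (\<lambda>w. h w i) \<in> borel_measurable M"
  shows "h \<in> measurable M (\<Pi>\<^sub>M i\<in>UNIV. (borel :: real measure))"
proof -
  have "(\<lambda>w. \<lambda>i\<in>UNIV. h w i) \<in> measurable M (\<Pi>\<^sub>M i\<in>UNIV. (borel :: real measure))"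
    by (rule measurable_restrict) (use assms in simp)
  then show ?thesis by (simp add: restrict_def)
qed

lemma borel_measurable_component_if:
  "(\<lambda>x. if i \<in> I then x i else 0) \<in> borel_measurable (\<Pi>\<^sub>M k\<in>I. (lborel :: real measure))"
proof (cases "i \<in> I")
  case True
  then have "(\<lambda>x. x i) \<in> measurable (\<Pi>\<^sub>M k\<in>I. (lborel :: real measure)) lborel"
    by (rule measurable_component_singleton)
  then show ?thesis using True by simp
qed simp

lemma borel_measurable_component:
  "i \<in> I \<Longrightarrow> (\<lambda>x. x i) \<in> borel_measurable (\<Pi>\<^sub>M k\<in>I. (lborel :: real measure))"
  using borel_measurable_component_if[of i I] by simp

interpretation lborel_PiM: product_sigma_finite "\<lambda>_::nat. lborel :: real measure"
  by standard

lemma nn_integral_PiM_scale: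
  fixes h :: "(nat \<Rightarrow> real) \<Rightarrow> ennreal" and c :: "nat \<Rightarrow> real"
  assumes "finite I" and "\<And>i. i \<in> I \<Longrightarrow> c i > 0"
    and "h \<in> borel_measurable (\<Pi>\<^sub>M i\<in>UNIV. borel)"
    and "\<And>u v. (\<And>i. i \<in> I \<Longrightarrow> u i = v i) \<Longrightarrow> h u = h v"
  shows "(\<integral>\<^sup>+x. h x \<partial>(\<Pi>\<^sub>M i\<in>I. lborel)) =
    ennreal (\<Prod>i\<in>I. 1 / c i) * (\<integral>\<^sup>+x. h (\<lambda>i. x i / c i) \<partial>(\<Pi>\<^sub>M i\<in>I. lborel))"
  using assms
proof (induction I arbitrary: h rule: finite_induct)
  case empty
  have "h (\<lambda>k. undefined) = h (\<lambda>k. undefined / c k)" by (rule empty.prems(3)) simp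
  then show ?case by (simp add: lborel_PiM.nn_integral_empty)
next
  case (insert i I)
  note [measurable] = insert.prems(2)
  have cong: "h u = h v" if "\<And>k. k \<in> insert i I \<Longrightarrow> u k = v k" for u v
    using insert.prems(3) that by blast
  let ?P = "\<Pi>\<^sub>M i\<in>I. (lborel :: real measure)"
  let ?r = "\<lambda>x k. if k \<in> I then x k else (0::real)"
  have rI [measurable]: "(\<lambda>x. ?r x k) \<in> borel_measurable ?P" for k
    by (rule borel_measurable_component_if)
  have ri: "(\<lambda>x. if k \<in> insert i I then x k else 0) \<in> borel_measurable (\<Pi>\<^sub>M i\<in>insert i I. (lborel :: real measure))" for k
    by (rule borel_measurable_component_if)
  have m1: "(\<lambda>x. h x) \<in> borel_measurable (\<Pi>\<^sub>M i\<in>insert i I. lborel)"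
  proof -
    have "(\<lambda>x. h (\<lambda>k. if k \<in> insert i I then x k else 0)) \<in> borel_measurable (\<Pi>\<^sub>M i\<in>insert i I. lborel)"
      by (rule measurable_compose[OF measurable_into_PiM_UNIV insert.prems(2)]) (rule ri)
    also have "(\<lambda>x. h (\<lambda>k. if k \<in> insert i I then x k else 0)) = h"
      by (rule ext, rule cong) simp
    finally show ?thesis .
  qed
  have m2: "(\<lambda>x. h (\<lambda>k. x k / c k)) \<in> borel_measurable (\<Pi>\<^sub>M i\<in>insert i I. lborel)"
  proof -
    have "(\<lambda>x. h (\<lambda>k. (if k \<in> insert i I then x k else 0) / c k)) \<in> borel_measurable (\<Pi>\<^sub>M i\<in>insert i I. lborel)"
      by (rule measurable_compose[OF measurable_into_PiM_UNIV insert.prems(2)])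
        (rule borel_measurable_divide[OF ri], simp)
    also have "(\<lambda>x. h (\<lambda>k. (if k \<in> insert i I then x k else 0) / c k)) = (\<lambda>x. h (\<lambda>k. x k / c k))"
      by (rule ext, rule cong) simp
    finally show ?thesis .
  qed
  have ci: "c i > 0" using insert.prems(1) by simp
  have IH: "(\<integral>\<^sup>+x. h (x(i := t)) \<partial>?P) =
      ennreal (\<Prod>i\<in>I. 1 / c i) * (\<integral>\<^sup>+x. h ((\<lambda>k. x k / c k)(i := t)) \<partial>?P)" for t
  proof (rule insert.IH)
    show "(\<lambda>x. h (x(i := t))) \<in> borel_measurable (\<Pi>\<^sub>M i\<in>UNIV. borel)"
      by (rule measurable_compose[OF measurable_into_PiM_UNIV insert.prems(2)]) simp
    show "h (u(i := t)) = h (v(i := t))" if "\<And>k. k \<in> I \<Longrightarrow> u k = v k" for u v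
      by (rule cong) (use that in auto)
  qed (use insert.prems(1) in auto)
  have m3: "(\<lambda>(t, x). h ((\<lambda>k. x k / c k)(i := t))) \<in> borel_measurable (lborel \<Otimes>\<^sub>M ?P)"
  proof -
    have "(\<lambda>(t, x). h ((\<lambda>k. ?r x k / c k)(i := t))) \<in> borel_measurable (lborel \<Otimes>\<^sub>M ?P)"
      unfolding split_beta'
      by (rule measurable_compose[OF measurable_into_PiM_UNIV insert.prems(2)]) simp
    also have "(\<lambda>(t, x). h ((\<lambda>k. ?r x k / c k)(i := t))) = (\<lambda>(t, x). h ((\<lambda>k. x k / c k)(i := t)))"
      using insert.hyps(2) by (auto intro!: ext cong)
    finally show ?thesis .
  qed
  interpret P: sigma_finite_measure ?P
    by (rule lborel_PiM.sigma_finite) (rule insert.hyps(1))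
  have m4 [measurable]: "(\<lambda>t. \<integral>\<^sup>+x. h ((\<lambda>k. x k / c k)(i := t)) \<partial>?P) \<in> borel_measurable borel"
    using P.borel_measurable_nn_integral[OF m3] by simp
  have "(\<integral>\<^sup>+x. h x \<partial>(\<Pi>\<^sub>M i\<in>insert i I. lborel)) = (\<integral>\<^sup>+t. (\<integral>\<^sup>+x. h (x(i := t)) \<partial>?P) \<partial>lborel)"
    by (rule lborel_PiM.product_nn_integral_insert_rev[OF insert.hyps(1,2) m1])
  also have "\<dots> = ennreal (\<Prod>i\<in>I. 1 / c i) * (\<integral>\<^sup>+t. (\<integral>\<^sup>+x. h ((\<lambda>k. x k / c k)(i := t)) \<partial>?P) \<partial>lborel)"
    unfolding IH by (rule nn_integral_cmult) simp
  also have "(\<integral>\<^sup>+t. (\<integral>\<^sup>+x. h ((\<lambda>k. x k / c k)(i := t)) \<partial>?P) \<partial>lborel) =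
      ennreal (1 / c i) * (\<integral>\<^sup>+t. (\<integral>\<^sup>+x. h ((\<lambda>k. x k / c k)(i := t / c i)) \<partial>?P) \<partial>lborel)"
    using nn_integral_real_affine[OF m4, of "1 / c i" 0] ci by simp
  also have "(\<integral>\<^sup>+t. (\<integral>\<^sup>+x. h ((\<lambda>k. x k / c k)(i := t / c i)) \<partial>?P) \<partial>lborel) =
     (\<integral>\<^sup>+x. h (\<lambda>k. x k / c k) \<partial>(\<Pi>\<^sub>M i\<in>insert i I. lborel))"
  proof -
    have "(\<lambda>k. x k / c k)(i := t / c i) = (\<lambda>k. (x(i := t)) k / c k)" for x t
      by auto
    then show ?thesis
      by (simp add: lborel_PiM.product_nn_integral_insert_rev[OF insert.hyps(1,2) m2])
  qed
  finally show ?case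
    using insert.hyps ci insert.prems(1)
    by (simp add: mult.assoc[symmetric] ennreal_mult'[symmetric] prod_nonneg less_imp_le mult.commute)
qed

lemma prod_partial_fraction:
  fixes x y :: "'a \<Rightarrow> 'b :: field"
  assumes fin: "finite I" and inj: "inj_on y I"
  shows "(\<Prod>k\<in>I. (T - x k)) = (\<Prod>k\<in>I. (T - y k)) -
    (\<Sum>i\<in>I. (\<Prod>k\<in>I. (x k - y i)) / (\<Prod>k\<in>I - {i}. (y k - y i)) * (\<Prod>k\<in>I - {i}. (T - y k)))"
proof -
  define c where "c i = (\<Prod>k\<in>I. (x k - y i)) / (\<Prod>k\<in>I - {i}. (y k - y i))" for i
  define A where "A = (\<Prod>k\<in>I. [:- x k, 1:])"
  define B where "B = (\<Prod>k\<in>I. [:- y k, 1:])"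
  define C where "C = (\<Sum>i\<in>I. smult (c i) (\<Prod>k\<in>I - {i}. [:- y k, 1:]))"
  have monic: "degree (\<Prod>k\<in>J. [:- u k, 1:]) = card J \<and> lead_coeff (\<Prod>k\<in>J. [:- u k, 1:]) = 1"
    for J and u :: "'a \<Rightarrow> 'b"
    using degree_prod_eq_sum_degree[of J "\<lambda>k. [:- u k, 1:]"] lead_coeff_prod[of "\<lambda>k. [:- u k, 1:]" J]
    by simp
  have "A - B + C = 0"
  proof (cases "I = {}")
    case True
    then show ?thesis by (simp add: A_def B_def C_def)
  next
    case False
    have pA: "poly A (y i) = (-1) ^ card I * (\<Prod>k\<in>I. (x k - y i))" for i
    proof -
      have "poly A (y i) = (\<Prod>k\<in>I. (-1) * (x k - y i))" by (simp add: A_def poly_prod)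
      then show ?thesis by (simp only: prod.distrib prod_constant)
    qed
    have root: "poly (A - B + C) (y i) = 0" if i: "i \<in> I" for i
    proof -
      have B: "poly B (y i) = 0" using i fin by (auto simp: B_def poly_prod)
      have 0: "c j * (\<Prod>k\<in>I - {j}. (y i - y k)) = 0" if "j \<in> I - {i}" for j
        using i fin that by auto
      have "poly C (y i) = (\<Sum>j\<in>I. c j * (\<Prod>k\<in>I - {j}. (y i - y k)))"
        by (simp add: C_def poly_sum poly_prod)
      also have "\<dots> = c i * (\<Prod>k\<in>I - {i}. (y i - y k))"
      proof -
        have "(\<Sum>j\<in>I - {i}. c j * (\<Prod>k\<in>I - {j}. (y i - y k))) = 0"
          by (rule sum.neutral) (use 0 in blast)
        then show ?thesis by (simp only: sum.remove[OF fin i] add_0_right)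
      qed
      also have "(\<Prod>k\<in>I - {i}. (y i - y k)) = (\<Prod>k\<in>I - {i}. (-1) * (y k - y i))" by simp
      also have "\<dots> = (-1) ^ (card I - 1) * (\<Prod>k\<in>I - {i}. (y k - y i))"
      proof -
        have "card (I - {i}) = card I - 1" using i fin by simp
        then show ?thesis by (simp only: prod.distrib prod_constant)
      qed
      also have "c i * \<dots> = (-1) ^ (card I - 1) * (\<Prod>k\<in>I. (x k - y i))"
      proof -
        have "(\<Prod>k\<in>I - {i}. (y k - y i)) \<noteq> 0"
          using fin i inj by (auto simp: inj_on_def)
        then show ?thesis by (simp add: c_def)
      qed
      finally have C: "poly C (y i) = (-1) ^ (card I - 1) * (\<Prod>k\<in>I. (x k - y i))" .
      have "(-1::'b) ^ card I = - ((-1) ^ (card I - 1))"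
        using False fin by (cases "card I") auto
      then show ?thesis using B C pA by simp
    qed
    have degAB: "degree (A - B) < card I"
    proof -
      have "degree (A - B) \<le> card I" using monic[of x I] monic[of y I]
        by (auto simp: A_def B_def intro: degree_diff_le)
      moreover have "coeff A (card I) = 1" "coeff B (card I) = 1"
        using monic[of x I] monic[of y I] unfolding A_def B_def by metis+
      then have "coeff (A - B) (card I) = 0" by simp
      ultimately show ?thesis
        using False fin by (metis card_gt_0_iff degree_0 leading_coeff_0_iff le_neq_implies_less)
    qed
    have degC: "degree C \<le> card I - 1"
      unfolding C_def by (rule degree_sum_le[OF fin])
        (use monic fin in \<open>auto intro!: order_trans[OF degree_smult_le]\<close>)
    have "degree (A - B + C) < card I"
      using degAB degC False fin
      by (metis (no_types, lifting) One_nat_def Suc_pred card_gt_0_iff degree_add_le le_imp_less_Suc less_Suc_eq_le)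
    moreover have "card I \<le> card {t. poly (A - B + C) t = 0}" if "A - B + C \<noteq> 0"
    proof -
      have "card I = card (y ` I)" using inj by (simp add: card_image)
      also have "\<dots> \<le> card {t. poly (A - B + C) t = 0}"
        by (rule card_mono[OF poly_roots_finite[OF that]]) (use root in blast)
      finally show ?thesis .
    qed
    ultimately show ?thesis
      using card_poly_roots_bound[of "A - B + C"] by force
  qed
  then have "poly (A - B + C) T = 0" by simp
  then show ?thesis
    by (simp add: A_def B_def C_def poly_prod poly_sum c_def algebra_simps)
qed

lemma nn_integral_substitution_pole:
  fixes f :: "real \<Rightarrow> ennreal" and y \<tau> :: "nat \<Rightarrow> real" and a b z Y :: real and J :: "nat set"
  defines "B \<equiv> \<lambda>t. z * a / t - 1 - (\<Sum>i\<in>J. \<tau> i * (y i - a) / (y i - t))"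
  defines "T \<equiv> \<lambda>t. (b - t) / (b - a) * B t"
  defines "T' \<equiv> \<lambda>t. (B t + (b - t) * (z * a / t\<^sup>2 + (\<Sum>i\<in>J. \<tau> i * (y i - a) / (y i - t)\<^sup>2))) / (b - a)"
  defines "D \<equiv> z - 1 - (\<Sum>i\<in>J. \<tau> i)"
  assumes f [measurable]: "f \<in> borel_measurable borel"
    and fin: "finite J" and a: "0 < a" "a < Y" and z: "z > 1" and Yb: "Y \<le> b"
    and yY: "\<And>i. i \<in> J \<Longrightarrow> Y \<le> y i" and \<tau>: "\<And>i. i \<in> J \<Longrightarrow> \<tau> i > 0"
    and Y: "(\<exists>j\<in>J. y j = Y) \<or> b = Y"
  shows "(\<integral>\<^sup>+t. f (D - T t) * ennreal (T' t) * indicator {t. a < t \<and> t < Y \<and> 0 < B t} t \<partial>lborel) =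
         (\<integral>\<^sup>+u. f u * indicator {0<..<D} u \<partial>lborel)"
proof -
  have za: "z * a > 0" using a z by simp
  have ab: "a < b" using a Yb by simp
  have den: "0 < y i - t" if "i \<in> J" "t < Y" for i t using yY[OF that(1)] that(2) by simp
  have ya: "0 < y i - a" if "i \<in> J" for i using den[OF that, of a] a by simp
  have dec: "B t < B s" if "a \<le> s" "s < t" "t < Y" for s t
  proof -
    have "z * a / t < z * a / s"
      using za that a by (intro divide_strict_left_mono) auto
    moreover have "(\<Sum>i\<in>J. \<tau> i * (y i - a) / (y i - s)) \<le> (\<Sum>i\<in>J. \<tau> i * (y i - a) / (y i - t))"
    proof (rule sum_mono)
      fix i assume i: "i \<in> J"
      show "\<tau> i * (y i - a) / (y i - s) \<le> \<tau> i * (y i - a) / (y i - t)"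
        using den[OF i, of t] den[OF i, of s] ya[OF i] \<tau>[OF i] that
        by (intro divide_left_mono) auto
    qed
    ultimately show ?thesis unfolding B_def by linarith
  qed
  have Ba: "B a = D"
  proof -
    have "(\<Sum>i\<in>J. \<tau> i * (y i - a) / (y i - a)) = (\<Sum>i\<in>J. \<tau> i)"
      using ya by (intro sum.cong) (auto simp: less_imp_neq[symmetric])
    then show ?thesis using a by (simp add: B_def D_def)
  qed
  have contB: "continuous_on S B" if "\<And>t. t \<in> S \<Longrightarrow> 0 < t \<and> (\<forall>i\<in>J. t < y i)" for S
    unfolding B_def using that by (intro continuous_intros) force+
  show ?thesis
  proof (cases "D > 0")
    case False
    have "{t. a < t \<and> t < Y \<and> 0 < B t} = {}"
      using dec[of a] Ba False by force
    moreover have "{0<..<D} = {}" using False by simp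
    ultimately show ?thesis by (simp only:) simp
  next
    case True
    obtain c where c: "a < c" "c \<le> Y" "\<And>t. a < t \<Longrightarrow> t < Y \<Longrightarrow> 0 < B t \<longleftrightarrow> t < c"
      "T c = 0" "\<And>i. i \<in> J \<Longrightarrow> c < y i"
    proof (cases "\<exists>r. a < r \<and> r < Y \<and> B r \<le> 0")
      case True
      then obtain r where r: "a < r" "r < Y" "B r \<le> 0" by blast
      have "continuous_on {a..r} B" using r a yY by (intro contB) force
      then obtain c where c: "a \<le> c" "c \<le> r" "B c = 0"
        using IVT2'[of B r 0 a] r Ba \<open>D > 0\<close> by auto
      have "a < c" using c Ba \<open>D > 0\<close> by (cases "a = c") auto
      moreover have "0 < B t \<longleftrightarrow> t < c" if "a < t" "t < Y" for t
        using dec[of t c] dec[of c t] c r that by (cases t c rule: linorder_cases) auto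
      moreover have "T c = 0" using c by (simp add: T_def)
      moreover have "c < y i" if "i \<in> J" for i using yY[OF that] c r by simp
      ultimately show ?thesis using that[of c] c r by auto
    next
      case False
      have noj: "y j \<noteq> Y" if j: "j \<in> J" for j
      proof
        assume yj: "y j = Y"
        define t where "t = Y - min ((Y - a) / 2) (\<tau> j * (Y - a) / z)"
        have m: "0 < min ((Y - a) / 2) (\<tau> j * (Y - a) / z)" using a \<tau>[OF j] z by simp
        have t: "a < t" "t < Y" 
        proof -
          have "Y - (Y - a) / 2 \<le> t"
            unfolding t_def using min.cobounded1[of "(Y - a) / 2"] by (intro diff_left_mono)
          then show "a < t" using a by argo
          show "t < Y" using m unfolding t_def by linarith
        qed
        have "Y - t \<le> \<tau> j * (Y - a) / z" unfolding t_def using min.cobounded2 by simp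
        then have "z \<le> \<tau> j * (y j - a) / (y j - t)"
          using t z by (simp add: yj field_simps)
        also have "\<dots> \<le> (\<Sum>i\<in>J. \<tau> i * (y i - a) / (y i - t))"
          using den[OF _ t(2)] ya \<tau> by (intro member_le_sum[OF j _ fin]) (auto intro!: divide_nonneg_pos mult_nonneg_nonneg less_imp_le)
        moreover have "z * a / t \<le> z" using t a z by (simp add: field_simps)
        ultimately have "B t \<le> 0" unfolding B_def by linarith
        then show False using False t by blast
      qed
      then have "b = Y" using Y by blast
      then have "T Y = 0" by (simp add: T_def)
      moreover have "Y < y i" if "i \<in> J" for i using noj[OF that] yY[OF that] by simp
      moreover have "0 < B t \<longleftrightarrow> t < Y" if "a < t" "t < Y" for t
        using False that by (auto simp: not_le)
      ultimately show ?thesis using that[of Y] a by blast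
    qed
    have contBc: "continuous_on {a..c} B"
    proof (rule contB)
      fix t assume t: "t \<in> {a..c}"
      then show "0 < t \<and> (\<forall>i\<in>J. t < y i)" using a(1) c(5) by force
    qed
    have contT: "continuous_on {a..c} T"
      unfolding T_def by (intro continuous_on_mult continuous_on_divide continuous_on_diff
          continuous_on_const continuous_on_id contBc) (use ab in auto)
    have derB: "(B has_real_derivative - (z * a / t\<^sup>2 + (\<Sum>i\<in>J. \<tau> i * (y i - a) / (y i - t)\<^sup>2))) (at t)"
      if t: "a < t" "t < c" for t
    proof -
      have t0: "t > 0" using t a by simp
      have "((\<lambda>t. \<tau> i * (y i - a) / (y i - t)) has_real_derivative \<tau> i * (y i - a) / (y i - t)\<^sup>2) (at t)"
        if "i \<in> J" for i
        using den[OF that, of t] t c(2) by (auto intro!: derivative_eq_intros simp: power2_eq_square)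
      then have "((\<lambda>t. \<Sum>i\<in>J. \<tau> i * (y i - a) / (y i - t)) has_real_derivative
          (\<Sum>i\<in>J. \<tau> i * (y i - a) / (y i - t)\<^sup>2)) (at t)"
        by (rule DERIV_sum)
      moreover have "((\<lambda>t. z * a / t - 1) has_real_derivative - (z * a / t\<^sup>2)) (at t)"
        using t0 by (auto intro!: derivative_eq_intros simp: power2_eq_square)
      ultimately have "((\<lambda>t. z * a / t - 1 - (\<Sum>i\<in>J. \<tau> i * (y i - a) / (y i - t))) has_real_derivative
          - (z * a / t\<^sup>2) - (\<Sum>i\<in>J. \<tau> i * (y i - a) / (y i - t)\<^sup>2)) (at t)"
        by (rule DERIV_diff[rotated])
      then show ?thesis unfolding B_def by (rule DERIV_cong) simp
    qed
    have derT: "((\<lambda>t. D - T t) has_real_derivative T' t) (at t)" if t: "a < t" "t < c" for t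
    proof -
      have "((\<lambda>t. (b - t) / (b - a)) has_real_derivative - 1 / (b - a)) (at t)"
        by (rule DERIV_cdivide) (auto intro!: derivative_eq_intros)
      note d = DERIV_mult[OF this derB[OF t]]
      have eq: "- 1 / d * p + - q * (r / d) = - ((p + r * q) / d)" for p q r d :: real
        by (simp add: add_divide_distrib)
      from d
      have "(T has_real_derivative - T' t) (at t)"
        unfolding T_def T'_def
        by (rule DERIV_cong) (rule eq)
      from DERIV_diff[OF DERIV_const this, of D] show ?thesis by simp
    qed
    have pos: "T' t > 0" if t: "a < t" "t < c" for t
    proof -
      have "B t > 0" using c t by auto
      moreover have "0 \<le> (\<Sum>i\<in>J. \<tau> i * (y i - a) / (y i - t)\<^sup>2)"
        using ya \<tau> by (intro sum_nonneg divide_nonneg_nonneg mult_nonneg_nonneg) (auto intro: less_imp_le)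
      moreover have "0 \<le> z * a / t\<^sup>2" using za by simp
      ultimately show ?thesis unfolding T'_def using t c Yb ab
        by (intro divide_pos_pos add_pos_nonneg mult_nonneg_nonneg) auto
    qed
    have contT': "continuous_on {a<..<c} T'"
    proof -
      have B: "continuous_on {a<..<c} B" using contBc by (rule continuous_on_subset) auto
      have "t < y i" if "t < c" "i \<in> J" for t i using c(5)[OF that(2)] that(1) by simp
      then have S: "continuous_on {a<..<c} (\<lambda>t. \<Sum>i\<in>J. \<tau> i * (y i - a) / (y i - t)\<^sup>2)"
        by (intro continuous_intros) force
      have Z: "continuous_on {a<..<c} (\<lambda>t. z * a / t\<^sup>2)"
        using a by (intro continuous_intros) auto
      show ?thesis
        unfolding T'_def by (intro continuous_on_mult continuous_on_divide[OF _ continuous_on_const]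
          continuous_on_diff continuous_on_const continuous_on_id continuous_on_add[OF B]
          continuous_on_add[OF Z S]) (use ab in auto)
    qed
    have [measurable]: "B \<in> borel_measurable borel" unfolding B_def by measurable
    have meas: "(\<lambda>t. D - T t) \<in> borel_measurable borel" "T' \<in> borel_measurable borel"
      unfolding T_def T'_def by measurable
    have "(\<integral>\<^sup>+t. f (D - T t) * ennreal (T' t) * indicator {a<..<c} t \<partial>lborel) =
        (\<integral>\<^sup>+u. f u * indicator {D - T a<..<D - T c} u \<partial>lborel)"
      by (rule nn_integral_substitution_Ioo[OF f meas c(1) _ derT contT' pos])
        (use contT in \<open>auto intro!: continuous_intros\<close>)
    also have "{D - T a<..<D - T c} = {0<..<D}"
    proof -
      have "T a = D" using Ba ab by (simp add: T_def)
      then show ?thesis using c(4) by simp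
    qed
    also have "{a<..<c} = {t. a < t \<and> t < Y \<and> 0 < B t}"
      using c by auto
    finally show ?thesis .
  qed
qed

section \<open>Interlacing points and their residue coordinates\<close>

definition interlacing_from :: "nat \<Rightarrow> nat \<Rightarrow> (nat \<Rightarrow> real) \<Rightarrow> (nat \<Rightarrow> real) set"
  where "interlacing_from l n y = {x. (\<forall>i\<in>{l..n}. y i < x i) \<and> (\<forall>i\<in>{l..<n}. x i < y (Suc i))}"

definition residues_tau :: "nat \<Rightarrow> nat \<Rightarrow> (nat \<Rightarrow> real) \<Rightarrow> (nat \<Rightarrow> real) \<Rightarrow> nat \<Rightarrow> real"
  where "residues_tau l n y x i = (\<Prod>k\<in>{l..n}. (x k - y i)) / (\<Prod>k\<in>{l..n} - {i}. (y k - y i)) / y i"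

definition vandermonde_ratio :: "nat \<Rightarrow> nat \<Rightarrow> (nat \<Rightarrow> real) \<Rightarrow> (nat \<Rightarrow> real) \<Rightarrow> real"
  where "vandermonde_ratio l n y x = (\<Prod>j\<in>{l..n}. \<Prod>i\<in>{l..<j}. (x j - x i) / (y j - y i))"

definition on_fibre :: "nat \<Rightarrow> nat \<Rightarrow> real \<Rightarrow> (nat \<Rightarrow> real) \<Rightarrow> (nat \<Rightarrow> real) \<Rightarrow> nat \<Rightarrow> real"
  where "on_fibre l n z y x = x(n := z * (\<Prod>i\<in>{l..n}. y i) / (\<Prod>i\<in>{l..<n}. x i))"

lemma prod_on_fibre:
  assumes "l \<le> n" "\<And>i. i \<in> {l..<n} \<Longrightarrow> x i \<noteq> 0"
  shows "(\<Prod>i\<in>{l..n}. on_fibre l n z y x i) = z * (\<Prod>i\<in>{l..n}. y i)"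
proof -
  have "{l..n} = insert n {l..<n}" using assms(1) by auto
  then have "(\<Prod>i\<in>{l..n}. on_fibre l n z y x i) = on_fibre l n z y x n * (\<Prod>i\<in>{l..<n}. on_fibre l n z y x i)"
    by simp
  also have "(\<Prod>i\<in>{l..<n}. on_fibre l n z y x i) = (\<Prod>i\<in>{l..<n}. x i)"
    by (intro prod.cong) (auto simp: on_fibre_def)
  finally show ?thesis using assms(2) by (simp add: on_fibre_def)
qed

lemma sum_residues_tau:
  assumes inj: "inj_on y {l..n}" and y0: "\<And>i. i \<in> {l..n} \<Longrightarrow> y i \<noteq> 0"
  shows "(\<Sum>i\<in>{l..n}. residues_tau l n y x i) = (\<Prod>i\<in>{l..n}. x i) / (\<Prod>i\<in>{l..n}. y i) - 1"
proof -
  let ?I = "{l..n}"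
  let ?c = "\<lambda>i. (\<Prod>k\<in>?I. (x k - y i)) / (\<Prod>k\<in>?I - {i}. (y k - y i))"
  have m: "(\<Prod>k\<in>J. 0 - u k) = (-1) ^ card J * (\<Prod>k\<in>J. u k)" for J and u :: "nat \<Rightarrow> real"
  proof -
    have "(\<Prod>k\<in>J. 0 - u k) = (\<Prod>k\<in>J. (-1) * u k)" by simp
    then show ?thesis by (simp only: prod.distrib prod_constant)
  qed
  have y0': "(\<Prod>k\<in>?I. y k) \<noteq> 0" using y0 by simp
  have t: "?c i * (\<Prod>k\<in>?I - {i}. 0 - y k) = - ((-1) ^ card ?I * (\<Prod>k\<in>?I. y k)) * residues_tau l n y x i"
    if i: "i \<in> ?I" for i
  proof -
    have "(\<Prod>k\<in>?I. 0 - y k) = (0 - y i) * (\<Prod>k\<in>?I - {i}. 0 - y k)"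
      by (rule prod.remove) (use i in auto)
    then have "(\<Prod>k\<in>?I - {i}. 0 - y k) = - ((-1) ^ card ?I * (\<Prod>k\<in>?I. y k)) / y i"
      using y0[OF i] by (simp only: m) (simp add: field_simps)
    then show ?thesis by (simp only: residues_tau_def) simp
  qed
  have "(-1) ^ card ?I * (\<Prod>k\<in>?I. x k) = (-1) ^ card ?I * (\<Prod>k\<in>?I. y k) +
      (-1) ^ card ?I * (\<Prod>k\<in>?I. y k) * (\<Sum>i\<in>?I. residues_tau l n y x i)"
  proof -
    have "(\<Sum>i\<in>?I. ?c i * (\<Prod>k\<in>?I - {i}. 0 - y k)) =
        - ((-1) ^ card ?I * (\<Prod>k\<in>?I. y k)) * (\<Sum>i\<in>?I. residues_tau l n y x i)"
      unfolding sum_distrib_left by (rule sum.cong[OF refl t])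
    with prod_partial_fraction[OF finite_atLeastAtMost inj, where T = 0 and x = x]
    have "(\<Prod>k\<in>?I. 0 - x k) = (\<Prod>k\<in>?I. 0 - y k) -
        - ((-1) ^ card ?I * (\<Prod>k\<in>?I. y k)) * (\<Sum>i\<in>?I. residues_tau l n y x i)"
      by simp
    then show ?thesis unfolding m by simp
  qed
  then have "(-1) ^ card ?I * ((\<Prod>k\<in>?I. x k) - (\<Prod>k\<in>?I. y k) * (1 + (\<Sum>i\<in>?I. residues_tau l n y x i))) = 0"
    by (simp add: algebra_simps)
  then have "(\<Prod>k\<in>?I. x k) = (\<Prod>k\<in>?I. y k) * (1 + (\<Sum>i\<in>?I. residues_tau l n y x i))" by simp
  then show ?thesis using y0' by simp
qed

lemma prod_ratio_residues_tau:
  assumes inj: "inj_on y {l..n}" and y0: "\<And>i. i \<in> {l..n} \<Longrightarrow> y i \<noteq> 0"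
    and t: "\<And>i. i \<in> {l..n} \<Longrightarrow> t \<noteq> y i"
  shows "(\<Prod>k\<in>{l..n}. (x k - t)) = (\<Prod>k\<in>{l..n}. (y k - t)) *
    (1 + (\<Sum>i\<in>{l..n}. y i * residues_tau l n y x i / (y i - t)))"
proof -
  let ?I = "{l..n}"
  let ?c = "\<lambda>i. (\<Prod>k\<in>?I. (x k - y i)) / (\<Prod>k\<in>?I - {i}. (y k - y i))"
  have m: "(\<Prod>k\<in>J. t - u k) = (-1) ^ card J * (\<Prod>k\<in>J. u k - t)" for J and u :: "nat \<Rightarrow> real"
  proof -
    have "(\<Prod>k\<in>J. t - u k) = (\<Prod>k\<in>J. (-1) * (u k - t))" by simp
    then show ?thesis by (simp only: prod.distrib prod_constant)
  qed
  have s: "?c i * (\<Prod>k\<in>?I - {i}. t - y k) =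
      - ((-1) ^ card ?I * (\<Prod>k\<in>?I. y k - t)) * (y i * residues_tau l n y x i / (y i - t))"
    if i: "i \<in> ?I" for i
  proof -
    have "(\<Prod>k\<in>?I. t - y k) = (t - y i) * (\<Prod>k\<in>?I - {i}. t - y k)"
      by (rule prod.remove) (use i in auto)
    then have "(\<Prod>k\<in>?I - {i}. t - y k) = ((-1) ^ card ?I * (\<Prod>k\<in>?I. y k - t)) / (t - y i)"
      using t[OF i] by (simp only: m) (simp add: field_simps)
    also have "\<dots> = - ((-1) ^ card ?I * (\<Prod>k\<in>?I. y k - t)) / (y i - t)"
      using t[OF i] by (simp add: divide_simps) (simp add: algebra_simps)
    finally show ?thesis using y0[OF i] by (simp only: residues_tau_def) simp
  qed
  have "(-1) ^ card ?I * (\<Prod>k\<in>?I. x k - t) = (-1) ^ card ?I * (\<Prod>k\<in>?I. y k - t) +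
      (-1) ^ card ?I * (\<Prod>k\<in>?I. y k - t) * (\<Sum>i\<in>?I. y i * residues_tau l n y x i / (y i - t))"
  proof -
    have "(\<Sum>i\<in>?I. ?c i * (\<Prod>k\<in>?I - {i}. t - y k)) = - ((-1) ^ card ?I * (\<Prod>k\<in>?I. y k - t)) *
        (\<Sum>i\<in>?I. y i * residues_tau l n y x i / (y i - t))"
      unfolding sum_distrib_left by (rule sum.cong[OF refl s])
    with prod_partial_fraction[OF finite_atLeastAtMost inj, where T = t and x = x]
    have "(\<Prod>k\<in>?I. t - x k) = (\<Prod>k\<in>?I. t - y k) - - ((-1) ^ card ?I * (\<Prod>k\<in>?I. y k - t)) *
        (\<Sum>i\<in>?I. y i * residues_tau l n y x i / (y i - t))"
      by simp
    then show ?thesis unfolding m by simp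
  qed
  then have "(-1) ^ card ?I * ((\<Prod>k\<in>?I. x k - t) -
      (\<Prod>k\<in>?I. y k - t) * (1 + (\<Sum>i\<in>?I. y i * residues_tau l n y x i / (y i - t)))) = 0"
    by (simp add: algebra_simps)
  then show ?thesis by simp
qed

lemma interlacing_from_pos:
  assumes "x \<in> interlacing_from l n y" "\<And>i. i \<in> {l..n} \<Longrightarrow> 0 < y i" "i \<in> {l..n}"
  shows "0 < x i"
  using assms unfolding interlacing_from_def by (force intro: order.strict_trans)

lemma interlacing_from_mono:
  assumes "x \<in> interlacing_from l n y" "l \<le> i" "i < j" "j \<le> n" "strict_mono_on {l..n} y"
  shows "x i < x j"
proof -
  have "x i < y (Suc i)" using assms unfolding interlacing_from_def by auto
  also have "y (Suc i) \<le> y j"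
    using assms strict_mono_onD[OF assms(5), of "Suc i" j] by (cases "Suc i = j") auto
  also have "y j < x j" using assms unfolding interlacing_from_def by auto
  finally show ?thesis .
qed

lemma vandermonde_ratio_nonneg:
  assumes "x \<in> interlacing_from l n y" "strict_mono_on {l..n} y"
  shows "0 \<le> vandermonde_ratio l n y x"
  unfolding vandermonde_ratio_def
proof (intro prod_nonneg divide_nonneg_nonneg)
  fix i j assume "j \<in> {l..n}" "i \<in> {l..<j}"
  then show "0 \<le> x j - x i" "0 \<le> y j - y i"
    using interlacing_from_mono[OF assms(1) _ _ _ assms(2), of i j] strict_mono_onD[OF assms(2), of i j] by auto
qed

lemma on_fibre_interlacing_gt_1:
  assumes "on_fibre l n z y x \<in> interlacing_from l n y" "\<And>i. i \<in> {l..n} \<Longrightarrow> 0 < y i" "l \<le> n"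
  shows "1 < z"
proof -
  let ?x = "on_fibre l n z y x"
  have pos: "0 < ?x i" if "i \<in> {l..n}" for i using interlacing_from_pos[OF assms(1,2) that] by blast
  then have "x i \<noteq> 0" if "i \<in> {l..<n}" for i using that pos[of i] by (force simp: on_fibre_def split: if_splits)
  then have "(\<Prod>i\<in>{l..n}. ?x i) = z * (\<Prod>i\<in>{l..n}. y i)" using assms(3) by (intro prod_on_fibre) auto
  moreover have "(\<Prod>i\<in>{l..n}. y i) < (\<Prod>i\<in>{l..n}. ?x i)"
    using assms pos unfolding interlacing_from_def by (intro prod_mono_strict) (auto intro: less_imp_le)
  moreover have "0 < (\<Prod>i\<in>{l..n}. y i)" using assms(2) by (rule prod_pos)
  ultimately show ?thesis by simp
qed

lemma vandermonde_ratio_rec: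
  assumes "l < n"
  shows "vandermonde_ratio l n y x = (\<Prod>j\<in>{Suc l..n}. (x j - x l) / (y j - y l)) * vandermonde_ratio (Suc l) n y x"
proof -
  have "{l..n} = insert l {Suc l..n}" using assms by auto
  then have "vandermonde_ratio l n y x = (\<Prod>j\<in>{Suc l..n}. \<Prod>i\<in>{l..<j}. (x j - x i) / (y j - y i))"
    by (simp add: vandermonde_ratio_def)
  also have "\<dots> = (\<Prod>j\<in>{Suc l..n}. (x j - x l) / (y j - y l) * (\<Prod>i\<in>{Suc l..<j}. (x j - x i) / (y j - y i)))"
  proof (rule prod.cong[OF refl])
    fix j assume "j \<in> {Suc l..n}"
    then have "{l..<j} = insert l {Suc l..<j}" by auto
    then show "(\<Prod>i\<in>{l..<j}. (x j - x i) / (y j - y i)) =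
        (x j - x l) / (y j - y l) * (\<Prod>i\<in>{Suc l..<j}. (x j - x i) / (y j - y i))" by simp
  qed
  finally show ?thesis by (simp only: prod.distrib vandermonde_ratio_def)
qed

lemma residues_tau_rec:
  assumes "l < n" "i \<in> {Suc l..n}"
  shows "residues_tau l n y x i = residues_tau (Suc l) n y x i * ((x l - y i) / (y l - y i))"
proof -
  have "{l..n} = insert l {Suc l..n}" "{l..n} - {i} = insert l ({Suc l..n} - {i})" using assms by auto
  then show ?thesis by (simp add: residues_tau_def mult_ac)
qed

section \<open>The measure on the fibre\<close>

definition fibre_density :: "nat \<Rightarrow> nat \<Rightarrow> real \<Rightarrow> (nat \<Rightarrow> real) \<Rightarrow> ((nat \<Rightarrow> real) \<Rightarrow> ennreal) \<Rightarrow> (nat \<Rightarrow> real) \<Rightarrow> ennreal"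
  where "fibre_density l n z y F x =
    ennreal (vandermonde_ratio l n y (on_fibre l n z y x) * (\<Prod>k\<in>{l..<n}. 1 / x k)) *
    F (residues_tau l n y (on_fibre l n z y x)) *
    indicator (interlacing_from l n y) (on_fibre l n z y x)"

definition simplex_density :: "nat \<Rightarrow> nat \<Rightarrow> real \<Rightarrow> ((nat \<Rightarrow> real) \<Rightarrow> ennreal) \<Rightarrow> (nat \<Rightarrow> real) \<Rightarrow> ennreal"
  where "simplex_density l n s F \<tau> = F (\<tau>(n := s - (\<Sum>i\<in>{l..<n}. \<tau> i))) *
    indicator {\<tau>. (\<forall>i\<in>{l..<n}. 0 < \<tau> i) \<and> (\<Sum>i\<in>{l..<n}. \<tau> i) < s} \<tau>"

definition peel :: "nat \<Rightarrow> nat \<Rightarrow> real \<Rightarrow> (nat \<Rightarrow> real) \<Rightarrow> ((nat \<Rightarrow> real) \<Rightarrow> ennreal) \<Rightarrow> real \<Rightarrow> (nat \<Rightarrow> real) \<Rightarrow> ennreal"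
  where "peel l n z y F t u =
    ennreal ((\<Prod>k\<in>{Suc l..n}. (y k - t) / (y k - y l)) * ((1 + (\<Sum>i\<in>{Suc l..n}. y i * u i / (y i - t))) / t)) *
    F (\<lambda>i. if i = l then z - 1 - (\<Sum>j\<in>{Suc l..n}. (y j - t) / (y j - y l) * u j)
           else u i * ((y i - t) / (y i - y l)))"

lemma fibre_density_eq_0:
  assumes "l < n" "\<not> (y l < t \<and> t < y (Suc l))"
  shows "fibre_density l n z y F (x(l := t)) = 0"
proof -
  have "on_fibre l n z y (x(l := t)) l = t" using assms(1) by (simp add: on_fibre_def)
  moreover have "l \<in> {l..n}" "l \<in> {l..<n}" using assms(1) by auto
  ultimately have "on_fibre l n z y (x(l := t)) \<notin> interlacing_from l n y"
    using assms(2) by (force simp: interlacing_from_def)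
  then show ?thesis by (simp add: fibre_density_def)
qed

lemma fibre_density_peel:
  assumes l: "l < n" and t: "y l < t" "t < y (Suc l)"
    and pos: "\<And>i. i \<in> {l..n} \<Longrightarrow> 0 < y i" and mono: "strict_mono_on {l..n} y"
    and cong: "\<And>u v. (\<And>i. i \<in> {l..n} \<Longrightarrow> u i = v i) \<Longrightarrow> F u = F v"
  shows "fibre_density l n z y F (x(l := t)) =
    fibre_density (Suc l) n (z * y l / t) y (peel l n z y F t) x"
proof -
  let ?z' = "z * y l / t"
  define X where "X = on_fibre l n z y (x(l := t))"
  define X' where "X' = on_fibre (Suc l) n ?z' y x"
  have t0: "0 < t" using t pos[of l] l by simp
  have ins: "{l..n} = insert l {Suc l..n}" "{l..<n} = insert l {Suc l..<n}" using l by auto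
  have XX: "X = X'(l := t)"
  proof -
    have "(\<Prod>i\<in>{Suc l..<n}. (x(l := t)) i) = (\<Prod>i\<in>{Suc l..<n}. x i)" by (rule prod.cong) auto
    then show ?thesis using l
      unfolding X_def X'_def on_fibre_def ins by (auto simp: fun_eq_iff field_simps)
  qed
  have Xl: "X l = t" by (simp add: XX)
  have XS: "X i = X' i" if "i \<in> {Suc l..n}" for i using that by (auto simp: XX)
  have yt: "t < y i" if "i \<in> {Suc l..n}" for i
  proof -
    have "y (Suc l) \<le> y i" using that strict_mono_onD[OF mono, of "Suc l" i] by (cases "Suc l = i") auto
    then show ?thesis using t by simp
  qed
  have inter: "X \<in> interlacing_from l n y \<longleftrightarrow> X' \<in> interlacing_from (Suc l) n y"
    unfolding interlacing_from_def ins using t l by (auto simp: XX)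
  show ?thesis
  proof (cases "X' \<in> interlacing_from (Suc l) n y")
    case False
    then show ?thesis using inter by (simp add: fibre_density_def X_def X'_def)
  next
    case True
    then have XI: "X \<in> interlacing_from l n y" using inter by simp
    define u where "u = residues_tau (Suc l) n y X'"
    have sub: "{Suc l..n} \<subseteq> {l..n}" by auto
    have mono': "strict_mono_on {Suc l..n} y" using mono by (rule monotone_on_subset) (use sub in simp)
    have inj: "inj_on y {l..n}" "inj_on y {Suc l..n}"
      using mono mono' strict_mono_on_imp_inj_on by auto
    have y0: "y i \<noteq> 0" if "i \<in> {l..n}" for i using pos[OF that] by simp
    have xn0: "(x(l := t)) i \<noteq> 0" if "i \<in> {l..<n}" for i
    proof -
      have "0 < X i" using interlacing_from_pos[OF XI pos] that by auto
      then show ?thesis using that by (simp add: X_def on_fibre_def)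
    qed
    have ri: "residues_tau l n y X i = u i * ((y i - t) / (y i - y l))" if i: "i \<in> {Suc l..n}" for i
    proof -
      have "residues_tau (Suc l) n y X i = u i"
        unfolding residues_tau_def u_def using XS by (intro arg_cong2[where f = "(/)"] prod.cong) auto
      moreover have "(t - y i) / (y l - y i) = (y i - t) / (y i - y l)"
        by (metis minus_diff_eq minus_divide_divide)
      ultimately show ?thesis using residues_tau_rec[OF l i, of y X] Xl by simp
    qed
    have rl: "residues_tau l n y X l = z - 1 - (\<Sum>j\<in>{Suc l..n}. (y j - t) / (y j - y l) * u j)"
    proof -
      have "(\<Sum>i\<in>{l..n}. residues_tau l n y X i) = z - 1"
        using sum_residues_tau[OF inj(1) y0, of X] prod_on_fibre[of l n "x(l := t)" z y] xn0 l y0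
        by (simp add: X_def)
      moreover have "(\<Sum>i\<in>{Suc l..n}. residues_tau l n y X i) = (\<Sum>j\<in>{Suc l..n}. (y j - t) / (y j - y l) * u j)"
        by (rule sum.cong) (use ri in \<open>auto simp: mult.commute\<close>)
      ultimately show ?thesis by (simp add: ins)
    qed
    have FF: "F (residues_tau l n y X) =
      F (\<lambda>i. if i = l then z - 1 - (\<Sum>j\<in>{Suc l..n}. (y j - t) / (y j - y l) * u j)
           else u i * ((y i - t) / (y i - y l)))"
      by (rule cong) (use ri rl ins in auto)
    have V: "vandermonde_ratio l n y X * (\<Prod>k\<in>{l..<n}. 1 / (x(l := t)) k) =
      (vandermonde_ratio (Suc l) n y X' * (\<Prod>k\<in>{Suc l..<n}. 1 / x k)) *
      ((\<Prod>k\<in>{Suc l..n}. (y k - t) / (y k - y l)) * ((1 + (\<Sum>i\<in>{Suc l..n}. y i * u i / (y i - t))) / t))"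
    proof -
      have "vandermonde_ratio (Suc l) n y X = vandermonde_ratio (Suc l) n y X'"
        unfolding vandermonde_ratio_def using XS by (intro prod.cong) auto
      moreover have "(\<Prod>j\<in>{Suc l..n}. (X j - X l) / (y j - y l)) =
          (\<Prod>k\<in>{Suc l..n}. (y k - t) / (y k - y l)) * (1 + (\<Sum>i\<in>{Suc l..n}. y i * u i / (y i - t)))"
      proof -
        have "(\<Prod>j\<in>{Suc l..n}. X j - X l) = (\<Prod>j\<in>{Suc l..n}. X' j - t)"
          using XS Xl by (intro prod.cong) auto
        also have "\<dots> = (\<Prod>k\<in>{Suc l..n}. (y k - t)) * (1 + (\<Sum>i\<in>{Suc l..n}. y i * u i / (y i - t)))"
          unfolding u_def by (rule prod_ratio_residues_tau[OF inj(2)]) (use y0 yt in force)+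
        finally show ?thesis by (simp add: prod_dividef)
      qed
      moreover have "(\<Prod>k\<in>{l..<n}. 1 / (x(l := t)) k) = 1 / t * (\<Prod>k\<in>{Suc l..<n}. 1 / x k)"
        unfolding ins by (subst prod.insert) (auto intro!: prod.cong)
      ultimately show ?thesis by (simp add: vandermonde_ratio_rec[OF l])
    qed
    have nn: "0 \<le> vandermonde_ratio (Suc l) n y X' * (\<Prod>k\<in>{Suc l..<n}. 1 / x k)"
    proof (intro mult_nonneg_nonneg prod_nonneg)
      show "0 \<le> vandermonde_ratio (Suc l) n y X'"
        by (rule vandermonde_ratio_nonneg[OF True mono'])
      fix k assume k: "k \<in> {Suc l..<n}"
      then have "0 < X' k" using interlacing_from_pos[OF True, of k] pos by auto
      then show "0 \<le> 1 / x k" using k by (simp add: X'_def on_fibre_def)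
    qed
    show ?thesis
      unfolding fibre_density_def X_def[symmetric] X'_def[symmetric] V ennreal_mult'[OF nn] FF
      using True XI by (simp add: peel_def u_def[symmetric] mult_ac)
  qed
qed

lemma simplex_density_peel:
  fixes y \<tau> :: "nat \<Rightarrow> real" and z t :: real
  assumes l: "l < n" and t: "y l < t" "t < y (Suc l)"
    and pos: "\<And>i. i \<in> {l..n} \<Longrightarrow> 0 < y i" and mono: "strict_mono_on {l..n} y"
    and cong: "\<And>u v. (\<And>i. i \<in> {l..n} \<Longrightarrow> u i = v i) \<Longrightarrow> F u = F v"
  defines "J \<equiv> {Suc l..<n}"
  defines "B \<equiv> z * y l / t - 1 - (\<Sum>i\<in>J. \<tau> i * (y i - y l) / (y i - t))"
  defines "T \<equiv> (y n - t) / (y n - y l) * B"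
  defines "D \<equiv> z - 1 - (\<Sum>i\<in>J. \<tau> i)"
  shows "ennreal (\<Prod>i\<in>J. 1 / ((y i - t) / (y i - y l))) *
      simplex_density (Suc l) n (z * y l / t - 1) (peel l n z y F t) (\<lambda>i. \<tau> i / ((y i - t) / (y i - y l))) =
    F (\<lambda>i. if i = l then D - T else if i = n then T else \<tau> i) *
    ennreal ((B + (y n - t) * (z * y l / t\<^sup>2 + (\<Sum>i\<in>J. \<tau> i * (y i - y l) / (y i - t)\<^sup>2))) / (y n - y l)) *
    indicator {\<tau>. \<forall>i\<in>J. 0 < \<tau> i} \<tau> * indicator {0<..} B"
proof -
  define c where "c i = (y i - t) / (y i - y l)" for i
  define u where "u = (\<lambda>i. \<tau> i / c i)(n := B)"
  have t0: "0 < t" using t pos[of l] l by simp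
  have yt: "t < y i" if "i \<in> {Suc l..n}" for i
  proof -
    have "y (Suc l) \<le> y i" using that strict_mono_onD[OF mono, of "Suc l" i] by (cases "Suc l = i") auto
    then show ?thesis using t by simp
  qed
  have ya: "y l < y i" if "i \<in> {Suc l..n}" for i using yt[OF that] t by simp
  have c0: "0 < c i" if "i \<in> {Suc l..n}" for i using yt[OF that] ya[OF that] by (simp add: c_def)
  have insn: "{Suc l..n} = insert n J" using l by (auto simp: J_def)
  have nJ: "n \<notin> J" "finite J" by (auto simp: J_def)
  have tc: "\<tau> i / c i = \<tau> i * (y i - y l) / (y i - t)" for i by (simp add: c_def)
  have B: "z * y l / t - 1 - (\<Sum>i\<in>J. \<tau> i / c i) = B" by (simp add: B_def tc)
  have uJ: "u i = \<tau> i / c i" if "i \<in> J" for i using that nJ by (auto simp: u_def)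
  have FF: "F (\<lambda>i. if i = l then z - 1 - (\<Sum>j\<in>{Suc l..n}. c j * u j) else u i * c i) =
      F (\<lambda>i. if i = l then D - T else if i = n then T else \<tau> i)"
  proof (rule cong)
    fix i assume i: "i \<in> {l..n}"
    have "(\<Sum>j\<in>J. c j * u j) = (\<Sum>j\<in>J. \<tau> j)"
      using c0 uJ insn by (intro sum.cong) (auto simp: less_imp_neq[symmetric])
    then have "z - 1 - (\<Sum>j\<in>{Suc l..n}. c j * u j) = D - T"
      using nJ by (simp add: insn D_def T_def u_def c_def)
    moreover have "u n * c n = T" by (simp add: u_def T_def c_def)
    moreover have "u i * c i = \<tau> i" if "i \<noteq> l" "i \<noteq> n"
      using that i c0[of i] uJ[of i] by (simp add: J_def)
    ultimately show "(if i = l then z - 1 - (\<Sum>j\<in>{Suc l..n}. c j * u j) else u i * c i) =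
        (if i = l then D - T else if i = n then T else \<tau> i)" by simp
  qed
  have coeff: "(\<Prod>i\<in>J. 1 / c i) * ((\<Prod>k\<in>{Suc l..n}. c k) * ((1 + (\<Sum>i\<in>{Suc l..n}. y i * u i / (y i - t))) / t)) =
    (B + (y n - t) * (z * y l / t\<^sup>2 + (\<Sum>i\<in>J. \<tau> i * (y i - y l) / (y i - t)\<^sup>2))) / (y n - y l)"
  proof -
    define S1 where "S1 = (\<Sum>i\<in>J. \<tau> i * (y i - y l) / (y i - t))"
    define S2 where "S2 = (\<Sum>i\<in>J. \<tau> i * (y i - y l) / (y i - t)\<^sup>2)"
    have "(\<Prod>i\<in>J. 1 / c i) * (\<Prod>k\<in>J. c k) = 1"
      using c0 insn by (simp add: prod.distrib[symmetric] less_imp_neq[symmetric])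
    then have P: "(\<Prod>i\<in>J. 1 / c i) * (\<Prod>k\<in>{Suc l..n}. c k) = c n"
      using nJ by (simp add: insn mult.left_commute)
    have S: "(\<Sum>i\<in>J. y i * u i / (y i - t)) = S1 + t * S2"
      unfolding S1_def S2_def sum_distrib_left sum.distrib[symmetric]
    proof (rule sum.cong[OF refl])
      fix i assume i: "i \<in> J"
      then have "y i - t \<noteq> 0" using yt[of i] insn by auto
      then show "y i * u i / (y i - t) = \<tau> i * (y i - y l) / (y i - t) + t * (\<tau> i * (y i - y l) / (y i - t)\<^sup>2)"
        by (simp add: uJ[OF i] tc divide_simps power2_eq_square) (simp add: algebra_simps)
    qed
    have S1: "S1 = z * y l / t - 1 - B" by (simp add: B_def S1_def)
    have E: "1 + (\<Sum>i\<in>{Suc l..n}. y i * u i / (y i - t)) = z * y l / t - B + t * S2 + y n * B / (y n - t)"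
    proof -
      have "(\<Sum>i\<in>{Suc l..n}. y i * u i / (y i - t)) = y n * u n / (y n - t) + (S1 + t * S2)"
        unfolding insn S[symmetric] using nJ by (rule sum.insert[rotated])
      moreover have "u n = B" by (simp add: u_def)
      ultimately show ?thesis unfolding S1 by (simp only:)
    qed
    have "(\<Prod>i\<in>J. 1 / c i) * ((\<Prod>k\<in>{Suc l..n}. c k) * ((1 + (\<Sum>i\<in>{Suc l..n}. y i * u i / (y i - t))) / t)) =
        c n * ((z * y l / t - B + t * S2 + y n * B / (y n - t)) / t)"
    proof -
      have "p * (q * r) = (p * q) * r" for p q r :: real by simp
      from this[of "\<Prod>i\<in>J. 1 / c i" "\<Prod>k\<in>{Suc l..n}. c k"] show ?thesis unfolding E P .
    qed
    also have "\<dots> = (B + (y n - t) * (z * y l / t\<^sup>2 + S2)) / (y n - y l)"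
    proof -
      define d e where "d = y n - t" and "e = y n - y l"
      have d: "d \<noteq> 0" and cn: "c n = d / e" using yt[of n] l by (auto simp: d_def e_def c_def)
      have "y n * B / d = B + t * B / d" using d by (simp add: d_def field_simps)
      then have "(z * y l / t - B + t * S2 + y n * B / d) / t = z * y l / t\<^sup>2 + S2 + B / d"
        using t0 by (simp add: add_divide_distrib power2_eq_square)
      moreover have "d / e * (z * y l / t\<^sup>2 + S2 + B / d) = (B + d * (z * y l / t\<^sup>2 + S2)) / e"
        using d by (simp add: distrib_left add_divide_distrib)
      ultimately show ?thesis unfolding cn d_def[symmetric] e_def[symmetric] by simp
    qed
    finally show ?thesis by (simp add: S2_def)
  qed
  have "simplex_density (Suc l) n (z * y l / t - 1) (peel l n z y F t) (\<lambda>i. \<tau> i / c i) =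
     peel l n z y F t u * indicator {\<tau>. (\<forall>i\<in>J. 0 < \<tau> i) \<and> (\<Sum>i\<in>J. \<tau> i) < z * y l / t - 1} (\<lambda>i. \<tau> i / c i)"
    unfolding simplex_density_def u_def J_def[symmetric] using B by simp
  also have "indicator {\<tau>. (\<forall>i\<in>J. 0 < \<tau> i) \<and> (\<Sum>i\<in>J. \<tau> i) < z * y l / t - 1} (\<lambda>i. \<tau> i / c i) =
      (indicator {\<tau>. \<forall>i\<in>J. 0 < \<tau> i} \<tau> * indicator {0<..} B :: ennreal)"
  proof -
    have "(\<forall>i\<in>J. 0 < \<tau> i / c i) \<longleftrightarrow> (\<forall>i\<in>J. 0 < \<tau> i)"
      using c0 insn by (auto simp: zero_less_divide_iff dest: order.strict_trans)
    moreover have "(\<Sum>i\<in>J. \<tau> i / c i) < z * y l / t - 1 \<longleftrightarrow> 0 < B" using B by linarith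
    ultimately show ?thesis by (simp add: indicator_def)
  qed
  finally have 1: "simplex_density (Suc l) n (z * y l / t - 1) (peel l n z y F t) (\<lambda>i. \<tau> i / c i) =
      peel l n z y F t u * (indicator {\<tau>. \<forall>i\<in>J. 0 < \<tau> i} \<tau> * indicator {0<..} B)" .
  have nn: "0 \<le> (\<Prod>i\<in>J. 1 / c i)" using c0 insn by (intro prod_nonneg) (auto intro: less_imp_le)
  have "ennreal (\<Prod>i\<in>J. 1 / c i) * peel l n z y F t u =
      ennreal ((B + (y n - t) * (z * y l / t\<^sup>2 + (\<Sum>i\<in>J. \<tau> i * (y i - y l) / (y i - t)\<^sup>2))) / (y n - y l)) *
      F (\<lambda>i. if i = l then D - T else if i = n then T else \<tau> i)"
    unfolding peel_def c_def[symmetric] FF mult.assoc[symmetric] ennreal_mult'[OF nn, symmetric]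
    using coeff by (simp add: mult.assoc)
  then show ?thesis
    unfolding c_def[symmetric] 1
    by (simp only: mult.assoc[symmetric]) (simp only: mult.commute[of "ennreal _" "F _"])
qed

lemma prod_indicator_eq:
  "finite I \<Longrightarrow> (\<Prod>i\<in>I. indicator (A i) (f i) :: ennreal) = of_bool (\<forall>i\<in>I. f i \<in> A i)"
  by (induction I rule: finite_induct) (auto simp: indicator_def)

lemma borel_measurable_on_fibre:
  assumes "i \<in> {l..n}"
  shows "(\<lambda>x. on_fibre l n z y x i) \<in> borel_measurable (\<Pi>\<^sub>M k\<in>{l..<n}. (lborel :: real measure))"
proof (cases "i = n")
  case True
  have "(\<lambda>x. z * (\<Prod>i\<in>{l..n}. y i) / (\<Prod>i\<in>{l..<n}. x i)) \<in> borel_measurable (\<Pi>\<^sub>M k\<in>{l..<n}. (lborel :: real measure))"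
    by (intro borel_measurable_divide borel_measurable_prod borel_measurable_component) auto
  then show ?thesis using True by (simp add: on_fibre_def)
next
  case False
  then show ?thesis using assms by (simp add: on_fibre_def borel_measurable_component)
qed

lemma borel_measurable_residues_tau:
  assumes "i \<in> {l..n}"
  shows "(\<lambda>x. residues_tau l n y (on_fibre l n z y x) i) \<in> borel_measurable (\<Pi>\<^sub>M k\<in>{l..<n}. (lborel :: real measure))"
  unfolding residues_tau_def
  by (intro borel_measurable_divide borel_measurable_prod borel_measurable_diff borel_measurable_on_fibre
      borel_measurable_const) auto

lemma borel_measurable_fibre_density:
  assumes F: "F \<in> borel_measurable (\<Pi>\<^sub>M i\<in>UNIV. borel)"
    and cong: "\<And>u v. (\<And>i. i \<in> {l..n} \<Longrightarrow> u i = v i) \<Longrightarrow> F u = F v"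
  shows "fibre_density l n z y F \<in> borel_measurable (\<Pi>\<^sub>M k\<in>{l..<n}. (lborel :: real measure))"
proof -
  let ?M = "\<Pi>\<^sub>M k\<in>{l..<n}. (lborel :: real measure)"
  let ?X = "\<lambda>x. on_fibre l n z y x"
  have F': "(\<lambda>x. F (residues_tau l n y (?X x))) \<in> borel_measurable ?M"
  proof -
    have "(\<lambda>x. F (\<lambda>i. if i \<in> {l..n} then residues_tau l n y (?X x) i else 0)) \<in> borel_measurable ?M"
    proof (rule measurable_compose[OF measurable_into_PiM_UNIV F])
      fix i show "(\<lambda>x. if i \<in> {l..n} then residues_tau l n y (?X x) i else 0) \<in> borel_measurable ?M"
        by (cases "i \<in> {l..n}") (simp_all only: borel_measurable_residues_tau if_True if_False borel_measurable_const)
    qed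
    also have "(\<lambda>x. F (\<lambda>i. if i \<in> {l..n} then residues_tau l n y (?X x) i else 0)) =
        (\<lambda>x. F (residues_tau l n y (?X x)))"
      by (rule ext, rule cong) simp
    finally show ?thesis .
  qed
  have I0: "(\<lambda>x. indicator (interlacing_from l n y) (?X x) :: ennreal) =
    (\<lambda>x. (\<Prod>i\<in>{l..n}. indicator {y i<..} (?X x i)) * (\<Prod>i\<in>{l..<n}. indicator {..<y (Suc i)} (?X x i)))"
    by (rule ext, simp only: prod_indicator_eq finite_atLeastAtMost finite_atLeastLessThan)
      (simp add: interlacing_from_def indicator_def)
  have I1: "(\<lambda>x. indicator {y i<..} (?X x i) :: ennreal) \<in> borel_measurable ?M" if "i \<in> {l..n}" for i
    using borel_measurable_on_fibre[OF that] by measurable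
  have I2: "(\<lambda>x. indicator {..<y (Suc i)} (?X x i) :: ennreal) \<in> borel_measurable ?M" if "i \<in> {l..<n}" for i
  proof -
    have "i \<in> {l..n}" using that by auto
    from borel_measurable_on_fibre[OF this] show ?thesis by measurable
  qed
  have I: "(\<lambda>x. indicator (interlacing_from l n y) (?X x) :: ennreal) \<in> borel_measurable ?M"
    unfolding I0 by (intro borel_measurable_times_ennreal borel_measurable_prod_ennreal I1 I2)
  have V: "(\<lambda>x. vandermonde_ratio l n y (?X x) * (\<Prod>k\<in>{l..<n}. 1 / x k)) \<in> borel_measurable ?M"
    unfolding vandermonde_ratio_def
    by (intro borel_measurable_times borel_measurable_divide borel_measurable_prod borel_measurable_diff
        borel_measurable_on_fibre borel_measurable_const borel_measurable_component) auto
  have "(\<lambda>x. fibre_density l n z y F x) \<in> borel_measurable ?M"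
    unfolding fibre_density_def
    by (intro borel_measurable_times_ennreal measurable_compose[OF V measurable_ennreal] F' I)
  then show ?thesis .
qed

lemma borel_measurable_simplex_density:
  assumes F: "F \<in> borel_measurable (\<Pi>\<^sub>M i\<in>UNIV. borel)"
  shows "simplex_density l n s F \<in> borel_measurable (\<Pi>\<^sub>M i\<in>UNIV. borel)"
proof -
  let ?M = "\<Pi>\<^sub>M i\<in>(UNIV::nat set). (borel :: real measure)"
  have c [measurable]: "(\<lambda>x. x i) \<in> borel_measurable ?M" for i
    by (rule measurable_component_singleton) simp
  have F': "(\<lambda>\<tau>. F (\<tau>(n := s - (\<Sum>i\<in>{l..<n}. \<tau> i)))) \<in> borel_measurable ?M"
  proof (rule measurable_compose[OF measurable_into_PiM_UNIV F])
    fix i show "(\<lambda>\<tau>. (\<tau>(n := s - (\<Sum>i\<in>{l..<n}. \<tau> i))) i) \<in> borel_measurable ?M"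
      by (cases "i = n") (simp_all add: c)
  qed
  have I0: "(\<lambda>\<tau>. indicator {\<tau>. (\<forall>i\<in>{l..<n}. 0 < \<tau> i) \<and> (\<Sum>i\<in>{l..<n}. \<tau> i) < s} \<tau> :: ennreal) =
    (\<lambda>\<tau>. (\<Prod>i\<in>{l..<n}. indicator {0<..} (\<tau> i)) * indicator {..<s} (\<Sum>i\<in>{l..<n}. \<tau> i))"
    by (rule ext, simp only: prod_indicator_eq finite_atLeastLessThan) (simp add: indicator_def)
  have I: "(\<lambda>\<tau>. indicator {\<tau>. (\<forall>i\<in>{l..<n}. 0 < \<tau> i) \<and> (\<Sum>i\<in>{l..<n}. \<tau> i) < s} \<tau> :: ennreal)
      \<in> borel_measurable ?M"
    unfolding I0 by (intro borel_measurable_times_ennreal borel_measurable_prod_ennreal) measurable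
  have "(\<lambda>\<tau>. simplex_density l n s F \<tau>) \<in> borel_measurable ?M"
    unfolding simplex_density_def by (intro borel_measurable_times_ennreal F' I)
  then show ?thesis .
qed

lemma simplex_density_cong:
  assumes "\<And>u v. (\<And>i. i \<in> {l..n} \<Longrightarrow> u i = v i) \<Longrightarrow> F u = F v"
    and "\<And>i. i \<in> {l..<n} \<Longrightarrow> u i = v i"
  shows "simplex_density l n s F u = simplex_density l n s F v"
proof -
  have s: "(\<Sum>i\<in>{l..<n}. u i) = (\<Sum>i\<in>{l..<n}. v i)" using assms(2) by (rule sum.cong[OF refl])
  have "F (u(n := s - (\<Sum>i\<in>{l..<n}. u i))) = F (v(n := s - (\<Sum>i\<in>{l..<n}. v i)))"
    by (rule assms(1)) (use assms(2) s in auto)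
  then show ?thesis unfolding simplex_density_def using s assms(2) by (simp add: indicator_def)
qed

lemma borel_measurable_peel:
  assumes F: "F \<in> borel_measurable (\<Pi>\<^sub>M i\<in>UNIV. borel)"
  shows "peel l n z y F t \<in> borel_measurable (\<Pi>\<^sub>M i\<in>UNIV. borel)"
proof -
  let ?M = "\<Pi>\<^sub>M i\<in>(UNIV::nat set). (borel :: real measure)"
  have c [measurable]: "(\<lambda>x. x i) \<in> borel_measurable ?M" for i
    by (rule measurable_component_singleton) simp
  have F': "(\<lambda>u. F (\<lambda>i. if i = l then z - 1 - (\<Sum>j\<in>{Suc l..n}. (y j - t) / (y j - y l) * u j)
           else u i * ((y i - t) / (y i - y l)))) \<in> borel_measurable ?M"
    by (rule measurable_compose[OF measurable_into_PiM_UNIV F]) measurable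
  have "(\<lambda>u. peel l n z y F t u) \<in> borel_measurable ?M"
    unfolding peel_def by (intro borel_measurable_times_ennreal F') measurable
  then show ?thesis .
qed

lemma peel_cong:
  assumes "\<And>u v. (\<And>i. i \<in> {l..n} \<Longrightarrow> u i = v i) \<Longrightarrow> F u = F v"
    and "\<And>i. i \<in> {Suc l..n} \<Longrightarrow> u i = v i"
  shows "peel l n z y F t u = peel l n z y F t v"
proof -
  have 1: "(\<Sum>i\<in>{Suc l..n}. y i * u i / (y i - t)) = (\<Sum>i\<in>{Suc l..n}. y i * v i / (y i - t))"
    "(\<Sum>j\<in>{Suc l..n}. (y j - t) / (y j - y l) * u j) = (\<Sum>j\<in>{Suc l..n}. (y j - t) / (y j - y l) * v j)"
    using assms(2) by (auto intro!: sum.cong)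
  have "F (\<lambda>i. if i = l then z - 1 - (\<Sum>j\<in>{Suc l..n}. (y j - t) / (y j - y l) * u j)
           else u i * ((y i - t) / (y i - y l))) =
        F (\<lambda>i. if i = l then z - 1 - (\<Sum>j\<in>{Suc l..n}. (y j - t) / (y j - y l) * v j)
           else v i * ((y i - t) / (y i - y l)))"
    by (rule assms(1)) (use assms(2) 1 in auto)
  then show ?thesis unfolding peel_def using 1 by simp
qed

theorem fibre_pushforward:
  assumes "l \<le> n" and "\<And>i. i \<in> {l..n} \<Longrightarrow> 0 < y i" and "strict_mono_on {l..n} y"
    and "F \<in> borel_measurable (\<Pi>\<^sub>M i\<in>UNIV. borel)"
    and "\<And>u v. (\<And>i. i \<in> {l..n} \<Longrightarrow> u i = v i) \<Longrightarrow> F u = F v"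
  shows "(\<integral>\<^sup>+x. fibre_density l n z y F x \<partial>(\<Pi>\<^sub>M k\<in>{l..<n}. lborel)) =
    (\<integral>\<^sup>+\<tau>. simplex_density l n (z - 1) F \<tau> \<partial>(\<Pi>\<^sub>M k\<in>{l..<n}. lborel))"
  using assms
proof (induction l arbitrary: F z rule: inc_induct)
  case base
  have yn: "0 < y n" using base.prems(1) by simp
  have "fibre_density n n z y F x = simplex_density n n (z - 1) F x" for x
  proof -
    define X where "X = on_fibre n n z y x"
    have X: "X = x(n := z * y n)" by (simp add: X_def on_fibre_def)
    have res: "residues_tau n n y X n = z - 1"
      using yn by (simp add: residues_tau_def X diff_divide_distrib)
    have "F (residues_tau n n y X) = F (x(n := z - 1))"
    proof (rule base.prems(4))
      fix i assume "i \<in> {n..n}"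
      then have "i = n" by simp
      then show "residues_tau n n y X i = (x(n := z - 1)) i" using res by simp
    qed
    moreover have "X \<in> interlacing_from n n y \<longleftrightarrow> 1 < z"
      using yn by (simp add: interlacing_from_def X)
    ultimately show ?thesis
      unfolding fibre_density_def simplex_density_def X_def[symmetric]
      by (simp add: vandermonde_ratio_def indicator_def)
  qed
  then show ?case by (simp add: lborel_PiM.nn_integral_empty)
next
  case (step l)
  note l = \<open>l < n\<close>
  note pos = step.prems(1) and mono = step.prems(2) and F = step.prems(3) and cong = step.prems(4)
  let ?J = "{Suc l..<n}"
  let ?P = "\<Pi>\<^sub>M k\<in>?J. (lborel :: real measure)"
  have sub: "{Suc l..n} \<subseteq> {l..n}" by auto
  have mono': "strict_mono_on {Suc l..n} y" using mono by (rule monotone_on_subset) (use sub in simp)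
  have ins: "{l..<n} = insert l ?J" using l by auto
  have yl: "y l < y i" if "i \<in> {Suc l..n}" for i using that strict_mono_onD[OF mono, of l i] by auto
  have yS: "y (Suc l) \<le> y i" if "i \<in> {Suc l..n}" for i
    using that strict_mono_onD[OF mono, of "Suc l" i] by (cases "Suc l = i") auto
  show ?case
  proof (cases "1 < z")
    case False
    have "fibre_density l n z y F x = 0" for x
    proof -
      have "on_fibre l n z y x \<notin> interlacing_from l n y"
        using on_fibre_interlacing_gt_1[of l n z y x, OF _ pos] False l by auto
      then show ?thesis by (simp add: fibre_density_def)
    qed
    moreover have "simplex_density l n (z - 1) F \<tau> = 0" for \<tau>
    proof -
      have "\<not> (\<Sum>i\<in>{l..<n}. \<tau> i) < z - 1" if \<tau>: "\<forall>i\<in>{l..<n}. 0 < \<tau> i"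
      proof -
        have "0 \<le> (\<Sum>i\<in>{l..<n}. \<tau> i)"
          by (rule sum_nonneg) (use \<tau> in \<open>simp add: less_imp_le\<close>)
        then show ?thesis using False by simp
      qed
      then show ?thesis by (auto simp: simplex_density_def indicator_def)
    qed
    ultimately show ?thesis by simp
  next
    case z: True
    define B where "B \<tau> t = z * y l / t - 1 - (\<Sum>i\<in>?J. \<tau> i * (y i - y l) / (y i - t))" for \<tau> t
    define T where "T \<tau> t = (y n - t) / (y n - y l) * B \<tau> t" for \<tau> t
    define T' where "T' \<tau> t = (B \<tau> t + (y n - t) * (z * y l / t\<^sup>2 +
      (\<Sum>i\<in>?J. \<tau> i * (y i - y l) / (y i - t)\<^sup>2))) / (y n - y l)" for \<tau> t
    define D where "D \<tau> = z - 1 - (\<Sum>i\<in>?J. \<tau> i)" for \<tau> :: "nat \<Rightarrow> real"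
    define K where "K t \<tau> = F (\<lambda>i. if i = l then D \<tau> - T \<tau> t else if i = n then T \<tau> t else if i \<in> ?J then \<tau> i else 0) *
      ennreal (T' \<tau> t) * (\<Prod>i\<in>?J. indicator {0<..} (\<tau> i)) * indicator {0<..} (B \<tau> t) * indicator {y l<..<y (Suc l)} t"
      for t \<tau>
    have inner: "(\<integral>\<^sup>+x. fibre_density l n z y F (x(l := t)) \<partial>?P) = (\<integral>\<^sup>+\<tau>. K t \<tau> \<partial>?P)" for t
    proof (cases "y l < t \<and> t < y (Suc l)")
      case False
      then show ?thesis using fibre_density_eq_0[OF l False] by (simp add: K_def)
    next
      case True
      then have t: "y l < t" "t < y (Suc l)" by auto
      let ?c = "\<lambda>i. (y i - t) / (y i - y l)"
      have c: "0 < ?c i" if "i \<in> ?J" for i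
        using yS[of i] yl[of i] t that by (intro divide_pos_pos) auto
      have pm: "peel l n z y F t \<in> borel_measurable (\<Pi>\<^sub>M i\<in>UNIV. borel)" by (rule borel_measurable_peel[OF F])
      have pc: "peel l n z y F t u = peel l n z y F t v" if "\<And>i. i \<in> {Suc l..n} \<Longrightarrow> u i = v i" for u v
        by (rule peel_cong[OF cong that])
      have "(\<integral>\<^sup>+x. fibre_density l n z y F (x(l := t)) \<partial>?P) =
          (\<integral>\<^sup>+x. fibre_density (Suc l) n (z * y l / t) y (peel l n z y F t) x \<partial>?P)"
        by (simp only: fibre_density_peel[OF l t pos mono cong])
      also have "\<dots> = (\<integral>\<^sup>+\<tau>. simplex_density (Suc l) n (z * y l / t - 1) (peel l n z y F t) \<tau> \<partial>?P)"
        by (rule step.IH[OF _ mono' pm pc]) (use pos in auto)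
      also have "\<dots> = ennreal (\<Prod>i\<in>?J. 1 / ?c i) *
         (\<integral>\<^sup>+\<tau>. simplex_density (Suc l) n (z * y l / t - 1) (peel l n z y F t) (\<lambda>i. \<tau> i / ?c i) \<partial>?P)"
        by (rule nn_integral_PiM_scale[OF _ c borel_measurable_simplex_density[OF pm]])
          (auto intro: simplex_density_cong[OF pc])
      also have "\<dots> = (\<integral>\<^sup>+\<tau>. ennreal (\<Prod>i\<in>?J. 1 / ?c i) *
          simplex_density (Suc l) n (z * y l / t - 1) (peel l n z y F t) (\<lambda>i. \<tau> i / ?c i) \<partial>?P)"
      proof (rule nn_integral_cmult[symmetric])
        have "(\<lambda>\<tau>. simplex_density (Suc l) n (z * y l / t - 1) (peel l n z y F t)
            (\<lambda>i. (if i \<in> ?J then \<tau> i else 0) / ?c i)) \<in> borel_measurable ?P"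
          by (rule measurable_compose[OF measurable_into_PiM_UNIV borel_measurable_simplex_density[OF pm]])
            (intro borel_measurable_divide borel_measurable_component_if borel_measurable_const)
        also have "(\<lambda>\<tau>. simplex_density (Suc l) n (z * y l / t - 1) (peel l n z y F t)
            (\<lambda>i. (if i \<in> ?J then \<tau> i else 0) / ?c i)) =
          (\<lambda>\<tau>. simplex_density (Suc l) n (z * y l / t - 1) (peel l n z y F t) (\<lambda>i. \<tau> i / ?c i))"
          by (rule ext, rule simplex_density_cong[OF pc]) auto
        finally show "(\<lambda>\<tau>. simplex_density (Suc l) n (z * y l / t - 1) (peel l n z y F t) (\<lambda>i. \<tau> i / ?c i))
          \<in> borel_measurable ?P" .
      qed
      also have "\<dots> = (\<integral>\<^sup>+\<tau>. K t \<tau> \<partial>?P)"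
      proof (rule nn_integral_cong)
        fix \<tau>
        have "F (\<lambda>i. if i = l then D \<tau> - T \<tau> t else if i = n then T \<tau> t else \<tau> i) =
          F (\<lambda>i. if i = l then D \<tau> - T \<tau> t else if i = n then T \<tau> t else if i \<in> ?J then \<tau> i else 0)"
          by (rule cong) auto
        moreover have "(indicator {\<tau>. \<forall>i\<in>?J. 0 < \<tau> i} \<tau> :: ennreal) = (\<Prod>i\<in>?J. indicator {0<..} (\<tau> i))"
          by (subst prod_indicator_eq) (auto simp: indicator_def)
        moreover have "(indicator {y l<..<y (Suc l)} t :: ennreal) = 1" using t by simp
        moreover have "ennreal (\<Prod>i\<in>?J. 1 / ?c i) *
          simplex_density (Suc l) n (z * y l / t - 1) (peel l n z y F t) (\<lambda>i. \<tau> i / ?c i) =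
          F (\<lambda>i. if i = l then D \<tau> - T \<tau> t else if i = n then T \<tau> t else \<tau> i) * ennreal (T' \<tau> t) *
          indicator {\<tau>. \<forall>i\<in>?J. 0 < \<tau> i} \<tau> * indicator {0<..} (B \<tau> t)"
          unfolding B_def T_def T'_def D_def by (rule simplex_density_peel[OF l t pos mono cong])
        ultimately show "ennreal (\<Prod>i\<in>?J. 1 / ?c i) *
          simplex_density (Suc l) n (z * y l / t - 1) (peel l n z y F t) (\<lambda>i. \<tau> i / ?c i) = K t \<tau>"
          unfolding K_def by (simp only: mult_1_right)
      qed
      finally show ?thesis .
    qed
    have comp: "(\<lambda>p. snd p i) \<in> borel_measurable (lborel \<Otimes>\<^sub>M ?P)" if "i \<in> ?J" for i
      by (rule measurable_compose[OF measurable_snd borel_measurable_component[OF that]])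
    have fst': "(\<lambda>p. fst p) \<in> borel_measurable (lborel \<Otimes>\<^sub>M ?P)"
      using measurable_fst[of "lborel :: real measure" ?P] by simp
    have mB: "(\<lambda>p. B (snd p) (fst p)) \<in> borel_measurable (lborel \<Otimes>\<^sub>M ?P)"
      unfolding B_def
      by (intro borel_measurable_diff borel_measurable_divide borel_measurable_times borel_measurable_const
          borel_measurable_sum comp fst')
    have mT: "(\<lambda>p. T (snd p) (fst p)) \<in> borel_measurable (lborel \<Otimes>\<^sub>M ?P)"
      unfolding T_def
      by (intro borel_measurable_diff borel_measurable_divide borel_measurable_times borel_measurable_const mB fst')
    have mT': "(\<lambda>p. T' (snd p) (fst p)) \<in> borel_measurable (lborel \<Otimes>\<^sub>M ?P)"
      unfolding T'_def
      by (intro borel_measurable_diff borel_measurable_divide borel_measurable_times borel_measurable_const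
          borel_measurable_add borel_measurable_power borel_measurable_sum mB fst' comp)
    have mD: "(\<lambda>p. D (snd p)) \<in> borel_measurable (lborel \<Otimes>\<^sub>M ?P)"
      unfolding D_def by (intro borel_measurable_diff borel_measurable_const borel_measurable_sum comp)
    have mK: "(\<lambda>(t, \<tau>). K t \<tau>) \<in> borel_measurable (lborel \<Otimes>\<^sub>M ?P)"
    proof -
      have "(\<lambda>p. F (\<lambda>i. if i = l then D (snd p) - T (snd p) (fst p) else if i = n then T (snd p) (fst p)
          else if i \<in> ?J then snd p i else 0)) \<in> borel_measurable (lborel \<Otimes>\<^sub>M ?P)"
      proof (rule measurable_compose[OF measurable_into_PiM_UNIV F])
        fix i show "(\<lambda>p. if i = l then D (snd p) - T (snd p) (fst p) else if i = n then T (snd p) (fst p)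
          else if i \<in> ?J then snd p i else 0) \<in> borel_measurable (lborel \<Otimes>\<^sub>M ?P)"
        proof -
          consider "i = l" | "i \<noteq> l" "i = n" | "i \<noteq> l" "i \<noteq> n" "i \<in> ?J" | "i \<noteq> l" "i \<noteq> n" "i \<notin> ?J" by blast
          then show ?thesis
          proof cases
            case 1
            show ?thesis by (simp only: 1 if_True refl) (rule borel_measurable_diff[OF mD mT])
          next
            case 2
            then have "l \<noteq> n" by simp
            then show ?thesis using mT by (simp add: 2)
          next
            case 3
            show ?thesis by (simp only: 3 if_True if_False) (rule comp[OF 3(3)])
          next
            case 4
            show ?thesis by (simp only: 4 if_False) (rule borel_measurable_const)
          qed
        qed
      qed
      moreover have "(\<lambda>p. indicator {0<..} (snd p i) :: ennreal) \<in> borel_measurable (lborel \<Otimes>\<^sub>M ?P)" if "i \<in> ?J" for i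
        using comp[OF that] by measurable
      moreover have "(\<lambda>p. indicator {0<..} (B (snd p) (fst p)) :: ennreal) \<in> borel_measurable (lborel \<Otimes>\<^sub>M ?P)"
        using mB by measurable
      moreover have "(\<lambda>p. indicator {y l<..<y (Suc l)} (fst p) :: ennreal) \<in> borel_measurable (lborel \<Otimes>\<^sub>M ?P)"
        using fst' by measurable
      ultimately show ?thesis
        unfolding split_beta' K_def
        by (intro borel_measurable_times_ennreal borel_measurable_prod_ennreal measurable_compose[OF mT' measurable_ennreal])
    qed
    have outer: "(\<integral>\<^sup>+t. K t \<tau> \<partial>lborel) = (\<integral>\<^sup>+u. simplex_density l n (z - 1) F (\<tau>(l := u)) \<partial>lborel)" for \<tau>
    proof (cases "\<forall>i\<in>?J. 0 < \<tau> i")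
      case False
      then have 0: "(\<Prod>i\<in>?J. indicator {0<..} (\<tau> i) :: ennreal) = 0"
        by (subst prod_indicator_eq) auto
      have "simplex_density l n (z - 1) F (\<tau>(l := u)) = 0" for u
        using False unfolding simplex_density_def ins by (auto simp: indicator_def)
      then show ?thesis by (simp only: K_def 0 mult_zero_right mult_zero_left)
    next
      case \<tau>: True
      then have 1: "(\<Prod>i\<in>?J. indicator {0<..} (\<tau> i) :: ennreal) = 1"
        by (subst prod_indicator_eq) auto
      define f where "f u = F (\<lambda>i. if i = l then u else if i = n then D \<tau> - u else if i \<in> ?J then \<tau> i else 0)" for u
      have [measurable]: "f \<in> borel_measurable borel"
      proof -
        have "(\<lambda>u. f u) \<in> borel_measurable borel"
          unfolding f_def by (rule measurable_compose[OF measurable_into_PiM_UNIV F]) measurable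
        then show ?thesis .
      qed
      have "K t \<tau> = f (D \<tau> - T \<tau> t) * ennreal (T' \<tau> t) * indicator {t. y l < t \<and> t < y (Suc l) \<and> 0 < B \<tau> t} t" for t
      proof -
        have e: "D \<tau> - (D \<tau> - T \<tau> t) = T \<tau> t" by simp
        show ?thesis unfolding K_def f_def e 1 by (auto simp: indicator_def)
      qed
      then have "(\<integral>\<^sup>+t. K t \<tau> \<partial>lborel) =
          (\<integral>\<^sup>+t. f (D \<tau> - T \<tau> t) * ennreal (T' \<tau> t) * indicator {t. y l < t \<and> t < y (Suc l) \<and> 0 < B \<tau> t} t \<partial>lborel)"
        by simp
      also have "\<dots> = (\<integral>\<^sup>+u. f u * indicator {0<..<D \<tau>} u \<partial>lborel)"
        unfolding B_def T_def T'_def D_def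
      proof (rule nn_integral_substitution_pole)
        show "f \<in> borel_measurable borel" "finite ?J" "0 < y l" "1 < z"
          using pos[of l] l z by auto
        show "y l < y (Suc l)" "y (Suc l) \<le> y n" using yl[of "Suc l"] yS[of n] l by auto
        show "y (Suc l) \<le> y i" if "i \<in> ?J" for i using yS[of i] that by simp
        show "0 < \<tau> i" if "i \<in> ?J" for i using \<tau> that by blast
        show "(\<exists>j\<in>?J. y j = y (Suc l)) \<or> y n = y (Suc l)"
        proof (cases "Suc l = n")
          case False
          then have "Suc l \<in> ?J" using l by simp
          then show ?thesis by blast
        qed simp
      qed
      also have "\<dots> = (\<integral>\<^sup>+u. simplex_density l n (z - 1) F (\<tau>(l := u)) \<partial>lborel)"
      proof (rule nn_integral_cong)
        fix u :: real
        have s: "(\<Sum>i\<in>{l..<n}. (\<tau>(l := u)) i) = u + (\<Sum>i\<in>?J. \<tau> i)"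
        proof -
          have "(\<Sum>i\<in>?J. (\<tau>(l := u)) i) = (\<Sum>i\<in>?J. \<tau> i)" by (rule sum.cong) auto
          then show ?thesis unfolding ins by simp
        qed
        have "F ((\<tau>(l := u))(n := z - 1 - (u + (\<Sum>i\<in>?J. \<tau> i)))) = f u"
          unfolding f_def D_def by (rule cong) (use l in auto)
        moreover have "(\<forall>i\<in>{l..<n}. 0 < (\<tau>(l := u)) i) \<and> u + (\<Sum>i\<in>?J. \<tau> i) < z - 1 \<longleftrightarrow> 0 < u \<and> u < D \<tau>"
          using \<tau> unfolding ins D_def by auto
        ultimately show "f u * indicator {0<..<D \<tau>} u = simplex_density l n (z - 1) F (\<tau>(l := u))"
          by (simp only: simplex_density_def s indicator_def mem_Collect_eq greaterThanLessThan_iff)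
      qed
      finally show ?thesis .
    qed
    have ms: "simplex_density l n (z - 1) F \<in> borel_measurable (\<Pi>\<^sub>M k\<in>insert l ?J. (lborel :: real measure))"
    proof -
      have "(\<lambda>\<tau>. simplex_density l n (z - 1) F (\<lambda>i. if i \<in> insert l ?J then \<tau> i else 0))
          \<in> borel_measurable (\<Pi>\<^sub>M k\<in>insert l ?J. (lborel :: real measure))"
        by (rule measurable_compose[OF measurable_into_PiM_UNIV borel_measurable_simplex_density[OF F]])
          (rule borel_measurable_component_if)
      also have "(\<lambda>\<tau>. simplex_density l n (z - 1) F (\<lambda>i. if i \<in> insert l ?J then \<tau> i else 0)) =
        simplex_density l n (z - 1) F"
        by (rule ext, rule simplex_density_cong[OF cong]) (use ins in auto)
      finally show ?thesis .
    qed
    have mf: "fibre_density l n z y F \<in> borel_measurable (\<Pi>\<^sub>M k\<in>insert l ?J. (lborel :: real measure))"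
      unfolding ins[symmetric] by (rule borel_measurable_fibre_density[OF F]) (rule cong, blast)
    interpret P: sigma_finite_measure ?P by (rule lborel_PiM.sigma_finite) simp
    have "(\<integral>\<^sup>+x. fibre_density l n z y F x \<partial>(\<Pi>\<^sub>M k\<in>{l..<n}. lborel)) =
        (\<integral>\<^sup>+t. (\<integral>\<^sup>+x. fibre_density l n z y F (x(l := t)) \<partial>?P) \<partial>lborel)"
      unfolding ins by (rule lborel_PiM.product_nn_integral_insert_rev[OF _ _ mf]) auto
    also have "\<dots> = (\<integral>\<^sup>+t. (\<integral>\<^sup>+\<tau>. K t \<tau> \<partial>?P) \<partial>lborel)" by (simp only: inner)
    also have "\<dots> = (\<integral>\<^sup>+\<tau>. (\<integral>\<^sup>+t. K t \<tau> \<partial>lborel) \<partial>?P)"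
      by (rule pair_sigma_finite.Fubini'[symmetric, OF _ mK])
        (simp add: P.sigma_finite_measure_axioms pair_sigma_finite.intro sigma_finite_lborel)
    also have "\<dots> = (\<integral>\<^sup>+\<tau>. (\<integral>\<^sup>+u. simplex_density l n (z - 1) F (\<tau>(l := u)) \<partial>lborel) \<partial>?P)"
      by (simp only: outer)
    also have "\<dots> = (\<integral>\<^sup>+\<tau>. simplex_density l n (z - 1) F \<tau> \<partial>(\<Pi>\<^sub>M k\<in>{l..<n}. lborel))"
      unfolding ins by (rule lborel_PiM.product_nn_integral_insert[symmetric, OF _ _ ms]) auto
    finally show ?thesis .
  qed
qed

section \<open>The Dirichlet integral and the integral operator\<close>

lemma nn_integral_beta:
  fixes a b s :: real
  assumes a: "a > 0" and b: "b > 0" and s: "s > 0"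
  shows "(\<integral>\<^sup>+t. ennreal (t powr (a - 1) * (s - t) powr (b - 1)) * indicator {0<..<s} t \<partial>lborel) =
    ennreal (s powr (a + b - 1) * Beta a b)"
proof -
  let ?f = "\<lambda>t. t powr (a - 1) * (1 - t) powr (b - 1)"
  have ind: "ennreal (?f t) * indicator {0<..<1} t = ennreal (indicator {0..1} t * ?f t)" for t
    by (auto simp: indicator_def)
  have 1: "(\<integral>\<^sup>+t. ennreal (?f t) * indicator {0<..<1} t \<partial>lborel) = ennreal (Beta a b)"
    unfolding ind by (rule nn_integral_has_integral_lebesgue[OF _ has_integral_Beta_real[OF a b]]) simp
  have 2: "(\<integral>\<^sup>+t. ennreal (t powr (a - 1) * (s - t) powr (b - 1)) * indicator {0<..<s} t \<partial>lborel) =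
      ennreal s * (\<integral>\<^sup>+t. ennreal ((s * t) powr (a - 1) * (s - s * t) powr (b - 1)) * indicator {0<..<s} (s * t) \<partial>lborel)"
    using nn_integral_real_affine[of "\<lambda>t. ennreal (t powr (a - 1) * (s - t) powr (b - 1)) * indicator {0<..<s} t" s 0] s
    by simp
  have 3: "ennreal ((s * t) powr (a - 1) * (s - s * t) powr (b - 1)) * indicator {0<..<s} (s * t) =
      ennreal (s powr (a + b - 2)) * (ennreal (?f t) * indicator {0<..<1} t)" for t
  proof (cases "0 < t \<and> t < 1")
    case True
    have "(s - s * t) = s * (1 - t)" by (simp add: algebra_simps)
    moreover have "s powr (a - 1) * s powr (b - 1) = s powr (a + b - 2)"
      by (simp add: powr_add[symmetric])
    ultimately have "(s * t) powr (a - 1) * (s - s * t) powr (b - 1) = s powr (a + b - 2) * ?f t"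
      using True s by (simp add: powr_mult mult_ac)
    then show ?thesis using True s by (simp add: ennreal_mult'[symmetric] indicator_def)
  next
    case False
    then have "\<not> (0 < s * t \<and> s * t < s)" using s by (simp add: zero_less_mult_iff)
    then show ?thesis using False by (auto simp: indicator_def)
  qed
  have 4: "s * s powr (a + b - 2) = s powr (a + b - 1)"
    using s powr_add[of s 1 "a + b - 2"] by simp
  have "(\<integral>\<^sup>+t. ennreal (s powr (a + b - 2)) * (ennreal (?f t) * indicator {0<..<1} t) \<partial>lborel) =
      ennreal (s powr (a + b - 2)) * ennreal (Beta a b)"
    unfolding 1[symmetric] by (rule nn_integral_cmult) measurable
  then show ?thesis
    unfolding 2 3 4[symmetric] using s by (simp add: ennreal_mult'[symmetric] mult.assoc)
qed

lemma borel_measurable_simplex_density_PiM: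
  assumes F: "F \<in> borel_measurable (\<Pi>\<^sub>M i\<in>UNIV. borel)"
    and cong: "\<And>u v. (\<And>i. i \<in> {l..n} \<Longrightarrow> u i = v i) \<Longrightarrow> F u = F v"
  shows "simplex_density l n s F \<in> borel_measurable (\<Pi>\<^sub>M k\<in>{l..<n}. (lborel :: real measure))"
proof -
  have "(\<lambda>\<tau>. simplex_density l n s F (\<lambda>i. if i \<in> {l..<n} then \<tau> i else 0))
      \<in> borel_measurable (\<Pi>\<^sub>M k\<in>{l..<n}. (lborel :: real measure))"
    by (rule measurable_compose[OF measurable_into_PiM_UNIV borel_measurable_simplex_density[OF F]])
      (rule borel_measurable_component_if)
  also have "(\<lambda>\<tau>. simplex_density l n s F (\<lambda>i. if i \<in> {l..<n} then \<tau> i else 0)) = simplex_density l n s F"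
    by (rule ext, rule simplex_density_cong[OF cong]) auto
  finally show ?thesis .
qed

lemma borel_measurable_prod_powr:
  fixes \<beta> :: "nat \<Rightarrow> real"
  shows "(\<lambda>u. ennreal (\<Prod>i\<in>I. u i powr \<beta> i)) \<in> borel_measurable (\<Pi>\<^sub>M i\<in>UNIV. borel)"
proof -
  have [measurable]: "(\<lambda>x. x i) \<in> borel_measurable (\<Pi>\<^sub>M i\<in>(UNIV::nat set). (borel :: real measure))" for i
    by (rule measurable_component_singleton) simp
  show ?thesis by measurable
qed

theorem nn_integral_dirichlet:
  fixes \<alpha> :: "nat \<Rightarrow> real"
  assumes "l \<le> n" and "\<And>i. i \<in> {l..n} \<Longrightarrow> \<alpha> i > 0" and "s > 0"
  shows "(\<integral>\<^sup>+\<tau>. simplex_density l n s (\<lambda>u. ennreal (\<Prod>i\<in>{l..n}. u i powr (\<alpha> i - 1))) \<tau> \<partial>(\<Pi>\<^sub>M k\<in>{l..<n}. lborel)) =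
    ennreal (s powr ((\<Sum>i\<in>{l..n}. \<alpha> i) - 1) * ((\<Prod>i\<in>{l..n}. Gamma (\<alpha> i)) / Gamma (\<Sum>i\<in>{l..n}. \<alpha> i)))"
  using assms
proof (induction l arbitrary: s rule: inc_induct)
  case base
  have "0 < \<alpha> n" using base.prems(1)[of n] by simp
  then have "Gamma (\<alpha> n) \<noteq> 0" using Gamma_real_pos less_irrefl by metis
  then show ?case using base.prems
    by (simp add: lborel_PiM.nn_integral_empty simplex_density_def indicator_def space_PiM_empty)
next
  case (step l)
  note l = \<open>l < n\<close>
  let ?J = "{Suc l..<n}"
  let ?P = "\<Pi>\<^sub>M k\<in>?J. (lborel :: real measure)"
  let ?F = "\<lambda>l u. ennreal (\<Prod>i\<in>{l..n}. u i powr (\<alpha> i - 1))"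
  define A where "A = (\<Sum>i\<in>{Suc l..n}. \<alpha> i)"
  define C where "C = (\<Prod>i\<in>{Suc l..n}. Gamma (\<alpha> i)) / Gamma A"
  have ins: "{l..<n} = insert l ?J" "{l..n} = insert l {Suc l..n}" using l by auto
  have \<alpha>: "\<alpha> i > 0" if "i \<in> {l..n}" for i using step.prems(1) that by blast
  have A: "A > 0" unfolding A_def using l \<alpha> by (intro sum_pos) auto
  have C: "C \<ge> 0" unfolding C_def using A \<alpha> l
    by (intro divide_nonneg_pos prod_nonneg) (auto intro!: less_imp_le Gamma_real_pos)
  have split: "simplex_density l n s (?F l) (\<tau>(l := t)) =
      ennreal (t powr (\<alpha> l - 1)) * indicator {0<..} t * simplex_density (Suc l) n (s - t) (?F (Suc l)) \<tau>" for t \<tau>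
  proof -
    have s: "(\<Sum>i\<in>{l..<n}. (\<tau>(l := t)) i) = t + (\<Sum>i\<in>?J. \<tau> i)"
    proof -
      have "(\<Sum>i\<in>?J. (\<tau>(l := t)) i) = (\<Sum>i\<in>?J. \<tau> i)" by (rule sum.cong) auto
      then show ?thesis unfolding ins by simp
    qed
    let ?u = "\<tau>(l := t, n := s - (t + (\<Sum>i\<in>?J. \<tau> i)))" and ?v = "\<tau>(n := s - t - (\<Sum>i\<in>?J. \<tau> i))"
    have "?F l ?u = ennreal (t powr (\<alpha> l - 1)) * ?F (Suc l) ?v"
    proof -
      have "(\<Prod>i\<in>{Suc l..n}. ?u i powr (\<alpha> i - 1)) = (\<Prod>i\<in>{Suc l..n}. ?v i powr (\<alpha> i - 1))"
        by (rule prod.cong) (auto simp: diff_diff_eq)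
      moreover have "?u l = t" using l by simp
      ultimately have "(\<Prod>i\<in>{l..n}. ?u i powr (\<alpha> i - 1)) = t powr (\<alpha> l - 1) * (\<Prod>i\<in>{Suc l..n}. ?v i powr (\<alpha> i - 1))"
        unfolding ins(2) by (subst prod.insert) auto
      then show ?thesis by (simp only: ennreal_mult' powr_ge_zero)
    qed
    moreover have "(indicator {\<tau>. (\<forall>i\<in>{l..<n}. 0 < \<tau> i) \<and> (\<Sum>i\<in>{l..<n}. \<tau> i) < s} (\<tau>(l := t)) :: ennreal) =
        indicator {0<..} t * indicator {\<tau>. (\<forall>i\<in>?J. 0 < \<tau> i) \<and> (\<Sum>i\<in>?J. \<tau> i) < s - t} \<tau>"
    proof -
      have "(\<forall>i\<in>{l..<n}. 0 < (\<tau>(l := t)) i) \<longleftrightarrow> 0 < t \<and> (\<forall>i\<in>?J. 0 < \<tau> i)" unfolding ins by auto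
      moreover have "t + (\<Sum>i\<in>?J. \<tau> i) < s \<longleftrightarrow> (\<Sum>i\<in>?J. \<tau> i) < s - t" by linarith
      ultimately show ?thesis by (simp only: indicator_def mem_Collect_eq s) auto
    qed
    ultimately show ?thesis unfolding simplex_density_def s by (simp add: mult_ac)
  qed
  have meas: "simplex_density l n s (?F l) \<in> borel_measurable (\<Pi>\<^sub>M k\<in>{l..<n}. (lborel :: real measure))" for l s
    by (rule borel_measurable_simplex_density_PiM[OF borel_measurable_prod_powr]) (auto intro!: arg_cong[where f = ennreal] prod.cong)
  have inner: "(\<integral>\<^sup>+\<tau>. simplex_density l n s (?F l) (\<tau>(l := t)) \<partial>?P) =
      ennreal C * (ennreal (t powr (\<alpha> l - 1) * (s - t) powr (A - 1)) * indicator {0<..<s} t)" for t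
  proof (cases "0 < t \<and> t < s")
    case True
    have "(\<integral>\<^sup>+\<tau>. simplex_density l n s (?F l) (\<tau>(l := t)) \<partial>?P) =
       ennreal (t powr (\<alpha> l - 1)) * (\<integral>\<^sup>+\<tau>. simplex_density (Suc l) n (s - t) (?F (Suc l)) \<tau> \<partial>?P)"
      unfolding split using True by (subst nn_integral_cmult[symmetric]) (auto intro: meas)
    also have "(\<integral>\<^sup>+\<tau>. simplex_density (Suc l) n (s - t) (?F (Suc l)) \<tau> \<partial>?P) = ennreal ((s - t) powr (A - 1) * C)"
      unfolding A_def C_def by (rule step.IH) (use True \<alpha> in auto)
    also have "ennreal (t powr (\<alpha> l - 1)) * ennreal ((s - t) powr (A - 1) * C) =
        ennreal C * (ennreal (t powr (\<alpha> l - 1) * (s - t) powr (A - 1)) * indicator {0<..<s} t)"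
      using True C by (simp add: ennreal_mult'[symmetric] mult_ac)
    finally show ?thesis .
  next
    case False
    have "simplex_density l n s (?F l) (\<tau>(l := t)) = 0" for \<tau>
    proof (cases "0 < t")
      case True
      have "\<not> (\<Sum>i\<in>?J. \<tau> i) < s - t" if "\<forall>i\<in>?J. 0 < \<tau> i"
        using sum_nonneg[of ?J \<tau>] that True False by (simp add: less_imp_le)
      then show ?thesis unfolding split by (auto simp: simplex_density_def indicator_def)
    qed (simp add: split)
    then show ?thesis using False by simp
  qed
  have "(\<integral>\<^sup>+\<tau>. simplex_density l n s (?F l) \<tau> \<partial>(\<Pi>\<^sub>M k\<in>{l..<n}. lborel)) =
      (\<integral>\<^sup>+t. (\<integral>\<^sup>+\<tau>. simplex_density l n s (?F l) (\<tau>(l := t)) \<partial>?P) \<partial>lborel)"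
    unfolding ins(1)
    by (rule lborel_PiM.product_nn_integral_insert_rev[OF _ _ meas[where l = l and s = s, unfolded ins(1)]]) auto
  also have "\<dots> = ennreal C * (\<integral>\<^sup>+t. ennreal (t powr (\<alpha> l - 1) * (s - t) powr (A - 1)) * indicator {0<..<s} t \<partial>lborel)"
    unfolding inner by (rule nn_integral_cmult) measurable
  also have "\<dots> = ennreal (C * (s powr (\<alpha> l + A - 1) * Beta (\<alpha> l) A))"
    using nn_integral_beta[OF _ A step.prems(2), of "\<alpha> l"] \<alpha>[of l] l C by (simp add: ennreal_mult')
  also have "C * (s powr (\<alpha> l + A - 1) * Beta (\<alpha> l) A) =
      s powr ((\<Sum>i\<in>{l..n}. \<alpha> i) - 1) * ((\<Prod>i\<in>{l..n}. Gamma (\<alpha> i)) / Gamma (\<Sum>i\<in>{l..n}. \<alpha> i))"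
  proof -
    have "Gamma A \<noteq> 0" using Gamma_real_pos[OF A] less_irrefl by metis
    moreover have "(\<Sum>i\<in>{l..n}. \<alpha> i) = \<alpha> l + A" "(\<Prod>i\<in>{l..n}. Gamma (\<alpha> i)) = Gamma (\<alpha> l) * (\<Prod>i\<in>{Suc l..n}. Gamma (\<alpha> i))"
      unfolding ins(2) A_def by auto
    ultimately show ?thesis by (simp add: C_def Beta_def)
  qed
  finally show ?case .
qed

lemma residues_tau_pos:
  assumes X: "X \<in> interlacing_from l n y" and mono: "strict_mono_on {l..n} y"
    and i: "i \<in> {l..n}" and yi: "0 < y i"
  shows "0 < residues_tau l n y X i"
proof -
  have "0 < (X k - y i) / (y k - y i)" if k: "k \<in> {l..n} - {i}" for k
  proof (cases "i < k")
    case True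
    then have "y i < y k" using strict_mono_onD[OF mono, of i k] i k by auto
    moreover have "y k < X k" using X k by (auto simp: interlacing_from_def)
    ultimately show ?thesis by simp
  next
    case False
    then have ki: "k < i" using k by auto
    have "X k < y (Suc k)" using X k i ki by (auto simp: interlacing_from_def)
    moreover have "y (Suc k) \<le> y i" using ki i k strict_mono_onD[OF mono, of "Suc k" i] by (cases "Suc k = i") auto
    moreover have "y k < y i" using strict_mono_onD[OF mono, of k i] i k ki by auto
    ultimately show ?thesis by (intro divide_neg_neg) auto
  qed
  then have "0 < (\<Prod>k\<in>{l..n} - {i}. (X k - y i) / (y k - y i))" by (rule prod_pos)
  moreover have "0 < X i - y i" using X i by (simp add: interlacing_from_def)
  moreover have "residues_tau l n y X i = (X i - y i) * (\<Prod>k\<in>{l..n} - {i}. (X k - y i) / (y k - y i)) / y i"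
    using i by (simp add: residues_tau_def prod.remove[of "{l..n}" i] prod_dividef)
  ultimately show ?thesis using yi by simp
qed

lemma surface_density:
  fixes x :: "nat \<Rightarrow> real" and C :: real
  assumes n: "1 \<le> n" and x: "\<And>k. k \<in> {1..<n} \<Longrightarrow> 0 < x k"
    and C: "0 < C"
  defines "\<phi> \<equiv> \<lambda>x. C / (\<Prod>i\<in>{1..<n}. x i)"
  shows "sqrt (1 + (grad_norm {1..<n} \<phi> x)\<^sup>2) / grad_norm {1..n} (\<lambda>x. (\<Prod>i=1..n. x i) - C) (x(n := \<phi> x)) =
    (\<Prod>k\<in>{1..<n}. 1 / x k)"
proof -
  let ?J = "{1..<n}"
  define X where "X = x(n := \<phi> x)"
  define p where "p = (\<Prod>i\<in>?J. x i)"
  define S where "S = (\<Sum>k\<in>?J. (X n / x k)\<^sup>2)"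
  have p: "0 < p" unfolding p_def using x by (rule prod_pos)
  have Xn: "X n = C / p" by (simp add: X_def \<phi>_def p_def)
  have Xn0: "0 < X n" using C p by (simp add: Xn)
  have XJ: "X k = x k" if "k \<in> ?J" for k using that by (simp add: X_def)
  have ins: "{1..n} = insert n ?J" using n by auto
  have PX: "(\<Prod>i\<in>{1..n}. X i) = p * X n"
  proof -
    have "(\<Prod>i\<in>?J. X i) = p" unfolding p_def by (rule prod.cong) (auto simp: XJ)
    then show ?thesis unfolding ins by (subst prod.insert) auto
  qed
  have X0: "0 < X k" if "k \<in> {1..n}" for k
  proof (cases "k = n")
    case False
    then have "k \<in> ?J" using that by auto
    then show ?thesis using XJ x by simp
  qed (use Xn0 in simp)
  have upd: "(\<Prod>i\<in>I. (u(k := t)) i) = t * (\<Prod>i\<in>I - {k}. u i)" if "finite I" "k \<in> I"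
    for I k t and u :: "nat \<Rightarrow> real"
  proof -
    have "(\<Prod>i\<in>I. (u(k := t)) i) = (u(k := t)) k * (\<Prod>i\<in>I - {k}. (u(k := t)) i)"
      using that by (rule prod.remove)
    also have "(\<Prod>i\<in>I - {k}. (u(k := t)) i) = (\<Prod>i\<in>I - {k}. u i)" by (rule prod.cong) auto
    finally show ?thesis by simp
  qed
  have d1: "deriv (\<lambda>t. \<phi> (x(k := t))) (x k) = - (X n / x k)" if k: "k \<in> ?J" for k
  proof -
    define r where "r = (\<Prod>i\<in>?J - {k}. x i)"
    have r: "r \<noteq> 0" unfolding r_def using x by (auto simp: less_imp_neq[symmetric])
    have "p = x k * r" unfolding p_def r_def using k by (intro prod.remove) auto
    then have pk: "p = x k * r" .
    have "((\<lambda>t. C / (t * r)) has_real_derivative - (C / (x k * r) / x k)) (at (x k))"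
      using x[OF k] r by (auto intro!: derivative_eq_intros simp: power2_eq_square)
    moreover have "(\<lambda>t. \<phi> (x(k := t))) = (\<lambda>t. C / (t * r))"
      unfolding \<phi>_def by (rule ext) (simp only: upd[OF finite_atLeastLessThan k] r_def)
    ultimately show ?thesis by (simp only: DERIV_imp_deriv Xn pk)
  qed
  have d2: "deriv (\<lambda>t. (\<Prod>i=1..n. (X(k := t)) i) - C) (X k) = p * X n / X k" if k: "k \<in> {1..n}" for k
  proof -
    define r where "r = (\<Prod>i\<in>{1..n} - {k}. X i)"
    have "p * X n = X k * r" unfolding PX[symmetric] r_def using k by (intro prod.remove) auto
    then have pk: "p * X n = X k * r" .
    have "((\<lambda>t. t * r - C) has_real_derivative r) (at (X k))"
      by (auto intro!: derivative_eq_intros)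
    moreover have "(\<lambda>t. (\<Prod>i=1..n. (X(k := t)) i) - C) = (\<lambda>t. t * r - C)"
      by (rule ext) (simp only: upd[OF finite_atLeastAtMost k] r_def)
    ultimately show ?thesis using X0[OF k] by (simp add: DERIV_imp_deriv pk)
  qed
  have "(grad_norm ?J \<phi> x)\<^sup>2 = S"
    by (simp add: grad_norm_def L2_set_def d1 S_def sum_nonneg)
  moreover have "grad_norm {1..n} (\<lambda>x. (\<Prod>i=1..n. x i) - C) X = p * sqrt (1 + S)"
  proof -
    have "(\<Sum>k\<in>{1..n}. (p * X n / X k)\<^sup>2) = p\<^sup>2 + p\<^sup>2 * S"
    proof -
      have "(\<Sum>k\<in>?J. (p * X n / X k)\<^sup>2) = p\<^sup>2 * S"
        unfolding S_def sum_distrib_left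
        by (rule sum.cong) (use XJ in \<open>auto simp: power_mult_distrib power_divide\<close>)
      then show ?thesis using Xn0 unfolding ins by (subst sum.insert) auto
    qed
    then have "grad_norm {1..n} (\<lambda>x. (\<Prod>i=1..n. x i) - C) X = sqrt (p\<^sup>2 * (1 + S))"
      unfolding grad_norm_def L2_set_def by (simp only: d2 cong: sum.cong) (simp add: algebra_simps)
    then show ?thesis using p by (simp add: real_sqrt_mult)
  qed
  moreover have "0 < sqrt (1 + S)"
  proof -
    have "0 \<le> S" unfolding S_def by (rule sum_nonneg) simp
    then show ?thesis by simp
  qed
  ultimately show ?thesis
    unfolding X_def[symmetric] by (simp add: p_def prod_dividef)
qed

definition dirichlet_mean :: "nat \<Rightarrow> real \<Rightarrow> real \<Rightarrow> complex mpoly \<Rightarrow> complex"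
  where "dirichlet_mean n g s p = (\<Sum>a\<in>Poly_Mapping.keys p. Poly_Mapping.lookup p a *
     complex_of_real (s ^ (\<Sum>i=1..n. Poly_Mapping.lookup a i) *
       (\<Prod>i=1..n. pochhammer g (Poly_Mapping.lookup a i)) /
       pochhammer (real n * g) (\<Sum>i=1..n. Poly_Mapping.lookup a i)))"

lemma meval_carrier:
  assumes "\<And>a. a \<in> Poly_Mapping.keys p \<Longrightarrow> Poly_Mapping.keys a \<subseteq> I" "finite I"
  shows "meval x p = (\<Sum>a\<in>Poly_Mapping.keys p. Poly_Mapping.lookup p a * (\<Prod>i\<in>I. x i ^ Poly_Mapping.lookup a i))"
  unfolding meval_def
proof (rule sum.cong[OF refl])
  fix a assume "a \<in> Poly_Mapping.keys p"
  then have "(\<Prod>i\<in>Poly_Mapping.keys a. x i ^ Poly_Mapping.lookup a i) = (\<Prod>i\<in>I. x i ^ Poly_Mapping.lookup a i)"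
    using assms by (intro prod.mono_neutral_left) (auto simp: in_keys_iff)
  then show "Poly_Mapping.lookup p a * (\<Prod>i\<in>Poly_Mapping.keys a. x i ^ Poly_Mapping.lookup a i) =
      Poly_Mapping.lookup p a * (\<Prod>i\<in>I. x i ^ Poly_Mapping.lookup a i)" by simp
qed

lemma Q_integral_eq_dirichlet_mean:
  fixes g z :: real and p P :: "complex mpoly"
  assumes n: "1 \<le> n" and g: "0 < g" and z: "1 < z" and y: "y \<in> chamber n"
    and p: "\<And>a. a \<in> Poly_Mapping.keys p \<Longrightarrow> Poly_Mapping.keys a \<subseteq> {1..n}"
    and rep: "\<And>X. X \<in> interlacing_from 1 n y \<Longrightarrow> (\<Prod>i=1..n. X i) = z * (\<Prod>i=1..n. y i) \<Longrightarrow>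
      c * meval (\<lambda>i. complex_of_real (X i)) P = meval (\<lambda>i. complex_of_real (residues_tau 1 n y X i)) p"
  shows "c * Q_integral n g z P y = dirichlet_mean n g (z - 1) p"
proof -
  define M where "M = (\<Pi>\<^sub>M k\<in>{1..<n}. (lborel :: real measure))"
  define C where "C = z * (\<Prod>i=1..n. y i)"
  define \<phi> where "\<phi> = (\<lambda>x. C / (\<Prod>i\<in>{1..<n}. x i))"
  define X where "X x = x(n := \<phi> x)" for x
  define \<tau> where "\<tau> x i = residues_tau 1 n y (X x) i" for x i
  define K where "K = vandermonde n y * (\<Prod>i=1..n. y i powr (g - 1))"
  define \<alpha> where "\<alpha> a i = g + real (Poly_Mapping.lookup a i)" for a :: expo and i
  define F where "F a u = ennreal (\<Prod>i\<in>{1..n}. u i powr (\<alpha> a i - 1))" for a u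
  define V where "V a = (z - 1) powr ((\<Sum>i\<in>{1..n}. \<alpha> a i) - 1) *
    ((\<Prod>i\<in>{1..n}. Gamma (\<alpha> a i)) / Gamma (\<Sum>i\<in>{1..n}. \<alpha> a i))" for a
  define f where "f a x = enn2real (fibre_density 1 n z y (F a) x)" for a x
  define G where "G x = complex_of_real (sqrt (1 + (grad_norm {1..<n} \<phi> x)\<^sup>2)) *
      (complex_of_real (vandermonde n (X x) * (\<Prod>i=1..n. xi n (X x) y i powr (g - 1))) *
       meval (\<lambda>i. complex_of_real (X x i)) P /
       complex_of_real (grad_norm {1..n} (\<lambda>x. (\<Prod>i=1..n. x i) - C) (X x)))" for x
  have y0: "0 < y i" if "i \<in> {1..n}" for i using y that by (simp add: chamber_def)
  have mono: "strict_mono_on {1..n} y" using y by (simp add: chamber_def)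
  have X_fib: "X x = on_fibre 1 n z y x" for x by (simp add: X_def \<phi>_def on_fibre_def C_def)
  have C0: "0 < C" unfolding C_def using z y0 by (intro mult_pos_pos prod_pos) auto
  have vy: "vandermonde n y > 0"
    unfolding vandermonde_def
    by (intro prod_pos) (use strict_mono_onD[OF mono] in auto)
  have int_eq: "interlacing n y = interlacing_from 1 n y" by (simp add: interlacing_def interlacing_from_def)
  have Q: "Q_integral n g z P y = complex_of_real (Gamma (real n * g) / Gamma g ^ n *
         ((z - 1) powr (1 - real n * g) / K)) *
         (\<integral>x. indicator {x. X x \<in> interlacing_from 1 n y} x *\<^sub>R G x \<partial>M)"
    unfolding Q_integral_def delta_integral_def graph_integral_def set_lebesgue_integral_def
      C_def[symmetric] \<phi>_def[symmetric] X_def[symmetric] M_def[symmetric] K_def int_eq G_def ..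
  have F: "F a \<in> borel_measurable (\<Pi>\<^sub>M i\<in>UNIV. borel)" for a
    unfolding F_def by (rule borel_measurable_prod_powr)
  have Fcong: "F a u = F a v" if "\<And>i. i \<in> {1..n} \<Longrightarrow> u i = v i" for a u v
    unfolding F_def using that by (auto intro!: arg_cong[where f = ennreal] prod.cong)
  have \<alpha>0: "0 < \<alpha> a i" for a i using g by (simp add: \<alpha>_def add_pos_nonneg)
  have S0: "0 < (\<Sum>i\<in>{1..n}. \<alpha> a i)" for a using n \<alpha>0 by (intro sum_pos) auto
  have V0: "0 \<le> V a" for a
    unfolding V_def using \<alpha>0 S0 by (intro mult_nonneg_nonneg divide_nonneg_pos prod_nonneg)
      (auto intro!: less_imp_le Gamma_real_pos)
  have mF: "fibre_density 1 n z y (F a) \<in> borel_measurable M" for a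
    unfolding M_def by (rule borel_measurable_fibre_density[OF F]) (rule Fcong, blast)
  have nn: "(\<integral>\<^sup>+x. fibre_density 1 n z y (F a) x \<partial>M) = ennreal (V a)" for a
  proof -
    have "(\<integral>\<^sup>+x. fibre_density 1 n z y (F a) x \<partial>M) =
        (\<integral>\<^sup>+\<tau>. simplex_density 1 n (z - 1) (F a) \<tau> \<partial>M)"
      unfolding M_def by (rule fibre_pushforward[OF n _ mono F]) (use y0 in blast, rule Fcong, blast)
    also have "\<dots> = ennreal (V a)"
      unfolding M_def V_def F_def by (rule nn_integral_dirichlet[OF n]) (use \<alpha>0 z in auto)
    finally show ?thesis .
  qed
  have fin: "fibre_density 1 n z y (F a) x < top" for a x
    unfolding fibre_density_def F_def
    by (simp add: ennreal_mult_less_top indicator_def)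
  have bi: "has_bochner_integral M (f a) (V a)" for a
  proof (rule has_bochner_integral_nn_integral)
    show "f a \<in> borel_measurable M" unfolding f_def using mF by measurable
    show "(\<integral>\<^sup>+x. ennreal (f a x) \<partial>M) = ennreal (V a)"
      unfolding f_def using fin nn by (simp add: ennreal_enn2real)
  qed (auto simp: f_def V0)
  have point: "c * (indicator {x. X x \<in> interlacing_from 1 n y} x *\<^sub>R G x) =
      (\<Sum>a\<in>Poly_Mapping.keys p. (Poly_Mapping.lookup p a * complex_of_real K) * complex_of_real (f a x))" for x
  proof (cases "X x \<in> interlacing_from 1 n y")
    case False
    then show ?thesis by (simp add: f_def fibre_density_def X_fib)
  next
    case True
    have X0: "0 < X x i" if "i \<in> {1..n}" for i using interlacing_from_pos[OF True y0 that] .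
    have x0: "0 < x i" if "i \<in> {1..<n}" for i using X0[of i] that by (simp add: X_def)
    have t0: "0 < \<tau> x i" if "i \<in> {1..n}" for i
      unfolding \<tau>_def using residues_tau_pos[OF True mono that y0[OF that]] .
    have xi: "xi n (X x) y i = y i * \<tau> x i" if "i \<in> {1..n}" for i
      using y0[OF that] by (simp add: xi_def \<tau>_def residues_tau_def)
    have PX: "(\<Prod>i=1..n. X x i) = z * (\<Prod>i=1..n. y i)"
      unfolding X_fib by (rule prod_on_fibre[OF n]) (use x0 in force)
    have V: "vandermonde n (X x) = vandermonde n y * vandermonde_ratio 1 n y (X x)"
      unfolding vandermonde_ratio_def prod_dividef vandermonde_def[symmetric] using vy by simp
    have xip: "(\<Prod>i=1..n. xi n (X x) y i powr (g - 1)) =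
        (\<Prod>i=1..n. y i powr (g - 1)) * (\<Prod>i=1..n. \<tau> x i powr (g - 1))"
      unfolding prod.distrib[symmetric]
      by (rule prod.cong) (use xi t0 y0 in \<open>auto simp: powr_mult less_imp_le\<close>)
    define W where "W = vandermonde_ratio 1 n y (X x) * (\<Prod>k\<in>{1..<n}. 1 / x k)"
    have W0: "0 \<le> W" unfolding W_def using x0 vandermonde_ratio_nonneg[OF True mono]
      by (intro mult_nonneg_nonneg prod_nonneg) (auto intro: less_imp_le)
    have fa: "f a x = W * ((\<Prod>i=1..n. \<tau> x i powr (g - 1)) * (\<Prod>i=1..n. \<tau> x i ^ Poly_Mapping.lookup a i))" for a
    proof -
      have "(\<Prod>i\<in>{1..n}. \<tau> x i powr (\<alpha> a i - 1)) = (\<Prod>i=1..n. \<tau> x i powr (g - 1)) * (\<Prod>i=1..n. \<tau> x i ^ Poly_Mapping.lookup a i)"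
        unfolding prod.distrib[symmetric]
      proof (rule prod.cong[OF refl])
        fix i assume i: "i \<in> {1..n}"
        have "\<alpha> a i - 1 = (g - 1) + real (Poly_Mapping.lookup a i)" by (simp add: \<alpha>_def)
        then show "\<tau> x i powr (\<alpha> a i - 1) = \<tau> x i powr (g - 1) * \<tau> x i ^ Poly_Mapping.lookup a i"
          using t0[OF i] by (simp only: powr_add powr_realpow)
      qed
      then have "fibre_density 1 n z y (F a) x =
        ennreal (W * ((\<Prod>i=1..n. \<tau> x i powr (g - 1)) * (\<Prod>i=1..n. \<tau> x i ^ Poly_Mapping.lookup a i)))"
        unfolding fibre_density_def X_fib[symmetric] W_def[symmetric] F_def \<tau>_def[symmetric] ennreal_mult'[OF W0]
        using True by simp
      moreover have "0 \<le> (\<Prod>i=1..n. \<tau> x i powr (g - 1)) * (\<Prod>i=1..n. \<tau> x i ^ Poly_Mapping.lookup a i)"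
        using t0 by (intro mult_nonneg_nonneg prod_nonneg) (auto intro: less_imp_le)
      ultimately show ?thesis using W0 by (simp add: f_def)
    qed
    have sd: "sqrt (1 + (grad_norm {1..<n} \<phi> x)\<^sup>2) / grad_norm {1..n} (\<lambda>x. (\<Prod>i=1..n. x i) - C) (X x) =
        (\<Prod>k\<in>{1..<n}. 1 / x k)"
      unfolding X_def \<phi>_def by (rule surface_density[OF n x0 C0])
    have "G x = complex_of_real (sqrt (1 + (grad_norm {1..<n} \<phi> x)\<^sup>2) / grad_norm {1..n} (\<lambda>x. (\<Prod>i=1..n. x i) - C) (X x)) *
      complex_of_real (vandermonde n (X x) * (\<Prod>i=1..n. xi n (X x) y i powr (g - 1))) *
      meval (\<lambda>i. complex_of_real (X x i)) P"
      by (simp add: G_def)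
    also have "\<dots> = complex_of_real (K * (W * (\<Prod>i=1..n. \<tau> x i powr (g - 1)))) * meval (\<lambda>i. complex_of_real (X x i)) P"
      unfolding sd V xip K_def W_def by simp
    finally have "c * G x = complex_of_real (K * (W * (\<Prod>i=1..n. \<tau> x i powr (g - 1)))) *
        meval (\<lambda>i. complex_of_real (\<tau> x i)) p"
      using rep[OF True PX] by (simp add: \<tau>_def)
    also have "\<dots> = (\<Sum>a\<in>Poly_Mapping.keys p. (Poly_Mapping.lookup p a * complex_of_real K) * complex_of_real (f a x))"
    proof -
      have "meval (\<lambda>i. complex_of_real (\<tau> x i)) p = (\<Sum>a\<in>Poly_Mapping.keys p. Poly_Mapping.lookup p a *
          (\<Prod>i\<in>{1..n}. complex_of_real (\<tau> x i) ^ Poly_Mapping.lookup a i))"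
        by (rule meval_carrier) (use p in auto)
      then show ?thesis by (simp add: sum_distrib_left fa mult_ac)
    qed
    finally show ?thesis using True by simp
  qed
  have "has_bochner_integral M (\<lambda>x. \<Sum>a\<in>Poly_Mapping.keys p. (Poly_Mapping.lookup p a * complex_of_real K) * complex_of_real (f a x))
      (\<Sum>a\<in>Poly_Mapping.keys p. (Poly_Mapping.lookup p a * complex_of_real K) * complex_of_real (V a))"
    by (intro has_bochner_integral_sum has_bochner_integral_mult_right has_bochner_integral_of_real bi)
  then have "c * (\<integral>x. indicator {x. X x \<in> interlacing_from 1 n y} x *\<^sub>R G x \<partial>M) =
      (\<Sum>a\<in>Poly_Mapping.keys p. (Poly_Mapping.lookup p a * complex_of_real K) * complex_of_real (V a))"
    unfolding point[symmetric] integral_mult_right_zero[symmetric] by (rule has_bochner_integral_integral_eq)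
  then have "c * Q_integral n g z P y = complex_of_real (Gamma (real n * g) / Gamma g ^ n *
         ((z - 1) powr (1 - real n * g) / K)) *
      (\<Sum>a\<in>Poly_Mapping.keys p. (Poly_Mapping.lookup p a * complex_of_real K) * complex_of_real (V a))"
    unfolding Q by simp
  also have "\<dots> = dirichlet_mean n g (z - 1) p"
    unfolding dirichlet_mean_def sum_distrib_left
  proof (rule sum.cong[OF refl])
    fix a assume "a \<in> Poly_Mapping.keys p"
    define m where "m = (\<Sum>i=1..n. Poly_Mapping.lookup a i)"
    have sum: "(\<Sum>i\<in>{1..n}. \<alpha> a i) = real n * g + real m"
      by (simp add: \<alpha>_def sum.distrib m_def)
    have K0: "K \<noteq> 0" unfolding K_def using vy y0 by (auto simp: less_imp_neq[symmetric])
    have ng: "0 < real n * g" using n g by simp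
    have Gp: "Gamma (x + real k) = Gamma x * pochhammer x k" if "0 < x" for x k
    proof -
      have "x \<notin> \<int>\<^sub>\<le>\<^sub>0" using that by (auto elim!: nonpos_Ints_cases)
      moreover have "Gamma x \<noteq> 0" using Gamma_real_pos[OF that] less_irrefl by metis
      ultimately show ?thesis using pochhammer_Gamma[of x k] by simp
    qed
    have prodG: "(\<Prod>i\<in>{1..n}. Gamma (\<alpha> a i)) = Gamma g ^ n * (\<Prod>i=1..n. pochhammer g (Poly_Mapping.lookup a i))"
      unfolding \<alpha>_def Gp[OF g] by (simp add: prod.distrib)
    have pw: "(z - 1) powr (1 - real n * g) * (z - 1) powr (real n * g + real m - 1) = (z - 1) ^ m"
      using z by (simp add: powr_add[symmetric] powr_realpow)
    have "Gamma (real n * g) \<noteq> 0" "Gamma g \<noteq> 0"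
      using Gamma_real_pos[OF ng] Gamma_real_pos[OF g] less_irrefl by metis+
    then have "Gamma (real n * g) / Gamma g ^ n * ((z - 1) powr (1 - real n * g) / K) * (K * V a) =
        (z - 1) ^ m * (\<Prod>i=1..n. pochhammer g (Poly_Mapping.lookup a i)) / pochhammer (real n * g) m"
      using K0 unfolding V_def sum prodG Gp[OF ng] pw[symmetric] by simp
    then have "complex_of_real (Gamma (real n * g) / Gamma g ^ n * ((z - 1) powr (1 - real n * g) / K)) * complex_of_real (K * V a) =
        complex_of_real ((z - 1) ^ m * (\<Prod>i=1..n. pochhammer g (Poly_Mapping.lookup a i)) / pochhammer (real n * g) m)"
      by (simp only: of_real_mult[symmetric])
    moreover have "q * (l * k * v) = l * (q * (k * v))" for q l k v :: complex by (simp add: mult_ac)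
    ultimately show "complex_of_real (Gamma (real n * g) / Gamma g ^ n * ((z - 1) powr (1 - real n * g) / K)) *
        (Poly_Mapping.lookup p a * complex_of_real K * complex_of_real (V a)) =
      Poly_Mapping.lookup p a * complex_of_real ((z - 1) ^ (\<Sum>i=1..n. Poly_Mapping.lookup a i) *
        (\<Prod>i=1..n. pochhammer g (Poly_Mapping.lookup a i)) / pochhammer (real n * g) (\<Sum>i=1..n. Poly_Mapping.lookup a i))"
      unfolding m_def[symmetric] by (simp only: of_real_mult[of K "V a"])
  qed
  finally show ?thesis .
qed

section \<open>Identities for elementary symmetric functions\<close>

definition subset_sum :: "(nat \<Rightarrow> 'a) \<Rightarrow> ('i set \<Rightarrow> 'a) \<Rightarrow> ('i \<Rightarrow> 'a) \<Rightarrow> 'i set \<Rightarrow> 'a::comm_ring_1"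
  where "subset_sum \<phi> f y I = (\<Sum>S\<in>Pow I. \<phi> (card S) * (\<Prod>i\<in>S. y i) * f S)"

lemma subset_sum_insert:
  assumes "finite I" "i \<notin> I"
  shows "subset_sum \<phi> f y (insert i I) =
    subset_sum \<phi> f y I + y i * subset_sum (\<lambda>k. \<phi> (Suc k)) (\<lambda>S. f (insert i S)) y I"
proof -
  have inj: "inj_on (insert i) (Pow I)" using assms(2) by (auto simp: inj_on_def)
  have "subset_sum \<phi> f y (insert i I) = subset_sum \<phi> f y I +
      (\<Sum>S\<in>insert i ` Pow I. \<phi> (card S) * (\<Prod>i\<in>S. y i) * f S)"
    unfolding subset_sum_def Pow_insert
    by (rule sum.union_disjoint) (use assms in auto)
  also have "(\<Sum>S\<in>insert i ` Pow I. \<phi> (card S) * (\<Prod>i\<in>S. y i) * f S) =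
      (\<Sum>S\<in>Pow I. \<phi> (card (insert i S)) * (\<Prod>i\<in>insert i S. y i) * f (insert i S))"
    by (simp add: sum.reindex[OF inj])
  also have "\<dots> = y i * subset_sum (\<lambda>k. \<phi> (Suc k)) (\<lambda>S. f (insert i S)) y I"
    unfolding subset_sum_def sum_distrib_left
  proof (rule sum.cong[OF refl])
    fix S assume "S \<in> Pow I"
    then have "finite S" "i \<notin> S" using assms finite_subset by auto
    then show "\<phi> (card (insert i S)) * (\<Prod>i\<in>insert i S. y i) * f (insert i S) =
      y i * (\<phi> (Suc (card S)) * (\<Prod>i\<in>S. y i) * f (insert i S))" by (simp add: mult_ac)
  qed
  finally show ?thesis .
qed

lemma subset_sum_cong:
  assumes "\<And>S. S \<subseteq> I \<Longrightarrow> f S = g S"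
  shows "subset_sum \<phi> f y I = subset_sum \<phi> g y I"
  unfolding subset_sum_def using assms by (intro sum.cong) auto

lemma subset_sum_add: "subset_sum \<phi> (\<lambda>S. f S + g S) y I = subset_sum \<phi> f y I + subset_sum \<phi> g y I"
  by (simp add: subset_sum_def distrib_left sum.distrib)

lemma subset_sum_cmult: "subset_sum \<phi> (\<lambda>S. c * f S) y I = c * subset_sum \<phi> f y I"
  by (simp add: subset_sum_def sum_distrib_left mult_ac)

lemma subset_sum_zero [simp]: "subset_sum \<phi> (\<lambda>S. 0) y I = 0"
  by (simp add: subset_sum_def)

lemma subset_sum_sum: "subset_sum \<phi> (\<lambda>S. \<Sum>k\<in>K. f k S) y I = (\<Sum>k\<in>K. subset_sum \<phi> (f k) y I)"
  unfolding subset_sum_def sum_distrib_left by (rule sum.swap)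

definition wt :: "('i \<Rightarrow> 'a) \<Rightarrow> 'i set \<Rightarrow> 'a::comm_ring_1"
  where "wt \<tau> S = 1 + (\<Sum>i\<in>S. \<tau> i)"

lemma subset_sum_wt_insert:
  assumes "finite I" "i \<notin> I"
  shows "subset_sum \<phi> (\<lambda>S. wt \<tau> (insert i S)) y I = subset_sum \<phi> (wt \<tau>) y I + \<tau> i * subset_sum \<phi> (\<lambda>_. 1) y I"
proof -
  have "subset_sum \<phi> (\<lambda>S. wt \<tau> (insert i S)) y I = subset_sum \<phi> (\<lambda>S. wt \<tau> S + \<tau> i * 1) y I"
  proof (rule subset_sum_cong)
    fix S assume "S \<subseteq> I"
    then have "finite S" "i \<notin> S" using assms finite_subset by auto
    then show "wt \<tau> (insert i S) = wt \<tau> S + \<tau> i * 1" by (simp add: wt_def)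
  qed
  then show ?thesis by (simp only: subset_sum_add subset_sum_cmult)
qed

definition sG where "sG \<phi> y \<tau> I = subset_sum \<phi> (wt \<tau>) y I"
definition sU where "sU \<phi> y \<tau> I i = subset_sum \<phi> (\<lambda>S. of_bool (i \<in> S) * wt \<tau> S) y I"
definition sV where "sV \<phi> y \<tau> I i j = subset_sum \<phi> (\<lambda>S. of_bool (i \<in> S) * of_bool (j \<in> S) * wt \<tau> S) y I"
definition sD where "sD \<phi> y I i j = subset_sum \<phi> (\<lambda>S. of_bool (i \<in> S) - of_bool (j \<in> S)) y I"

lemma sU_remove:
  assumes "finite I" "i \<in> I"
  shows "sU \<phi> y \<tau> I i = y i * (sG (\<lambda>k. \<phi> (Suc k)) y \<tau> (I - {i}) + \<tau> i * subset_sum (\<lambda>k. \<phi> (Suc k)) (\<lambda>_. 1) y (I - {i}))"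
proof -
  define K where "K = I - {i}"
  have K: "finite K" "i \<notin> K" "I = insert i K" using assms by (auto simp: K_def)
  have "sU \<phi> y \<tau> I i = subset_sum \<phi> (\<lambda>S. 0) y K + y i * subset_sum (\<lambda>k. \<phi> (Suc k)) (\<lambda>S. wt \<tau> (insert i S)) y K"
    unfolding sU_def K(3) subset_sum_insert[OF K(1,2)]
    by (intro arg_cong2[where f = "(+)"] arg_cong2[where f = times] refl subset_sum_cong) (use K in auto)
  then show ?thesis unfolding K_def[symmetric] by (simp add: subset_sum_wt_insert[OF K(1,2)] sG_def)
qed

lemma sG_remove:
  assumes "finite I" "i \<in> I"
  shows "sG \<phi> y \<tau> I = sG \<phi> y \<tau> (I - {i}) + sU \<phi> y \<tau> I i"
proof -
  define K where "K = I - {i}"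
  have K: "finite K" "i \<notin> K" "I = insert i K" using assms by (auto simp: K_def)
  show ?thesis unfolding sU_remove[OF assms] K_def[symmetric]
    by (simp add: sG_def K(3) subset_sum_insert[OF K(1,2)] subset_sum_wt_insert[OF K(1,2)])
qed

context
  fixes I :: "'i set" and i j :: 'i and y \<tau> :: "'i \<Rightarrow> 'a::field" and \<phi> :: "nat \<Rightarrow> 'a"
  assumes I: "finite I" "i \<in> I" "j \<in> I" "i \<noteq> j"
begin

lemma sU_pair:
  fixes K A1 Q1 Z
  defines "K \<equiv> I - {i, j}"
  defines "A1 \<equiv> sG (\<lambda>k. \<phi> (Suc k)) y \<tau> K" and "Q1 \<equiv> subset_sum (\<lambda>k. \<phi> (Suc k)) (\<lambda>_. 1) y K"
  defines "Z \<equiv> y i * y j * (sG (\<lambda>k. \<phi> (Suc (Suc k))) y \<tau> K + (\<tau> i + \<tau> j) * subset_sum (\<lambda>k. \<phi> (Suc (Suc k))) (\<lambda>_. 1) y K)"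
  shows "sU \<phi> y \<tau> I i = y i * (A1 + \<tau> i * Q1) + Z" "sU \<phi> y \<tau> I j = y j * (A1 + \<tau> j * Q1) + Z"
    "sV \<phi> y \<tau> I i j = Z" "sD \<phi> y I i j = (y i - y j) * Q1"
proof -
  have K: "finite K" "i \<notin> K" "j \<notin> K" "finite (insert j K)" "i \<notin> insert j K" "I = insert i (insert j K)"
    using I by (auto simp: K_def)
  note ss = subset_sum_insert[OF K(4,5)] subset_sum_insert[OF K(1,3)]
  have wij: "subset_sum \<psi> (\<lambda>S. wt \<tau> (insert i (insert j S))) y K =
      subset_sum \<psi> (wt \<tau>) y K + (\<tau> i + \<tau> j) * subset_sum \<psi> (\<lambda>_. 1) y K" for \<psi>
  proof -
    have "subset_sum \<psi> (\<lambda>S. wt \<tau> (insert i (insert j S))) y K = subset_sum \<psi> (\<lambda>S. wt \<tau> S + (\<tau> i + \<tau> j) * 1) y K"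
    proof (rule subset_sum_cong)
      fix S assume "S \<subseteq> K"
      then have "finite S" "i \<notin> S" "j \<notin> S" using K finite_subset by auto
      then show "wt \<tau> (insert i (insert j S)) = wt \<tau> S + (\<tau> i + \<tau> j) * 1"
        using I(4) by (simp add: wt_def add_ac)
    qed
    then show ?thesis by (simp only: subset_sum_add subset_sum_cmult)
  qed
  have z: "subset_sum \<psi> f y K = 0" if "\<And>S. S \<subseteq> K \<Longrightarrow> f S = 0" for \<psi> f
    using subset_sum_cong[of K f "\<lambda>_. 0"] that by simp
  have notin: "of_bool (i \<in> S) = (0::'a)" "of_bool (j \<in> S) = (0::'a)" if "S \<subseteq> K" for S
    using K that by auto
  have "sU \<phi> y \<tau> I i = y i * (subset_sum (\<lambda>k. \<phi> (Suc k)) (\<lambda>S. wt \<tau> (insert i S)) y K +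
      y j * subset_sum (\<lambda>k. \<phi> (Suc (Suc k))) (\<lambda>S. wt \<tau> (insert i (insert j S))) y K)"
    unfolding sU_def K(6) ss using I(4) by (simp add: z notin)
  then show "sU \<phi> y \<tau> I i = y i * (A1 + \<tau> i * Q1) + Z"
    by (simp add: wij subset_sum_wt_insert[OF K(1,2)] A1_def Q1_def Z_def sG_def algebra_simps)
  have "sU \<phi> y \<tau> I j = y j * subset_sum (\<lambda>k. \<phi> (Suc k)) (\<lambda>S. wt \<tau> (insert j S)) y K +
      y i * (y j * subset_sum (\<lambda>k. \<phi> (Suc (Suc k))) (\<lambda>S. wt \<tau> (insert i (insert j S))) y K)"
    unfolding sU_def K(6) ss using I(4) by (simp add: z notin)
  then show "sU \<phi> y \<tau> I j = y j * (A1 + \<tau> j * Q1) + Z"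
    by (simp add: wij subset_sum_wt_insert[OF K(1,3)] A1_def Q1_def Z_def sG_def algebra_simps)
  have "sV \<phi> y \<tau> I i j = y i * (y j * subset_sum (\<lambda>k. \<phi> (Suc (Suc k))) (\<lambda>S. wt \<tau> (insert i (insert j S))) y K)"
    unfolding sV_def K(6) ss using I(4) by (simp add: z notin)
  then show "sV \<phi> y \<tau> I i j = Z"
    by (simp add: wij Z_def sG_def algebra_simps)
  have n: "subset_sum \<psi> (\<lambda>S. - 1) y K = - subset_sum \<psi> (\<lambda>S. 1) y K" for \<psi>
    using subset_sum_cmult[of \<psi> "- 1" "\<lambda>_. 1" y K] by simp
  have o: "subset_sum \<psi> f y K = subset_sum \<psi> (\<lambda>_. c) y K" if "\<And>S. S \<subseteq> K \<Longrightarrow> f S = c" for \<psi> f c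
    using that by (rule subset_sum_cong)
  have "subset_sum (\<lambda>k. \<phi> (Suc k)) (\<lambda>S. of_bool (i \<in> insert j S) - of_bool (j \<in> insert j S)) y K = - Q1"
    unfolding Q1_def n[symmetric] by (rule o) (use notin I(4) in auto)
  moreover have "subset_sum (\<lambda>k. \<phi> (Suc k)) (\<lambda>S. of_bool (i \<in> insert i S) - of_bool (j \<in> insert i S)) y K = Q1"
    unfolding Q1_def by (rule o) (use notin I(4) in auto)
  moreover have "subset_sum (\<lambda>k. \<phi> (Suc (Suc k))) (\<lambda>S. of_bool (i \<in> insert i (insert j S)) - of_bool (j \<in> insert i (insert j S))) y K = 0"
    by (rule z) simp
  moreover have "subset_sum \<phi> (\<lambda>S. of_bool (i \<in> S) - of_bool (j \<in> S)) y K = 0"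
    by (rule z) (simp add: notin)
  ultimately show "sD \<phi> y I i j = (y i - y j) * Q1"
    unfolding sD_def K(6) ss by (simp add: algebra_simps)
qed

lemma pair_identity:
  assumes "y i \<noteq> y j"
  shows "(y i * sU \<phi> y \<tau> I i - y j * sU \<phi> y \<tau> I j) / (y i - y j) +
      y i * y j / (y i - y j)\<^sup>2 * ((\<tau> j - \<tau> i) * sD \<phi> y I i j) =
    sU \<phi> y \<tau> I i + sU \<phi> y \<tau> I j - sV \<phi> y \<tau> I i j"
proof -
  define K where "K = I - {i, j}"
  define A1 where "A1 = sG (\<lambda>k. \<phi> (Suc k)) y \<tau> K"
  define Q1 where "Q1 = subset_sum (\<lambda>k. \<phi> (Suc k)) (\<lambda>_. 1) y K"
  define Z where "Z = y i * y j * (sG (\<lambda>k. \<phi> (Suc (Suc k))) y \<tau> K + (\<tau> i + \<tau> j) * subset_sum (\<lambda>k. \<phi> (Suc (Suc k))) (\<lambda>_. 1) y K)"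
  have d: "y i - y j \<noteq> 0" using assms by simp
  note p = sU_pair[folded K_def, folded A1_def Q1_def Z_def]
  show ?thesis unfolding p using d
    by (simp add: divide_simps power2_eq_square) (simp add: algebra_simps)
qed

end

lemma sum_sU: "finite I \<Longrightarrow> (\<Sum>i\<in>I. sU \<phi> y \<tau> I i) = sG (\<lambda>k. of_nat k * \<phi> k) y \<tau> I"
proof -
  assume I: "finite I"
  have "(\<Sum>i\<in>I. sU \<phi> y \<tau> I i) = subset_sum \<phi> (\<lambda>S. \<Sum>i\<in>I. of_bool (i \<in> S) * wt \<tau> S) y I"
    by (simp add: sU_def subset_sum_sum)
  also have "\<dots> = subset_sum \<phi> (\<lambda>S. of_nat (card S) * wt \<tau> S) y I"
  proof (rule subset_sum_cong)
    fix S assume "S \<subseteq> I"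
    then have "{i \<in> I. i \<in> S} = S" by auto
    then have "(\<Sum>i\<in>I. of_bool (i \<in> S)) = (of_nat (card S) :: 'b)" using I by (simp add: sum.If_cases of_bool_def Int_def)
    then show "(\<Sum>i\<in>I. of_bool (i \<in> S) * wt \<tau> S) = of_nat (card S) * wt \<tau> S"
      by (simp only: sum_distrib_right[symmetric])
  qed
  also have "\<dots> = sG (\<lambda>k. of_nat k * \<phi> k) y \<tau> I"
    by (simp add: sG_def subset_sum_def mult_ac)
  finally show ?thesis .
qed

lemma sum_sV: "finite I \<Longrightarrow> (\<Sum>i\<in>I. \<Sum>j\<in>I. sV \<phi> y \<tau> I i j) = sG (\<lambda>k. (of_nat k)\<^sup>2 * \<phi> k) y \<tau> I"
proof -
  assume I: "finite I"
  have "(\<Sum>i\<in>I. \<Sum>j\<in>I. sV \<phi> y \<tau> I i j) =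
      subset_sum \<phi> (\<lambda>S. \<Sum>i\<in>I. \<Sum>j\<in>I. of_bool (i \<in> S) * of_bool (j \<in> S) * wt \<tau> S) y I"
    by (simp add: sV_def subset_sum_sum)
  also have "\<dots> = subset_sum \<phi> (\<lambda>S. (of_nat (card S))\<^sup>2 * wt \<tau> S) y I"
  proof (rule subset_sum_cong)
    fix S assume "S \<subseteq> I"
    then have "{i \<in> I. i \<in> S} = S" by auto
    then have "(\<Sum>i\<in>I. of_bool (i \<in> S)) = (of_nat (card S) :: 'b)" using I by (simp add: sum.If_cases of_bool_def Int_def)
    then show "(\<Sum>i\<in>I. \<Sum>j\<in>I. of_bool (i \<in> S) * of_bool (j \<in> S) * wt \<tau> S) = (of_nat (card S))\<^sup>2 * wt \<tau> S"
      by (simp only: sum_distrib_right[symmetric] sum_distrib_left[symmetric] power2_eq_square)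
  qed
  also have "\<dots> = sG (\<lambda>k. (of_nat k)\<^sup>2 * \<phi> k) y \<tau> I"
    by (simp add: sG_def subset_sum_def mult_ac)
  finally show ?thesis .
qed

lemma sV_diag: "sV \<phi> y \<tau> I i i = sU \<phi> y \<tau> I i"
  by (simp add: sV_def sU_def) (rule subset_sum_cong, simp)

theorem first_order_identity:
  fixes y \<tau> :: "'i \<Rightarrow> 'a::field"
  assumes I: "finite I" and inj: "inj_on y I" and two: "(2::'a) \<noteq> 0"
  shows "(\<Sum>i\<in>I. sU \<phi> y \<tau> I i) + 2 * g * (\<Sum>i\<in>I. \<Sum>j\<in>I - {i}. y i / (y i - y j) * sU \<phi> y \<tau> I i) +
      g * (\<Sum>i\<in>I. \<Sum>j\<in>I - {i}. y i * y j / (y i - y j)\<^sup>2 * ((\<tau> j - \<tau> i) * sD \<phi> y I i j)) =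
    sG (\<lambda>k. (of_nat k + g * (2 * (of_nat (card I) - 1) * of_nat k - ((of_nat k)\<^sup>2 - of_nat k))) * \<phi> k) y \<tau> I"
proof -
  let ?u = "sU \<phi> y \<tau> I" and ?v = "sV \<phi> y \<tau> I"
  let ?c = "\<lambda>i j. y i * y j / (y i - y j)\<^sup>2 * ((\<tau> j - \<tau> i) * sD \<phi> y I i j)"
  have swap: "(\<Sum>i\<in>I. \<Sum>j\<in>I - {i}. F i j) = (\<Sum>i\<in>I. \<Sum>j\<in>I - {i}. F j i)" for F :: "'i \<Rightarrow> 'i \<Rightarrow> 'a"
  proof -
    have e: "(\<Sum>i\<in>I. \<Sum>j\<in>I - {i}. F i j) = (\<Sum>i\<in>I. \<Sum>j\<in>I. if i = j then 0 else F i j)" for F :: "'i \<Rightarrow> 'i \<Rightarrow> 'a"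
      using I by (intro sum.cong sum.mono_neutral_cong_left) auto
    show ?thesis unfolding e by (subst sum.swap) (intro sum.cong, auto)
  qed
  have "2 * (\<Sum>i\<in>I. \<Sum>j\<in>I - {i}. y i / (y i - y j) * ?u i) + (\<Sum>i\<in>I. \<Sum>j\<in>I - {i}. ?c i j) =
      (\<Sum>i\<in>I. \<Sum>j\<in>I - {i}. y i / (y i - y j) * ?u i) + (\<Sum>i\<in>I. \<Sum>j\<in>I - {i}. y j / (y j - y i) * ?u j)
       + (\<Sum>i\<in>I. \<Sum>j\<in>I - {i}. ?c i j)"
    using swap[of "\<lambda>i j. y i / (y i - y j) * ?u i"] by simp
  also have "\<dots> = (\<Sum>i\<in>I. \<Sum>j\<in>I - {i}. ?u i + ?u j - ?v i j)"
    unfolding sum.distrib[symmetric]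
  proof (intro sum.cong[OF refl])
    fix i j assume ij: "i \<in> I" "j \<in> I - {i}"
    then have ne: "y i \<noteq> y j" using inj by (auto simp: inj_on_def)
    have "y j / (y j - y i) = - (y j / (y i - y j))"
      by (metis minus_diff_eq minus_divide_right)
    then have "y i / (y i - y j) * ?u i + y j / (y j - y i) * ?u j = (y i * ?u i - y j * ?u j) / (y i - y j)"
      by (simp add: diff_divide_distrib)
    then show "y i / (y i - y j) * ?u i + y j / (y j - y i) * ?u j + ?c i j = ?u i + ?u j - ?v i j"
      using pair_identity[of I i j y \<phi> \<tau>] I ij ne by auto
  qed
  also have "\<dots> = (\<Sum>i\<in>I. \<Sum>j\<in>I - {i}. ?u i) + (\<Sum>i\<in>I. \<Sum>j\<in>I - {i}. ?u j) - (\<Sum>i\<in>I. \<Sum>j\<in>I - {i}. ?v i j)"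
    by (simp add: sum.distrib sum_subtractf)
  also have "(\<Sum>i\<in>I. \<Sum>j\<in>I - {i}. ?u j) = (\<Sum>i\<in>I. \<Sum>j\<in>I - {i}. ?u i)"
    by (rule swap)
  also have "(\<Sum>i\<in>I. \<Sum>j\<in>I - {i}. ?u i) = (of_nat (card I) - 1) * (\<Sum>i\<in>I. ?u i)"
  proof -
    have "(\<Sum>j\<in>I - {i}. ?u i) = (of_nat (card I) - 1) * ?u i" if "i \<in> I" for i
    proof -
      have "card I \<ge> 1" using that I by (metis card_gt_0_iff empty_iff less_eq_Suc_le One_nat_def)
      then show ?thesis using that I by (simp add: of_nat_diff)
    qed
    then show ?thesis unfolding sum_distrib_left by (rule sum.cong[OF refl])
  qed
  also have "(\<Sum>i\<in>I. \<Sum>j\<in>I - {i}. ?v i j) = (\<Sum>i\<in>I. \<Sum>j\<in>I. ?v i j) - (\<Sum>i\<in>I. ?u i)"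
  proof -
    have "(\<Sum>j\<in>I - {i}. ?v i j) = (\<Sum>j\<in>I. ?v i j) - ?u i" if "i \<in> I" for i
      using that I by (simp add: sum_diff1 sV_diag)
    then show ?thesis unfolding sum_subtractf[symmetric] by (rule sum.cong[OF refl])
  qed
  finally have *: "2 * (\<Sum>i\<in>I. \<Sum>j\<in>I - {i}. y i / (y i - y j) * ?u i) + (\<Sum>i\<in>I. \<Sum>j\<in>I - {i}. ?c i j) =
      2 * (of_nat (card I) - 1) * sG (\<lambda>k. of_nat k * \<phi> k) y \<tau> I -
      (sG (\<lambda>k. (of_nat k)\<^sup>2 * \<phi> k) y \<tau> I - sG (\<lambda>k. of_nat k * \<phi> k) y \<tau> I)"
    unfolding sum_sU[OF I] sum_sV[OF I] by (simp add: algebra_simps)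
  have lin: "sG (\<lambda>k. a k * \<phi> k) y \<tau> I + c * (d * sG (\<lambda>k. a k * \<phi> k) y \<tau> I - (sG (\<lambda>k. b k * \<phi> k) y \<tau> I - sG (\<lambda>k. a k * \<phi> k) y \<tau> I)) =
      sG (\<lambda>k. (a k + c * (d * a k - (b k - a k))) * \<phi> k) y \<tau> I" for a b c d
    by (simp add: sG_def subset_sum_def algebra_simps sum.distrib sum_subtractf sum_distrib_left)
  show ?thesis
    unfolding lin[symmetric] *[symmetric] sum_sU[OF I] by (simp add: algebra_simps)
qed

lemma subset_sum_one_power:
  assumes "finite I"
  shows "subset_sum (\<lambda>k. w ^ k) (\<lambda>_. 1) y I = (\<Prod>k\<in>I. 1 + w * y k)"
  using assms
proof (induction I rule: finite_induct)
  case (insert i I)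
  have "subset_sum (\<lambda>k. w ^ Suc k) (\<lambda>_. 1) y I = w * subset_sum (\<lambda>k. w ^ k) (\<lambda>_. 1) y I"
    by (simp add: subset_sum_def sum_distrib_left mult_ac)
  then show ?case using insert by (simp add: subset_sum_insert algebra_simps)
qed (simp add: subset_sum_def)

lemma sG_power:
  fixes y \<tau> :: "'i \<Rightarrow> 'a::field"
  assumes "finite I" "\<And>k. k \<in> I \<Longrightarrow> 1 + w * y k \<noteq> 0"
  shows "sG (\<lambda>k. w ^ k) y \<tau> I = (\<Prod>k\<in>I. 1 + w * y k) * (1 + (\<Sum>k\<in>I. \<tau> k * (w * y k / (1 + w * y k))))"
  using assms
proof (induction I rule: finite_induct)
  case (insert i I)
  have 1: "sG (\<lambda>k. w ^ Suc k) y \<tau> I = w * sG (\<lambda>k. w ^ k) y \<tau> I"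
    "subset_sum (\<lambda>k. w ^ Suc k) (\<lambda>_. 1) y I = w * subset_sum (\<lambda>k. w ^ k) (\<lambda>_. 1) y I"
    by (simp_all add: sG_def subset_sum_def sum_distrib_left mult_ac)
  define E where "E = (\<Prod>k\<in>I. 1 + w * y k)"
  define T where "T = (\<Sum>k\<in>I. \<tau> k * (w * y k / (1 + w * y k)))"
  have d: "1 + w * y i \<noteq> 0" using insert by simp
  have "sG (\<lambda>k. w ^ k) y \<tau> (insert i I) = E * (1 + T) + y i * (w * (E * (1 + T)) + \<tau> i * (w * E))"
    using insert 1 sU_remove[of "insert i I" i "\<lambda>k. w ^ k" y \<tau>] sG_remove[of "insert i I" i "\<lambda>k. w ^ k" y \<tau>]
    by (simp add: subset_sum_one_power E_def T_def)
  also have "\<dots> = ((1 + w * y i) * E) * (1 + (\<tau> i * (w * y i / (1 + w * y i)) + T))"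
    using d by (simp add: divide_simps) (simp add: algebra_simps)
  finally show ?case using insert by (simp add: E_def T_def)
qed (simp add: sG_def subset_sum_def wt_def)

section \<open>Polynomials and their derivatives\<close>

abbreviation lk where "lk \<equiv> Poly_Mapping.lookup"
abbreviation single where "single \<equiv> Poly_Mapping.single"
abbreviation keys where "keys \<equiv> Poly_Mapping.keys"

lemma sum_single_keys:
  assumes "finite A" "keys p \<subseteq> A"
  shows "(\<Sum>k\<in>A. single k (lk p k)) = p"
proof (rule poly_mapping_eqI)
  fix k
  have "lk (\<Sum>k\<in>A. single k (lk p k)) k = (\<Sum>a\<in>A. if a = k then lk p a else 0)"
    by (simp add: lookup_sum lookup_single when_def)
  also have "\<dots> = lk p k" using assms by (auto simp: sum.delta' in_keys_iff)
  finally show "lk (\<Sum>k\<in>A. single k (lk p k)) k = lk p k" .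
qed

lemma mpoly_additive_induct [case_names single add]:
  assumes s: "\<And>k c. P (single k c)" and a: "\<And>p q. P p \<Longrightarrow> P q \<Longrightarrow> P (p + q)"
  shows "P (p :: 'k \<Rightarrow>\<^sub>0 'b::comm_monoid_add)"
proof -
  have "P (\<Sum>k\<in>A. single k (lk p k))" if "finite A" for A
    using that
  proof (induction A rule: finite_induct)
    case empty
    have "P (single undefined 0)" by (rule s)
    then show ?case by simp
  qed (simp add: s a)
  from this[of "keys p"] show ?thesis by (simp add: sum_single_keys)
qed

definition mon :: "(nat \<Rightarrow> 'a::comm_semiring_1) \<Rightarrow> expo \<Rightarrow> 'a"
  where "mon x \<nu> = (\<Prod>i\<in>keys \<nu>. x i ^ lk \<nu> i)"

lemma mon_superset:
  assumes "finite A" "keys \<nu> \<subseteq> A"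
  shows "mon x \<nu> = (\<Prod>i\<in>A. x i ^ lk \<nu> i)"
  unfolding mon_def using assms by (intro prod.mono_neutral_left) (auto simp: in_keys_iff)

lemma mon_0 [simp]: "mon x 0 = 1"
  by (simp add: mon_def)

lemma mon_add: "mon x (\<mu> + \<nu>) = mon x \<mu> * mon x \<nu>"
proof -
  let ?A = "keys \<mu> \<union> keys \<nu>"
  have "keys (\<mu> + \<nu>) \<subseteq> ?A" by (rule keys_add)
  then show ?thesis
    by (simp add: mon_superset[of ?A] lookup_add power_add prod.distrib)
qed

lemma mon_single [simp]: "mon x (single i k) = x i ^ k"
  by (cases "k = 0") (simp_all add: mon_def)

lemma meval_superset:
  assumes "finite A" "keys p \<subseteq> A"
  shows "meval x p = (\<Sum>\<nu>\<in>A. lk p \<nu> * mon x \<nu>)"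
  unfolding meval_def mon_def[symmetric] using assms
  by (intro sum.mono_neutral_left) (auto simp: in_keys_iff)

lemma meval_add: "meval x (p + q) = meval x p + meval x q"
proof -
  let ?A = "keys p \<union> keys q"
  have "keys (p + q) \<subseteq> ?A" by (rule keys_add)
  then show ?thesis
    by (simp add: meval_superset[of ?A] lookup_add distrib_right sum.distrib)
qed

lemma meval_single [simp]: "meval x (single \<nu> c) = c * mon x \<nu>"
  by (cases "c = 0") (simp_all add: meval_superset[of "{\<nu>}"])

lemma meval_0 [simp]: "meval x 0 = 0"
  by (simp add: meval_def)

lemma meval_1 [simp]: "meval x 1 = 1"
  using meval_single[of x 0 1] by simp

lemma meval_mult: "meval x (p * q) = meval x p * meval x q"
proof (induction p rule: mpoly_additive_induct)
  case (single k c)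
  show ?case
  proof (induction q rule: mpoly_additive_induct)
    case (single l d)
    then show ?case by (simp add: mult_single mon_add mult_ac)
  qed (simp add: meval_add distrib_left)
qed (simp add: meval_add distrib_right)

lemma meval_uminus: "meval x (- p) = - meval x (p :: 'a::comm_ring_1 mpoly)"
  using meval_add[of x p "- p"] by (simp add: eq_neg_iff_add_eq_0 add.commute)

lemma meval_diff: "meval x (p - q) = meval x p - meval x (q :: 'a::comm_ring_1 mpoly)"
  using meval_add[of x p "- q"] by (simp add: meval_uminus)

lemma meval_sum: "meval x (\<Sum>i\<in>A. f i) = (\<Sum>i\<in>A. meval x (f i))"
  by (induction A rule: infinite_finite_induct) (simp_all add: meval_add)

lemma meval_prod: "meval x (\<Prod>i\<in>A. f i) = (\<Prod>i\<in>A. meval x (f i))"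
  by (induction A rule: infinite_finite_induct) (simp_all add: meval_mult)

lemma meval_power: "meval x (p ^ k) = meval x p ^ k"
  by (induction k) (simp_all add: meval_mult)

lemma meval_mconst [simp]: "meval x (mconst c) = c"
  by (simp add: mconst_def)

lemma meval_mvar [simp]: "meval x (mvar i) = x i"
  by (simp add: mvar_def)

lemma mconst_mult: "mconst (a * b) = mconst a * mconst (b :: 'a::comm_semiring_1)"
  by (simp add: mconst_def mult_single)

lemma mconst_add: "mconst (a + b) = mconst a + mconst (b :: 'a::comm_semiring_1)"
  by (simp add: mconst_def single_add)

lemma mconst_0 [simp]: "mconst 0 = 0" by (simp add: mconst_def)

lemma mconst_1 [simp]: "mconst 1 = 1" by (simp add: mconst_def)

lemma lookup_mconst_mult [simp]: "lk (mconst c * p) \<nu> = c * lk p \<nu>"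
proof (induction p rule: mpoly_additive_induct)
  case (single k d)
  then show ?case by (simp add: mconst_def mult_single lookup_single when_def)
qed (simp add: distrib_left lookup_add)

lemma keys_mconst_mult: "keys (mconst c * p) \<subseteq> keys p"
  by (auto simp: in_keys_iff)

lemma mpderiv_superset:
  assumes "finite A" "keys p \<subseteq> A"
  shows "mpderiv i p = (\<Sum>\<nu>\<in>A. single (\<nu> - single i 1) (of_nat (lk \<nu> i) * lk p \<nu>))"
  unfolding mpderiv_def using assms by (intro sum.mono_neutral_left) (auto simp: in_keys_iff)

lemma mpderiv_add: "mpderiv i (p + q) = mpderiv i p + mpderiv i q"
proof -
  let ?A = "keys p \<union> keys q"
  have "keys (p + q) \<subseteq> ?A" by (rule keys_add)
  then show ?thesis
    by (simp add: mpderiv_superset[of ?A] lookup_add distrib_left single_add sum.distrib)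
qed

lemma mpderiv_single [simp]: "mpderiv i (single \<nu> c) = single (\<nu> - single i 1) (of_nat (lk \<nu> i) * c)"
  by (cases "c = 0") (simp_all add: mpderiv_superset[of "{\<nu>}"])

lemma mpderiv_0 [simp]: "mpderiv i 0 = 0"
  by (simp add: mpderiv_def)

lemma mpderiv_1 [simp]: "mpderiv i 1 = 0"
  using mpderiv_single[of i 0 1] by simp

lemma mpderiv_mconst [simp]: "mpderiv i (mconst c) = 0"
  by (simp add: mconst_def)

lemma mpderiv_sum: "mpderiv i (\<Sum>k\<in>A. f k) = (\<Sum>k\<in>A. mpderiv i (f k))"
  by (induction A rule: infinite_finite_induct) (simp_all add: mpderiv_add)

lemma expo_minus_add:
  assumes "lk \<mu> i \<noteq> 0"
  shows "\<mu> - single i 1 + \<nu> = \<mu> + \<nu> - single i (1::nat)"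
  using assms by (intro poly_mapping_eqI) (auto simp: lookup_add lookup_minus lookup_single when_def)

lemma mpderiv_mult: "mpderiv i (p * q) = mpderiv i p * q + p * mpderiv i (q :: 'a::comm_semiring_1 mpoly)"
proof (induction p rule: mpoly_additive_induct)
  case (single \<mu> c)
  show ?case
  proof (induction q rule: mpoly_additive_induct)
    case (single \<nu> d)
    have 1: "single (\<mu> - single i 1 + \<nu>) (of_nat (lk \<mu> i) * c * d) = single (\<mu> + \<nu> - single i 1) (of_nat (lk \<mu> i) * c * d)"
      by (cases "lk \<mu> i = 0") (simp_all add: expo_minus_add del: One_nat_def)
    have 2: "single (\<mu> + (\<nu> - single i 1)) (c * (of_nat (lk \<nu> i) * d)) = single (\<mu> + \<nu> - single i 1) (c * (of_nat (lk \<nu> i) * d))"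
      using expo_minus_add[of \<nu> i \<mu>] by (cases "lk \<nu> i = 0") (simp_all add: add.commute del: One_nat_def)
    have 3: "of_nat (lk \<mu> i + lk \<nu> i) * (c * d) = of_nat (lk \<mu> i) * c * d + c * (of_nat (lk \<nu> i) * d)"
      by (simp add: algebra_simps)
    show ?case
      by (simp only: mult_single mpderiv_single lookup_add 1 2 3 single_add)
  qed (simp add: mpderiv_add distrib_left add_ac)
qed (simp add: mpderiv_add distrib_right add_ac)

definition theta :: "nat \<Rightarrow> 'a::comm_semiring_1 mpoly \<Rightarrow> 'a mpoly"
  where "theta i p = mvar i * mpderiv i p"

lemma theta_add: "theta i (p + q) = theta i p + theta i q"
  by (simp add: theta_def mpderiv_add distrib_left)

lemma theta_sum: "theta i (\<Sum>k\<in>A. f k) = (\<Sum>k\<in>A. theta i (f k))"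
  by (simp add: theta_def mpderiv_sum sum_distrib_left)

lemma theta_0 [simp]: "theta i 0 = 0" by (simp add: theta_def)

lemma theta_1 [simp]: "theta i 1 = 0" by (simp add: theta_def)

lemma theta_mult: "theta i (p * q) = theta i p * q + p * theta i q"
  by (simp add: theta_def mpderiv_mult algebra_simps)

lemma theta_single [simp]: "theta i (single \<nu> c) = single \<nu> (of_nat (lk \<nu> i) * c)"
proof (cases "lk \<nu> i = 0")
  case False
  have "single i 1 + (\<nu> - single i 1) = \<nu>"
    using False by (intro poly_mapping_eqI) (auto simp: lookup_add lookup_minus lookup_single when_def)
  then show ?thesis by (simp add: theta_def mvar_def mult_single del: One_nat_def)
qed (simp add: theta_def)

lemma lookup_theta: "lk (theta i p) \<nu> = of_nat (lk \<nu> i) * lk p \<nu>"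
  by (induction p rule: mpoly_additive_induct)
    (auto simp: theta_add lookup_add distrib_left lookup_single when_def)

lemma keys_theta: "keys (theta i p) \<subseteq> keys p"
  by (auto simp: in_keys_iff lookup_theta)

lemma theta_mconst_mult: "theta i (mconst c * p) = mconst c * theta i p"
  by (simp add: theta_def mpderiv_mult mult_ac)

lemma lookup_mult_sum:
  fixes p q :: "'a::comm_semiring_1 mpoly"
  assumes "finite A" "keys p \<subseteq> A" "finite B" "keys q \<subseteq> B"
  shows "lk (p * q) \<kappa> = (\<Sum>\<mu>\<in>A. \<Sum>\<nu>\<in>B. if \<mu> + \<nu> = \<kappa> then lk p \<mu> * lk q \<nu> else 0)"
proof -
  have "p * q = (\<Sum>\<mu>\<in>A. single \<mu> (lk p \<mu>)) * (\<Sum>\<nu>\<in>B. single \<nu> (lk q \<nu>))"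
    unfolding sum_single_keys[OF assms(1,2)] sum_single_keys[OF assms(3,4)] ..
  also have "\<dots> = (\<Sum>\<mu>\<in>A. \<Sum>\<nu>\<in>B. single (\<mu> + \<nu>) (lk p \<mu> * lk q \<nu>))"
    by (simp add: sum_product mult_single)
  finally show ?thesis by (simp add: lookup_sum lookup_single when_def)
qed

lemma expo_eqI_atMost:
  assumes "keys \<mu> \<subseteq> {1..n}" "keys \<nu> \<subseteq> {1..n}" "\<And>i. i \<in> {1..n} \<Longrightarrow> lk \<mu> i = lk \<nu> i"
  shows "\<mu> = (\<nu> :: expo)"
proof (rule poly_mapping_eqI)
  fix i show "lk \<mu> i = lk \<nu> i"
  proof (cases "i \<in> {1..n}")
    case False
    then have "i \<notin> keys \<mu>" "i \<notin> keys \<nu>" using assms by blast+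
    then show ?thesis by (simp add: in_keys_iff)
  qed (rule assms(3))
qed

lemma sU_power:
  fixes y \<tau> :: "'i \<Rightarrow> 'a::field"
  assumes I: "finite I" "i \<in> I" and nz: "\<And>k. k \<in> I \<Longrightarrow> 1 + w * y k \<noteq> 0"
  shows "sU (\<lambda>k. w ^ k) y \<tau> I i = (\<Prod>k\<in>I. 1 + w * y k) * (w * y i / (1 + w * y i)) *
    (1 + (\<Sum>k\<in>I. \<tau> k * (w * y k / (1 + w * y k))) + \<tau> i / (1 + w * y i))"
proof -
  let ?K = "I - {i}"
  define E where "E = (\<Prod>k\<in>?K. 1 + w * y k)"
  define T where "T = (\<Sum>k\<in>?K. \<tau> k * (w * y k / (1 + w * y k)))"
  have 1: "sG (\<lambda>k. w ^ Suc k) y \<tau> ?K = w * sG (\<lambda>k. w ^ k) y \<tau> ?K"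
    "subset_sum (\<lambda>k. w ^ Suc k) (\<lambda>_. 1) y ?K = w * subset_sum (\<lambda>k. w ^ k) (\<lambda>_. 1) y ?K"
    by (simp_all add: sG_def subset_sum_def sum_distrib_left mult_ac)
  have d: "1 + w * y i \<noteq> 0" using I nz by simp
  have "sU (\<lambda>k. w ^ k) y \<tau> I i = y i * (w * (E * (1 + T)) + \<tau> i * (w * E))"
  proof -
    have "sG (\<lambda>k. w ^ k) y \<tau> ?K = E * (1 + T)" unfolding E_def T_def by (rule sG_power) (use I nz in auto)
    moreover have "subset_sum (\<lambda>k. w ^ k) (\<lambda>_. 1) y ?K = E" unfolding E_def by (rule subset_sum_one_power) (use I in auto)
    ultimately show ?thesis unfolding sU_remove[OF I] 1 by simp
  qed
  also have "\<dots> = ((1 + w * y i) * E) * (w * y i / (1 + w * y i)) *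
      (1 + (\<tau> i * (w * y i / (1 + w * y i)) + T) + \<tau> i / (1 + w * y i))"
    using d by (simp add: divide_simps) (simp add: algebra_simps)
  finally show ?thesis
    using I by (simp add: E_def T_def prod.remove[of I i] sum.remove[of I i])
qed

lemma sD_power:
  fixes y :: "'i \<Rightarrow> 'a::field"
  assumes I: "finite I" "i \<in> I" "j \<in> I" "i \<noteq> j" and nz: "\<And>k. k \<in> I \<Longrightarrow> 1 + w * y k \<noteq> 0"
  shows "sD (\<lambda>k. w ^ k) y I i j = (\<Prod>k\<in>I. 1 + w * y k) * w * (y i - y j) / ((1 + w * y i) * (1 + w * y j))"
proof -
  have 1: "subset_sum (\<lambda>k. w ^ Suc k) (\<lambda>_. 1) y K = w * subset_sum (\<lambda>k. w ^ k) (\<lambda>_. 1) y K" for K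
    by (simp_all add: subset_sum_def sum_distrib_left mult_ac)
  have "I = insert i (insert j (I - {i, j}))" using I by auto
  then have "(\<Prod>k\<in>I. 1 + w * y k) = (\<Prod>k\<in>insert i (insert j (I - {i, j})). 1 + w * y k)" by simp
  also have "\<dots> = (1 + w * y i) * ((1 + w * y j) * (\<Prod>k\<in>I - {i, j}. 1 + w * y k))"
    using I by simp
  finally show ?thesis
    unfolding sU_pair(4)[OF I] 1 using I nz[of i] nz[of j] by (simp add: subset_sum_one_power)
qed

theorem second_order_identity:
  fixes y \<tau> :: "'i \<Rightarrow> 'a::field"
  assumes I: "finite I" and inj: "inj_on y I"
    and nw: "\<And>k. k \<in> I \<Longrightarrow> 1 + w * y k \<noteq> 0" and nv: "\<And>k. k \<in> I \<Longrightarrow> 1 + v * y k \<noteq> 0"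
  defines "U \<equiv> \<lambda>w. sU (\<lambda>k. w ^ k) y \<tau> I" and "D \<equiv> \<lambda>w. sD (\<lambda>k. w ^ k) y I"
    and "G \<equiv> \<lambda>w. sG (\<lambda>k. w ^ k) y \<tau> I"
  shows "(v - w) * ((\<Sum>i\<in>I. U w i * U v i) +
      (\<Sum>i\<in>I. \<Sum>j\<in>I - {i}. y i * y j / (y i - y j)\<^sup>2 * (\<tau> i * \<tau> j * (D w i j * D v i j)))) =
    v * (\<Sum>i\<in>I. U w i) * G v - w * (\<Sum>i\<in>I. U v i) * G w"
proof -
  define E where "E w = (\<Prod>k\<in>I. 1 + w * y k)" for w
  define a where "a w k = w * y k / (1 + w * y k)" for w k
  define b where "b w k = 1 / (1 + w * y k)" for w k
  define S where "S w = 1 + (\<Sum>k\<in>I. \<tau> k * a w k)" for w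
  define \<beta> where "\<beta> i = \<tau> i * y i * b w i * b v i" for i
  have G: "G w = E w * S w" "G v = E v * S v"
    unfolding G_def E_def S_def a_def by (rule sG_power[OF I nw], assumption) (rule sG_power[OF I nv], assumption)
  have U: "U w i = E w * (a w i * (S w + \<tau> i * b w i))" "U v i = E v * (a v i * (S v + \<tau> i * b v i))" if "i \<in> I" for i
    using sU_power[OF I that nw, where \<tau> = \<tau>] sU_power[OF I that nv, where \<tau> = \<tau>]
    by (simp_all add: U_def E_def S_def a_def b_def)
  have D: "y i * y j / (y i - y j)\<^sup>2 * (\<tau> i * \<tau> j * (D w i j * D v i j)) = E w * E v * (w * v * (\<beta> i * \<beta> j))"
    if "i \<in> I" "j \<in> I - {i}" for i j
  proof -
    have ne: "y i - y j \<noteq> 0" using that inj by (auto simp: inj_on_def)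
    have "D w i j = E w * (w * b w i * b w j) * (y i - y j)" "D v i j = E v * (v * b v i * b v j) * (y i - y j)"
      using sD_power[OF I _ _ _ nw, of i j] sD_power[OF I _ _ _ nv, of i j] that
      by (auto simp: D_def E_def b_def)
    then show ?thesis using ne by (simp add: \<beta>_def power2_eq_square mult_ac)
  qed
  have aa: "(v - w) * (a w i * a v i) = v * a w i - w * a v i"
    and wa: "w * a v i * b w i = w * v * (y i * b w i * b v i)" "v * a w i * b v i = w * v * (y i * b w i * b v i)"
    and ad: "a w i - a v i = - ((v - w) * (y i * b w i * b v i))" if "i \<in> I" for i
    using nw[OF that] nv[OF that] by (simp_all add: a_def b_def divide_simps) (simp_all add: algebra_simps)
  have SS: "S w - S v = - ((v - w) * (\<Sum>i\<in>I. \<beta> i))"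
  proof -
    have "S w - S v = (\<Sum>k\<in>I. \<tau> k * (a w k - a v k))"
      by (simp add: S_def sum_subtractf right_diff_distrib)
    also have "\<dots> = (\<Sum>k\<in>I. - (v - w) * \<beta> k)"
      by (rule sum.cong) (simp_all add: ad \<beta>_def algebra_simps)
    also have "\<dots> = - (v - w) * (\<Sum>i\<in>I. \<beta> i)" by (rule sum_distrib_left[symmetric])
    finally show ?thesis by (simp only: mult_minus_left)
  qed
  have per: "(v - w) * ((a w i * (S w + \<tau> i * b w i)) * (a v i * (S v + \<tau> i * b v i))) =
      v * (a w i * (S w + \<tau> i * b w i)) * S v - w * (a v i * (S v + \<tau> i * b v i)) * S w +
      w * v * (S w - S v) * \<beta> i + (v - w) * (w * v * (\<beta> i * \<beta> i))" if i: "i \<in> I" for i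
  proof -
    have "(v - w) * ((a w i * (S w + \<tau> i * b w i)) * (a v i * (S v + \<tau> i * b v i))) =
      ((v - w) * (a w i * a v i)) * (S w * S v + \<tau> i * b w i * S v + \<tau> i * b v i * S w) +
      (v - w) * (\<tau> i * \<tau> i * (a w i * b v i) * (a v i * b w i))" by (simp add: algebra_simps)
    also have "(v - w) * (\<tau> i * \<tau> i * (a w i * b v i) * (a v i * b w i)) = (v - w) * (w * v * (\<beta> i * \<beta> i))"
      by (simp add: a_def b_def \<beta>_def mult_ac)
    also have "((v - w) * (a w i * a v i)) * (S w * S v + \<tau> i * b w i * S v + \<tau> i * b v i * S w) =
      v * (a w i * (S w + \<tau> i * b w i)) * S v - w * (a v i * (S v + \<tau> i * b v i)) * S w +
      \<tau> i * (v * a w i * b v i) * S w - \<tau> i * (w * a v i * b w i) * S v"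
      unfolding aa[OF i] by (simp add: algebra_simps)
    finally show ?thesis unfolding wa[OF i] by (simp add: \<beta>_def algebra_simps)
  qed
  have off: "(\<Sum>i\<in>I. \<Sum>j\<in>I - {i}. \<beta> i * \<beta> j) = (\<Sum>i\<in>I. \<beta> i) * (\<Sum>i\<in>I. \<beta> i) - (\<Sum>i\<in>I. \<beta> i * \<beta> i)"
  proof -
    have "(\<Sum>j\<in>I - {i}. \<beta> i * \<beta> j) = (\<Sum>j\<in>I. \<beta> i * \<beta> j) - \<beta> i * \<beta> i" if "i \<in> I" for i
      using that I by (simp add: sum_diff1)
    then show ?thesis by (simp add: sum_subtractf sum_product)
  qed
  define B where "B = (\<Sum>i\<in>I. \<beta> i)"
  define B2 where "B2 = (\<Sum>i\<in>I. \<beta> i * \<beta> i)"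
  have "(\<Sum>i\<in>I. U w i * U v i) = E w * E v * (\<Sum>i\<in>I. (a w i * (S w + \<tau> i * b w i)) * (a v i * (S v + \<tau> i * b v i)))"
    unfolding sum_distrib_left by (rule sum.cong) (simp_all add: U mult_ac)
  then have 1: "(v - w) * (\<Sum>i\<in>I. U w i * U v i) = E w * E v *
      (\<Sum>i\<in>I. (v - w) * ((a w i * (S w + \<tau> i * b w i)) * (a v i * (S v + \<tau> i * b v i))))"
    by (simp add: sum_distrib_left mult_ac)
  have 2: "(\<Sum>i\<in>I. (v - w) * ((a w i * (S w + \<tau> i * b w i)) * (a v i * (S v + \<tau> i * b v i)))) =
      v * (\<Sum>i\<in>I. a w i * (S w + \<tau> i * b w i)) * S v - w * (\<Sum>i\<in>I. a v i * (S v + \<tau> i * b v i)) * S w +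
      w * v * (S w - S v) * B + (v - w) * (w * v * B2)"
    unfolding B_def B2_def
    by (simp add: per sum.distrib sum_subtractf sum_distrib_left sum_distrib_right cong: sum.cong)
  have 3: "(\<Sum>i\<in>I. \<Sum>j\<in>I - {i}. y i * y j / (y i - y j)\<^sup>2 * (\<tau> i * \<tau> j * (D w i j * D v i j))) =
      E w * E v * (w * v * (B * B - B2))"
  proof -
    have "(\<Sum>i\<in>I. \<Sum>j\<in>I - {i}. y i * y j / (y i - y j)\<^sup>2 * (\<tau> i * \<tau> j * (D w i j * D v i j))) =
        (\<Sum>i\<in>I. \<Sum>j\<in>I - {i}. (E w * E v * (w * v)) * (\<beta> i * \<beta> j))"
    proof (intro sum.cong refl)
      fix i j assume ij: "i \<in> I" "j \<in> I - {i}"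
      show "y i * y j / (y i - y j)\<^sup>2 * (\<tau> i * \<tau> j * (D w i j * D v i j)) = (E w * E v * (w * v)) * (\<beta> i * \<beta> j)"
        unfolding D[OF ij] by (simp only: mult.assoc)
    qed
    also have "\<dots> = (E w * E v * (w * v)) * (\<Sum>i\<in>I. \<Sum>j\<in>I - {i}. \<beta> i * \<beta> j)"
      by (simp only: sum_distrib_left)
    finally show ?thesis unfolding off B_def B2_def by (simp only: mult.assoc)
  qed
  have 4: "(\<Sum>i\<in>I. U w i) = E w * (\<Sum>i\<in>I. a w i * (S w + \<tau> i * b w i))"
    "(\<Sum>i\<in>I. U v i) = E v * (\<Sum>i\<in>I. a v i * (S v + \<tau> i * b v i))"
    unfolding sum_distrib_left by (auto intro!: sum.cong simp: U)
  have alg: "e * e' * (v * p * s' - w * p' * s + w * v * (- ((v - w) * b)) * b + (v - w) * (w * v * b2)) +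
      (v - w) * (e * e' * (w * v * (b * b - b2))) = v * (e * p) * (e' * s') - w * (e' * p') * (e * s)"
    for e e' p p' s s' b b2 :: 'a
    by (simp add: algebra_simps)
  show ?thesis
    unfolding distrib_left[of "v - w"] 1 2 3 4 G SS B_def[symmetric] by (rule alg)
qed

lemma power_sum_eq_0_imp:
  fixes c :: "nat \<Rightarrow> 'a::idom"
  assumes "infinite W" "\<And>w. w \<in> W \<Longrightarrow> (\<Sum>r\<le>n. w ^ r * c r) = 0" "r \<le> n"
  shows "c r = 0"
proof -
  define p where "p = (\<Sum>r\<le>n. monom (c r) r)"
  have "W \<subseteq> {w. poly p w = 0}"
    using assms(2) by (auto simp: p_def poly_sum poly_monom mult.commute)
  then have "p = 0" using assms(1) poly_roots_finite finite_subset by blast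
  moreover have "coeff p r = c r" using assms(3) by (simp add: p_def coeff_sum)
  ultimately show ?thesis by simp
qed

text \<open>Abstractly, a second-order differential operator \<open>H\<close> at a point, with its carre du champ \<open>\<Gamma>\<close>;
  \<open>v\<close> is evaluation at the point.\<close>

definition second_order :: "('b::comm_ring_1 \<Rightarrow> 'c::comm_ring_1) \<Rightarrow> ('b \<Rightarrow> 'c) \<Rightarrow> ('b \<Rightarrow> 'b \<Rightarrow> 'c) \<Rightarrow> bool"
  where "second_order v H \<Gamma> \<longleftrightarrow> v 1 = 1 \<and> H 1 = 0 \<and> (\<forall>f. \<Gamma> f 1 = 0) \<and>
    (\<forall>f g. v (f * g) = v f * v g) \<and>
    (\<forall>f g. H (f * g) = v f * H g + v g * H f + 2 * \<Gamma> f g) \<and>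
    (\<forall>f g h. \<Gamma> f (g * h) = v g * \<Gamma> f h + v h * \<Gamma> f g)"

lemma second_order_transfer:
  assumes 1: "second_order v1 H1 \<Gamma>1" and 2: "second_order v2 H2 \<Gamma>2"
    and v: "\<And>r. r \<in> R \<Longrightarrow> v1 (G r) = v2 (e r)"
    and H: "\<And>r. r \<in> R \<Longrightarrow> H1 (G r) = H2 (e r)"
    and \<Gamma>: "\<And>r s. r \<in> R \<Longrightarrow> s \<in> R \<Longrightarrow> \<Gamma>1 (G r) (G s) = \<Gamma>2 (e r) (e s)"
    and "set rs \<subseteq> R"
  shows "v1 (prod_list (map G rs)) = v2 (prod_list (map e rs))"
    and "H1 (prod_list (map G rs)) = H2 (prod_list (map e rs))"
proof -
  have "v1 (prod_list (map G rs)) = v2 (prod_list (map e rs)) \<and>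
    (\<forall>r\<in>R. \<Gamma>1 (G r) (prod_list (map G rs)) = \<Gamma>2 (e r) (prod_list (map e rs))) \<and>
    H1 (prod_list (map G rs)) = H2 (prod_list (map e rs))"
    using assms(6)
  proof (induction rs)
    case Nil
    then show ?case using 1 2 by (simp add: second_order_def)
  next
    case (Cons a rs)
    have v1: "v1 (f * g) = v1 f * v1 g" "H1 (f * g) = v1 f * H1 g + v1 g * H1 f + 2 * \<Gamma>1 f g"
      "\<Gamma>1 f (g * h) = v1 g * \<Gamma>1 f h + v1 h * \<Gamma>1 f g" for f g h
      using 1 unfolding second_order_def by blast+
    have v2: "v2 (f * g) = v2 f * v2 g" "H2 (f * g) = v2 f * H2 g + v2 g * H2 f + 2 * \<Gamma>2 f g"
      "\<Gamma>2 f (g * h) = v2 g * \<Gamma>2 f h + v2 h * \<Gamma>2 f g" for f g h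
      using 2 unfolding second_order_def by blast+
    show ?case using Cons v[of a] H[of a] \<Gamma> by (simp add: v1 v2)
  qed
  then show "v1 (prod_list (map G rs)) = v2 (prod_list (map e rs))"
    "H1 (prod_list (map G rs)) = H2 (prod_list (map e rs))" by auto
qed

section \<open>The Sutherland operator in both sets of coordinates\<close>

definition chi :: "nat set \<Rightarrow> expo"
  where "chi S = (\<Sum>i\<in>S. single i 1)"

lemma lookup_chi: "finite S \<Longrightarrow> lk (chi S) i = of_bool (i \<in> S)"
  by (simp add: chi_def lookup_sum lookup_single when_def of_bool_def)

lemma keys_chi: "finite S \<Longrightarrow> keys (chi S) = S"
  by (auto simp: in_keys_iff lookup_chi)

lemma mon_chi: "finite S \<Longrightarrow> mon x (chi S) = (\<Prod>i\<in>S. x i)"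
  by (simp add: mon_def keys_chi lookup_chi)

definition ES :: "nat \<Rightarrow> nat \<Rightarrow> (nat set \<Rightarrow> 'a::comm_ring_1) \<Rightarrow> 'a mpoly"
  where "ES n r f = (\<Sum>S\<in>{S. S \<subseteq> {1..n} \<and> card S = r}. single (chi S) (f S))"

lemma finite_subsets_atMost: "S \<subseteq> {1..n::nat} \<Longrightarrow> finite S"
  by (rule finite_subset) auto

lemma meval_ES:
  "meval x (ES n r f) = subset_sum (\<lambda>k. of_bool (k = r)) f x {1..n}"
proof -
  have "meval x (ES n r f) = (\<Sum>S\<in>{S\<in>Pow {1..n}. card S = r}. (\<Prod>i\<in>S. x i) * f S)"
    unfolding ES_def meval_sum by (rule sum.cong) (auto simp: mon_chi finite_subsets_atMost mult.commute)
  also have "\<dots> = (\<Sum>S\<in>Pow {1..n}. if card S = r then (\<Prod>i\<in>S. x i) * f S else 0)"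
    by (rule sum.inter_filter) simp
  also have "\<dots> = subset_sum (\<lambda>k. of_bool (k = r)) f x {1..n}"
    unfolding subset_sum_def by (rule sum.cong) auto
  finally show ?thesis .
qed

lemma theta_ES: "theta i (ES n r f) = ES n r (\<lambda>S. of_bool (i \<in> S) * f S)"
  unfolding ES_def theta_sum
  by (rule sum.cong) (auto simp: lookup_chi finite_subsets_atMost)

definition dd :: "nat \<Rightarrow> nat \<Rightarrow> 'a::comm_ring_1 mpoly \<Rightarrow> 'a mpoly"
  where "dd i j p = mpderiv i p - mpderiv j p"

lemma dd_mult: "dd i j (p * q) = dd i j p * q + p * dd i j q"
  by (simp add: dd_def mpderiv_mult algebra_simps)

lemma dd_add: "dd i j (p + q) = dd i j p + dd i j q"
  by (simp add: dd_def mpderiv_add)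

lemma dd_sum: "dd i j (\<Sum>k\<in>A. f k) = (\<Sum>k\<in>A. dd i j (f k))"
  by (simp add: dd_def mpderiv_sum sum_subtractf)

lemma dd_1 [simp]: "dd i j 1 = 0" by (simp add: dd_def)

lemma dd_mconst [simp]: "dd i j (mconst c) = 0" by (simp add: dd_def)

lemma dd_0 [simp]: "dd i j 0 = 0" by (simp add: dd_def)

definition exchange_op :: "nat \<Rightarrow> nat \<Rightarrow> 'a \<Rightarrow> 'a::comm_ring_1 mpoly \<Rightarrow> 'a mpoly"
  where "exchange_op i j g p = mvar i * mvar j * dd i j (dd i j p) + mconst g * ((mvar j - mvar i) * dd i j p)"

lemma mpderiv_mvar: "mpderiv i (mvar j) = of_bool (i = j)"
proof (cases "i = j")
  case True
  have "single j (1::nat) - single j 1 = 0" by simp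
  then show ?thesis using True by (simp add: mvar_def del: One_nat_def)
qed (simp add: mvar_def lookup_single)

abbreviation eY where "eY y F \<equiv> meval (\<lambda>i. mconst (y i)) F"

definition HX :: "nat \<Rightarrow> complex \<Rightarrow> (nat \<Rightarrow> complex) \<Rightarrow> complex mpoly \<Rightarrow> complex"
  where "HX n g x f = (\<Sum>i\<in>{1..n}. meval x (theta i (theta i f))) +
    2 * g * (\<Sum>i\<in>{1..n}. \<Sum>j\<in>{1..n} - {i}. x i / (x i - x j) * meval x (theta i f))"

definition GX :: "nat \<Rightarrow> (nat \<Rightarrow> complex) \<Rightarrow> complex mpoly \<Rightarrow> complex mpoly \<Rightarrow> complex"
  where "GX n x f h = (\<Sum>i\<in>{1..n}. meval x (theta i f) * meval x (theta i h))"

definition HY :: "nat \<Rightarrow> complex \<Rightarrow> (nat \<Rightarrow> complex) \<Rightarrow> (nat \<Rightarrow> complex) \<Rightarrow> complex mpoly mpoly \<Rightarrow> complex"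
  where "HY n g y \<tau> F = (\<Sum>i\<in>{1..n}. meval \<tau> (eY y (theta i (theta i F)))) +
    2 * g * (\<Sum>i\<in>{1..n}. \<Sum>j\<in>{1..n} - {i}. y i / (y i - y j) * meval \<tau> (eY y (theta i F))) +
    (\<Sum>i\<in>{1..n}. \<Sum>j\<in>{1..n} - {i}. y i * y j / (y i - y j)\<^sup>2 * meval \<tau> (exchange_op i j g (eY y F)))"

definition GY :: "nat \<Rightarrow> (nat \<Rightarrow> complex) \<Rightarrow> (nat \<Rightarrow> complex) \<Rightarrow> complex mpoly mpoly \<Rightarrow> complex mpoly mpoly \<Rightarrow> complex"
  where "GY n y \<tau> F K = (\<Sum>i\<in>{1..n}. meval \<tau> (eY y (theta i F)) * meval \<tau> (eY y (theta i K))) +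
    (\<Sum>i\<in>{1..n}. \<Sum>j\<in>{1..n} - {i}. y i * y j / (y i - y j)\<^sup>2 *
      (\<tau> i * \<tau> j * (meval \<tau> (dd i j (eY y F)) * meval \<tau> (dd i j (eY y K)))))"

lemma meval_numeral [simp]: "meval x (numeral k) = numeral k"
  using meval_single[of x 0 "numeral k"] by simp

lemma second_order_HX: "second_order (meval x) (HX n g x) (GX n x)"
  unfolding second_order_def HX_def GX_def
  by (simp add: meval_mult theta_mult theta_add meval_add sum.distrib sum_distrib_left algebra_simps)

lemma second_order_HY: "second_order (\<lambda>F. meval \<tau> (eY y F)) (HY n g y \<tau>) (GY n y \<tau>)"
proof -
  let ?v = "\<lambda>F. meval \<tau> (eY y F)"
  have th: "?v (theta i (F * K)) = ?v (theta i F) * ?v K + ?v F * ?v (theta i K)" for i F K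
    by (simp add: meval_mult theta_mult meval_add)
  have th2: "?v (theta i (theta i (F * K))) = ?v (theta i (theta i F)) * ?v K + ?v F * ?v (theta i (theta i K)) +
      2 * (?v (theta i F) * ?v (theta i K))" for i F K
    by (simp add: meval_mult theta_mult theta_add meval_add)
  have d: "meval \<tau> (dd i j (eY y (F * K))) = meval \<tau> (dd i j (eY y F)) * ?v K + ?v F * meval \<tau> (dd i j (eY y K))" for i j F K
    by (simp add: meval_mult dd_mult meval_add)
  have d2: "meval \<tau> (exchange_op i j g (eY y (F * K))) = ?v F * meval \<tau> (exchange_op i j g (eY y K)) +
      ?v K * meval \<tau> (exchange_op i j g (eY y F)) + 2 * (\<tau> i * \<tau> j * (meval \<tau> (dd i j (eY y F)) * meval \<tau> (dd i j (eY y K))))"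
    for i j F K
    by (simp add: exchange_op_def meval_mult dd_mult dd_add meval_add meval_diff algebra_simps)
  have H: "HY n g y \<tau> (F * K) = ?v F * HY n g y \<tau> K + ?v K * HY n g y \<tau> F + 2 * GY n y \<tau> F K" for F K
    unfolding HY_def GY_def th th2 d2
    by (simp add: sum.distrib sum_distrib_left distrib_left distrib_right mult_ac)
  have G: "GY n y \<tau> F (K * L) = ?v K * GY n y \<tau> F L + ?v L * GY n y \<tau> F K" for F K L
    unfolding GY_def th d
    by (simp add: sum.distrib sum_distrib_left distrib_left distrib_right mult_ac)
  show ?thesis
    unfolding second_order_def using H G
    by (auto simp: meval_mult) (simp_all add: HY_def GY_def exchange_op_def)
qed

abbreviation esym :: "nat \<Rightarrow> nat \<Rightarrow> complex mpoly" where "esym n r \<equiv> ES n r (\<lambda>_. 1)"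
abbreviation gsym :: "nat \<Rightarrow> nat \<Rightarrow> complex mpoly mpoly" where "gsym n r \<equiv> ES n r (\<lambda>S. 1 + (\<Sum>i\<in>S. mvar i))"

lemma subset_sum_meval:
  fixes y \<tau> :: "nat \<Rightarrow> complex" and n :: nat
  assumes "\<And>S. S \<subseteq> {1..n} \<Longrightarrow> meval \<tau> (f S) = h S"
  shows "meval \<tau> (subset_sum (\<lambda>k. of_bool (k = r)) f (\<lambda>i. mconst (y i)) {1..n}) =
    subset_sum (\<lambda>k. of_bool (k = r)) h y {1..n}"
  unfolding subset_sum_def meval_sum
  by (rule sum.cong) (auto simp: meval_mult meval_prod assms of_bool_def)

context
  fixes n :: nat and y \<tau> :: "nat \<Rightarrow> complex" and \<phi> :: "nat \<Rightarrow> nat \<Rightarrow> complex"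
  defines "\<phi> \<equiv> \<lambda>r k. of_bool (k = r)"
begin

lemma gsym_values:
  "meval \<tau> (eY y (gsym n r)) = sG (\<phi> r) y \<tau> {1..n}"
  "meval \<tau> (eY y (theta i (gsym n r))) = sU (\<phi> r) y \<tau> {1..n} i"
  "meval \<tau> (eY y (theta i (theta i (gsym n r)))) = sU (\<phi> r) y \<tau> {1..n} i"
  unfolding theta_ES meval_ES sG_def sU_def \<phi>_def
  by (rule subset_sum_meval, simp add: meval_mult meval_add meval_sum wt_def of_bool_def)+

lemma dd_gsym:
  assumes "i \<in> {1..n}" "j \<in> {1..n}"
  shows "dd i j (eY y (gsym n r)) = mconst (sD (\<phi> r) y {1..n} i j)"
proof -
  have 1: "dd i j (1 + (\<Sum>k\<in>S. mvar k)) = mconst (of_bool (i \<in> S) - of_bool (j \<in> S) :: complex)" if "S \<subseteq> {1..n}" for S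
  proof -
    have fin: "finite S" using that by (rule finite_subsets_atMost)
    have e: "mpderiv a (\<Sum>k\<in>S. mvar k) = (of_bool (a \<in> S) :: complex mpoly)" for a
      using fin by (simp add: mpderiv_sum mpderiv_mvar of_bool_def sum.delta)
    show ?thesis by (auto simp: dd_def mpderiv_add e mconst_def single_diff single_uminus)
  qed
  have "dd i j (eY y (gsym n r)) =
     (\<Sum>S\<in>Pow {1..n}. of_bool (card S = r) * ((\<Prod>k\<in>S. mconst (y k)) * dd i j (1 + (\<Sum>k\<in>S. mvar k))))"
    unfolding meval_ES subset_sum_def dd_sum
  proof (rule sum.cong[OF refl])
    fix S
    have c: "(\<Prod>k\<in>S. mconst (y k)) = mconst (\<Prod>k\<in>S. y k)"
      by (induction S rule: infinite_finite_induct) (simp_all add: mconst_mult)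
    show "dd i j (of_bool (card S = r) * (\<Prod>i\<in>S. mconst (y i)) * (1 + (\<Sum>i\<in>S. mvar i))) =
       of_bool (card S = r) * ((\<Prod>k\<in>S. mconst (y k)) * dd i j (1 + (\<Sum>k\<in>S. mvar k)))"
      by (cases "card S = r") (simp_all add: dd_mult c)
  qed
  also have "\<dots> = (\<Sum>S\<in>Pow {1..n}. mconst (of_bool (card S = r) * (\<Prod>k\<in>S. y k) * (of_bool (i \<in> S) - of_bool (j \<in> S))))"
  proof (rule sum.cong[OF refl])
    fix S assume "S \<in> Pow {1..n}"
    then have S: "S \<subseteq> {1..n}" by simp
    have c: "(\<Prod>k\<in>S. mconst (y k)) = mconst (\<Prod>k\<in>S. y k)"
      by (induction S rule: infinite_finite_induct) (simp_all add: mconst_mult)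
    show "of_bool (card S = r) * ((\<Prod>k\<in>S. mconst (y k)) * dd i j (1 + (\<Sum>k\<in>S. mvar k))) =
       mconst (of_bool (card S = r) * (\<Prod>k\<in>S. y k) * (of_bool (i \<in> S) - of_bool (j \<in> S)))"
      unfolding 1[OF S] c by (cases "card S = r") (simp_all add: mconst_mult)
  qed
  also have "\<dots> = mconst (sD (\<phi> r) y {1..n} i j)"
  proof -
    have "(\<Sum>k\<in>A. mconst (h k)) = mconst (\<Sum>k\<in>A. h k)" for A and h :: "nat set \<Rightarrow> complex"
      by (induction A rule: infinite_finite_induct) (simp_all add: mconst_add)
    then show ?thesis by (simp add: sD_def subset_sum_def \<phi>_def)
  qed
  finally show ?thesis .
qed

lemma HY_gsym:
  assumes "inj_on y {1..n}"
  shows "HY n g y \<tau> (gsym n r) = (of_nat r + g * (2 * (of_nat n - 1) * of_nat r - ((of_nat r)\<^sup>2 - of_nat r))) *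
    sG (\<phi> r) y \<tau> {1..n}"
proof -
  have ex: "meval \<tau> (exchange_op i j g (eY y (gsym n r))) = g * ((\<tau> j - \<tau> i) * sD (\<phi> r) y {1..n} i j)"
    if "i \<in> {1..n}" "j \<in> {1..n} - {i}" for i j
    unfolding exchange_op_def using that by (simp add: dd_gsym meval_add meval_mult meval_diff)
  have "HY n g y \<tau> (gsym n r) = (\<Sum>i\<in>{1..n}. sU (\<phi> r) y \<tau> {1..n} i) +
      2 * g * (\<Sum>i\<in>{1..n}. \<Sum>j\<in>{1..n} - {i}. y i / (y i - y j) * sU (\<phi> r) y \<tau> {1..n} i) +
      g * (\<Sum>i\<in>{1..n}. \<Sum>j\<in>{1..n} - {i}. y i * y j / (y i - y j)\<^sup>2 * ((\<tau> j - \<tau> i) * sD (\<phi> r) y {1..n} i j))"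
    unfolding HY_def gsym_values sum_distrib_left[of g]
    by (intro arg_cong2[where f = "(+)"] refl sum.cong) (simp only: ex mult.left_commute)
  also have "\<dots> = sG (\<lambda>k. (of_nat k + g * (2 * (of_nat (card {1..n}) - 1) * of_nat k - ((of_nat k)\<^sup>2 - of_nat k))) * \<phi> r k) y \<tau> {1..n}"
    by (rule first_order_identity) (use assms in auto)
  also have "\<dots> = (of_nat r + g * (2 * (of_nat n - 1) * of_nat r - ((of_nat r)\<^sup>2 - of_nat r))) * sG (\<phi> r) y \<tau> {1..n}"
    unfolding sG_def subset_sum_def sum_distrib_left
    by (rule sum.cong) (auto simp: \<phi>_def of_bool_def)
  finally show ?thesis .
qed

definition carre :: "nat \<Rightarrow> nat \<Rightarrow> complex"
  where "carre r s = (\<Sum>i\<in>{1..n}. sU (\<phi> r) y \<tau> {1..n} i * sU (\<phi> s) y \<tau> {1..n} i) +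
    (\<Sum>i\<in>{1..n}. \<Sum>j\<in>{1..n} - {i}. y i * y j / (y i - y j)\<^sup>2 *
      (\<tau> i * \<tau> j * (sD (\<phi> r) y {1..n} i j * sD (\<phi> s) y {1..n} i j)))"

lemma GY_gsym: "GY n y \<tau> (gsym n r) (gsym n s) = carre r s"
  unfolding GY_def carre_def gsym_values
  by (intro arg_cong2[where f = "(+)"] refl sum.cong) (simp add: dd_gsym)

lemma subset_sum_power:
  "subset_sum (\<lambda>k. w ^ k) f y {1..n} = (\<Sum>r\<le>n. w ^ r * subset_sum (\<phi> r) f y {1..n})"
proof -
  have "(\<Sum>r\<le>n. w ^ r * subset_sum (\<phi> r) f y {1..n}) =
      (\<Sum>S\<in>Pow {1..n}. \<Sum>r\<le>n. w ^ r * (\<phi> r (card S) * (\<Prod>i\<in>S. y i) * f S))"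
    unfolding subset_sum_def sum_distrib_left by (rule sum.swap)
  also have "\<dots> = (\<Sum>S\<in>Pow {1..n}. w ^ card S * (\<Prod>i\<in>S. y i) * f S)"
  proof (rule sum.cong[OF refl])
    fix S assume "S \<in> Pow {1..n}"
    then have "card S \<le> n" using card_mono[of "{1..n}" S] by simp
    then show "(\<Sum>r\<le>n. w ^ r * (\<phi> r (card S) * (\<Prod>i\<in>S. y i) * f S)) = w ^ card S * (\<Prod>i\<in>S. y i) * f S"
      by (simp add: \<phi>_def of_bool_def if_distrib[of "\<lambda>c. c * _"] if_distrib[of "\<lambda>c. _ * c"] sum.delta cong: if_cong)
  qed
  finally show ?thesis by (simp add: subset_sum_def)
qed

lemma carre_generating:
  assumes inj: "inj_on y {1..n}"
    and nw: "\<And>k. k \<in> {1..n} \<Longrightarrow> 1 + w * y k \<noteq> 0" and nv: "\<And>k. k \<in> {1..n} \<Longrightarrow> 1 + v * y k \<noteq> 0"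
  shows "(v - w) * (\<Sum>r\<le>n. w ^ r * (\<Sum>s\<le>n. v ^ s * carre r s)) =
    v * (\<Sum>r\<le>n. w ^ r * (of_nat r * sG (\<phi> r) y \<tau> {1..n})) * (\<Sum>r\<le>n. v ^ r * sG (\<phi> r) y \<tau> {1..n}) -
    w * (\<Sum>r\<le>n. v ^ r * (of_nat r * sG (\<phi> r) y \<tau> {1..n})) * (\<Sum>r\<le>n. w ^ r * sG (\<phi> r) y \<tau> {1..n})"
proof -
  let ?I = "{1..n}"
  have U: "sU (\<lambda>k. w ^ k) y \<tau> ?I i = (\<Sum>r\<le>n. w ^ r * sU (\<phi> r) y \<tau> ?I i)" for w i
    unfolding sU_def by (rule subset_sum_power)
  have D: "sD (\<lambda>k. w ^ k) y ?I i j = (\<Sum>r\<le>n. w ^ r * sD (\<phi> r) y ?I i j)" for w i j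
    unfolding sD_def by (rule subset_sum_power)
  have G: "sG (\<lambda>k. w ^ k) y \<tau> ?I = (\<Sum>r\<le>n. w ^ r * sG (\<phi> r) y \<tau> ?I)" for w
    unfolding sG_def by (rule subset_sum_power)
  have sU: "(\<Sum>i\<in>?I. sU (\<lambda>k. w ^ k) y \<tau> ?I i) = (\<Sum>r\<le>n. w ^ r * (of_nat r * sG (\<phi> r) y \<tau> ?I))" for w
  proof -
    have "(\<Sum>i\<in>?I. sU (\<phi> r) y \<tau> ?I i) = of_nat r * sG (\<phi> r) y \<tau> ?I" for r
      unfolding sum_sU[OF finite_atLeastAtMost] sG_def subset_sum_def sum_distrib_left
      by (rule sum.cong) (auto simp: \<phi>_def of_bool_def)
    then show ?thesis unfolding U by (subst sum.swap) (simp add: sum_distrib_left[symmetric])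
  qed
  have bil: "(\<Sum>r\<le>n. w ^ r * (\<Sum>s\<le>n. v ^ s * (\<Sum>p\<in>A. k p * (f r p * f s p)))) =
      (\<Sum>p\<in>A. k p * ((\<Sum>r\<le>n. w ^ r * f r p) * (\<Sum>s\<le>n. v ^ s * f s p)))" for A k and f :: "nat \<Rightarrow> 'p \<Rightarrow> complex"
  proof -
    have "(\<Sum>r\<le>n. w ^ r * (\<Sum>s\<le>n. v ^ s * (\<Sum>p\<in>A. k p * (f r p * f s p)))) =
        (\<Sum>r\<le>n. \<Sum>s\<le>n. \<Sum>p\<in>A. k p * ((w ^ r * f r p) * (v ^ s * f s p)))"
      by (simp add: sum_distrib_left mult_ac)
    also have "\<dots> = (\<Sum>r\<le>n. \<Sum>p\<in>A. \<Sum>s\<le>n. k p * ((w ^ r * f r p) * (v ^ s * f s p)))"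
      by (intro sum.cong refl sum.swap)
    also have "\<dots> = (\<Sum>p\<in>A. \<Sum>r\<le>n. \<Sum>s\<le>n. k p * ((w ^ r * f r p) * (v ^ s * f s p)))"
      by (rule sum.swap)
    also have "\<dots> = (\<Sum>p\<in>A. k p * ((\<Sum>r\<le>n. w ^ r * f r p) * (\<Sum>s\<le>n. v ^ s * f s p)))"
      unfolding sum_product by (simp only: sum_distrib_left)
    finally show ?thesis .
  qed
  have sig: "(\<Sum>i\<in>?I. \<Sum>j\<in>?I - {i}. F i j) = (\<Sum>p\<in>Sigma ?I (\<lambda>i. ?I - {i}). F (fst p) (snd p))" for F :: "nat \<Rightarrow> nat \<Rightarrow> complex"
    by (subst sum.Sigma) (auto simp: split_beta')
  have car: "carre r s = (\<Sum>i\<in>?I. 1 * (sU (\<phi> r) y \<tau> ?I i * sU (\<phi> s) y \<tau> ?I i)) +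
      (\<Sum>p\<in>Sigma ?I (\<lambda>i. ?I - {i}). (y (fst p) * y (snd p) / (y (fst p) - y (snd p))\<^sup>2 * (\<tau> (fst p) * \<tau> (snd p))) *
        (sD (\<phi> r) y ?I (fst p) (snd p) * sD (\<phi> s) y ?I (fst p) (snd p)))" for r s
    unfolding carre_def sig by (simp add: mult_ac)
  have "(\<Sum>r\<le>n. w ^ r * (\<Sum>s\<le>n. v ^ s * carre r s)) =
      (\<Sum>i\<in>?I. sU (\<lambda>k. w ^ k) y \<tau> ?I i * sU (\<lambda>k. v ^ k) y \<tau> ?I i) +
      (\<Sum>i\<in>?I. \<Sum>j\<in>?I - {i}. y i * y j / (y i - y j)\<^sup>2 * (\<tau> i * \<tau> j *
         (sD (\<lambda>k. w ^ k) y ?I i j * sD (\<lambda>k. v ^ k) y ?I i j)))"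
    unfolding car distrib_left sum.distrib bil sig U D by (simp add: mult.assoc)
  then show ?thesis
    using second_order_identity[OF finite_atLeastAtMost inj nw nv, where \<tau> = \<tau>]
    unfolding sU G by simp
qed

end

lemma wt_0 [simp]: "wt (\<lambda>_. 0) S = 1"
  by (simp add: wt_def)

lemma esym_values:
  fixes x :: "nat \<Rightarrow> complex"
  shows "meval x (esym n r) = sG (\<lambda>k. of_bool (k = r)) x (\<lambda>_. 0) {1..n}"
    "meval x (theta i (esym n r)) = sU (\<lambda>k. of_bool (k = r)) x (\<lambda>_. 0) {1..n} i"
    "meval x (theta i (theta i (esym n r))) = sU (\<lambda>k. of_bool (k = r)) x (\<lambda>_. 0) {1..n} i"
  unfolding theta_ES meval_ES sG_def sU_def by (rule subset_sum_cong, simp)+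

lemma HX_esym:
  assumes "inj_on x {1..n}"
  shows "HX n g x (esym n r) = (of_nat r + g * (2 * (of_nat n - 1) * of_nat r - ((of_nat r)\<^sup>2 - of_nat r))) *
    sG (\<lambda>k. of_bool (k = r)) x (\<lambda>_. 0) {1..n}"
proof -
  have "HX n g x (esym n r) = sG (\<lambda>k. (of_nat k + g * (2 * (of_nat (card {1..n}) - 1) * of_nat k - ((of_nat k)\<^sup>2 - of_nat k))) *
      of_bool (k = r)) x (\<lambda>_. 0) {1..n}"
    using first_order_identity[OF finite_atLeastAtMost assms, where \<phi> = "\<lambda>k. of_bool (k = r)" and \<tau> = "\<lambda>_. 0" and g = g]
    unfolding HX_def esym_values by simp
  also have "\<dots> = (of_nat r + g * (2 * (of_nat n - 1) * of_nat r - ((of_nat r)\<^sup>2 - of_nat r))) *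
      sG (\<lambda>k. of_bool (k = r)) x (\<lambda>_. 0) {1..n}"
    unfolding sG_def subset_sum_def sum_distrib_left
    by (rule sum.cong) (auto simp: of_bool_def)
  finally show ?thesis .
qed

lemma GX_esym: "GX n x (esym n r) (esym n s) = carre n x (\<lambda>_. 0) r s"
  unfolding GX_def carre_def esym_values by simp

lemma carre_eq:
  fixes x y \<tau> :: "nat \<Rightarrow> complex"
  assumes inj: "inj_on y {1..n}" "inj_on x {1..n}"
    and G: "\<And>r. r \<le> n \<Longrightarrow> sG (\<lambda>k. of_bool (k = r)) y \<tau> {1..n} = sG (\<lambda>k. of_bool (k = r)) x (\<lambda>_. 0) {1..n}"
    and W: "infinite W" and nW: "\<And>w k. w \<in> W \<Longrightarrow> k \<in> {1..n} \<Longrightarrow> 1 + w * y k \<noteq> 0 \<and> 1 + w * x k \<noteq> 0"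
    and rs: "r \<le> n" "s \<le> n"
  shows "carre n y \<tau> r s = carre n x (\<lambda>_. 0) r s"
proof -
  define d where "d r s = carre n y \<tau> r s - carre n x (\<lambda>_. 0) r s" for r s
  have 1: "(\<Sum>r\<le>n. w ^ r * (\<Sum>s\<le>n. v ^ s * d r s)) = 0" if "v \<in> W" "w \<in> W - {v}" for v w
  proof -
    have e: "(\<Sum>r\<le>n. w ^ r * sG (\<lambda>k. of_bool (k = r)) y \<tau> {1..n}) = (\<Sum>r\<le>n. w ^ r * sG (\<lambda>k. of_bool (k = r)) x (\<lambda>_. 0) {1..n})"
      "(\<Sum>r\<le>n. w ^ r * (of_nat r * sG (\<lambda>k. of_bool (k = r)) y \<tau> {1..n})) =
        (\<Sum>r\<le>n. w ^ r * (of_nat r * sG (\<lambda>k. of_bool (k = r)) x (\<lambda>_. 0) {1..n}))" for w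
      by (rule sum.cong[OF refl], simp add: G del: One_nat_def)+
    have n: "1 + w * y k \<noteq> 0" "1 + v * y k \<noteq> 0" "1 + w * x k \<noteq> 0" "1 + v * x k \<noteq> 0" if "k \<in> {1..n}" for k
      using nW \<open>v \<in> W\<close> \<open>w \<in> W - {v}\<close> that by blast+
    let ?R = "\<lambda>y \<tau>. v * (\<Sum>r\<le>n. w ^ r * (of_nat r * sG (\<lambda>k. of_bool (k = r)) y \<tau> {1..n})) *
        (\<Sum>r\<le>n. v ^ r * sG (\<lambda>k. of_bool (k = r)) y \<tau> {1..n}) -
      w * (\<Sum>r\<le>n. v ^ r * (of_nat r * sG (\<lambda>k. of_bool (k = r)) y \<tau> {1..n})) *
        (\<Sum>r\<le>n. w ^ r * sG (\<lambda>k. of_bool (k = r)) y \<tau> {1..n})"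
    have "(v - w) * (\<Sum>r\<le>n. w ^ r * (\<Sum>s\<le>n. v ^ s * carre n y \<tau> r s)) = ?R y \<tau>"
      by (rule carre_generating[OF inj(1)]) (rule n(1), assumption, rule n(2), assumption)
    also have "?R y \<tau> = ?R x (\<lambda>_. 0)" unfolding e ..
    also have "?R x (\<lambda>_. 0) = (v - w) * (\<Sum>r\<le>n. w ^ r * (\<Sum>s\<le>n. v ^ s * carre n x (\<lambda>_. 0) r s))"
      by (rule carre_generating[OF inj(2), symmetric]) (rule n(3), assumption, rule n(4), assumption)
    finally have "(v - w) * (\<Sum>r\<le>n. w ^ r * (\<Sum>s\<le>n. v ^ s * carre n y \<tau> r s)) =
        (v - w) * (\<Sum>r\<le>n. w ^ r * (\<Sum>s\<le>n. v ^ s * carre n x (\<lambda>_. 0) r s))" .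
    then have "(\<Sum>r\<le>n. w ^ r * (\<Sum>s\<le>n. v ^ s * carre n y \<tau> r s)) = (\<Sum>r\<le>n. w ^ r * (\<Sum>s\<le>n. v ^ s * carre n x (\<lambda>_. 0) r s))"
      using that by auto
    then show ?thesis by (simp add: d_def right_diff_distrib sum_subtractf)
  qed
  have 2: "(\<Sum>s\<le>n. v ^ s * d r s) = 0" if "v \<in> W" for v
  proof (rule power_sum_eq_0_imp[where W = "W - {v}" and n = n and c = "\<lambda>r. \<Sum>s\<le>n. v ^ s * d r s"])
    show "infinite (W - {v})" using W by simp
    show "r \<le> n" by (rule rs(1))
  qed (rule 1[OF that])
  have "d r s = 0" by (rule power_sum_eq_0_imp[OF W _ rs(2)]) (rule 2)
  then show ?thesis by (simp add: d_def)
qed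

lemma HY_eq_HX:
  fixes x y \<tau> :: "nat \<Rightarrow> complex"
  assumes inj: "inj_on y {1..n}" "inj_on x {1..n}"
    and G: "\<And>r. r \<le> n \<Longrightarrow> sG (\<lambda>k. of_bool (k = r)) y \<tau> {1..n} = sG (\<lambda>k. of_bool (k = r)) x (\<lambda>_. 0) {1..n}"
    and W: "infinite W" and nW: "\<And>w k. w \<in> W \<Longrightarrow> k \<in> {1..n} \<Longrightarrow> 1 + w * y k \<noteq> 0 \<and> 1 + w * x k \<noteq> 0"
    and rs: "set rs \<subseteq> {..n}"
  shows "meval \<tau> (eY y (prod_list (map (gsym n) rs))) = meval x (prod_list (map (esym n) rs))"
    and "HY n g y \<tau> (prod_list (map (gsym n) rs)) = HX n g x (prod_list (map (esym n) rs))"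
proof -
  have v: "meval \<tau> (eY y (gsym n r)) = meval x (esym n r)" if "r \<in> {..n}" for r
    using G that by (simp only: gsym_values esym_values) simp
  have H: "HY n g y \<tau> (gsym n r) = HX n g x (esym n r)" if "r \<in> {..n}" for r
    using G that by (simp only: HY_gsym[OF inj(1)] HX_esym[OF inj(2)]) simp
  have \<Gamma>: "GY n y \<tau> (gsym n r) (gsym n s) = GX n x (esym n r) (esym n s)" if "r \<in> {..n}" "s \<in> {..n}" for r s
    unfolding GY_gsym GX_esym by (rule carre_eq[OF inj G W nW]) (use that in auto)
  show "meval \<tau> (eY y (prod_list (map (gsym n) rs))) = meval x (prod_list (map (esym n) rs))"
    and "HY n g y \<tau> (prod_list (map (gsym n) rs)) = HX n g x (prod_list (map (esym n) rs))"
    using second_order_transfer[OF second_order_HY second_order_HX v H \<Gamma> rs] by auto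
qed

lemma sG_fibre:
  fixes X y :: "nat \<Rightarrow> real"
  assumes X: "X \<in> interlacing_from 1 n y" and y0: "\<And>i. i \<in> {1..n} \<Longrightarrow> 0 < y i" and mono: "strict_mono_on {1..n} y"
    and r: "r \<le> n"
  shows "sG (\<lambda>k. of_bool (k = r)) (\<lambda>i. complex_of_real (y i)) (\<lambda>i. complex_of_real (residues_tau 1 n y X i)) {1..n} =
    sG (\<lambda>k. of_bool (k = r)) (\<lambda>i. complex_of_real (X i)) (\<lambda>_. 0) {1..n}"
proof -
  let ?y = "\<lambda>i. complex_of_real (y i)" and ?X = "\<lambda>i. complex_of_real (X i)"
  let ?t = "\<lambda>i. complex_of_real (residues_tau 1 n y X i)"
  define d where "d r = sG (\<lambda>k. of_bool (k = r)) ?y ?t {1..n} - sG (\<lambda>k. of_bool (k = r)) ?X (\<lambda>_. 0) {1..n}" for r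
  have X0: "0 < X i" if "i \<in> {1..n}" for i using interlacing_from_pos[OF X y0 that] .
  have gen: "(\<Sum>r\<le>n. w ^ r * d r) = 0" if "w \<in> complex_of_real ` {0<..}" for w
  proof -
    obtain u where u: "w = complex_of_real u" "0 < u" using \<open>w \<in> _\<close> by auto
    have ne: "1 + u * y k > 0" "1 + u * X k > 0" if "k \<in> {1..n}" for k
      using u y0[OF that] X0[OF that] by (auto intro!: add_pos_pos)
    have ne': "1 + w * ?y k \<noteq> 0" "1 + w * ?X k \<noteq> 0" if "k \<in> {1..n}" for k
    proof -
      have "1 + w * ?y k = complex_of_real (1 + u * y k)" "1 + w * ?X k = complex_of_real (1 + u * X k)"
        by (simp_all add: u)
      then show "1 + w * ?y k \<noteq> 0" "1 + w * ?X k \<noteq> 0"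
        using ne[OF that] by (simp_all only: of_real_eq_0_iff)
    qed
    have "(\<Prod>k\<in>{1..n}. (X k - (- 1 / u))) = (\<Prod>k\<in>{1..n}. (y k - (- 1 / u))) *
        (1 + (\<Sum>i\<in>{1..n}. y i * residues_tau 1 n y X i / (y i - (- 1 / u))))"
    proof (rule prod_ratio_residues_tau)
      show "inj_on y {1..n}" using mono strict_mono_on_imp_inj_on by blast
      show "y i \<noteq> 0" "- 1 / u \<noteq> y i" if "i \<in> {1..n}" for i
      proof -
        show "y i \<noteq> 0" using y0[OF that] by simp
        have "- 1 / u < 0" using u by simp
        then show "- 1 / u \<noteq> y i" using y0[OF that] by linarith
      qed
    qed
    then have h1: "u ^ n * (\<Prod>k\<in>{1..n}. (X k - (- 1 / u))) = (u ^ n * (\<Prod>k\<in>{1..n}. (y k - (- 1 / u)))) *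
        (1 + (\<Sum>i\<in>{1..n}. y i * residues_tau 1 n y X i / (y i - (- 1 / u))))"
      by (simp only: mult.assoc)
    have conv: "u ^ n * (\<Prod>k\<in>{1..n}. (q k - (- 1 / u))) = (\<Prod>k\<in>{1..n}. 1 + u * q k)" for q :: "nat \<Rightarrow> real"
    proof -
      have "u ^ n * (\<Prod>k\<in>{1..n}. (q k - (- 1 / u))) = (\<Prod>k\<in>{1..n}. u * (q k - (- 1 / u)))"
        by (simp only: prod.distrib prod_constant card_atLeastAtMost diff_Suc_1)
      also have "\<dots> = (\<Prod>k\<in>{1..n}. 1 + u * q k)"
      proof (rule prod.cong[OF refl])
        fix k show "u * (q k - (- 1 / u)) = 1 + u * q k" using u(2) by (simp add: distrib_left)
      qed
      finally show ?thesis .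
    qed
    have per: "y i * residues_tau 1 n y X i / (y i - (- 1 / u)) = residues_tau 1 n y X i * (u * y i / (1 + u * y i))"
      if "i \<in> {1..n}" for i
    proof -
      have e: "y i - (- 1 / u) = (1 + u * y i) / u" using u(2) by (simp add: add_divide_distrib)
      show ?thesis unfolding e by (simp add: mult_ac)
    qed
    have s: "(\<Sum>i\<in>{1..n}. y i * residues_tau 1 n y X i / (y i - (- 1 / u))) =
        (\<Sum>i\<in>{1..n}. residues_tau 1 n y X i * (u * y i / (1 + u * y i)))"
      by (rule sum.cong[OF refl]) (rule per)
    have "(\<Prod>k\<in>{1..n}. 1 + u * X k) = (\<Prod>k\<in>{1..n}. 1 + u * y k) *
        (1 + (\<Sum>i\<in>{1..n}. residues_tau 1 n y X i * (u * y i / (1 + u * y i))))"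
      using h1 unfolding conv s .
    then have "complex_of_real (\<Prod>k\<in>{1..n}. 1 + u * X k) = complex_of_real ((\<Prod>k\<in>{1..n}. 1 + u * y k) *
        (1 + (\<Sum>i\<in>{1..n}. residues_tau 1 n y X i * (u * y i / (1 + u * y i)))))" by (rule arg_cong)
    then have "(\<Prod>k\<in>{1..n}. 1 + w * ?X k) = (\<Prod>k\<in>{1..n}. 1 + w * ?y k) *
        (1 + (\<Sum>i\<in>{1..n}. ?t i * (w * ?y i / (1 + w * ?y i))))"
      unfolding u by (simp only: of_real_prod of_real_add of_real_mult of_real_1 of_real_sum of_real_divide)
    then have "sG (\<lambda>k. w ^ k) ?X (\<lambda>_. 0) {1..n} = sG (\<lambda>k. w ^ k) ?y ?t {1..n}"
    proof -
      assume e: "(\<Prod>k\<in>{1..n}. 1 + w * ?X k) = (\<Prod>k\<in>{1..n}. 1 + w * ?y k) *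
        (1 + (\<Sum>i\<in>{1..n}. ?t i * (w * ?y i / (1 + w * ?y i))))"
      have "sG (\<lambda>k. w ^ k) ?X (\<lambda>_. 0) {1..n} = (\<Prod>k\<in>{1..n}. 1 + w * ?X k) * (1 + (\<Sum>k\<in>{1..n}. 0 * (w * ?X k / (1 + w * ?X k))))"
        by (rule sG_power) (use ne' in auto)
      also have "\<dots> = (\<Prod>k\<in>{1..n}. 1 + w * ?X k)" by simp
      also note e
      also have "(\<Prod>k\<in>{1..n}. 1 + w * ?y k) * (1 + (\<Sum>i\<in>{1..n}. ?t i * (w * ?y i / (1 + w * ?y i)))) =
          sG (\<lambda>k. w ^ k) ?y ?t {1..n}"
        by (rule sG_power[symmetric]) (use ne' in auto)
      finally show ?thesis .
    qed
    then show ?thesis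
      unfolding sG_def subset_sum_power by (simp add: d_def sG_def right_diff_distrib sum_subtractf)
  qed
  have "infinite (complex_of_real ` {0<..})"
    using infinite_Ioi[of "0::real"] by (simp add: finite_image_iff inj_on_def)
  then have "d r = 0" by (rule power_sum_eq_0_imp[OF _ _ r]) (rule gen)
  then show ?thesis by (simp add: d_def)
qed

definition dirichlet_moment :: "nat \<Rightarrow> real \<Rightarrow> real \<Rightarrow> expo \<Rightarrow> complex"
  where "dirichlet_moment n g s a = complex_of_real (s ^ (\<Sum>i=1..n. lk a i) *
       (\<Prod>i=1..n. pochhammer g (lk a i)) / pochhammer (real n * g) (\<Sum>i=1..n. lk a i))"

lemma dirichlet_mean_superset:
  assumes "finite A" "keys p \<subseteq> A"
  shows "dirichlet_mean n g s p = (\<Sum>a\<in>A. lk p a * dirichlet_moment n g s a)"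
  unfolding dirichlet_mean_def dirichlet_moment_def[symmetric] using assms
  by (intro sum.mono_neutral_left) (auto simp: in_keys_iff)

lemma dirichlet_mean_add: "dirichlet_mean n g s (p + q) = dirichlet_mean n g s p + dirichlet_mean n g s q"
proof -
  let ?A = "keys p \<union> keys q"
  have "keys (p + q) \<subseteq> ?A" by (rule keys_add)
  then show ?thesis by (simp add: dirichlet_mean_superset[of ?A] lookup_add distrib_right sum.distrib)
qed

lemma dirichlet_mean_0 [simp]: "dirichlet_mean n g s 0 = 0"
  by (simp add: dirichlet_mean_def)

lemma dirichlet_mean_single: "dirichlet_mean n g s (single a c) = c * dirichlet_moment n g s a"
  by (cases "c = 0") (simp_all add: dirichlet_mean_superset[of "{a}"])

lemma dirichlet_mean_mconst_mult: "dirichlet_mean n g s (mconst c * p) = c * dirichlet_mean n g s p"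
proof -
  have "dirichlet_mean n g s (mconst c * p) = (\<Sum>a\<in>keys p. lk (mconst c * p) a * dirichlet_moment n g s a)"
    by (rule dirichlet_mean_superset[OF finite_keys keys_mconst_mult])
  also have "\<dots> = c * (\<Sum>a\<in>keys p. lk p a * dirichlet_moment n g s a)"
    by (simp only: lookup_mconst_mult sum_distrib_left mult.assoc)
  finally show ?thesis by (simp only: dirichlet_mean_superset[OF finite_keys order_refl])
qed

lemma dirichlet_mean_sum: "dirichlet_mean n g s (\<Sum>k\<in>A. f k) = (\<Sum>k\<in>A. dirichlet_mean n g s (f k))"
  by (induction A rule: infinite_finite_induct) (simp_all add: dirichlet_mean_add)

lemma dirichlet_moment_add_single:
  assumes "i \<in> {1..n}"
  shows "dirichlet_moment n g s (b + single i 1) =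
    complex_of_real (g + real (lk b i)) * complex_of_real (s ^ Suc (\<Sum>i=1..n. lk b i) *
       (\<Prod>i=1..n. pochhammer g (lk b i)) / pochhammer (real n * g) (Suc (\<Sum>i=1..n. lk b i)))"
proof -
  have s: "(\<Sum>k=1..n. lk (b + single i 1) k) = Suc (\<Sum>k=1..n. lk b k)"
    using assms by (simp add: lookup_add sum.distrib lookup_single when_def del: One_nat_def)
  have "(\<Prod>k=1..n. pochhammer g (lk (b + single i 1) k)) =
      (\<Prod>k=1..n. pochhammer g (lk b k) * (if k = i then g + real (lk b i) else 1))"
    by (rule prod.cong) (auto simp: lookup_add lookup_single pochhammer_Suc)
  also have "\<dots> = (\<Prod>k=1..n. pochhammer g (lk b k)) * (g + real (lk b i))"
    using assms by (simp add: prod.distrib del: One_nat_def)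
  finally show ?thesis unfolding dirichlet_moment_def s by (simp add: mult_ac)
qed

lemma dirichlet_mean_exchange:
  assumes "i \<in> {1..n}" "j \<in> {1..n}"
  shows "dirichlet_mean n g s (exchange_op i j (complex_of_real g) p) = 0"
proof -
  have *: "dirichlet_mean n g s (mvar i * mvar j * dd i j q + mconst (complex_of_real g) * ((mvar j - mvar i) * q)) = 0" for q
  proof (induction q rule: mpoly_additive_induct)
    case (single b c)
    have e0: "mvar i * mvar j * dd i j (single b c) = mvar j * theta i (single b c) - mvar i * theta j (single b c)"
      by (simp only: dd_def theta_def) (simp add: algebra_simps)
    have e: "mvar i * mvar j * dd i j (single b c) + mconst (complex_of_real g) * ((mvar j - mvar i) * single b c) =
      mconst (of_nat (lk b i) + complex_of_real g) * single (b + single j 1) c +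
      mconst (- (of_nat (lk b j) + complex_of_real g)) * single (b + single i 1) c"
      unfolding e0
      by (simp add: mvar_def mconst_def mult_single left_diff_distrib right_diff_distrib add.commute
          single_add single_diff single_uminus distrib_right del: One_nat_def single_of_nat)
    have z: "(bi + g') * (c * ((g' + bj) * Q)) + - (bj + g') * (c * ((g' + bi) * Q)) = 0" for bi bj g' Q :: complex
      by (simp add: algebra_simps)
    show ?case
      unfolding e dirichlet_mean_add dirichlet_mean_mconst_mult dirichlet_mean_single
        dirichlet_moment_add_single[OF assms(1)] dirichlet_moment_add_single[OF assms(2)] of_real_add of_real_of_nat_eq
      by (rule z)
  next
    case (add p q)
    have "mvar i * mvar j * dd i j (p + q) + mconst (complex_of_real g) * ((mvar j - mvar i) * (p + q)) =
      (mvar i * mvar j * dd i j p + mconst (complex_of_real g) * ((mvar j - mvar i) * p)) +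
      (mvar i * mvar j * dd i j q + mconst (complex_of_real g) * ((mvar j - mvar i) * q))"
      by (simp add: dd_add algebra_simps)
    then show ?case using add by (simp only: dirichlet_mean_add add_0_left)
  qed
  show ?thesis unfolding exchange_op_def by (rule *)
qed

section \<open>The operator on products of elementary symmetric polynomials\<close>

definition vars_in :: "nat \<Rightarrow> 'a::zero mpoly \<Rightarrow> bool"
  where "vars_in n p \<longleftrightarrow> (\<forall>a\<in>keys p. keys a \<subseteq> {1..n})"

lemma vars_in_0 [simp]: "vars_in n 0" by (simp add: vars_in_def)

lemma vars_in_single: "keys a \<subseteq> {1..n} \<Longrightarrow> vars_in n (single a c)"
  by (simp add: vars_in_def)

lemma vars_in_add: "vars_in n p \<Longrightarrow> vars_in n q \<Longrightarrow> vars_in n (p + q)"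
  using keys_add[of p q] by (auto simp: vars_in_def)

lemma vars_in_uminus: "vars_in n p \<Longrightarrow> vars_in n (- p :: 'a::ab_group_add mpoly)"
  by (simp add: vars_in_def in_keys_iff)

lemma vars_in_diff: "vars_in n p \<Longrightarrow> vars_in n q \<Longrightarrow> vars_in n (p - q :: 'a::ab_group_add mpoly)"
  using vars_in_add[of n p "- q"] vars_in_uminus by auto

lemma vars_in_sum: "(\<And>k. k \<in> A \<Longrightarrow> vars_in n (f k)) \<Longrightarrow> vars_in n (\<Sum>k\<in>A. f k)"
  by (induction A rule: infinite_finite_induct) (auto intro: vars_in_add)

lemma vars_in_mult: "vars_in n p \<Longrightarrow> vars_in n q \<Longrightarrow> vars_in n (p * q)"
proof -
  assume pq: "vars_in n p" "vars_in n q"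
  show ?thesis unfolding vars_in_def
  proof
    fix c assume "c \<in> keys (p * q)"
    then obtain a b where "c = a + b" "a \<in> keys p" "b \<in> keys q" using keys_mult[of p q] by blast
    then show "keys c \<subseteq> {1..n}" using pq keys_add[of a b] unfolding vars_in_def by blast
  qed
qed

lemma vars_in_mconst: "vars_in n (mconst c)"
  unfolding mconst_def by (rule vars_in_single) simp

lemma vars_in_1: "vars_in n (1 :: 'a::zero_neq_one mpoly)"
  by (simp add: vars_in_def)

lemma vars_in_mvar: "i \<in> {1..n} \<Longrightarrow> vars_in n (mvar i)"
  unfolding mvar_def by (rule vars_in_single) simp

lemma vars_in_mpderiv: "vars_in n p \<Longrightarrow> vars_in n (mpderiv i p)"
  unfolding mpderiv_def
proof (rule vars_in_sum, rule vars_in_single)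
  fix \<nu> assume "vars_in n p" "\<nu> \<in> keys p"
  moreover have "keys (\<nu> - single i 1) \<subseteq> keys \<nu>" by (auto simp: in_keys_iff lookup_minus)
  ultimately show "keys (\<nu> - single i 1) \<subseteq> {1..n}" unfolding vars_in_def by blast
qed

lemma vars_in_exchange_op:
  assumes "vars_in n p" "i \<in> {1..n}" "j \<in> {1..n}"
  shows "vars_in n (exchange_op i j g p)"
  unfolding exchange_op_def dd_def
  by (intro vars_in_add vars_in_mult vars_in_diff vars_in_mvar vars_in_mconst vars_in_mpderiv assms)

definition cvars_in :: "nat \<Rightarrow> 'a::zero mpoly mpoly \<Rightarrow> bool"
  where "cvars_in n F \<longleftrightarrow> (\<forall>\<nu>. vars_in n (lk F \<nu>))"

lemma cvars_in_single: "vars_in n c \<Longrightarrow> cvars_in n (single \<nu> c)"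
  by (auto simp: cvars_in_def lookup_single when_def)

lemma cvars_in_sum: "(\<And>k. k \<in> A \<Longrightarrow> cvars_in n (f k)) \<Longrightarrow> cvars_in n (\<Sum>k\<in>A. f k)"
  by (auto simp: cvars_in_def lookup_sum intro: vars_in_sum)

lemma cvars_in_mult: "cvars_in n F \<Longrightarrow> cvars_in n K \<Longrightarrow> cvars_in n (F * K :: 'a::comm_ring_1 mpoly mpoly)"
  unfolding cvars_in_def lookup_mult_sum[OF finite_keys order_refl finite_keys order_refl]
  by (auto intro!: vars_in_sum vars_in_mult)

lemma cvars_in_mconst: "vars_in n c \<Longrightarrow> cvars_in n (mconst c)"
  unfolding mconst_def by (rule cvars_in_single)

lemma cvars_in_prod_list: "(\<And>k. k \<in> set rs \<Longrightarrow> cvars_in n (f k)) \<Longrightarrow> cvars_in n (prod_list (map f rs) :: 'a::comm_ring_1 mpoly mpoly)"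
proof (induction rs)
  case Nil
  have "cvars_in n (mconst (1 :: 'a mpoly))" by (rule cvars_in_mconst) (rule vars_in_1)
  then show ?case by simp
qed (auto intro: cvars_in_mult)

lemma cvars_in_theta: "cvars_in n F \<Longrightarrow> cvars_in n (theta i (F :: 'a::comm_ring_1 mpoly mpoly))"
proof -
  have "vars_in n (of_nat k :: 'a mpoly)" for k
    unfolding of_nat_single comp_def by (rule vars_in_single) simp
  then show "cvars_in n F \<Longrightarrow> ?thesis" by (auto simp: cvars_in_def lookup_theta intro: vars_in_mult)
qed

lemma cvars_in_gsym: "cvars_in n (gsym n r)"
  unfolding ES_def
  by (intro cvars_in_sum cvars_in_single vars_in_add vars_in_1 vars_in_sum vars_in_mvar) auto

lemma mon_mconst: "mon (\<lambda>i. mconst (y i)) \<nu> = mconst (mon y \<nu>)"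
proof -
  have p: "mconst (a :: 'a::comm_semiring_1) ^ k = mconst (a ^ k)" for a k
    by (induction k) (simp_all add: mconst_mult)
  have "(\<Prod>i\<in>A. mconst (h i)) = mconst (\<Prod>i\<in>A. h i)" for A and h :: "nat \<Rightarrow> 'a"
    by (induction A rule: infinite_finite_induct) (simp_all add: mconst_mult)
  then show ?thesis by (simp add: mon_def p)
qed

lemma eY_eq: "eY y F = (\<Sum>\<nu>\<in>keys F. mconst (mon y \<nu>) * lk F \<nu>)"
  by (simp add: meval_superset[OF finite_keys order_refl] mon_mconst mult.commute)

lemma vars_in_eY: "cvars_in n F \<Longrightarrow> vars_in n (eY y (F :: 'a::comm_ring_1 mpoly mpoly))"
  unfolding eY_eq cvars_in_def by (intro vars_in_sum vars_in_mult vars_in_mconst) auto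

definition mean_coeffs :: "nat \<Rightarrow> real \<Rightarrow> real \<Rightarrow> complex mpoly mpoly \<Rightarrow> complex mpoly"
  where "mean_coeffs n g s F = Poly_Mapping.map (dirichlet_mean n g s) F"

lemma lookup_mean_coeffs: "lk (mean_coeffs n g s F) \<nu> = dirichlet_mean n g s (lk F \<nu>)"
  by (simp add: mean_coeffs_def map.rep_eq when_def)

lemma meval_mean_coeffs: "meval y (mean_coeffs n g s F) = dirichlet_mean n g s (eY y F)"
proof -
  have "keys (mean_coeffs n g s F) \<subseteq> keys F" by (auto simp: in_keys_iff lookup_mean_coeffs)
  then show ?thesis
    unfolding eY_eq dirichlet_mean_sum dirichlet_mean_mconst_mult
    by (simp add: meval_superset[of "keys F"] lookup_mean_coeffs mult.commute)
qed

lemma dirichlet_mean_of_nat_mult: "dirichlet_mean n g s (of_nat k * p) = of_nat k * dirichlet_mean n g s p"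
proof -
  have "of_nat k = (mconst (of_nat k) :: complex mpoly)" unfolding mconst_def by simp
  then show ?thesis by (simp only: dirichlet_mean_mconst_mult)
qed

lemma theta_mean_coeffs: "theta i (mean_coeffs n g s F) = mean_coeffs n g s (theta i F)"
  by (rule poly_mapping_eqI) (simp add: lookup_theta lookup_mean_coeffs dirichlet_mean_of_nat_mult)

lemma HX_linear:
  "HX n g x (\<Sum>k\<in>A. mconst (c k) * f k) = (\<Sum>k\<in>A. c k * HX n g x (f k))"
proof -
  have add: "HX n g x (p + q) = HX n g x p + HX n g x q" for p q
    unfolding HX_def by (simp add: theta_add meval_add distrib_left sum.distrib)
  have scale: "HX n g x (mconst a * p) = a * HX n g x p" for a p
    unfolding HX_def theta_mconst_mult meval_mult meval_mconst by (simp add: sum_distrib_left distrib_left mult_ac)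
  have "HX n g x 0 = 0" by (simp add: HX_def)
  then show ?thesis by (induction A rule: infinite_finite_induct) (simp_all add: add scale)
qed

lemma HY_linear:
  "HY n g y \<tau> (\<Sum>k\<in>A. mconst (mconst (c k)) * F k) = (\<Sum>k\<in>A. c k * HY n g y \<tau> (F k))"
proof -
  have ex: "exchange_op i j g (p + q) = exchange_op i j g p + exchange_op i j g q" for i j p q
    by (simp add: exchange_op_def dd_add algebra_simps)
  have ex0: "exchange_op i j g 0 = 0" for i j by (simp add: exchange_op_def)
  have exs: "exchange_op i j g (mconst a * p) = mconst a * exchange_op i j g p" for i j a p
    by (simp add: exchange_op_def dd_mult algebra_simps)
  have add: "HY n g y \<tau> (p + q) = HY n g y \<tau> p + HY n g y \<tau> q" for p q
    unfolding HY_def by (simp add: theta_add meval_add ex distrib_left sum.distrib)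
  have scale: "HY n g y \<tau> (mconst (mconst a) * p) = a * HY n g y \<tau> p" for a p
    unfolding HY_def theta_mconst_mult meval_mult meval_mconst exs
    by (simp add: sum_distrib_left distrib_left mult_ac)
  have "HY n g y \<tau> 0 = 0" by (simp add: HY_def ex0)
  then show ?thesis by (induction A rule: infinite_finite_induct) (simp_all add: add scale)
qed

theorem Q_integral_mean_coeffs:
  fixes g z :: real and n :: nat and A :: "'k set" and c :: "'k \<Rightarrow> complex" and rs :: "'k \<Rightarrow> nat list"
  defines "f \<equiv> (\<Sum>k\<in>A. mconst (c k) * prod_list (map (esym n) (rs k)))"
    and "F \<equiv> (\<Sum>k\<in>A. mconst (mconst (c k)) * prod_list (map (gsym n) (rs k)))"
  assumes n: "1 \<le> n" and g: "0 < g" and z: "1 < z" and y: "y \<in> chamber n"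
    and rs: "\<And>k. k \<in> A \<Longrightarrow> set (rs k) \<subseteq> {..n}"
  shows "Q_integral n g z f y = meval (\<lambda>i. complex_of_real (y i)) (mean_coeffs n g (z - 1) F)"
    and "(\<And>x. x \<in> chamber n \<Longrightarrow> HX n (complex_of_real g) (\<lambda>i. complex_of_real (x i)) f = \<epsilon> * meval (\<lambda>i. complex_of_real (x i)) f) \<Longrightarrow>
      HX n (complex_of_real g) (\<lambda>i. complex_of_real (y i)) (mean_coeffs n g (z - 1) F) =
      \<epsilon> * meval (\<lambda>i. complex_of_real (y i)) (mean_coeffs n g (z - 1) F)"
proof -
  let ?Y = "\<lambda>i. complex_of_real (y i)"
  let ?T = "\<lambda>X i. complex_of_real (residues_tau 1 n y X i)"
  let ?g = "complex_of_real g"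
  have y0: "0 < y i" if "i \<in> {1..n}" for i using y that by (simp add: chamber_def)
  have mono: "strict_mono_on {1..n} y" using y by (simp add: chamber_def)
  have cF: "cvars_in n F"
    unfolding F_def by (intro cvars_in_sum cvars_in_mult cvars_in_mconst vars_in_mconst cvars_in_prod_list cvars_in_gsym)
  have fibre: "meval (?T X) (eY ?Y F) = meval (\<lambda>i. complex_of_real (X i)) f"
    "HY n ?g ?Y (?T X) F = HX n ?g (\<lambda>i. complex_of_real (X i)) f"
    "X \<in> chamber n" if X: "X \<in> interlacing_from 1 n y" for X
  proof -
    let ?X = "\<lambda>i. complex_of_real (X i)"
    have X0: "0 < X i" if "i \<in> {1..n}" for i using interlacing_from_pos[OF X y0 that] .
    have Xm: "strict_mono_on {1..n} X"
    proof (rule strict_mono_onI)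
      fix r s assume "r \<in> {1..n}" "s \<in> {1..n}" "r < s"
      then show "X r < X s" by (intro interlacing_from_mono[OF X _ _ _ mono]) auto
    qed
    show "X \<in> chamber n" using X0 Xm by (simp add: chamber_def)
    have inj: "inj_on ?Y {1..n}" "inj_on ?X {1..n}"
      using strict_mono_on_imp_inj_on[OF mono] strict_mono_on_imp_inj_on[OF Xm]
      unfolding inj_on_def of_real_eq_iff by blast+
    have W: "infinite (complex_of_real ` {0<..})"
      using infinite_Ioi[of "0::real"] by (simp add: finite_image_iff inj_on_def)
    have nW: "1 + w * ?Y k \<noteq> 0 \<and> 1 + w * ?X k \<noteq> 0" if w: "w \<in> complex_of_real ` {0<..}" and k: "k \<in> {1..n}" for w k
    proof -
      obtain u where u: "w = complex_of_real u" "0 < u" using w by auto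
      have h: "0 < 1 + u * y k" "0 < 1 + u * X k"
        using mult_pos_pos[OF u(2) y0[OF k]] mult_pos_pos[OF u(2) X0[OF k]] by linarith+
      have e: "1 + w * ?Y k = complex_of_real (1 + u * y k)" "1 + w * ?X k = complex_of_real (1 + u * X k)"
        by (simp_all add: u(1))
      show ?thesis unfolding e of_real_eq_0_iff using h by linarith
    qed
    have "meval (?T X) (eY ?Y (prod_list (map (gsym n) (rs k)))) = meval ?X (prod_list (map (esym n) (rs k)))"
      "HY n ?g ?Y (?T X) (prod_list (map (gsym n) (rs k))) = HX n ?g ?X (prod_list (map (esym n) (rs k)))" if "k \<in> A" for k
    proof -
      have G: "sG (\<lambda>k. of_bool (k = r)) ?Y (?T X) {1..n} = sG (\<lambda>k. of_bool (k = r)) ?X (\<lambda>_. 0) {1..n}" if "r \<le> n" for r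
        by (rule sG_fibre[OF X _ mono that]) (rule y0)
      show "meval (?T X) (eY ?Y (prod_list (map (gsym n) (rs k)))) = meval ?X (prod_list (map (esym n) (rs k)))"
        by (rule HY_eq_HX(1)[OF inj G W nW rs[OF that]])
      show "HY n ?g ?Y (?T X) (prod_list (map (gsym n) (rs k))) = HX n ?g ?X (prod_list (map (esym n) (rs k)))"
        by (rule HY_eq_HX(2)[OF inj G W nW rs[OF that]])
    qed
    then show "meval (?T X) (eY ?Y F) = meval ?X f" "HY n ?g ?Y (?T X) F = HX n ?g ?X f"
      unfolding f_def F_def HX_linear HY_linear
      by (simp_all only: meval_sum meval_mult meval_mconst cong: sum.cong)
  qed
  show Q: "Q_integral n g z f y = meval ?Y (mean_coeffs n g (z - 1) F)"
  proof -
    have "1 * Q_integral n g z f y = dirichlet_mean n g (z - 1) (eY ?Y F)"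
    proof (rule Q_integral_eq_dirichlet_mean[OF n g z y])
      show "keys a \<subseteq> {1..n}" if "a \<in> keys (eY ?Y F)" for a
        using vars_in_eY[OF cF, of ?Y] that unfolding vars_in_def by blast
      show "1 * meval (\<lambda>i. complex_of_real (X i)) f = meval (?T X) (eY ?Y F)" if "X \<in> interlacing_from 1 n y" for X
        unfolding fibre(1)[OF that] by simp
    qed
    then show ?thesis unfolding meval_mean_coeffs by simp
  qed
  assume eig: "\<And>x. x \<in> chamber n \<Longrightarrow> HX n ?g (\<lambda>i. complex_of_real (x i)) f = \<epsilon> * meval (\<lambda>i. complex_of_real (x i)) f"
  define P2 where "P2 = (\<Sum>i\<in>{1..n}. eY ?Y (theta i (theta i F))) +
    mconst (2 * ?g) * (\<Sum>i\<in>{1..n}. \<Sum>j\<in>{1..n} - {i}. mconst (?Y i / (?Y i - ?Y j)) * eY ?Y (theta i F)) +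
    (\<Sum>i\<in>{1..n}. \<Sum>j\<in>{1..n} - {i}. mconst (?Y i * ?Y j / (?Y i - ?Y j)\<^sup>2) * exchange_op i j ?g (eY ?Y F))"
  have P2: "meval \<tau> P2 = HY n ?g ?Y \<tau> F" for \<tau>
    unfolding P2_def HY_def by (simp only: meval_add meval_sum meval_mult meval_mconst)
  have "vars_in n P2"
    unfolding P2_def
    by (intro vars_in_add vars_in_sum vars_in_mult vars_in_mconst vars_in_eY vars_in_exchange_op cvars_in_theta cF) auto
  then have v: "keys a \<subseteq> {1..n}" if "a \<in> keys P2" for a using that by (simp add: vars_in_def)
  have "\<epsilon> * Q_integral n g z f y = dirichlet_mean n g (z - 1) P2"
  proof (rule Q_integral_eq_dirichlet_mean[OF n g z y v])
    fix X assume X: "X \<in> interlacing_from 1 n y"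
    show "\<epsilon> * meval (\<lambda>i. complex_of_real (X i)) f = meval (?T X) P2"
      unfolding P2 fibre(2)[OF X] using eig[OF fibre(3)[OF X]] by simp
  qed
  also have "\<dots> = HX n ?g ?Y (mean_coeffs n g (z - 1) F)"
  proof -
    have z: "dirichlet_mean n g (z - 1) (\<Sum>i\<in>{1..n}. \<Sum>j\<in>{1..n} - {i}. mconst (?Y i * ?Y j / (?Y i - ?Y j)\<^sup>2) * exchange_op i j ?g (eY ?Y F)) = 0"
      unfolding dirichlet_mean_sum dirichlet_mean_mconst_mult
      by (intro sum.neutral ballI) (simp add: dirichlet_mean_exchange)
    show ?thesis
      unfolding P2_def HX_def dirichlet_mean_add z theta_mean_coeffs meval_mean_coeffs
      by (simp only: dirichlet_mean_sum dirichlet_mean_mconst_mult add_0_right)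
  qed
  finally show "HX n ?g ?Y (mean_coeffs n g (z - 1) F) = \<epsilon> * meval ?Y (mean_coeffs n g (z - 1) F)"
    unfolding Q by simp
qed

section \<open>Eigenvalue equations for coefficients\<close>

definition delta_expo :: "nat \<Rightarrow> (nat \<Rightarrow> nat) \<Rightarrow> expo"
  where "delta_expo n \<sigma> = (\<Sum>i\<in>{1..n}. single i (n - \<sigma> i))"

lemma lookup_sum_single:
  assumes "finite A"
  shows "lk (\<Sum>i\<in>A. single i (h i)) k = (if k \<in> A then h k else (0::nat))"
  using assms by (simp add: lookup_sum lookup_single when_def sum.delta)

lemma lookup_delta_expo: "lk (delta_expo n \<sigma>) k = (if k \<in> {1..n} then n - \<sigma> k else 0)"
  unfolding delta_expo_def by (rule lookup_sum_single) simp

lemma mvar_power: "mvar i ^ k = (single (single i k) 1 :: 'a::comm_ring_1 mpoly)"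
proof (induction k)
  case (Suc k)
  have "single i 1 + single i k = single i (Suc k)" by (simp add: single_add[symmetric])
  then show ?case using Suc by (simp add: mvar_def mult_single)
qed simp

lemma D_entry_single:
  "D_entry n u g i j (single \<nu> c) = single (\<nu> + single i (n - j)) ((of_nat (lk \<nu> i) + (of_nat (n - j) * g + u)) * (c::'a::comm_ring_1))"
  unfolding D_entry_def theta_def[symmetric] theta_single mvar_power
  by (simp add: mconst_def mult_single single_add[symmetric] distrib_right add.commute)

lemma D_entry_sum: "D_entry n u g i j (\<Sum>k\<in>A. f k) = (\<Sum>k\<in>A. D_entry n u g i j (f k))"
  unfolding D_entry_def by (simp add: mpderiv_sum sum_distrib_left sum.distrib distrib_left)

lemma foldr_D_entry_single:
  assumes "distinct ks"
  shows "foldr (\<lambda>i. D_entry n u g i (\<sigma> i)) ks (single \<nu> c) =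
    single (\<nu> + (\<Sum>i\<in>set ks. single i (n - \<sigma> i))) ((\<Prod>i\<in>set ks. of_nat (lk \<nu> i) + (of_nat (n - \<sigma> i) * g + u)) * (c::'a::comm_ring_1))"
  using assms
proof (induction ks)
  case (Cons k ks)
  have "lk (\<nu> + (\<Sum>i\<in>set ks. single i (n - \<sigma> i))) k = lk \<nu> k"
    using Cons.prems by (simp add: lookup_add lookup_sum_single)
  then show ?case using Cons by (simp add: D_entry_single add_ac mult_ac)
qed simp

lemma foldr_D_entry_sum:
  "foldr (\<lambda>i. D_entry n u g i (\<sigma> i)) ks (\<Sum>k\<in>A. f k) = (\<Sum>k\<in>A. foldr (\<lambda>i. D_entry n u g i (\<sigma> i)) ks (f k))"
  by (induction ks) (simp_all add: D_entry_sum)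

lemma lookup_of_int_mult: "lk (of_int k * (p :: 'a::comm_ring_1 mpoly)) \<kappa> = of_int k * lk p \<kappa>"
proof -
  have "of_int k = (mconst (of_int k) :: 'a mpoly)" unfolding mconst_def by simp
  then show ?thesis by (simp only: lookup_mconst_mult)
qed

lemma lookup_D_det:
  fixes p :: "'a::comm_ring_1 mpoly"
  assumes "finite N" "keys p \<subseteq> N"
  shows "lk (D_det n u g p) \<kappa> = (\<Sum>\<sigma> | \<sigma> permutes {1..n}. \<Sum>\<nu>\<in>N.
     (if \<nu> + delta_expo n \<sigma> = \<kappa> then of_int (sign \<sigma>) * lk p \<nu> else 0) *
     (\<Prod>i\<in>{1..n}. (of_nat (lk \<nu> i) + of_nat (n - \<sigma> i) * g) + u))"
proof -
  have "D_det n u g p = (\<Sum>\<sigma> | \<sigma> permutes {1..n}. of_int (sign \<sigma>) *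
      (\<Sum>\<nu>\<in>N. single (\<nu> + delta_expo n \<sigma>) ((\<Prod>i\<in>{1..n}. of_nat (lk \<nu> i) + (of_nat (n - \<sigma> i) * g + u)) * lk p \<nu>)))"
    unfolding D_det_def
  proof (rule sum.cong[OF refl])
    fix \<sigma>
    have "foldr (\<lambda>i. D_entry n u g i (\<sigma> i)) [1..<Suc n] p =
        (\<Sum>\<nu>\<in>N. foldr (\<lambda>i. D_entry n u g i (\<sigma> i)) [1..<Suc n] (single \<nu> (lk p \<nu>)))"
      by (subst sum_single_keys[OF assms, symmetric]) (rule foldr_D_entry_sum)
    also have "\<dots> = (\<Sum>\<nu>\<in>N. single (\<nu> + delta_expo n \<sigma>) ((\<Prod>i\<in>{1..n}. of_nat (lk \<nu> i) + (of_nat (n - \<sigma> i) * g + u)) * lk p \<nu>))"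
      by (simp add: foldr_D_entry_single delta_expo_def atLeastLessThanSuc_atLeastAtMost del: upt_Suc)
    finally show "of_int (sign \<sigma>) * foldr (\<lambda>i. D_entry n u g i (\<sigma> i)) [1..<Suc n] p = of_int (sign \<sigma>) *
      (\<Sum>\<nu>\<in>N. single (\<nu> + delta_expo n \<sigma>) ((\<Prod>i\<in>{1..n}. of_nat (lk \<nu> i) + (of_nat (n - \<sigma> i) * g + u)) * lk p \<nu>))"
      by simp
  qed
  then show ?thesis
    by (simp only: lookup_sum lookup_of_int_mult lookup_single when_def sum_distrib_left add.assoc)
      (auto intro!: sum.cong simp: mult_ac)
qed

lemma coeffs_prod_linear:
  fixes a :: "'i \<Rightarrow> 'a::comm_ring_1"
  assumes "finite I"
  shows "coeff (\<Prod>i\<in>I. [:1, a i:]) 0 = 1" and "coeff (\<Prod>i\<in>I. [:1, a i:]) 1 = (\<Sum>i\<in>I. a i)"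
    and "2 * coeff (\<Prod>i\<in>I. [:1, a i:]) 2 = (\<Sum>i\<in>I. a i)\<^sup>2 - (\<Sum>i\<in>I. (a i)\<^sup>2)"
proof -
  have "coeff (\<Prod>i\<in>I. [:1, a i:]) 0 = 1 \<and> coeff (\<Prod>i\<in>I. [:1, a i:]) 1 = (\<Sum>i\<in>I. a i) \<and>
    2 * coeff (\<Prod>i\<in>I. [:1, a i:]) 2 = (\<Sum>i\<in>I. a i)\<^sup>2 - (\<Sum>i\<in>I. (a i)\<^sup>2)"
    using assms
  proof (induction I rule: finite_induct)
    case (insert j I)
    let ?P = "\<Prod>i\<in>I. [:1, a i:]"
    have "(\<Prod>i\<in>insert j I. [:1, a i:]) = ?P + pCons 0 (smult (a j) ?P)"
      using insert.hyps by (simp add: mult_pCons_left)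
    moreover have "coeff (pCons 0 q) 2 = coeff q 1" "coeff (pCons 0 q) 1 = coeff q 0" for q :: "'a poly"
      by (simp_all add: numeral_2_eq_2)
    ultimately show ?case using insert
      by (simp add: algebra_simps power2_eq_square)
  qed (simp add: numeral_2_eq_2)
  then show "coeff (\<Prod>i\<in>I. [:1, a i:]) 0 = 1" "coeff (\<Prod>i\<in>I. [:1, a i:]) 1 = (\<Sum>i\<in>I. a i)"
    "2 * coeff (\<Prod>i\<in>I. [:1, a i:]) 2 = (\<Sum>i\<in>I. a i)\<^sup>2 - (\<Sum>i\<in>I. (a i)\<^sup>2)" by auto
qed

lemma power_sums_of_shifted_products:
  fixes w :: "'z \<Rightarrow> 'a::field" and a :: "'z \<Rightarrow> 'i \<Rightarrow> 'a"
  assumes inf: "infinite (UNIV :: 'a set)" and I: "finite I"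
    and eq: "\<And>u. (\<Sum>z\<in>Z. w z * (\<Prod>i\<in>I. a z i + u)) = (\<Prod>i\<in>I. b i + u) * B"
    and E: "\<And>z. z \<in> Z \<Longrightarrow> w z \<noteq> 0 \<Longrightarrow> (\<Sum>i\<in>I. a z i) = (\<Sum>i\<in>I. b i)"
  shows "(\<Sum>z\<in>Z. w z * ((\<Sum>i\<in>I. (a z i)\<^sup>2) - (\<Sum>i\<in>I. (b i)\<^sup>2))) = 0"
proof -
  define L where "L = (\<Sum>z\<in>Z. smult (w z) (\<Prod>i\<in>I. [:1, a z i:])) - smult B (\<Prod>i\<in>I. [:1, b i:])"
  have "poly L v = 0" if "v \<noteq> 0" for v
  proof -
    have p: "(\<Prod>i\<in>I. 1 + v * h i) = v ^ card I * (\<Prod>i\<in>I. h i + 1 / v)" for h :: "'i \<Rightarrow> 'a"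
    proof -
      have "(\<Prod>i\<in>I. 1 + v * h i) = (\<Prod>i\<in>I. v * (h i + 1 / v))"
        using that by (intro prod.cong) (auto simp: distrib_left)
      then show ?thesis by (simp only: prod.distrib prod_constant)
    qed
    have "poly L v = (\<Sum>z\<in>Z. w z * (\<Prod>i\<in>I. 1 + v * a z i)) - B * (\<Prod>i\<in>I. 1 + v * b i)"
      by (simp add: L_def poly_sum poly_prod)
    also have "\<dots> = v ^ card I * ((\<Sum>z\<in>Z. w z * (\<Prod>i\<in>I. a z i + 1 / v)) - (\<Prod>i\<in>I. b i + 1 / v) * B)"
      unfolding p by (simp add: right_diff_distrib sum_distrib_left mult_ac)
    finally show ?thesis unfolding eq by simp
  qed
  then have "UNIV - {0} \<subseteq> {v. poly L v = 0}" by auto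
  moreover have "infinite (UNIV - {0::'a})" using inf by simp
  ultimately have L: "L = 0" using poly_roots_finite finite_subset by blast
  let ?e = "(\<Sum>i\<in>I. b i)\<^sup>2"
  have "coeff L 0 = 0" "2 * coeff L 2 = 0" by (simp_all add: L)
  moreover have "coeff L 0 = (\<Sum>z\<in>Z. w z) - B"
    by (simp add: L_def coeff_sum coeffs_prod_linear(1)[OF I])
  moreover have "2 * coeff L 2 = (\<Sum>z\<in>Z. w z * (?e - (\<Sum>i\<in>I. (a z i)\<^sup>2))) - B * (?e - (\<Sum>i\<in>I. (b i)\<^sup>2))"
  proof -
    have "2 * coeff L 2 = (\<Sum>z\<in>Z. w z * (2 * coeff (\<Prod>i\<in>I. [:1, a z i:]) 2)) - B * (2 * coeff (\<Prod>i\<in>I. [:1, b i:]) 2)"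
      by (simp add: L_def coeff_sum right_diff_distrib sum_distrib_left mult_ac)
    also have "(\<Sum>z\<in>Z. w z * (2 * coeff (\<Prod>i\<in>I. [:1, a z i:]) 2)) = (\<Sum>z\<in>Z. w z * (?e - (\<Sum>i\<in>I. (a z i)\<^sup>2)))"
    proof (rule sum.cong[OF refl])
      fix z assume "z \<in> Z"
      then show "w z * (2 * coeff (\<Prod>i\<in>I. [:1, a z i:]) 2) = w z * (?e - (\<Sum>i\<in>I. (a z i)\<^sup>2))"
        using E[of z] coeffs_prod_linear(3)[OF I, of "a z"] by (cases "w z = 0") simp_all
    qed
    finally show ?thesis by (simp only: coeffs_prod_linear(3)[OF I])
  qed
  ultimately have B: "B = (\<Sum>z\<in>Z. w z)" and
    q: "(\<Sum>z\<in>Z. w z * (?e - (\<Sum>i\<in>I. (a z i)\<^sup>2))) = B * (?e - (\<Sum>i\<in>I. (b i)\<^sup>2))" by simp_all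
  have "(\<Sum>z\<in>Z. w z * ((\<Sum>i\<in>I. (a z i)\<^sup>2) - (\<Sum>i\<in>I. (b i)\<^sup>2))) =
      (\<Sum>z\<in>Z. w z * (?e - (\<Sum>i\<in>I. (b i)\<^sup>2)) - w z * (?e - (\<Sum>i\<in>I. (a z i)\<^sup>2)))"
    by (rule sum.cong) (simp_all add: right_diff_distrib)
  also have "\<dots> = B * (?e - (\<Sum>i\<in>I. (b i)\<^sup>2)) - (\<Sum>z\<in>Z. w z * (?e - (\<Sum>i\<in>I. (a z i)\<^sup>2)))"
    by (simp only: sum_subtractf sum_distrib_right[symmetric] B)
  finally have "(\<Sum>z\<in>Z. w z * ((\<Sum>i\<in>I. (a z i)\<^sup>2) - (\<Sum>i\<in>I. (b i)\<^sup>2))) =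
      B * (?e - (\<Sum>i\<in>I. (b i)\<^sup>2)) - (\<Sum>z\<in>Z. w z * (?e - (\<Sum>i\<in>I. (a z i)\<^sup>2)))" .
  then show ?thesis using q by simp
qed

definition qnorm :: "nat \<Rightarrow> 'a::comm_ring_1 \<Rightarrow> (nat \<Rightarrow> nat) \<Rightarrow> expo \<Rightarrow> 'a"
  where "qnorm n g \<sigma> \<nu> = (\<Sum>i\<in>{1..n}. (of_nat (lk \<nu> i) + of_nat (n - \<sigma> i) * g)\<^sup>2)"

definition hcoeff :: "nat \<Rightarrow> 'a::comm_ring_1 \<Rightarrow> expo \<Rightarrow> expo set \<Rightarrow> (expo \<Rightarrow> 'a) \<Rightarrow> expo \<Rightarrow> 'a"
  where "hcoeff n g lam N f \<kappa> = (\<Sum>\<sigma> | \<sigma> permutes {1..n}. \<Sum>\<nu>\<in>N.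
     (if \<nu> + delta_expo n \<sigma> = \<kappa> then of_int (sign \<sigma>) * f \<nu> else 0) * (qnorm n g \<sigma> \<nu> - qnorm n g id lam))"

definition lam_bounded :: "nat \<Rightarrow> expo \<Rightarrow> expo \<Rightarrow> bool"
  where "lam_bounded n lam \<nu> \<longleftrightarrow> keys \<nu> \<subseteq> {1..n} \<and> (\<Sum>i=1..n. lk \<nu> i) = (\<Sum>i=1..n. lk lam i) \<and>
    (\<forall>K. K \<subseteq> {1..n} \<longrightarrow> (\<Sum>i\<in>K. lk \<nu> i) \<le> (\<Sum>i=1..card K. lk lam i))"

lemma D_op_eigen_hcoeff:
  fixes P :: "'a::field mpoly" and g :: 'a
  assumes inf: "infinite (UNIV :: 'a set)"
    and eig: "\<And>u. D_op n u g P = Fract (mconst (\<Prod>i=1..n. of_nat (lk lam i) + of_nat (n - i) * g + u) * P) 1"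
    and N: "finite N" "keys P \<subseteq> N" and deg: "\<And>\<nu>. \<nu> \<in> N \<Longrightarrow> (\<Sum>i=1..n. lk \<nu> i) = (\<Sum>i=1..n. lk lam i)"
  shows "hcoeff n g lam N (lk P) \<kappa> = 0"
proof -
  let ?\<Delta> = "mvandermonde n :: 'a mpoly"
  let ?s = "(-1) ^ (n * (n - 1) div 2) :: 'a mpoly"
  have nz: "?\<Delta> \<noteq> 0"
  proof -
    have "mvar j - mvar i \<noteq> (0 :: 'a mpoly)" if "i < j" for i j :: nat
    proof
      assume "mvar j - mvar i = (0 :: 'a mpoly)"
      then have "mvar j = (mvar i :: 'a mpoly)" by simp
      then have "single j 1 = (single i 1 :: expo)" unfolding mvar_def
        by (metis lookup_single_eq lookup_single_not_eq zero_neq_one)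
      then have "lk (single j 1) j = lk (single i (1::nat)) j" by simp
      then show False using that by (simp add: lookup_single)
    qed
    then show ?thesis by (auto simp: mvandermonde_def)
  qed
  define b where "b i = of_nat (lk lam i) + of_nat (n - i) * g" for i
  define B where "B = lk (?s * (P * ?\<Delta>)) \<kappa>"
  have ss: "?s * ?s = 1" by (simp add: power_mult_distrib[symmetric])
  have D: "lk (D_det n u g P) \<kappa> = (\<Prod>i\<in>{1..n}. b i + u) * B" for u
  proof -
    have "?s * D_det n u g P = mconst (\<Prod>i=1..n. b i + u) * P * ?\<Delta>"
      using eig[of u] nz by (simp add: D_op_def eq_fract b_def)
    then have "?s * (?s * D_det n u g P) = ?s * (mconst (\<Prod>i=1..n. b i + u) * P * ?\<Delta>)" by simp
    then have "D_det n u g P = mconst (\<Prod>i=1..n. b i + u) * (?s * (P * ?\<Delta>))"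
      by (simp only: mult.assoc[symmetric] ss mult_1) (simp only: mult_ac)
    then show ?thesis by (simp only: lookup_mconst_mult B_def)
  qed
  let ?Z = "{\<sigma>. \<sigma> permutes {1..n}} \<times> N"
  define w where "w = (\<lambda>(\<sigma>, \<nu>). if \<nu> + delta_expo n \<sigma> = \<kappa> then of_int (sign \<sigma>) * lk P \<nu> else 0)"
  define a where "a = (\<lambda>(\<sigma> :: nat \<Rightarrow> nat, \<nu> :: expo) i. of_nat (lk \<nu> i) + of_nat (n - \<sigma> i) * g)"
  have "(\<Sum>z\<in>?Z. w z * ((\<Sum>i\<in>{1..n}. (a z i)\<^sup>2) - (\<Sum>i\<in>{1..n}. (b i)\<^sup>2))) = 0"
  proof (rule power_sums_of_shifted_products)
    show "infinite (UNIV :: 'a set)" by (rule inf)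
    show "(\<Sum>z\<in>?Z. w z * (\<Prod>i\<in>{1..n}. a z i + u)) = (\<Prod>i\<in>{1..n}. b i + u) * B" for u
      unfolding D[symmetric] lookup_D_det[OF N] sum.cartesian_product w_def a_def
      by (rule sum.cong) auto
    fix z assume z: "z \<in> ?Z"
    obtain \<sigma> \<nu> where zz: "z = (\<sigma>, \<nu>)" "\<sigma> permutes {1..n}" "\<nu> \<in> N" using z by auto
    have "(\<Sum>i\<in>{1..n}. n - \<sigma> i) = (\<Sum>i\<in>{1..n}. n - i)"
      using sum.permute[OF zz(2), of "\<lambda>i. n - i"] by (simp add: comp_def)
    then have "(\<Sum>i\<in>{1..n}. of_nat (n - \<sigma> i)) = (\<Sum>i\<in>{1..n}. of_nat (n - i) :: 'a)"
      by (simp only: of_nat_sum[symmetric])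
    moreover have "(\<Sum>i\<in>{1..n}. of_nat (lk \<nu> i)) = (\<Sum>i\<in>{1..n}. of_nat (lk lam i) :: 'a)"
      using deg[OF zz(3)] by (simp only: of_nat_sum[symmetric])
    ultimately show "(\<Sum>i\<in>{1..n}. a z i) = (\<Sum>i\<in>{1..n}. b i)"
      by (simp only: zz(1) a_def b_def prod.case sum.distrib sum_distrib_right[symmetric])
  qed simp
  then show ?thesis
    unfolding hcoeff_def sum.cartesian_product w_def a_def b_def qnorm_def id_apply
    by (simp only: split_beta' fst_conv snd_conv)
qed

lemma sum_squares_lam_bounded:
  assumes "lam_bounded n lam \<mu>"
  shows "(\<Sum>i=1..n. (lk \<mu> i)\<^sup>2) \<le> (\<Sum>i=1..n. (lk lam i)\<^sup>2)"
proof -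
  define M where "M = (\<Sum>i=1..n. lk lam i)"
  have sumM: "(\<Sum>i=1..n. lk \<mu> i) = M" using assms by (simp add: lam_bounded_def M_def)
  have sq: "m\<^sup>2 = m + 2 * (\<Sum>j=1..M. m - j)" if "m \<le> M" for m
  proof -
    have "(\<Sum>j=1..M. m - j) = (\<Sum>j=1..m. m - j)"
      using that by (intro sum.mono_neutral_right) auto
    also have "\<dots> = (\<Sum>j<m. j)"
      by (rule sum.reindex_bij_witness[of _ "\<lambda>j. m - j" "\<lambda>j. m - j"]) auto
    also have "2 * \<dots> = m * (m - 1)" by (induction m) (auto simp: algebra_simps)
    finally show ?thesis by (cases m) (auto simp: power2_eq_square algebra_simps)
  qed
  have lev: "(\<Sum>i=1..n. lk \<mu> i - j) \<le> (\<Sum>i=1..n. lk lam i - j)" for j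
  proof -
    define K where "K = {i\<in>{1..n}. j < lk \<mu> i}"
    have K: "K \<subseteq> {1..n}" "finite K" "card K \<le> n"
    proof -
      show "K \<subseteq> {1..n}" by (auto simp: K_def)
      then show "finite K" "card K \<le> n" using finite_subset[of K "{1..n}"] card_mono[of "{1..n}" K] by auto
    qed
    have "(\<Sum>i=1..n. lk \<mu> i - j) + j * card K = (\<Sum>i\<in>K. lk \<mu> i - j) + (\<Sum>i\<in>K. j)"
    proof -
      have "(\<Sum>i=1..n. lk \<mu> i - j) = (\<Sum>i\<in>K. lk \<mu> i - j)"
        by (rule sum.mono_neutral_right) (auto simp: K_def)
      then show ?thesis by simp
    qed
    also have "\<dots> = (\<Sum>i\<in>K. lk \<mu> i)"
      unfolding sum.distrib[symmetric] by (rule sum.cong) (auto simp: K_def)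
    also have "\<dots> \<le> (\<Sum>i=1..card K. lk lam i)" using assms K by (simp add: lam_bounded_def)
    also have "\<dots> \<le> (\<Sum>i=1..card K. (lk lam i - j) + j)" by (rule sum_mono) simp
    also have "\<dots> = (\<Sum>i=1..card K. lk lam i - j) + j * card K" by (simp add: sum.distrib)
    also have "(\<Sum>i=1..card K. lk lam i - j) \<le> (\<Sum>i=1..n. lk lam i - j)"
      using K by (intro sum_mono2) auto
    finally show ?thesis by simp
  qed
  have tot: "(\<Sum>i=1..n. (h i)\<^sup>2) = M + 2 * (\<Sum>j=1..M. \<Sum>i=1..n. h i - j)" if "(\<Sum>i=1..n. h i) = M" for h :: "nat \<Rightarrow> nat"
  proof -
    have "h i \<le> M" if "i \<in> {1..n}" for i
      using member_le_sum[of i "{1..n}" h] that \<open>(\<Sum>i=1..n. h i) = M\<close> by simp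
    then have "(\<Sum>i=1..n. (h i)\<^sup>2) = (\<Sum>i=1..n. h i + 2 * (\<Sum>j=1..M. h i - j))"
      using sq by (intro sum.cong) auto
    also have "\<dots> = M + 2 * (\<Sum>i=1..n. \<Sum>j=1..M. h i - j)"
      using that by (simp add: sum.distrib sum_distrib_left)
    finally show ?thesis by (subst (asm) sum.swap)
  qed
  show ?thesis
    unfolding tot[OF sumM] tot[OF M_def[symmetric]] by (rule add_left_mono, rule mult_left_mono, rule sum_mono, rule lev, simp)
qed

lemma prefix_sum_lam_bounded:
  assumes "lam_bounded n lam \<mu>" "k \<le> n"
  shows "(\<Sum>i=1..k. lk \<mu> i) \<le> (\<Sum>i=1..k. lk lam i)"
  using assms unfolding lam_bounded_def by (auto dest: spec[of _ "{1..k}"])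

lemma prefix_sums_eq_imp:
  fixes \<mu> lam :: expo
  assumes "keys \<mu> \<subseteq> {1..n}" "keys lam \<subseteq> {1..n}"
    and eq: "\<And>k. k \<le> n \<Longrightarrow> (\<Sum>i=1..k. lk \<mu> i) = (\<Sum>i=1..k. lk lam i)"
  shows "\<mu> = lam"
proof (rule expo_eqI_atMost[OF assms(1,2)])
  fix i assume i: "i \<in> {1..n}"
  then obtain k where k: "i = Suc k" "Suc k \<le> n" by (cases i) auto
  then show "lk \<mu> i = lk lam i" using eq[of k] eq[of "Suc k"] by simp
qed

lemma sum_weight_prefix:
  fixes h :: "nat \<Rightarrow> nat"
  shows "(\<Sum>i=1..n. (n - i) * h i) = (\<Sum>k\<in>{1..<n}. \<Sum>i=1..k. h i)"
proof (induction n)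
  case (Suc n)
  have "(\<Sum>i=1..Suc n. (Suc n - i) * h i) = (\<Sum>i=1..n. (n - i) * h i + h i)"
  proof -
    have "(\<Sum>i=1..Suc n. (Suc n - i) * h i) = (\<Sum>i=1..n. (Suc n - i) * h i)" by simp
    also have "\<dots> = (\<Sum>i=1..n. (n - i) * h i + h i)" by (rule sum.cong) (auto simp: Suc_diff_le)
    finally show ?thesis .
  qed
  also have "\<dots> = (\<Sum>k\<in>{1..<n}. \<Sum>i=1..k. h i) + (\<Sum>i=1..n. h i)" by (simp only: sum.distrib Suc.IH)
  also have "\<dots> = (\<Sum>k\<in>{1..<Suc n}. \<Sum>i=1..k. h i)" by (cases n) auto
  finally show ?case .
qed simp

lemma qnorm_less:
  fixes g :: real
  assumes b: "lam_bounded n lam \<mu>" and lam: "keys lam \<subseteq> {1..n}" and ne: "\<mu> \<noteq> lam" and g: "0 < g"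
  shows "qnorm n g id \<mu> < qnorm n g id lam"
proof -
  have ex: "qnorm n g id \<nu> = real (\<Sum>i=1..n. (lk \<nu> i)\<^sup>2) + 2 * g * real (\<Sum>i=1..n. (n - i) * lk \<nu> i) + (\<Sum>i=1..n. (real (n - i) * g)\<^sup>2)" for \<nu>
    unfolding qnorm_def of_nat_sum sum_distrib_left sum.distrib[symmetric]
    by (rule sum.cong) (auto simp: power2_eq_square algebra_simps)
  have le: "(\<Sum>i=1..k. lk \<mu> i) \<le> (\<Sum>i=1..k. lk lam i)" if "k \<le> n" for k
    by (rule prefix_sum_lam_bounded[OF b that])
  have "\<exists>k\<in>{1..<n}. (\<Sum>i=1..k. lk \<mu> i) < (\<Sum>i=1..k. lk lam i)"
  proof (rule ccontr)
    assume neg: "\<not> ?thesis"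
    have "(\<Sum>i=1..k. lk \<mu> i) = (\<Sum>i=1..k. lk lam i)" if "k \<le> n" for k
    proof (cases "k \<in> {1..<n}")
      case True
      then show ?thesis using neg le[OF that] by force
    next
      case False
      then have "k = 0 \<or> k = n" using that by auto
      then show ?thesis using b by (auto simp: lam_bounded_def)
    qed
    then have "\<mu> = lam" using prefix_sums_eq_imp b lam unfolding lam_bounded_def by blast
    then show False using ne by simp
  qed
  then have "(\<Sum>i=1..n. (n - i) * lk \<mu> i) < (\<Sum>i=1..n. (n - i) * lk lam i)"
    unfolding sum_weight_prefix using le by (intro sum_strict_mono_ex1) auto
  then have "2 * g * real (\<Sum>i=1..n. (n - i) * lk \<mu> i) < 2 * g * real (\<Sum>i=1..n. (n - i) * lk lam i)"
    using g by (intro mult_strict_left_mono) (auto simp del: of_nat_sum of_nat_mult)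
  moreover have "real (\<Sum>i=1..n. (lk \<mu> i)\<^sup>2) \<le> real (\<Sum>i=1..n. (lk lam i)\<^sup>2)"
    using sum_squares_lam_bounded[OF b] by (simp only: of_nat_le_iff)
  ultimately show ?thesis unfolding ex by linarith
qed

lemma delta_expo_less:
  assumes "\<sigma> permutes {1..n}" "\<sigma> \<noteq> id"
  shows "delta_expo n \<sigma> < delta_expo n id"
proof -
  define i where "i = (LEAST i. \<sigma> i \<noteq> i)"
  have "\<exists>i. \<sigma> i \<noteq> i" using assms(2) by (auto simp: fun_eq_iff)
  then have i: "\<sigma> i \<noteq> i" unfolding i_def by (rule LeastI_ex)
  have less: "\<sigma> k = k" if "k < i" for k
    using not_less_Least[OF that[unfolded i_def]] by blast
  have iI: "i \<in> {1..n}" using i assms(1) by (meson permutes_not_in)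
  have "\<not> \<sigma> i < i"
  proof
    assume h: "\<sigma> i < i"
    then have "\<sigma> (\<sigma> i) = \<sigma> i" by (rule less)
    then have "\<sigma> i = i" by (rule injD[OF permutes_inj[OF assms(1)]])
    then show False using i by simp
  qed
  then have gt: "i < \<sigma> i" using i by simp
  have "\<sigma> i \<in> {1..n}" using iI permutes_in_image[OF assms(1)] by blast
  then have "n - \<sigma> i < n - i" using gt by simp
  then have "lk (delta_expo n \<sigma>) i < lk (delta_expo n id) i" using iI by (simp add: lookup_delta_expo)
  moreover have "lk (delta_expo n \<sigma>) k = lk (delta_expo n id) k" if "k < i" for k
    using less[OF that] by (simp add: lookup_delta_expo)
  ultimately have "less_fun (lk (delta_expo n \<sigma>)) (lk (delta_expo n id))"
    unfolding less_fun_def by blast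
  then show ?thesis by (simp add: less_poly_mapping.rep_eq)
qed

theorem hcoeff_unique:
  fixes g :: real and f :: "expo \<Rightarrow> complex"
  assumes N: "finite N" "\<And>\<nu>. \<nu> \<in> N \<Longrightarrow> lam_bounded n lam \<nu>" and lam: "keys lam \<subseteq> {1..n}" and g: "0 < g"
    and h: "\<And>\<kappa>. hcoeff n (complex_of_real g) lam N f \<kappa> = 0" and f0: "f lam = 0" and \<nu>: "\<nu> \<in> N"
  shows "f \<nu> = 0"
proof (rule ccontr)
  assume ne: "f \<nu> \<noteq> 0"
  define S where "S = {\<nu>\<in>N. f \<nu> \<noteq> 0}"
  have S: "finite S" "S \<noteq> {}" using N \<nu> ne by (auto simp: S_def)
  define \<mu> where "\<mu> = Max S"
  have \<mu>: "\<mu> \<in> N" "f \<mu> \<noteq> 0" using Max_in[OF S] by (auto simp: \<mu>_def S_def)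
  have max: "\<nu> \<le> \<mu>" if "\<nu> \<in> N" "f \<nu> \<noteq> 0" for \<nu> using Max_ge[OF S(1)] that by (auto simp: \<mu>_def S_def)
  let ?t = "\<lambda>\<sigma> \<nu>. (if \<nu> + delta_expo n \<sigma> = \<mu> + delta_expo n id then of_int (sign \<sigma>) * f \<nu> else 0) *
     (qnorm n (complex_of_real g) \<sigma> \<nu> - qnorm n (complex_of_real g) id lam)"
  have z: "?t \<sigma> \<nu> = 0" if s: "\<sigma> permutes {1..n}" and \<nu>: "\<nu> \<in> N" and ne: "(\<sigma>, \<nu>) \<noteq> (id, \<mu>)" for \<sigma> \<nu>
  proof (rule ccontr)
    assume c: "?t \<sigma> \<nu> \<noteq> 0"
    then have e: "\<nu> + delta_expo n \<sigma> = \<mu> + delta_expo n id" and f: "f \<nu> \<noteq> 0" by (auto split: if_splits)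
    show False
    proof (cases "\<sigma> = id")
      case True
      then show False using e ne by simp
    next
      case False
      have "\<nu> + delta_expo n \<sigma> < \<mu> + delta_expo n id"
        by (rule add_le_less_mono[OF max[OF \<nu> f] delta_expo_less[OF s False]])
      then show False using e by simp
    qed
  qed
  have "hcoeff n (complex_of_real g) lam N f (\<mu> + delta_expo n id) = (\<Sum>\<sigma>\<in>{id}. \<Sum>\<nu>\<in>N. ?t \<sigma> \<nu>)"
    unfolding hcoeff_def
  proof (rule sum.mono_neutral_right)
    show "finite {\<sigma>. \<sigma> permutes {1..n}}" by (rule finite_permutations) simp
    show "{id} \<subseteq> {\<sigma>. \<sigma> permutes {1..n}}" by (simp add: permutes_id)
    show "\<forall>\<sigma>\<in>{\<sigma>. \<sigma> permutes {1..n}} - {id}. (\<Sum>\<nu>\<in>N. ?t \<sigma> \<nu>) = 0"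
    proof (rule ballI, rule sum.neutral, rule ballI)
      fix \<sigma> \<nu> assume "\<sigma> \<in> {\<sigma>. \<sigma> permutes {1..n}} - {id}" "\<nu> \<in> N"
      then show "?t \<sigma> \<nu> = 0" by (intro z) auto
    qed
  qed
  also have "\<dots> = (\<Sum>\<nu>\<in>{\<mu>}. ?t id \<nu>)"
  proof -
    have "(\<Sum>\<nu>\<in>N. ?t id \<nu>) = (\<Sum>\<nu>\<in>{\<mu>}. ?t id \<nu>)"
    proof (rule sum.mono_neutral_right[OF N(1)])
      show "{\<mu>} \<subseteq> N" using \<mu> by simp
      show "\<forall>\<nu>\<in>N - {\<mu>}. ?t id \<nu> = 0"
      proof
        fix \<nu> assume "\<nu> \<in> N - {\<mu>}"
        then show "?t id \<nu> = 0" by (intro z permutes_id) auto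
      qed
    qed
    then show ?thesis by simp
  qed
  also have "\<dots> = f \<mu> * (qnorm n (complex_of_real g) id \<mu> - qnorm n (complex_of_real g) id lam)"
    by (simp add: sign_id)
  finally have "qnorm n (complex_of_real g) id \<mu> = qnorm n (complex_of_real g) id lam"
    using h \<mu> by simp
  moreover have "qnorm n (complex_of_real g) id \<nu> = complex_of_real (qnorm n g id \<nu>)" for \<nu>
    by (simp add: qnorm_def)
  ultimately have "qnorm n g id \<mu> = qnorm n g id lam" by simp
  moreover have "qnorm n g id \<mu> < qnorm n g id lam"
    by (rule qnorm_less[OF N(2)[OF \<mu>(1)] lam _ g]) (use \<mu> f0 in auto)
  ultimately show False by simp
qed

definition alt :: "nat \<Rightarrow> nat set \<Rightarrow> (nat \<Rightarrow> 'a::comm_ring_1) \<Rightarrow> 'a"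
  where "alt n I y = (\<Sum>\<sigma> | \<sigma> permutes I. of_int (sign \<sigma>) * (\<Prod>k\<in>I. y k ^ (n - \<sigma> k)))"

definition altpoly :: "nat \<Rightarrow> nat set \<Rightarrow> nat \<Rightarrow> (nat \<Rightarrow> 'a::comm_ring_1) \<Rightarrow> 'a poly"
  where "altpoly n I i y = (\<Sum>\<sigma> | \<sigma> permutes I.
    smult (of_int (sign \<sigma>) * (\<Prod>k\<in>I - {i}. y k ^ (n - \<sigma> k))) (monom 1 (n - \<sigma> i)))"

lemma alt_eq_0:
  fixes y :: "nat \<Rightarrow> 'a::field_char_0"
  assumes I: "finite I" "a \<in> I" "b \<in> I" "a \<noteq> b" and eq: "y a = y b"
  shows "alt n I y = 0"
proof -
  let ?t = "Transposition.transpose a b"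
  have t: "?t permutes I" using I by (simp add: permutes_swap_id)
  have yt: "y (?t k) = y k" for k using eq by (auto simp: Transposition.transpose_def)
  have "alt n I y = (\<Sum>\<sigma> | \<sigma> permutes I. of_int (sign (\<sigma> \<circ> ?t)) * (\<Prod>k\<in>I. y k ^ (n - (\<sigma> \<circ> ?t) k)))"
    unfolding alt_def by (rule sum_permutations_compose_right[OF t])
  also have "\<dots> = (\<Sum>\<sigma> | \<sigma> permutes I. - (of_int (sign \<sigma>) * (\<Prod>k\<in>I. y k ^ (n - \<sigma> k))))"
  proof (rule sum.cong[OF refl])
    fix \<sigma> assume "\<sigma> \<in> {\<sigma>. \<sigma> permutes I}"
    then have s: "\<sigma> permutes I" by simp
    have "sign (\<sigma> \<circ> ?t) = - sign \<sigma>"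
    proof -
      have "permutation \<sigma>" "permutation ?t" using s t I(1) permutation_permutes by blast+
      then have "sign (\<sigma> \<circ> ?t) = sign \<sigma> * sign ?t" by (rule sign_compose)
      then show ?thesis using I(4) by (simp add: sign_swap_id)
    qed
    moreover have "(\<Prod>k\<in>I. y k ^ (n - (\<sigma> \<circ> ?t) k)) = (\<Prod>k\<in>I. y k ^ (n - \<sigma> k))"
      using prod.permute[OF t, of "\<lambda>k. y k ^ (n - \<sigma> k)"] by (simp add: comp_def yt)
    ultimately show "of_int (sign (\<sigma> \<circ> ?t)) * (\<Prod>k\<in>I. y k ^ (n - (\<sigma> \<circ> ?t) k)) =
      - (of_int (sign \<sigma>) * (\<Prod>k\<in>I. y k ^ (n - \<sigma> k)))" by simp
  qed
  also have "\<dots> = - alt n I y" by (simp add: alt_def sum_negf)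
  finally have "alt n I y + alt n I y = 0" by (rule eq_neg_iff_add_eq_0[THEN iffD1])
  then have "2 * alt n I y = 0" by (simp only: mult_2)
  then show ?thesis by simp
qed

lemma poly_altpoly:
  assumes "finite I" "i \<in> I"
  shows "poly (altpoly n I i y) T = alt n I (y(i := T))"
proof -
  have "(\<Prod>k\<in>I. (y(i := T)) k ^ (n - \<sigma> k)) = (\<Prod>k\<in>I - {i}. y k ^ (n - \<sigma> k)) * T ^ (n - \<sigma> i)" for \<sigma> :: "nat \<Rightarrow> nat"
  proof -
    have "(\<Prod>k\<in>I - {i}. (y(i := T)) k ^ (n - \<sigma> k)) = (\<Prod>k\<in>I - {i}. y k ^ (n - \<sigma> k))"
      by (rule prod.cong) auto
    then show ?thesis
      unfolding prod.remove[OF assms] by (simp only: fun_upd_same mult.commute)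
  qed
  then show ?thesis by (simp add: altpoly_def alt_def poly_sum poly_monom mult.assoc)
qed

lemma altpoly_factor:
  fixes y :: "nat \<Rightarrow> 'a::field_char_0"
  assumes i: "i \<in> {l..n}" and inj: "inj_on y {l..n}"
  shows "altpoly n {l..n} i y =
    smult (coeff (altpoly n {l..n} i y) (n - l)) (\<Prod>k\<in>{l..n} - {i}. [:- y k, 1:])"
proof -
  let ?I = "{l..n}" let ?K = "{l..n} - {i}" let ?R = "\<Prod>k\<in>?K. [:- y k, 1:]"
  have cK: "card ?K = n - l" using i by auto
  have dR: "degree ?R = n - l"
    using cK by (subst degree_prod_eq_sum_degree) auto
  have lR: "coeff ?R (n - l) = 1"
    using lead_coeff_prod[of "\<lambda>k. [:- y k, 1:]" ?K] by (simp add: dR)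
  show ?thesis
  proof (rule poly_eqI_degree_lead_coeff[where n = "n - l" and A = "y ` ?K"])
    show "coeff (altpoly n ?I i y) (n - l) = coeff (smult (coeff (altpoly n ?I i y) (n - l)) ?R) (n - l)"
      by (simp add: lR)
    have "inj_on y ?K" using inj by (rule inj_on_subset) auto
    then show "n - l \<le> card (y ` ?K)" by (simp add: card_image cK)
    show "degree (smult (coeff (altpoly n ?I i y) (n - l)) ?R) \<le> n - l"
      by (rule order_trans[OF degree_smult_le]) (simp only: dR order_refl)
    show "degree (altpoly n ?I i y) \<le> n - l"
      unfolding altpoly_def
    proof (rule degree_sum_le)
      show "finite {\<sigma>. \<sigma> permutes ?I}" by (rule finite_permutations) simp
      fix \<sigma> assume "\<sigma> \<in> {\<sigma>. \<sigma> permutes ?I}"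
      then have "\<sigma> permutes ?I" by simp
      then have "\<sigma> i \<in> ?I" using i by (simp only: permutes_in_image)
      then have "n - \<sigma> i \<le> n - l" by auto
      then show "degree (smult (of_int (sign \<sigma>) * (\<Prod>k\<in>?K. y k ^ (n - \<sigma> k))) (monom 1 (n - \<sigma> i))) \<le> n - l"
        by (meson degree_monom_le degree_smult_le le_trans)
    qed
    fix T assume "T \<in> y ` ?K"
    then obtain k where k: "k \<in> ?K" "T = y k" by (rule imageE)
    have "alt n ?I (y(i := T)) = 0"
      by (rule alt_eq_0[of _ k i]) (use k i in auto)
    moreover have "poly ?R T = 0" using k by (auto simp: poly_prod)
    ultimately show "poly (altpoly n ?I i y) T = poly (smult (coeff (altpoly n ?I i y) (n - l)) ?R) T"
      using i by (simp add: poly_altpoly)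
  qed
qed

lemma alt_nonzero:
  fixes y :: "nat \<Rightarrow> 'a::field_char_0"
  assumes "l \<le> Suc n" "inj_on y {l..n}"
  shows "alt n {l..n} y \<noteq> 0"
  using assms
proof (induction rule: inc_induct)
  case base
  then show ?case by (simp add: alt_def)
next
  case (step l)
  have l: "l \<in> {l..n}" using step.hyps by simp
  have "alt n {Suc l..n} y \<noteq> 0" by (rule step.IH) (rule inj_on_subset[OF step.prems], auto)
  moreover have "coeff (altpoly n {l..n} l y) (n - l) = alt n {Suc l..n} y"
  proof -
    have sub: "{\<sigma>. \<sigma> permutes {Suc l..n}} \<subseteq> {\<sigma>. \<sigma> permutes {l..n}}"
      using permutes_subset[of _ "{Suc l..n}" "{l..n}"] by auto
    have m: "n - \<sigma> l = n - l \<longleftrightarrow> \<sigma> permutes {Suc l..n}" if "\<sigma> permutes {l..n}" for \<sigma>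
    proof
      assume h: "n - \<sigma> l = n - l"
      have "\<sigma> l \<in> {l..n}" using l by (simp only: permutes_in_image[OF that])
      then have "\<sigma> l = l" using h l by auto
      then show "\<sigma> permutes {Suc l..n}"
        by (intro permutes_superset[OF that]) (auto simp: not_less_eq_eq le_antisym)
    next
      assume "\<sigma> permutes {Suc l..n}"
      then have "\<sigma> l = l" by (rule permutes_not_in) simp
      then show "n - \<sigma> l = n - l" by simp
    qed
    have d: "{l..n} - {l} = {Suc l..n}" by auto
    have "coeff (altpoly n {l..n} l y) (n - l) = (\<Sum>\<sigma> | \<sigma> permutes {l..n}.
        if \<sigma> permutes {Suc l..n} then of_int (sign \<sigma>) * (\<Prod>k\<in>{Suc l..n}. y k ^ (n - \<sigma> k)) else 0)"
      unfolding altpoly_def coeff_sum d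
    proof (rule sum.cong[OF refl])
      fix \<sigma> assume "\<sigma> \<in> {\<sigma>. \<sigma> permutes {l..n}}"
      then have "n - \<sigma> l = n - l \<longleftrightarrow> \<sigma> permutes {Suc l..n}" by (intro m) simp
      then show "coeff (smult (of_int (sign \<sigma>) * (\<Prod>k\<in>{Suc l..n}. y k ^ (n - \<sigma> k))) (monom 1 (n - \<sigma> l))) (n - l) =
        (if \<sigma> permutes {Suc l..n} then of_int (sign \<sigma>) * (\<Prod>k\<in>{Suc l..n}. y k ^ (n - \<sigma> k)) else 0)"
        by (simp only: coeff_smult coeff_monom if_distrib[of "times _"] mult_1_right mult_zero_right)
    qed
    also have "\<dots> = alt n {Suc l..n} y"
      unfolding alt_def
    proof (rule sum.mono_neutral_cong_right[OF _ sub])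
      show "finite {\<sigma>. \<sigma> permutes {l..n}}" by (rule finite_permutations) simp
    qed auto
    finally show ?thesis .
  qed
  moreover have "alt n {l..n} y = coeff (altpoly n {l..n} l y) (n - l) * (\<Prod>k\<in>{l..n} - {l}. y l - y k)"
    using arg_cong[OF altpoly_factor[OF l step.prems], of "\<lambda>p. poly p (y l)"] l
    by (simp add: poly_altpoly poly_prod fun_upd_triv)
  moreover have "y l \<noteq> y k" if "k \<in> {l..n} - {l}" for k
    using that l step.prems by (auto dest: inj_onD)
  ultimately show ?case by simp
qed

lemma pderiv_sum_index: "pderiv (\<Sum>k\<in>A. f k) = (\<Sum>k\<in>A. pderiv (f k))"
  by (induction A rule: infinite_finite_induct) (simp_all add: pderiv_add)

lemma alt_derivative:
  fixes y :: "nat \<Rightarrow> 'a::field_char_0"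
  assumes i: "i \<in> {l..n}" and inj: "inj_on y {l..n}"
  shows "(\<Sum>\<sigma> | \<sigma> permutes {l..n}. of_int (sign \<sigma>) * of_nat (n - \<sigma> i) * (\<Prod>k\<in>{l..n}. y k ^ (n - \<sigma> k))) =
    alt n {l..n} y * (\<Sum>k\<in>{l..n} - {i}. y i / (y i - y k))"
proof -
  let ?K = "{l..n} - {i}" let ?p = "altpoly n {l..n} i y"
  define C where "C = coeff ?p (n - l)"
  have ne: "y i - y k \<noteq> 0" if "k \<in> ?K" for k using that i inj by (auto dest: inj_onD)
  have f: "?p = smult C (\<Prod>k\<in>?K. [:- y k, 1:])" unfolding C_def by (rule altpoly_factor[OF i inj])
  have "alt n {l..n} y = poly ?p (y i)" using i by (simp add: poly_altpoly)
  also have "\<dots> = C * (\<Prod>k\<in>?K. y i - y k)" unfolding f by (simp add: poly_prod)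
  finally have a: "alt n {l..n} y = C * (\<Prod>k\<in>?K. y i - y k)" .
  have "poly (pderiv ?p) (y i) = C * (\<Sum>a\<in>?K. \<Prod>k\<in>?K - {a}. y i - y k)"
    unfolding f pderiv_smult pderiv_prod by (simp add: poly_sum poly_prod pderiv_pCons)
  also have "(\<Sum>a\<in>?K. \<Prod>k\<in>?K - {a}. y i - y k) = (\<Sum>a\<in>?K. (\<Prod>k\<in>?K. y i - y k) / (y i - y a))"
  proof (rule sum.cong[OF refl])
    fix a assume "a \<in> ?K"
    then show "(\<Prod>k\<in>?K - {a}. y i - y k) = (\<Prod>k\<in>?K. y i - y k) / (y i - y a)"
      using ne[of a] prod.remove[of ?K a "\<lambda>k. y i - y k"] by simp
  qed
  finally have "y i * poly (pderiv ?p) (y i) = alt n {l..n} y * (\<Sum>k\<in>?K. y i / (y i - y k))"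
    unfolding a by (simp add: sum_distrib_left mult_ac)
  moreover have "y i * poly (pderiv ?p) (y i) =
    (\<Sum>\<sigma> | \<sigma> permutes {l..n}. of_int (sign \<sigma>) * of_nat (n - \<sigma> i) * (\<Prod>k\<in>{l..n}. y k ^ (n - \<sigma> k)))"
  proof -
    have m: "y i * (of_nat m * y i ^ (m - 1)) = of_nat m * y i ^ m" for m
      by (cases m) (simp_all add: mult_ac)
    have "y i * poly (pderiv ?p) (y i) = (\<Sum>\<sigma> | \<sigma> permutes {l..n}.
        of_int (sign \<sigma>) * (\<Prod>k\<in>?K. y k ^ (n - \<sigma> k)) * (y i * (of_nat (n - \<sigma> i) * y i ^ (n - \<sigma> i - 1))))"
      unfolding altpoly_def pderiv_sum_index poly_sum sum_distrib_left
      by (rule sum.cong) (simp_all add: pderiv_smult pderiv_monom poly_monom mult_ac)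
    also have "\<dots> = (\<Sum>\<sigma> | \<sigma> permutes {l..n}. of_int (sign \<sigma>) * of_nat (n - \<sigma> i) * (\<Prod>k\<in>{l..n}. y k ^ (n - \<sigma> k)))"
      unfolding m unfolding prod.remove[OF finite_atLeastAtMost i] by (intro sum.cong refl) (simp only: mult_ac)
    finally show ?thesis .
  qed
  ultimately show ?thesis by simp
qed

lemma mon_delta_expo: "mon y (delta_expo n \<sigma>) = (\<Prod>k\<in>{1..n}. y k ^ (n - \<sigma> k))"
proof -
  have "keys (delta_expo n \<sigma>) \<subseteq> {1..n}" by (auto simp: in_keys_iff lookup_delta_expo split: if_splits)
  then have "mon y (delta_expo n \<sigma>) = (\<Prod>k\<in>{1..n}. y k ^ lk (delta_expo n \<sigma>) k)"
    by (intro mon_superset) auto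
  then show ?thesis by (simp add: lookup_delta_expo)
qed

lemma meval_theta: 
  assumes "finite N" "keys f \<subseteq> N"
  shows "meval y (theta i f) = (\<Sum>\<nu>\<in>N. of_nat (lk \<nu> i) * (lk f \<nu> * mon y \<nu>))"
    and "meval y (theta i (theta i f)) = (\<Sum>\<nu>\<in>N. (of_nat (lk \<nu> i))\<^sup>2 * (lk f \<nu> * mon y \<nu>))"
proof -
  have k: "keys (theta i f) \<subseteq> N" "keys (theta i (theta i f)) \<subseteq> N"
    using keys_theta assms(2) by (metis subset_trans)+
  show "meval y (theta i f) = (\<Sum>\<nu>\<in>N. of_nat (lk \<nu> i) * (lk f \<nu> * mon y \<nu>))"
    unfolding meval_superset[OF assms(1) k(1)] lookup_theta by (simp add: mult.assoc)
  show "meval y (theta i (theta i f)) = (\<Sum>\<nu>\<in>N. (of_nat (lk \<nu> i))\<^sup>2 * (lk f \<nu> * mon y \<nu>))"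
    unfolding meval_superset[OF assms(1) k(2)] lookup_theta by (simp add: mult.assoc power2_eq_square)
qed

definition eps :: "nat \<Rightarrow> complex \<Rightarrow> expo \<Rightarrow> complex"
  where "eps n g lam = (\<Sum>i\<in>{1..n}. (of_nat (lk lam i))\<^sup>2) + 2 * g * (\<Sum>i\<in>{1..n}. of_nat (lk lam i) * of_nat (n - i))"

lemma qnorm_diff:
  assumes s: "\<sigma> permutes {1..n}"
  shows "qnorm n g \<sigma> \<nu> - qnorm n g id lam =
    (\<Sum>i\<in>{1..n}. (of_nat (lk \<nu> i))\<^sup>2) + 2 * g * (\<Sum>i\<in>{1..n}. of_nat (lk \<nu> i) * of_nat (n - \<sigma> i)) - eps n g lam"
proof -
  have q: "qnorm n g \<tau> \<mu> = (\<Sum>i\<in>{1..n}. (of_nat (lk \<mu> i))\<^sup>2) + 2 * g * (\<Sum>i\<in>{1..n}. of_nat (lk \<mu> i) * of_nat (n - \<tau> i)) +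
      (\<Sum>i\<in>{1..n}. (of_nat (n - \<tau> i) * g)\<^sup>2)" for \<tau> \<mu>
    unfolding qnorm_def sum_distrib_left sum.distrib[symmetric]
    by (rule sum.cong) (simp_all add: power2_eq_square algebra_simps del: of_nat_diff)
  have "(\<Sum>i\<in>{1..n}. (of_nat (n - \<sigma> i) * g)\<^sup>2) = (\<Sum>i\<in>{1..n}. (of_nat (n - i) * g)\<^sup>2)"
    using sum.permute[OF s, of "\<lambda>i. (of_nat (n - i) * g)\<^sup>2"] by (simp only: comp_def)
  then show ?thesis unfolding q eps_def id_apply by simp
qed

lemma hcoeff_poly:
  fixes f :: "complex mpoly" and g :: complex
  assumes N: "finite N" "keys f \<subseteq> N"
  obtains T where "\<And>\<kappa>. lk T \<kappa> = hcoeff n g lam N (lk f) \<kappa>"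
    and "\<And>y. inj_on y {1..n} \<Longrightarrow> meval y T = alt n {1..n} y * (HX n g y f - eps n g lam * meval y f)"
    and "(\<And>\<nu>. \<nu> \<in> N \<Longrightarrow> keys \<nu> \<subseteq> {1..n}) \<Longrightarrow> vars_in n T"
proof
  let ?q = "\<lambda>\<sigma> \<nu>. qnorm n g \<sigma> \<nu> - qnorm n g id lam"
  let ?S = "{\<sigma>. \<sigma> permutes {1..n}}"
  let ?T = "\<Sum>\<sigma>\<in>?S. \<Sum>\<nu>\<in>N. single (\<nu> + delta_expo n \<sigma>) (of_int (sign \<sigma>) * lk f \<nu> * ?q \<sigma> \<nu>)"
  show "lk ?T \<kappa> = hcoeff n g lam N (lk f) \<kappa>" for \<kappa>
    unfolding hcoeff_def lookup_sum lookup_single when_def by (intro sum.cong refl) simp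
  show "vars_in n ?T" if "\<And>\<nu>. \<nu> \<in> N \<Longrightarrow> keys \<nu> \<subseteq> {1..n}"
  proof (intro vars_in_sum vars_in_single)
    fix \<sigma> \<nu> assume "\<nu> \<in> N"
    moreover have "keys (delta_expo n \<sigma>) \<subseteq> {1..n}" by (auto simp: in_keys_iff lookup_delta_expo split: if_splits)
    ultimately show "keys (\<nu> + delta_expo n \<sigma>) \<subseteq> {1..n}" using that keys_add[of \<nu> "delta_expo n \<sigma>"] by blast
  qed
  fix y :: "nat \<Rightarrow> complex" assume inj: "inj_on y {1..n}"
  have al: "t * (b + 2 * g * s - e) = t * (b - e) + 2 * g * (t * s)" for t b s e :: complex
    by (simp add: algebra_simps)
  define A where "A = alt n {1..n} y"
  define V where "V i = (\<Sum>k\<in>{1..n} - {i}. y i / (y i - y k))" for i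
  define d where "d \<sigma> = of_int (sign \<sigma>) * (\<Prod>k\<in>{1..n}. y k ^ (n - \<sigma> k))" for \<sigma> :: "nat \<Rightarrow> nat"
  have A: "(\<Sum>\<sigma>\<in>?S. d \<sigma>) = A" by (simp add: A_def alt_def d_def)
  have U: "(\<Sum>\<sigma>\<in>?S. of_nat (n - \<sigma> i) * d \<sigma>) = A * V i" if "i \<in> {1..n}" for i
    unfolding A_def V_def alt_derivative[OF that inj, symmetric] d_def by (intro sum.cong refl) (simp add: mult_ac del: of_nat_diff)
  define a where "a \<nu> = (\<Sum>i\<in>{1..n}. (of_nat (lk \<nu> i))\<^sup>2 :: complex)" for \<nu> :: expo
  define m where "m \<nu> = lk f \<nu> * mon y \<nu>" for \<nu>
  have "meval y ?T = (\<Sum>\<sigma>\<in>?S. \<Sum>\<nu>\<in>N. m \<nu> * (d \<sigma> * ?q \<sigma> \<nu>))"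
    unfolding meval_sum meval_single mon_add mon_delta_expo d_def m_def by (intro sum.cong refl) (simp add: mult_ac)
  also have "\<dots> = (\<Sum>\<nu>\<in>N. m \<nu> * (\<Sum>\<sigma>\<in>?S. d \<sigma> * ?q \<sigma> \<nu>))"
    unfolding sum_distrib_left by (rule sum.swap)
  also have "\<dots> = (\<Sum>\<nu>\<in>N. m \<nu> * (A * (a \<nu> - eps n g lam + 2 * g * (\<Sum>i\<in>{1..n}. of_nat (lk \<nu> i) * V i))))"
  proof (intro sum.cong refl arg_cong2[where f = times])
    fix \<nu>
    have "(\<Sum>\<sigma>\<in>?S. d \<sigma> * ?q \<sigma> \<nu>) = (\<Sum>\<sigma>\<in>?S. d \<sigma> * (a \<nu> - eps n g lam) +
        2 * g * (\<Sum>i\<in>{1..n}. of_nat (lk \<nu> i) * (of_nat (n - \<sigma> i) * d \<sigma>)))"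
    proof (rule sum.cong[OF refl])
      fix \<sigma> assume "\<sigma> \<in> ?S"
      then have s: "\<sigma> permutes {1..n}" by simp
      have "(\<Sum>i\<in>{1..n}. of_nat (lk \<nu> i) * (of_nat (n - \<sigma> i) * d \<sigma>)) =
          d \<sigma> * (\<Sum>i\<in>{1..n}. of_nat (lk \<nu> i) * of_nat (n - \<sigma> i))"
        by (simp add: sum_distrib_left mult_ac del: of_nat_diff)
      then show "d \<sigma> * ?q \<sigma> \<nu> = d \<sigma> * (a \<nu> - eps n g lam) + 2 * g * (\<Sum>i\<in>{1..n}. of_nat (lk \<nu> i) * (of_nat (n - \<sigma> i) * d \<sigma>))"
        unfolding qnorm_diff[OF s] a_def by (simp only: al)
    qed
    also have "\<dots> = A * (a \<nu> - eps n g lam) + 2 * g * (\<Sum>\<sigma>\<in>?S. \<Sum>i\<in>{1..n}. of_nat (lk \<nu> i) * (of_nat (n - \<sigma> i) * d \<sigma>))"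
      by (simp only: sum.distrib sum_distrib_right[symmetric] sum_distrib_left[symmetric] A)
    also have "(\<Sum>\<sigma>\<in>?S. \<Sum>i\<in>{1..n}. of_nat (lk \<nu> i) * (of_nat (n - \<sigma> i) * d \<sigma>)) =
        (\<Sum>i\<in>{1..n}. of_nat (lk \<nu> i) * (\<Sum>\<sigma>\<in>?S. of_nat (n - \<sigma> i) * d \<sigma>))"
      unfolding sum_distrib_left by (rule sum.swap)
    also have "\<dots> = (\<Sum>i\<in>{1..n}. of_nat (lk \<nu> i) * (A * V i))"
      by (intro sum.cong refl arg_cong2[where f = times] U)
    also have "\<dots> = A * (\<Sum>i\<in>{1..n}. of_nat (lk \<nu> i) * V i)" by (simp add: sum_distrib_left mult_ac)
    finally show "(\<Sum>\<sigma>\<in>?S. d \<sigma> * ?q \<sigma> \<nu>) = A * (a \<nu> - eps n g lam + 2 * g * (\<Sum>i\<in>{1..n}. of_nat (lk \<nu> i) * V i))"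
      by (simp only: distrib_left mult_ac)
  qed
  also have "\<dots> = A * ((\<Sum>\<nu>\<in>N. a \<nu> * m \<nu>) + 2 * g * (\<Sum>\<nu>\<in>N. \<Sum>i\<in>{1..n}. V i * (of_nat (lk \<nu> i) * m \<nu>)) - eps n g lam * (\<Sum>\<nu>\<in>N. m \<nu>))"
    by (simp add: sum_distrib_left sum_distrib_right sum.distrib sum_subtractf distrib_left right_diff_distrib mult_ac)
  also have "(\<Sum>\<nu>\<in>N. m \<nu>) = meval y f" by (simp add: meval_superset[OF N] m_def)
  also have "(\<Sum>\<nu>\<in>N. a \<nu> * m \<nu>) = (\<Sum>i\<in>{1..n}. meval y (theta i (theta i f)))"
    unfolding meval_theta[OF N] a_def m_def sum_distrib_right by (rule sum.swap)
  also have "(\<Sum>\<nu>\<in>N. \<Sum>i\<in>{1..n}. V i * (of_nat (lk \<nu> i) * m \<nu>)) =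
      (\<Sum>i\<in>{1..n}. \<Sum>j\<in>{1..n} - {i}. y i / (y i - y j) * meval y (theta i f))"
    unfolding meval_theta[OF N] sum_distrib_right[symmetric] V_def[symmetric] m_def
    unfolding sum_distrib_left by (rule sum.swap)
  finally show "meval y ?T = alt n {1..n} y * (HX n g y f - eps n g lam * meval y f)"
    unfolding HX_def A_def .
qed

lemma base_digits_inj:
  fixes a b :: "nat \<Rightarrow> nat"
  assumes "(\<Sum>i<n. a i * B ^ i) = (\<Sum>i<n. b i * B ^ i)" "\<And>i. i < n \<Longrightarrow> a i < B" "\<And>i. i < n \<Longrightarrow> b i < B" "i < n"
  shows "a i = b i"
  using assms
proof (induction n arbitrary: a b i)
  case (Suc n)
  have ex: "(\<Sum>i<Suc n. c i * B ^ i) = c 0 + B * (\<Sum>i<n. c (Suc i) * B ^ i)" for c :: "nat \<Rightarrow> nat"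
    by (simp add: sum.lessThan_Suc_shift sum_distrib_left mult_ac del: sum.lessThan_Suc)
  have eq: "a 0 + B * (\<Sum>i<n. a (Suc i) * B ^ i) = b 0 + B * (\<Sum>i<n. b (Suc i) * B ^ i)"
    using Suc.prems(1) unfolding ex .
  have lt: "a 0 < B" "b 0 < B" using Suc.prems by auto
  have 0: "a 0 = b 0"
    using arg_cong[OF eq, of "\<lambda>x. x mod B"] lt by simp
  have "(\<Sum>i<n. a (Suc i) * B ^ i) = (\<Sum>i<n. b (Suc i) * B ^ i)"
    using eq 0 lt by simp
  then have "a (Suc j) = b (Suc j)" if "j < n" for j
    using Suc.IH[of "\<lambda>i. a (Suc i)" "\<lambda>i. b (Suc i)" j] Suc.prems that by auto
  then show ?case using 0 Suc.prems(4) by (cases i) auto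
qed simp

theorem chamber_dense:
  fixes p :: "complex mpoly"
  assumes v: "vars_in n p" and z: "\<And>y. y \<in> chamber n \<Longrightarrow> meval (\<lambda>i. complex_of_real (y i)) p = 0"
  shows "p = 0"
proof -
  define B where "B = Suc (Suc (\<Sum>\<nu>\<in>keys p. \<Sum>i\<in>{1..n}. lk \<nu> i))"
  have lt: "lk \<nu> i < B" if "\<nu> \<in> keys p" "i \<in> {1..n}" for \<nu> i
  proof -
    have "lk \<nu> i \<le> (\<Sum>i\<in>{1..n}. lk \<nu> i)" using that by (intro member_le_sum) auto
    also have "\<dots> \<le> (\<Sum>\<nu>\<in>keys p. \<Sum>i\<in>{1..n}. lk \<nu> i)" using that by (intro member_le_sum[of _ "keys p" "\<lambda>\<nu>. \<Sum>i\<in>{1..n}. lk \<nu> i"]) auto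
    finally show ?thesis by (simp add: B_def)
  qed
  define e where "e \<nu> = (\<Sum>i<n. lk \<nu> (Suc i) * B ^ i)" for \<nu> :: expo
  have e': "e \<nu> = (\<Sum>i\<in>{1..n}. lk \<nu> i * B ^ (i - 1))" for \<nu>
    unfolding e_def by (rule sum.reindex_bij_witness[of _ "\<lambda>i. i - 1" Suc]) auto
  have inj: "\<mu> = \<nu>" if "\<mu> \<in> keys p" "\<nu> \<in> keys p" "e \<mu> = e \<nu>" for \<mu> \<nu>
  proof (rule expo_eqI_atMost)
    show "keys \<mu> \<subseteq> {1..n}" "keys \<nu> \<subseteq> {1..n}" using that v by (auto simp: vars_in_def)
    fix i assume i: "i \<in> {1..n}"
    have "lk \<mu> (Suc (i - 1)) = lk \<nu> (Suc (i - 1))"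
      by (rule base_digits_inj[where B = B and n = n and a = "\<lambda>i. lk \<mu> (Suc i)" and b = "\<lambda>i. lk \<nu> (Suc i)"])
        (use that i lt in \<open>auto simp: e_def\<close>)
    then show "lk \<mu> i = lk \<nu> i" using i by simp
  qed
  define Q where "Q = (\<Sum>\<nu>\<in>keys p. monom (lk p \<nu>) (e \<nu>))"
  have "poly Q (complex_of_real T) = 0" if T: "1 < T" for T
  proof -
    define y where "y i = T ^ (B ^ (i - 1))" for i :: nat
    have "y \<in> chamber n"
      unfolding chamber_def
    proof (intro CollectI conjI ballI strict_mono_onI)
      show "0 < y i" for i using T by (simp add: y_def)
      fix r s :: nat assume "r \<in> {1..n}" "s \<in> {1..n}" "r < s"
      moreover have "1 < B" by (simp add: B_def)
      ultimately have "B ^ (r - 1) < B ^ (s - 1)" by (intro power_strict_increasing) auto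
      then show "y r < y s" unfolding y_def by (rule power_strict_increasing[OF _ T])
    qed
    then have "0 = meval (\<lambda>i. complex_of_real (y i)) p" using z by simp
    also have "\<dots> = (\<Sum>\<nu>\<in>keys p. lk p \<nu> * mon (\<lambda>i. complex_of_real (y i)) \<nu>)"
      by (rule meval_superset) auto
    also have "\<dots> = poly Q (complex_of_real T)"
      unfolding Q_def poly_sum poly_monom
    proof (intro sum.cong refl arg_cong2[where f = times])
      fix \<nu> assume "\<nu> \<in> keys p"
      then have "keys \<nu> \<subseteq> {1..n}" using v by (auto simp: vars_in_def)
      then have "mon (\<lambda>i. complex_of_real (y i)) \<nu> = (\<Prod>i\<in>{1..n}. complex_of_real (y i) ^ lk \<nu> i)"
        by (intro mon_superset) auto
      also have "\<dots> = (\<Prod>i\<in>{1..n}. complex_of_real T ^ (lk \<nu> i * B ^ (i - 1)))"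
        by (intro prod.cong refl) (simp add: y_def power_mult[symmetric] mult.commute)
      finally show "mon (\<lambda>i. complex_of_real (y i)) \<nu> = complex_of_real T ^ e \<nu>"
        unfolding e' power_sum .
    qed
    finally show ?thesis by simp
  qed
  then have sub: "complex_of_real ` {1<..} \<subseteq> {x. poly Q x = 0}" by auto
  have "infinite (complex_of_real ` {1<..})"
    by (subst finite_image_iff) (auto intro!: inj_onI infinite_Ioi)
  then have Q: "Q = 0" using poly_roots_finite finite_subset[OF sub] by blast
  have "lk p \<mu> = 0" if "\<mu> \<in> keys p" for \<mu>
  proof -
    have "coeff Q (e \<mu>) = (\<Sum>\<nu>\<in>keys p. if \<nu> = \<mu> then lk p \<nu> else 0)"
      unfolding Q_def coeff_sum using inj that by (intro sum.cong refl) auto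
    then show ?thesis using that Q by simp
  qed
  then show "p = 0" using in_keys_iff by (metis keys_eq_empty equals0I)
qed

section \<open>Dominance and symmetric polynomials\<close>

lemma lam_boundedD:
  assumes "lam_bounded n lam \<nu>"
  shows "keys \<nu> \<subseteq> {1..n}" "(\<Sum>i=1..n. lk \<nu> i) = (\<Sum>i=1..n. lk lam i)"
    "K \<subseteq> {1..n} \<Longrightarrow> (\<Sum>i\<in>K. lk \<nu> i) \<le> (\<Sum>i=1..card K. lk lam i)"
  using assms by (auto simp: lam_bounded_def)

lemma lam_bounded_add:
  assumes "lam_bounded n \<alpha> \<mu>" "lam_bounded n \<beta> \<nu>"
  shows "lam_bounded n (\<alpha> + \<beta>) (\<mu> + \<nu>)"
  unfolding lam_bounded_def lookup_add sum.distrib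
proof (intro conjI allI impI)
  show "keys (\<mu> + \<nu>) \<subseteq> {1..n}" using keys_add[of \<mu> \<nu>] assms[THEN lam_boundedD(1)] by blast
  show "(\<Sum>i=1..n. lk \<mu> i) + (\<Sum>i=1..n. lk \<nu> i) = (\<Sum>i=1..n. lk \<alpha> i) + (\<Sum>i=1..n. lk \<beta> i)"
    by (simp only: assms[THEN lam_boundedD(2)])
  show "(\<Sum>i\<in>K. lk \<mu> i) + (\<Sum>i\<in>K. lk \<nu> i) \<le> (\<Sum>i=1..card K. lk \<alpha> i) + (\<Sum>i=1..card K. lk \<beta> i)" if "K \<subseteq> {1..n}" for K
    by (intro add_mono assms[THEN lam_boundedD(3)] that)
qed

lemma card_le_atMost: "K \<subseteq> {1..n} \<Longrightarrow> card K \<le> n"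
  using card_mono[of "{1..n}" K] by simp

lemma lam_bounded_trans:
  assumes "lam_bounded n lam \<mu>" "lam_bounded n \<mu> \<nu>"
  shows "lam_bounded n lam \<nu>"
  unfolding lam_bounded_def
proof (intro conjI allI impI)
  show "keys \<nu> \<subseteq> {1..n}" by (rule lam_boundedD(1)[OF assms(2)])
  show "(\<Sum>i=1..n. lk \<nu> i) = (\<Sum>i=1..n. lk lam i)"
    by (simp only: assms[THEN lam_boundedD(2)])
  fix K assume K: "K \<subseteq> {1..n}"
  show "(\<Sum>i\<in>K. lk \<nu> i) \<le> (\<Sum>i=1..card K. lk lam i)"
    using lam_boundedD(3)[OF assms(2) K] prefix_sum_lam_bounded[OF assms(1) card_le_atMost[OF K]] by (rule order_trans)
qed

lemma lam_bounded_antisym: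
  assumes "lam_bounded n \<mu> \<nu>" "lam_bounded n \<nu> \<mu>"
  shows "\<mu> = \<nu>"
proof (rule prefix_sums_eq_imp)
  show "keys \<mu> \<subseteq> {1..n}" "keys \<nu> \<subseteq> {1..n}" using assms lam_boundedD(1) by auto
  show "(\<Sum>i=1..k. lk \<mu> i) = (\<Sum>i=1..k. lk \<nu> i)" if "k \<le> n" for k
    using prefix_sum_lam_bounded[OF assms(1) that] prefix_sum_lam_bounded[OF assms(2) that] by simp
qed

lemma is_partitionD:
  assumes "is_partition n \<mu>" "i \<in> {1..n}" "j \<in> {1..n}" "i \<le> j"
  shows "lk \<mu> j \<le> lk \<mu> i"
  using assms unfolding is_partition_def by (intro monotone_onD[of "{1..n}" "(\<le>)" "(\<ge>)" "lk \<mu>"]) auto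

lemma sum_antimono_le:
  assumes p: "is_partition n \<mu>" and K: "K \<subseteq> {1..n}"
  shows "(\<Sum>i\<in>K. lk \<mu> i) \<le> (\<Sum>i=1..card K. lk \<mu> i)"
  using K
proof (induction "card K" arbitrary: K)
  case 0
  then have "K = {}" using finite_subset[OF 0(2)] by simp
  then show ?case by simp
next
  case (Suc m)
  have fin: "finite K" and ne: "K \<noteq> {}" using Suc.hyps(2) by (auto intro: card_ge_0_finite)
  define M where "M = Max K"
  have M: "M \<in> K" unfolding M_def by (rule Max_in[OF fin ne])
  have cK: "card (K - {M}) = m" using Suc.hyps(2) M fin by simp
  have "K \<subseteq> {1..M}" using Suc.prems Max_ge[OF fin] by (auto simp: M_def)
  then have "Suc m \<le> M" using card_le_atMost Suc.hyps(2) by metis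
  moreover have "M \<in> {1..n}" using M Suc.prems by blast
  ultimately have "lk \<mu> M \<le> lk \<mu> (Suc m)"
    by (intro is_partitionD[OF p]) auto
  moreover have "(\<Sum>i\<in>K - {M}. lk \<mu> i) \<le> (\<Sum>i=1..m. lk \<mu> i)"
    using Suc.hyps(1)[of "K - {M}"] cK Suc.prems by blast
  moreover have "(\<Sum>i\<in>K. lk \<mu> i) = lk \<mu> M + (\<Sum>i\<in>K - {M}. lk \<mu> i)" by (rule sum.remove[OF fin M])
  ultimately show ?case unfolding Suc.hyps(2)[symmetric] by simp
qed

lemma dominated_lam_bounded:
  assumes p: "is_partition n \<mu>" and d: "dominated n \<mu> lam"
  shows "lam_bounded n lam \<mu>"
  unfolding lam_bounded_def
proof (intro conjI allI impI)
  show "keys \<mu> \<subseteq> {1..n}" using p by (simp add: is_partition_def)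
  show s: "(\<Sum>i=1..n. lk \<mu> i) = (\<Sum>i=1..n. lk lam i)" using d by (simp add: dominated_def)
  fix K assume K: "K \<subseteq> {1..n}"
  have "card K = 0 \<or> card K = n \<or> card K \<in> {1..<n}" using card_le_atMost[OF K] by auto
  then have "(\<Sum>i=1..card K. lk \<mu> i) \<le> (\<Sum>i=1..card K. lk lam i)"
    using d s unfolding dominated_def by auto
  then show "(\<Sum>i\<in>K. lk \<mu> i) \<le> (\<Sum>i=1..card K. lk lam i)"
    using sum_antimono_le[OF p K] by (rule order_trans[rotated])
qed

lemma dominated_refl: "dominated n \<mu> \<mu>" by (simp add: dominated_def)

lemma lookup_map_key: "inj \<sigma> \<Longrightarrow> lk (Poly_Mapping.map_key \<sigma> p) i = lk p (\<sigma> i)"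
  by (simp add: map_key.rep_eq)

lemma lam_bounded_map_key:
  assumes p: "is_partition n \<mu>" and s: "\<sigma> permutes {1..n}"
  shows "lam_bounded n \<mu> (Poly_Mapping.map_key \<sigma> \<mu>)"
proof -
  have inj: "inj \<sigma>" by (rule permutes_inj[OF s])
  have l: "lk (Poly_Mapping.map_key \<sigma> \<mu>) i = lk \<mu> (\<sigma> i)" for i by (rule lookup_map_key[OF inj])
  have img: "(\<Sum>i\<in>K. lk \<mu> (\<sigma> i)) = (\<Sum>i\<in>\<sigma> ` K. lk \<mu> i)" for K
    by (subst sum.reindex) (auto intro: inj_on_subset[OF inj])
  show ?thesis unfolding lam_bounded_def l img
  proof (intro conjI allI impI)
    show "keys (Poly_Mapping.map_key \<sigma> \<mu>) \<subseteq> {1..n}"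
    proof
      fix i assume "i \<in> keys (Poly_Mapping.map_key \<sigma> \<mu>)"
      then have "\<sigma> i \<in> keys \<mu>" by (simp add: in_keys_iff l)
      then have "\<sigma> i \<in> {1..n}" using p by (auto simp: is_partition_def)
      then show "i \<in> {1..n}" by (simp only: permutes_in_image[OF s])
    qed
    show "(\<Sum>i\<in>\<sigma> ` {1..n}. lk \<mu> i) = (\<Sum>i=1..n. lk \<mu> i)" by (simp only: permutes_image[OF s])
    fix K assume K: "K \<subseteq> {1..n}"
    then have "\<sigma> ` K \<subseteq> {1..n}" using permutes_image[OF s] by blast
    moreover have "card (\<sigma> ` K) = card K" by (rule card_image) (rule inj_on_subset[OF inj], simp)
    ultimately show "(\<Sum>i\<in>\<sigma> ` K. lk \<mu> i) \<le> (\<Sum>i=1..card K. lk \<mu> i)"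
      using sum_antimono_le[OF p, of "\<sigma> ` K"] by simp
  qed
qed

lemma finite_lam_bounded: "finite {\<nu>. lam_bounded n lam \<nu>}"
proof -
  define M where "M = (\<Sum>j=1..n. lk lam j)"
  let ?F = "{f :: nat \<Rightarrow> nat. \<forall>i. (i \<in> {1..n} \<longrightarrow> f i \<in> {0..M}) \<and> (i \<notin> {1..n} \<longrightarrow> f i = 0)}"
  have "lk ` {\<nu>. lam_bounded n lam \<nu>} \<subseteq> ?F"
  proof (rule image_subsetI)
    fix \<mu> assume "\<mu> \<in> {\<nu>. lam_bounded n lam \<nu>}"
    then have b: "lam_bounded n lam \<mu>" by simp
    have "lk \<mu> i \<le> M" if "i \<in> {1..n}" for i
      using member_le_sum[of i "{1..n}" "lk \<mu>"] that lam_boundedD(2)[OF b] by (simp add: M_def)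
    moreover have "lk \<mu> i = 0" if "i \<notin> {1..n}" for i
      using that lam_boundedD(1)[OF b] by (meson in_keys_iff subsetD)
    ultimately show "lk \<mu> \<in> ?F" by auto
  qed
  moreover have "finite ?F" by (rule finite_set_of_finite_funs) auto
  ultimately have "finite (lk ` {\<nu>. lam_bounded n lam \<nu>})" by (rule finite_subset)
  then show ?thesis by (rule finite_imageD) (simp add: inj_on_def)
qed

lemma lam_bounded_le:
  assumes b: "lam_bounded n \<alpha> \<beta>" and \<alpha>: "keys \<alpha> \<subseteq> {1..n}"
  shows "\<beta> \<le> \<alpha>"
proof (cases "\<beta> = \<alpha>")
  case False
  define i where "i = (LEAST i. lk \<beta> i \<noteq> lk \<alpha> i)"
  have "\<exists>i. lk \<beta> i \<noteq> lk \<alpha> i" using False by (metis poly_mapping_eqI)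
  then have i: "lk \<beta> i \<noteq> lk \<alpha> i" unfolding i_def by (rule LeastI_ex)
  have eq: "lk \<beta> k = lk \<alpha> k" if "k < i" for k
    using not_less_Least[OF that[unfolded i_def]] by blast
  have iI: "i \<in> {1..n}" using i \<alpha> lam_boundedD(1)[OF b] by (metis in_keys_iff subsetD)
  have "(\<Sum>k=1..i. lk \<beta> k) \<le> (\<Sum>k=1..i. lk \<alpha> k)" using iI by (intro prefix_sum_lam_bounded[OF b]) simp
  moreover have "(\<Sum>k=1..i. h k) = (\<Sum>k=1..<i. h k) + h i" for h :: "nat \<Rightarrow> nat"
    using iI by (cases i) (auto simp: atLeastLessThanSuc_atLeastAtMost)
  moreover have "(\<Sum>k=1..<i. lk \<beta> k) = (\<Sum>k=1..<i. lk \<alpha> k)" by (rule sum.cong) (auto simp: eq)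
  ultimately have "lk \<beta> i < lk \<alpha> i" using i by simp
  then have "less_fun (lk \<beta>) (lk \<alpha>)" unfolding less_fun_def using eq by blast
  then show ?thesis by (simp add: less_poly_mapping.rep_eq less_imp_le)
qed simp

definition ldom :: "nat \<Rightarrow> expo \<Rightarrow> 'a::zero mpoly \<Rightarrow> bool"
  where "ldom n \<alpha> p \<longleftrightarrow> (\<forall>\<nu>\<in>keys p. lam_bounded n \<alpha> \<nu>)"

lemma ldom_mult:
  assumes "ldom n \<alpha> p" "ldom n \<beta> q"
  shows "ldom n (\<alpha> + \<beta>) (p * q)"
  unfolding ldom_def
proof
  fix \<kappa> assume "\<kappa> \<in> keys (p * q)"
  then obtain \<mu> \<nu> where "\<kappa> = \<mu> + \<nu>" "\<mu> \<in> keys p" "\<nu> \<in> keys q" using keys_mult[of p q] by blast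
  then show "lam_bounded n (\<alpha> + \<beta>) \<kappa>" using assms by (auto simp: ldom_def intro: lam_bounded_add)
qed

lemma lam_bounded_add_eq:
  assumes "lam_bounded n \<alpha> \<mu>" "lam_bounded n \<beta> \<nu>" "\<mu> + \<nu> = \<alpha> + \<beta>" "keys \<alpha> \<subseteq> {1..n}"
  shows "\<mu> = \<alpha>"
proof (rule prefix_sums_eq_imp[OF lam_boundedD(1)[OF assms(1)] assms(4)])
  fix k assume k: "k \<le> n"
  have "(\<Sum>i=1..k. lk (\<mu> + \<nu>) i) = (\<Sum>i=1..k. lk (\<alpha> + \<beta>) i)" by (simp only: assms(3))
  then show "(\<Sum>i=1..k. lk \<mu> i) = (\<Sum>i=1..k. lk \<alpha> i)"
    using prefix_sum_lam_bounded[OF assms(1) k] prefix_sum_lam_bounded[OF assms(2) k]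
    by (simp add: lookup_add sum.distrib)
qed

lemma lookup_mult_leading:
  fixes p q :: "'a::comm_ring_1 mpoly"
  assumes "ldom n \<alpha> p" "ldom n \<beta> q" "keys \<alpha> \<subseteq> {1..n}"
  shows "lk (p * q) (\<alpha> + \<beta>) = lk p \<alpha> * lk q \<beta>"
proof -
  have "lk (p * q) (\<alpha> + \<beta>) = (\<Sum>\<mu>\<in>keys p. \<Sum>\<nu>\<in>keys q. if \<mu> + \<nu> = \<alpha> + \<beta> then lk p \<mu> * lk q \<nu> else 0)"
    by (rule lookup_mult_sum) auto
  also have "\<dots> = (\<Sum>\<mu>\<in>keys p. \<Sum>\<nu>\<in>keys q. if \<nu> = \<beta> then (if \<mu> = \<alpha> then lk p \<alpha> * lk q \<beta> else 0) else 0)"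
  proof (intro sum.cong refl)
    fix \<mu> \<nu> assume "\<mu> \<in> keys p" "\<nu> \<in> keys q"
    then have b: "lam_bounded n \<alpha> \<mu>" "lam_bounded n \<beta> \<nu>" using assms by (auto simp: ldom_def)
    have "\<mu> = \<alpha>" if "\<mu> + \<nu> = \<alpha> + \<beta>"
      by (rule lam_bounded_add_eq[OF b that assms(3)])
    then have "\<mu> + \<nu> = \<alpha> + \<beta> \<longleftrightarrow> \<mu> = \<alpha> \<and> \<nu> = \<beta>" by (metis add_left_cancel)
    then show "(if \<mu> + \<nu> = \<alpha> + \<beta> then lk p \<mu> * lk q \<nu> else 0) = (if \<nu> = \<beta> then (if \<mu> = \<alpha> then lk p \<alpha> * lk q \<beta> else 0) else 0)"
      by simp
  qed
  also have "\<dots> = lk p \<alpha> * lk q \<beta>" by (cases "lk q \<beta> = 0") (simp_all add: in_keys_iff)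
  finally show ?thesis .
qed

lemma sum_lookup_chi: "finite S \<Longrightarrow> finite K \<Longrightarrow> (\<Sum>i\<in>K. lk (chi S) i) = card (K \<inter> S)"
  by (simp add: lookup_chi Int_def)

lemma lookup_ES_nonzero:
  assumes "lk (ES n r f) \<nu> \<noteq> 0"
  obtains S where "S \<subseteq> {1..n}" "card S = r" "\<nu> = chi S"
proof -
  have "\<exists>S\<in>{S. S \<subseteq> {1..n} \<and> card S = r}. lk (single (chi S) (f S)) \<nu> \<noteq> 0"
    using assms unfolding ES_def lookup_sum by (meson sum.neutral)
  then show ?thesis using that by (auto simp: lookup_single when_def split: if_splits)
qed

lemma ldom_ES: assumes "r \<le> n" shows "ldom n (chi {1..r}) (ES n r f)"
  unfolding ldom_def
proof
  fix \<nu> assume "\<nu> \<in> keys (ES n r f)"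
  then obtain S where S: "S \<subseteq> {1..n}" "card S = r" "\<nu> = chi S" using lookup_ES_nonzero by (metis in_keys_iff)
  have fin: "finite S" using S(1) by (rule finite_subset) simp
  show "lam_bounded n (chi {1..r}) \<nu>"
    unfolding lam_bounded_def
  proof (intro conjI allI impI)
    show "keys \<nu> \<subseteq> {1..n}" using S fin by (simp add: keys_chi)
    have "card ({1..n} \<inter> S) = card ({1..n} \<inter> {1..r})"
      using S assms by (simp add: Int_absorb1)
    then show "(\<Sum>i=1..n. lk \<nu> i) = (\<Sum>i=1..n. lk (chi {1..r}) i)"
      unfolding S(3) by (simp only: sum_lookup_chi[OF fin finite_atLeastAtMost] sum_lookup_chi[OF finite_atLeastAtMost finite_atLeastAtMost])
    fix K assume K: "K \<subseteq> {1..n}"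
    then have fK: "finite K" by (rule finite_subset) simp
    have "card (K \<inter> S) \<le> card K" "card (K \<inter> S) \<le> r"
      using S(2) fin fK by (auto intro: card_mono)
    moreover have "{1..card K} \<inter> {1..r} = {1..min (card K) r}" by auto
    ultimately have "card (K \<inter> S) \<le> card ({1..card K} \<inter> {1..r})" by simp
    then show "(\<Sum>i\<in>K. lk \<nu> i) \<le> (\<Sum>i=1..card K. lk (chi {1..r}) i)"
      unfolding S(3) by (simp only: sum_lookup_chi[OF fin fK] sum_lookup_chi[OF finite_atLeastAtMost finite_atLeastAtMost])
  qed
qed

lemma lookup_ES_leading: assumes "r \<le> n" shows "lk (ES n r f) (chi {1..r}) = f {1..r}"
proof -
  have "lk (ES n r f) (chi {1..r}) = (\<Sum>S\<in>{S. S \<subseteq> {1..n} \<and> card S = r}. if S = {1..r} then f S else 0)"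
    unfolding ES_def lookup_sum lookup_single when_def
  proof (rule sum.cong[OF refl])
    fix S assume "S \<in> {S. S \<subseteq> {1..n} \<and> card S = r}"
    then have "finite S" by (auto intro: finite_subset)
    then have "chi S = chi {1..r} \<longleftrightarrow> S = {1..r}" by (metis keys_chi finite_atLeastAtMost)
    then show "(if chi S = chi {1..r} then f S else 0) = (if S = {1..r} then f S else 0)" by simp
  qed
  also have "\<dots> = f {1..r}" using assms by (subst sum.delta) auto
  finally show ?thesis .
qed

definition expo_of :: "nat list \<Rightarrow> expo"
  where "expo_of rs = sum_list (map (\<lambda>r. chi {1..r}) rs)"

lemma prod_ES_leading:
  fixes f :: "nat set \<Rightarrow> 'a::comm_ring_1"
  assumes "set rs \<subseteq> {..n}"
  shows "ldom n (expo_of rs) (prod_list (map (\<lambda>r. ES n r f) rs))"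
    and "lk (prod_list (map (\<lambda>r. ES n r f) rs)) (expo_of rs) = prod_list (map (\<lambda>r. f {1..r}) rs)"
proof -
  have "ldom n (expo_of rs) (prod_list (map (\<lambda>r. ES n r f) rs)) \<and>
    lk (prod_list (map (\<lambda>r. ES n r f) rs)) (expo_of rs) = prod_list (map (\<lambda>r. f {1..r}) rs)"
    using assms
  proof (induction rs)
    case Nil
    then show ?case by (simp add: expo_of_def ldom_def lam_bounded_def lookup_one)
  next
    case (Cons r rs)
    have r: "r \<le> n" using Cons.prems by simp
    have k: "keys (chi {1..r}) \<subseteq> {1..n}" using r by (simp add: keys_chi)
    have IH: "ldom n (expo_of rs) (prod_list (map (\<lambda>r. ES n r f) rs))"
      "lk (prod_list (map (\<lambda>r. ES n r f) rs)) (expo_of rs) = prod_list (map (\<lambda>r. f {1..r}) rs)"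
      using Cons by auto
    have e: "expo_of (r # rs) = chi {1..r} + expo_of rs" by (simp add: expo_of_def)
    show ?case unfolding e list.map prod_list.Cons lookup_mult_leading[OF ldom_ES[OF r] IH(1) k] lookup_ES_leading[OF r] IH(2)
      using ldom_mult[OF ldom_ES[OF r] IH(1)] by blast
  qed
  then show "ldom n (expo_of rs) (prod_list (map (\<lambda>r. ES n r f) rs))"
    "lk (prod_list (map (\<lambda>r. ES n r f) rs)) (expo_of rs) = prod_list (map (\<lambda>r. f {1..r}) rs)" by auto
qed

lemma partition_expo_of:
  assumes "is_partition n \<mu>"
  shows "\<exists>rs. set rs \<subseteq> {..n} \<and> expo_of rs = \<mu>"
  using assms
proof (induction "\<Sum>i=1..n. lk \<mu> i" arbitrary: \<mu> rule: less_induct)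
  case less
  show ?case
  proof (cases "\<mu> = 0")
    case True
    then show ?thesis by (intro exI[of _ "[]"]) (simp add: expo_of_def)
  next
    case False
    have kn: "keys \<mu> \<subseteq> {1..n}" using less.prems by (simp add: is_partition_def)
    note anti = is_partitionD[OF less.prems]
    define r where "r = Max (keys \<mu>)"
    have "keys \<mu> \<noteq> {}" using False by (simp add: keys_eq_empty)
    then have rk: "r \<in> keys \<mu>" unfolding r_def by (intro Max_in) auto
    then have r: "r \<in> {1..n}" using kn by blast
    have pos: "0 < lk \<mu> i" if "i \<in> {1..r}" for i
      using anti[of i r] that r rk by (auto simp: in_keys_iff)
    have zero: "lk \<mu> i = 0" if "r < i" for i
      using that Max_ge[of "keys \<mu>" i] unfolding r_def by (metis finite_keys in_keys_iff not_less)
    define \<mu>' where "\<mu>' = \<mu> - chi {1..r}"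
    have l': "lk \<mu>' i = lk \<mu> i - of_bool (i \<in> {1..r})" for i
      by (simp add: \<mu>'_def lookup_minus lookup_chi)
    have eq: "chi {1..r} + \<mu>' = \<mu>"
    proof (rule poly_mapping_eqI)
      fix i show "lk (chi {1..r} + \<mu>') i = lk \<mu> i"
        using pos[of i] by (cases "i \<in> {1..r}") (auto simp: lookup_add l' lookup_chi)
    qed
    have "is_partition n \<mu>'"
      unfolding is_partition_def
    proof (intro conjI monotone_onI)
      show "keys \<mu>' \<subseteq> {1..n}"
      proof
        fix i assume "i \<in> keys \<mu>'"
        then have "lk \<mu> i \<noteq> 0" unfolding in_keys_iff l' by (metis diff_0_eq_0)
        then have "i \<in> keys \<mu>" by (simp add: in_keys_iff)
        then show "i \<in> {1..n}" by (rule subsetD[OF kn])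
      qed
      fix i j assume ij: "i \<in> {1..n}" "j \<in> {1..n}" "i \<le> j"
      show "lk \<mu>' j \<le> lk \<mu>' i"
      proof (cases "j \<le> r")
        case True
        then show ?thesis using anti[OF ij] ij unfolding l' by simp
      next
        case False
        then show ?thesis using zero[of j] unfolding l' by simp
      qed
    qed
    moreover have "(\<Sum>i=1..n. lk \<mu>' i) < (\<Sum>i=1..n. lk \<mu> i)"
    proof (rule sum_strict_mono_ex1)
      show "\<forall>i\<in>{1..n}. lk \<mu>' i \<le> lk \<mu> i" by (simp add: l')
      show "\<exists>i\<in>{1..n}. lk \<mu>' i < lk \<mu> i" using pos[of r] r by (intro bexI[of _ r]) (auto simp: l')
    qed simp
    ultimately obtain rs where rs: "set rs \<subseteq> {..n}" "expo_of rs = \<mu>'" using less.hyps by blast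
    then show ?thesis using r eq by (intro exI[of _ "r # rs"]) (auto simp: expo_of_def)
  qed
qed

definition act :: "(nat \<Rightarrow> nat) \<Rightarrow> 'a::comm_ring_1 mpoly \<Rightarrow> 'a mpoly"
  where "act \<sigma> p = Poly_Mapping.map_key (Poly_Mapping.map_key \<sigma>) p"

lemma map_key_inv:
  assumes "bij \<sigma>"
  shows "Poly_Mapping.map_key \<sigma> (Poly_Mapping.map_key (inv \<sigma>) \<nu>) = \<nu>"
    "Poly_Mapping.map_key (inv \<sigma>) (Poly_Mapping.map_key \<sigma> \<nu>) = \<nu>"
proof -
  have i: "inj \<sigma>" "inj (inv \<sigma>)" using assms bij_imp_bij_inv bij_is_inj by blast+
  show "Poly_Mapping.map_key \<sigma> (Poly_Mapping.map_key (inv \<sigma>) \<nu>) = \<nu>"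
    by (rule poly_mapping_eqI) (simp add: lookup_map_key i)
  show "Poly_Mapping.map_key (inv \<sigma>) (Poly_Mapping.map_key \<sigma> \<nu>) = \<nu>"
    by (rule poly_mapping_eqI) (simp add: lookup_map_key i surj_f_inv_f[OF bij_is_surj[OF assms]])
qed

lemma inj_map_key: "bij \<sigma> \<Longrightarrow> inj (Poly_Mapping.map_key \<sigma> :: expo \<Rightarrow> expo)"
  using map_key_inv(2) by (metis injI)

lemma lookup_act: "bij \<sigma> \<Longrightarrow> lk (act \<sigma> p) \<nu> = lk p (Poly_Mapping.map_key \<sigma> \<nu>)"
  unfolding act_def by (rule lookup_map_key[OF inj_map_key])

lemma act_single: assumes "bij \<sigma>" shows "act \<sigma> (single \<nu> c) = single (Poly_Mapping.map_key (inv \<sigma>) \<nu>) c"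
proof -
  have "act \<sigma> (single (Poly_Mapping.map_key \<sigma> \<kappa>) c) = single \<kappa> c" for \<kappa>
    unfolding act_def by (rule map_key_single[OF inj_map_key[OF assms]])
  then show ?thesis by (metis map_key_inv(1)[OF assms])
qed

lemma act_add: "bij \<sigma> \<Longrightarrow> act \<sigma> (p + q) = act \<sigma> p + act \<sigma> q"
  unfolding act_def by (rule map_key_plus[OF inj_map_key])

lemma act_0: "bij \<sigma> \<Longrightarrow> act \<sigma> 0 = 0"
  unfolding act_def by (rule map_key_zero[OF inj_map_key])

lemma act_sum: "bij \<sigma> \<Longrightarrow> act \<sigma> (\<Sum>k\<in>A. f k) = (\<Sum>k\<in>A. act \<sigma> (f k))"
  by (induction A rule: infinite_finite_induct) (simp_all add: act_add act_0)

lemma act_mult: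
  assumes b: "bij \<sigma>"
  shows "act \<sigma> (p * q) = act \<sigma> p * act \<sigma> q"
proof (induction p rule: mpoly_additive_induct)
  case (single \<mu> c)
  show ?case
  proof (induction q rule: mpoly_additive_induct)
    case (single \<nu> d)
    have "inj (inv \<sigma>)" using b bij_imp_bij_inv bij_is_inj by blast
    then show ?case by (simp add: act_single[OF b] mult_single map_key_plus)
  qed (simp only: distrib_left act_add[OF b])
qed (simp only: distrib_right act_add[OF b])

lemma symmetric_mpoly_act:
  "symmetric_mpoly n p \<longleftrightarrow> vars_in n p \<and> (\<forall>\<sigma>. \<sigma> permutes {1..n} \<longrightarrow> act \<sigma> p = p)"
proof -
  have "(\<forall>\<nu>. lk p (Poly_Mapping.map_key \<sigma> \<nu>) = lk p \<nu>) \<longleftrightarrow> act \<sigma> p = p" if "\<sigma> permutes {1..n}" for \<sigma>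
    using lookup_act[OF permutes_bij[OF that], of p] by (metis poly_mapping_eqI)
  then show ?thesis unfolding symmetric_mpoly_def vars_in_def by blast
qed

lemma symmetric_mpoly_mult:
  "symmetric_mpoly n p \<Longrightarrow> symmetric_mpoly n q \<Longrightarrow> symmetric_mpoly n (p * q :: 'a::comm_ring_1 mpoly)"
  unfolding symmetric_mpoly_act
proof (intro conjI allI impI)
  assume h: "vars_in n p \<and> (\<forall>\<sigma>. \<sigma> permutes {1..n} \<longrightarrow> act \<sigma> p = p)" "vars_in n q \<and> (\<forall>\<sigma>. \<sigma> permutes {1..n} \<longrightarrow> act \<sigma> q = q)"
  show "vars_in n (p * q)" using h vars_in_mult by blast
  show "act \<sigma> (p * q) = p * q" if "\<sigma> permutes {1..n}" for \<sigma>
    unfolding act_mult[OF permutes_bij[OF that]] using h that by metis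
qed

lemma symmetric_mpoly_1: "symmetric_mpoly n (1 :: 'a::comm_ring_1 mpoly)"
proof -
  have "act \<sigma> 1 = (1 :: 'a mpoly)" if "\<sigma> permutes {1..n}" for \<sigma>
  proof -
    have "inj (inv \<sigma>)" using that permutes_inj permutes_inv by blast
    then have "act \<sigma> (single 0 1) = (single 0 1 :: 'a mpoly)"
      unfolding act_single[OF permutes_bij[OF that]] by simp
    then show ?thesis by simp
  qed
  then show ?thesis unfolding symmetric_mpoly_act using vars_in_1 by blast
qed

lemma symmetric_mpoly_mconst_mult: "symmetric_mpoly n p \<Longrightarrow> symmetric_mpoly n (mconst c * p)"
  unfolding symmetric_mpoly_def lookup_mconst_mult by (metis keys_mconst_mult subsetD)

lemma symmetric_mpoly_diff: "symmetric_mpoly n p \<Longrightarrow> symmetric_mpoly n q \<Longrightarrow> symmetric_mpoly n (p - q :: 'a::comm_ring_1 mpoly)"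
  using vars_in_diff[of n p q] unfolding symmetric_mpoly_def vars_in_def by (auto simp: lookup_minus)

lemma symmetric_mpoly_ES: "symmetric_mpoly n (ES n r (\<lambda>_. c))"
  unfolding symmetric_mpoly_act
proof (intro conjI allI impI)
  show "vars_in n (ES n r (\<lambda>_. c))"
    unfolding ES_def by (intro vars_in_sum vars_in_single) (metis (mono_tags, lifting) mem_Collect_eq keys_chi finite_subsets_atMost)
  fix \<sigma> :: "nat \<Rightarrow> nat" assume s: "\<sigma> permutes {1..n}"
  have b: "bij \<sigma>" by (rule permutes_bij[OF s])
  have inj: "inj \<sigma>" "inj (inv \<sigma>)" using b bij_imp_bij_inv bij_is_inj by blast+
  have f: "finite S" if "S \<subseteq> {1..n}" for S using that by (rule finite_subset) simp
  have chi: "Poly_Mapping.map_key (inv \<sigma>) (chi S) = chi (\<sigma> ` S)" if "finite S" for S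
  proof (rule poly_mapping_eqI)
    fix i
    have "inv \<sigma> i \<in> S \<longleftrightarrow> i \<in> \<sigma> ` S"
      using b by (metis bij_inv_eq_iff image_iff)
    then show "lk (Poly_Mapping.map_key (inv \<sigma>) (chi S)) i = lk (chi (\<sigma> ` S)) i"
      using that by (simp add: lookup_map_key inj lookup_chi)
  qed
  let ?C = "{S. S \<subseteq> {1..n} \<and> card S = r}"
  have "act \<sigma> (ES n r (\<lambda>_. c)) = (\<Sum>S\<in>?C. single (chi (\<sigma> ` S)) c)"
    unfolding ES_def act_sum[OF b] act_single[OF b] by (intro sum.cong refl) (simp add: chi f)
  also have "\<dots> = (\<Sum>S\<in>?C. single (chi S) c)"
  proof (rule sum.reindex_bij_witness[of _ "\<lambda>S. inv \<sigma> ` S" "\<lambda>S. \<sigma> ` S"])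
    fix S assume S: "S \<in> ?C"
    show "inv \<sigma> ` \<sigma> ` S = S" using inj(1) by (simp add: image_image)
    show "\<sigma> ` inv \<sigma> ` S = S" using b by (simp add: image_image surj_f_inv_f bij_is_surj)
    show "\<sigma> ` S \<in> ?C" using S permutes_image[OF s] card_image[OF inj_on_subset[OF inj(1) subset_UNIV], of S] by blast
    show "inv \<sigma> ` S \<in> ?C"
      using S permutes_image[OF permutes_inv[OF s]] card_image[OF inj_on_subset[OF inj(2) subset_UNIV], of S] by blast
  qed simp
  finally show "act \<sigma> (ES n r (\<lambda>_. c)) = ES n r (\<lambda>_. c)" unfolding ES_def .
qed

lemma symmetric_mpoly_prod_list:
  "(\<And>r. r \<in> set rs \<Longrightarrow> symmetric_mpoly n (f r)) \<Longrightarrow> symmetric_mpoly n (prod_list (map f rs) :: 'a::comm_ring_1 mpoly)"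
  by (induction rs) (auto intro: symmetric_mpoly_mult symmetric_mpoly_1)

lemma symmetric_Max_partition:
  assumes s: "symmetric_mpoly n f" and ne: "f \<noteq> 0"
  shows "is_partition n (Max (keys f))"
proof -
  let ?\<mu> = "Max (keys f)"
  have \<mu>: "?\<mu> \<in> keys f" using ne by (intro Max_in) (auto simp: keys_eq_empty)
  show ?thesis unfolding is_partition_def
  proof (intro conjI monotone_onI)
    show "keys ?\<mu> \<subseteq> {1..n}" using s \<mu> unfolding symmetric_mpoly_def by blast
    fix i j assume ij: "i \<in> {1..n}" "j \<in> {1..n}" "i \<le> j"
    show "lk ?\<mu> j \<le> lk ?\<mu> i"
    proof (rule ccontr)
      assume c: "\<not> ?thesis"
      then have lt: "i < j" using ij by (cases "i = j") auto
      let ?t = "Transposition.transpose i j"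
      let ?\<nu> = "Poly_Mapping.map_key ?t ?\<mu>"
      have t: "?t permutes {1..n}" using ij by (simp add: permutes_swap_id)
      have l: "lk ?\<nu> k = lk ?\<mu> (?t k)" for k by (rule lookup_map_key[OF permutes_inj[OF t]])
      have "lk f ?\<nu> = lk f ?\<mu>" using s t unfolding symmetric_mpoly_def by blast
      then have "?\<nu> \<in> keys f" using \<mu> by (simp add: in_keys_iff)
      then have le: "?\<nu> \<le> ?\<mu>" by simp
      have "less_fun (lk ?\<mu>) (lk ?\<nu>)"
        unfolding less_fun_def l
      proof (intro exI[of _ i] conjI allI impI)
        show "lk ?\<mu> i < lk ?\<mu> (?t i)" using c by simp
        show "lk ?\<mu> k = lk ?\<mu> (?t k)" if "k < i" for k
          using that lt by (simp add: transpose_apply_other)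
      qed
      then have "?\<mu> < ?\<nu>" by (simp add: less_poly_mapping.rep_eq)
      then show False using le by simp
    qed
  qed
qed

theorem symmetric_span:
  fixes f :: "complex mpoly"
  assumes rs: "\<And>\<mu>. is_partition n \<mu> \<Longrightarrow> set (rs \<mu>) \<subseteq> {..n} \<and> expo_of (rs \<mu>) = \<mu>"
    and f: "symmetric_mpoly n f" "ldom n lam f"
  shows "\<exists>c. f = (\<Sum>\<mu> | is_partition n \<mu> \<and> lam_bounded n lam \<mu>. mconst (c \<mu>) * prod_list (map (esym n) (rs \<mu>)))"
  using f
proof (induction "card {\<nu>. lam_bounded n lam \<nu> \<and> (\<exists>\<kappa>\<in>keys f. \<nu> \<le> \<kappa>)}" arbitrary: f rule: less_induct)
  case less
  let ?A = "{\<mu>. is_partition n \<mu> \<and> lam_bounded n lam \<mu>}"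
  let ?e = "\<lambda>\<mu>. prod_list (map (esym n) (rs \<mu>))"
  have finA: "finite ?A" by (rule finite_subset[OF _ finite_lam_bounded[of n lam]]) auto
  show ?case
  proof (cases "f = 0")
    case True
    then show ?thesis by (intro exI[of _ "\<lambda>_. 0"]) simp
  next
    case False
    define \<mu> where "\<mu> = Max (keys f)"
    have \<mu>k: "\<mu> \<in> keys f" unfolding \<mu>_def using False by (intro Max_in) (auto simp: keys_eq_empty)
    have p: "is_partition n \<mu>" unfolding \<mu>_def by (rule symmetric_Max_partition[OF less.prems(1) False])
    have b: "lam_bounded n lam \<mu>" using less.prems(2) \<mu>k by (simp add: ldom_def)
    have R: "set (rs \<mu>) \<subseteq> {..n}" "expo_of (rs \<mu>) = \<mu>" using rs[OF p] by auto
    have dom: "ldom n \<mu> (?e \<mu>)" using prod_ES_leading(1)[OF R(1), of "\<lambda>_. 1"] unfolding R(2) .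
    have lead: "lk (?e \<mu>) \<mu> = 1"
      using prod_ES_leading(2)[OF R(1), of "\<lambda>_. 1 :: complex"] unfolding R(2) by (simp add: prod_list_replicate map_replicate_const)
    define f' where "f' = f - mconst (lk f \<mu>) * ?e \<mu>"
    have sym': "symmetric_mpoly n f'"
      unfolding f'_def by (intro symmetric_mpoly_diff less.prems symmetric_mpoly_mconst_mult symmetric_mpoly_prod_list symmetric_mpoly_ES)
    have keys': "lam_bounded n lam \<kappa> \<and> \<kappa> < \<mu>" if "\<kappa> \<in> keys f'" for \<kappa>
    proof -
      have k: "\<kappa> \<in> keys f \<or> \<kappa> \<in> keys (?e \<mu>)"
      proof (rule ccontr)
        assume "\<not> ?thesis"
        then have "lk f' \<kappa> = 0" unfolding f'_def lookup_minus lookup_mconst_mult by (simp add: in_keys_iff)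
        then show False using that by (simp add: in_keys_iff)
      qed
      have "\<kappa> \<noteq> \<mu>"
      proof
        assume "\<kappa> = \<mu>"
        then have "lk f' \<kappa> = 0" unfolding f'_def lookup_minus lookup_mconst_mult by (simp add: lead)
        then show False using that by (simp add: in_keys_iff)
      qed
      moreover have "lam_bounded n lam \<kappa> \<and> \<kappa> \<le> \<mu>"
        using k
      proof
        assume "\<kappa> \<in> keys f"
        then show ?thesis using less.prems(2) by (simp add: ldom_def \<mu>_def)
      next
        assume "\<kappa> \<in> keys (?e \<mu>)"
        then have bk: "lam_bounded n \<mu> \<kappa>" using dom by (simp add: ldom_def)
        show ?thesis
          using lam_bounded_trans[OF b bk] lam_bounded_le[OF bk lam_boundedD(1)[OF b]] by simp
      qed
      ultimately show ?thesis using order_le_imp_less_or_eq by blast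
    qed
    have "card {\<nu>. lam_bounded n lam \<nu> \<and> (\<exists>\<kappa>\<in>keys f'. \<nu> \<le> \<kappa>)} < card {\<nu>. lam_bounded n lam \<nu> \<and> (\<exists>\<kappa>\<in>keys f. \<nu> \<le> \<kappa>)}"
    proof (rule psubset_card_mono)
      show "finite {\<nu>. lam_bounded n lam \<nu> \<and> (\<exists>\<kappa>\<in>keys f. \<nu> \<le> \<kappa>)}"
        by (rule finite_subset[OF _ finite_lam_bounded[of n lam]]) auto
      have "\<mu> \<in> {\<nu>. lam_bounded n lam \<nu> \<and> (\<exists>\<kappa>\<in>keys f. \<nu> \<le> \<kappa>)}" using b \<mu>k by blast
      moreover have "\<mu> \<notin> {\<nu>. lam_bounded n lam \<nu> \<and> (\<exists>\<kappa>\<in>keys f'. \<nu> \<le> \<kappa>)}" using keys' leD by blast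
      moreover have "{\<nu>. lam_bounded n lam \<nu> \<and> (\<exists>\<kappa>\<in>keys f'. \<nu> \<le> \<kappa>)} \<subseteq> {\<nu>. lam_bounded n lam \<nu> \<and> (\<exists>\<kappa>\<in>keys f. \<nu> \<le> \<kappa>)}"
      proof (intro subsetI CollectI conjI)
        fix \<nu> assume "\<nu> \<in> {\<nu>. lam_bounded n lam \<nu> \<and> (\<exists>\<kappa>\<in>keys f'. \<nu> \<le> \<kappa>)}"
        then obtain \<kappa> where \<kappa>: "lam_bounded n lam \<nu>" "\<kappa> \<in> keys f'" "\<nu> \<le> \<kappa>" by blast
        then have "\<nu> \<le> \<mu>" using keys'[OF \<kappa>(2)] by (meson less_imp_le order_trans)
        then show "\<exists>\<kappa>\<in>keys f. \<nu> \<le> \<kappa>" using \<mu>k by blast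
        show "lam_bounded n lam \<nu>" by (rule \<kappa>(1))
      qed
      ultimately show "{\<nu>. lam_bounded n lam \<nu> \<and> (\<exists>\<kappa>\<in>keys f'. \<nu> \<le> \<kappa>)} \<subset> {\<nu>. lam_bounded n lam \<nu> \<and> (\<exists>\<kappa>\<in>keys f. \<nu> \<le> \<kappa>)}" by blast
    qed
    moreover have "ldom n lam f'" using keys' by (simp add: ldom_def)
    ultimately obtain c where c: "f' = (\<Sum>\<mu>\<in>?A. mconst (c \<mu>) * ?e \<mu>)" using less.hyps sym' by blast
    have "(\<Sum>\<nu>\<in>?A. mconst (c \<nu> + (if \<nu> = \<mu> then lk f \<mu> else 0)) * ?e \<nu>) =
        (\<Sum>\<nu>\<in>?A. mconst (c \<nu>) * ?e \<nu>) + (\<Sum>\<nu>\<in>?A. if \<nu> = \<mu> then mconst (lk f \<mu>) * ?e \<mu> else 0)"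
      unfolding sum.distrib[symmetric] by (intro sum.cong refl) (simp add: mconst_add distrib_right)
    also have "\<dots> = f' + mconst (lk f \<mu>) * ?e \<mu>"
      unfolding c using p b finA by (simp add: sum.delta)
    also have "\<dots> = f" by (simp add: f'_def)
    finally show ?thesis by (intro exI[of _ "\<lambda>\<nu>. c \<nu> + (if \<nu> = \<mu> then lk f \<mu> else 0)"]) simp
  qed
qed

section \<open>Specialisation of rational functions\<close>

definition rvalue :: "complex \<Rightarrow> ratfun \<Rightarrow> complex \<Rightarrow> bool"
  where "rvalue c r v \<longleftrightarrow> ratfun_regular c r \<and> ratfun_at c r = v"

lemma rvalue_Fract: "poly q c \<noteq> 0 \<Longrightarrow> rvalue c (Fract p q) (poly p c / poly q c)"
  unfolding rvalue_def using ratfun_Fract by blast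

lemma rvalueE:
  assumes "rvalue c r v"
  obtains p q where "r = Fract p q" "poly q c \<noteq> 0" "v = poly p c / poly q c"
proof
  let ?p = "fst (quot_of_fract r)" and ?q = "snd (quot_of_fract r)"
  show "r = Fract ?p ?q" using quot_to_fract_quot_of_fract[of r] by (simp add: quot_to_fract_def case_prod_unfold)
  show "poly ?q c \<noteq> 0" "v = poly ?p c / poly ?q c"
    using assms by (simp_all add: rvalue_def ratfun_regular_def ratfun_at_def)
qed

lemma rvalue_unique: "rvalue c r v \<Longrightarrow> rvalue c r w \<Longrightarrow> v = w"
  by (simp add: rvalue_def)

lemma rvalue_add: assumes "rvalue c r v" "rvalue c s w" shows "rvalue c (r + s) (v + w)"
proof -
  obtain p q p' q' where e: "r = Fract p q" "poly q c \<noteq> 0" "v = poly p c / poly q c"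
    "s = Fract p' q'" "poly q' c \<noteq> 0" "w = poly p' c / poly q' c"
    using assms by (metis rvalueE)
  then have "q \<noteq> 0" "q' \<noteq> 0" by auto
  then have "r + s = Fract (p * q' + p' * q) (q * q')" using e by (simp add: add_fract)
  moreover have "v + w = poly (p * q' + p' * q) c / poly (q * q') c" using e by (simp add: add_frac_eq)
  ultimately show ?thesis using rvalue_Fract[of "q * q'" c "p * q' + p' * q"] e by simp
qed

lemma rvalue_mult: assumes "rvalue c r v" "rvalue c s w" shows "rvalue c (r * s) (v * w)"
proof -
  obtain p q p' q' where e: "r = Fract p q" "poly q c \<noteq> 0" "v = poly p c / poly q c"
    "s = Fract p' q'" "poly q' c \<noteq> 0" "w = poly p' c / poly q' c"
    using assms by (metis rvalueE)
  then have "r * s = Fract (p * p') (q * q')" by simp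
  moreover have "v * w = poly (p * p') c / poly (q * q') c" using e by simp
  ultimately show ?thesis using rvalue_Fract[of "q * q'" c "p * p'"] e by simp
qed

lemma rvalue_of_poly: "rvalue c (Fract p 1) (poly p c)"
  using rvalue_Fract[of 1 c p] by simp

lemma rvalue_of_nat: "rvalue c (of_nat k) (of_nat k)"
  using rvalue_of_poly[of c "of_nat k"] by (simp add: of_nat_fract)

lemma rvalue_0: "rvalue c 0 0" using rvalue_of_nat[of c 0] by simp

lemma rvalue_1: "rvalue c 1 1" using rvalue_of_nat[of c 1] by simp

lemma rvalue_uminus: assumes "rvalue c r v" shows "rvalue c (- r) (- v)"
proof -
  have "rvalue c (Fract (- 1) 1) (- 1)" using rvalue_of_poly[of c "- 1"] by simp
  then have "rvalue c (Fract (- 1) 1 * r) (- 1 * v)" by (rule rvalue_mult[OF _ assms])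
  moreover have "Fract (- 1) 1 = (- 1 :: ratfun)" by (simp add: One_fract_def)
  ultimately show ?thesis by simp
qed

lemma rvalue_diff: "rvalue c r v \<Longrightarrow> rvalue c s w \<Longrightarrow> rvalue c (r - s) (v - w)"
  using rvalue_add[of c r v "- s" "- w"] rvalue_uminus by simp

lemma rvalue_of_int: "rvalue c (of_int k) (of_int k)"
proof -
  obtain a b where k: "k = int a - int b" by (rule int_diff_cases)
  have "rvalue c (of_nat a - of_nat b) (of_nat a - of_nat b)" by (intro rvalue_diff rvalue_of_nat)
  then show ?thesis unfolding k by simp
qed

lemma rvalue_sum: "(\<And>i. i \<in> A \<Longrightarrow> rvalue c (f i) (h i)) \<Longrightarrow> rvalue c (\<Sum>i\<in>A. f i) (\<Sum>i\<in>A. h i)"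
  by (induction A rule: infinite_finite_induct) (simp_all add: rvalue_0 rvalue_add)

lemma rvalue_prod: "(\<And>i. i \<in> A \<Longrightarrow> rvalue c (f i) (h i)) \<Longrightarrow> rvalue c (\<Prod>i\<in>A. f i) (\<Prod>i\<in>A. h i)"
  by (induction A rule: infinite_finite_induct) (simp_all add: rvalue_1 rvalue_mult)

lemma rvalue_power: "rvalue c r v \<Longrightarrow> rvalue c (r ^ k) (v ^ k)"
  by (induction k) (simp_all add: rvalue_1 rvalue_mult)

lemma rvalue_g_param: "rvalue c g_param c"
  using rvalue_of_poly[of c "[:0, 1:]"] by (simp add: g_param_def)

lemma rvalue_divide: assumes "rvalue c r v" "rvalue c s w" "w \<noteq> 0" shows "rvalue c (r / s) (v / w)"
proof -
  obtain p q where e: "s = Fract p q" "poly q c \<noteq> 0" "w = poly p c / poly q c"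
    using assms(2) by (rule rvalueE)
  have p: "poly p c \<noteq> 0" using assms(3) e by auto
  have "rvalue c (inverse s) (inverse w)" using rvalue_Fract[OF p, of q] e by simp
  then have "rvalue c (r * inverse s) (v * inverse w)" by (rule rvalue_mult[OF assms(1)])
  then show ?thesis by (simp only: divide_inverse)
qed

lemma rvalue_if: "(b \<Longrightarrow> rvalue c x u) \<Longrightarrow> (\<not> b \<Longrightarrow> rvalue c y v) \<Longrightarrow> rvalue c (if b then x else y) (if b then u else v)"
  by simp

lemma rvalue_hcoeff:
  assumes "\<And>\<nu>. \<nu> \<in> N \<Longrightarrow> rvalue c (f \<nu>) (h \<nu>)"
  shows "rvalue c (hcoeff n g_param lam N f \<kappa>) (hcoeff n c lam N h \<kappa>)"
  unfolding hcoeff_def qnorm_def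
  by (intro rvalue_sum rvalue_mult rvalue_diff rvalue_if rvalue_of_int rvalue_of_nat rvalue_0 rvalue_power
      rvalue_add rvalue_g_param assms)

lemma hcoeff_linear:
  "hcoeff n g lam N (\<lambda>\<nu>. u \<nu> - w * v \<nu>) \<kappa> = hcoeff n g lam N u \<kappa> - w * hcoeff n g lam N v \<kappa>"
  unfolding hcoeff_def sum_distrib_left sum_subtractf[symmetric]
  by (intro sum.cong refl) (simp add: algebra_simps)

lemma hcoeff_scale: "hcoeff n g lam N (\<lambda>\<nu>. w * v \<nu>) \<kappa> = w * hcoeff n g lam N v \<kappa>"
  unfolding hcoeff_def sum_distrib_left by (intro sum.cong refl) (simp add: mult_ac)

lemma regular_cancel_root:
  assumes "rvalue c (Fract [:- c, 1:] 1 * r) 0"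
  shows "ratfun_regular c r"
proof -
  let ?X = "Fract [:- c, 1:] 1"
  obtain p q where e: "?X * r = Fract p q" "poly q c \<noteq> 0" "0 = poly p c / poly q c"
    using assms by (rule rvalueE)
  then have "poly p c = 0" by auto
  then obtain p' where p': "p = [:- c, 1:] * p'" using poly_eq_0_iff_dvd by blast
  have "?X * r = ?X * Fract p' q" using e p' by simp
  moreover have "?X \<noteq> 0" by (simp add: Zero_fract_def eq_fract)
  ultimately have "r = Fract p' q" by (metis mult_left_cancel)
  then show ?thesis using ratfun_Fract(1)[OF e(2)] by simp
qed

lemma Fract_power: "Fract p 1 ^ k = Fract (p ^ k :: complex poly) 1"
  by (induction k) (simp_all add: One_fract_def)

lemma regular_after_scaling: "\<exists>k. \<forall>m\<ge>k. ratfun_regular c (Fract [:- c, 1:] 1 ^ m * r)"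
proof -
  let ?X = "Fract [:- c, 1:] 1"
  obtain p q where e: "r = Fract p q" "q \<noteq> 0" by (cases r)
  define k where "k = order c q"
  obtain q' where q': "q = [:- c, 1:] ^ k * q'" "\<not> [:- c, 1:] dvd q'"
    using order_decomp[OF e(2), of c] unfolding k_def by blast
  then have nz: "poly q' c \<noteq> 0" by (simp add: poly_eq_0_iff_dvd)
  have "q' \<noteq> 0" using nz by auto
  then have "?X ^ k * r = Fract p q'"
    unfolding e(1) q'(1) Fract_power by (simp add: eq_fract)
  then have k: "rvalue c (?X ^ k * r) (poly p c / poly q' c)" using rvalue_Fract[OF nz] by simp
  have "ratfun_regular c (?X ^ m * r)" if "k \<le> m" for m
  proof -
    have "rvalue c (?X ^ (m - k) * (?X ^ k * r)) (poly [:- c, 1:] c ^ (m - k) * (poly p c / poly q' c))"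
      by (intro rvalue_mult[OF _ k] rvalue_power rvalue_of_poly)
    moreover have "?X ^ (m - k) * (?X ^ k * r) = ?X ^ m * r"
      using that by (simp add: mult.assoc[symmetric] power_add[symmetric])
    ultimately show ?thesis by (simp add: rvalue_def)
  qed
  then show ?thesis by blast
qed

text \<open>A pole at \<open>g\<close> is impossible: after clearing it with the least power of \<open>X - g\<close>, the values at
  \<open>g\<close> would form a nonzero solution of the eigenvalue equations without leading term.\<close>

lemma eigen_regular:
  fixes g :: real
  assumes N: "finite N" "\<And>\<nu>. \<nu> \<in> N \<Longrightarrow> lam_bounded n lam \<nu>" and lam: "keys lam \<subseteq> {1..n}" "lam \<in> N" and g: "0 < g"
    and h: "\<And>\<kappa>. hcoeff n g_param lam N f \<kappa> = 0" and f: "f lam = 1" and \<nu>: "\<nu> \<in> N"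
  shows "ratfun_regular (complex_of_real g) (f \<nu>)"
proof -
  let ?c = "complex_of_real g"
  let ?X = "Fract [:- ?c, 1:] 1 :: ratfun"
  have step: "\<forall>\<nu>\<in>N. ratfun_regular ?c (f \<nu>)" if "\<forall>\<nu>\<in>N. ratfun_regular ?c (?X ^ k * f \<nu>)" for k
    using that
  proof (induction k)
    case (Suc k)
    define f' where "f' \<nu> = ratfun_at ?c (?X ^ Suc k * f \<nu>)" for \<nu>
    have v: "rvalue ?c (?X ^ Suc k * f \<nu>) (f' \<nu>)" if "\<nu> \<in> N" for \<nu>
      using Suc.prems that by (simp add: rvalue_def f'_def)
    have "hcoeff n ?c lam N f' \<kappa> = 0" for \<kappa>
    proof -
      have "rvalue ?c (hcoeff n g_param lam N (\<lambda>\<nu>. ?X ^ Suc k * f \<nu>) \<kappa>) (hcoeff n ?c lam N f' \<kappa>)"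
        by (rule rvalue_hcoeff) (rule v)
      then have "rvalue ?c 0 (hcoeff n ?c lam N f' \<kappa>)" unfolding hcoeff_scale h by simp
      then show ?thesis using rvalue_0 rvalue_unique by blast
    qed
    moreover have "f' lam = 0"
    proof -
      have "rvalue ?c (?X ^ Suc k) (poly [:- ?c, 1:] ?c ^ Suc k)" by (intro rvalue_power rvalue_of_poly)
      then have "rvalue ?c (?X ^ Suc k * f lam) 0" unfolding f by simp
      then show ?thesis using v[OF lam(2)] rvalue_unique by blast
    qed
    ultimately have "f' \<nu> = 0" if "\<nu> \<in> N" for \<nu>
      using hcoeff_unique[OF N lam(1) g _ _ that, of f'] by blast
    then have "ratfun_regular ?c (?X ^ k * f \<nu>)" if "\<nu> \<in> N" for \<nu>
      using v[OF that] that by (intro regular_cancel_root) (simp add: mult.assoc)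
    then show ?case using Suc.IH by blast
  qed simp
  have "\<exists>k. \<forall>\<nu>. \<forall>m\<ge>k \<nu>. ratfun_regular ?c (?X ^ m * f \<nu>)"
    using regular_after_scaling by (intro choice) blast
  then obtain k where k: "\<And>\<nu> m. k \<nu> \<le> m \<Longrightarrow> ratfun_regular ?c (?X ^ m * f \<nu>)" by blast
  have "\<forall>\<nu>\<in>N. ratfun_regular ?c (?X ^ (\<Sum>\<nu>\<in>N. k \<nu>) * f \<nu>)"
    using k member_le_sum[OF _ _ N(1), of _ k] by blast
  then show ?thesis using step \<nu> by blast
qed

lemma lookup_monomial_sym:
  "lk (monomial_sym n \<mu>) \<nu> = (if \<exists>\<sigma>. \<sigma> permutes {1..n} \<and> \<nu> = Poly_Mapping.map_key \<sigma> \<mu> then 1 else 0)"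
proof -
  let ?O = "{Poly_Mapping.map_key \<sigma> \<mu> | \<sigma>. \<sigma> permutes {1..n}}"
  have "?O = (\<lambda>\<sigma>. Poly_Mapping.map_key \<sigma> \<mu>) ` {\<sigma>. \<sigma> permutes {1..n}}" by auto
  then have "finite ?O" using finite_permutations[of "{1..n}"] by simp
  then show ?thesis unfolding monomial_sym_def lookup_sum lookup_single when_def by (auto simp: sum.delta)
qed

lemma jack_support:
  assumes lam: "is_partition n lam" and P: "is_jack n lam P"
  shows "ldom n lam P" and "lk P lam = 1"
proof -
  obtain v where v: "P = monomial_sym n lam + (\<Sum>\<mu>\<in>strictly_below n lam. mconst (v \<mu>) * monomial_sym n \<mu>)"
    using P unfolding is_jack_def by blast
  have l: "lk P \<nu> = lk (monomial_sym n lam) \<nu> + (\<Sum>\<mu>\<in>strictly_below n lam. v \<mu> * lk (monomial_sym n \<mu>) \<nu>)" for \<nu>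
    unfolding v by (simp add: lookup_add lookup_sum)
  have m: "lam_bounded n \<mu> \<nu>" if "is_partition n \<mu>" "lk (monomial_sym n \<mu> :: ratfun mpoly) \<nu> \<noteq> 0" for \<mu> \<nu>
    using that lam_bounded_map_key[OF that(1)] by (auto simp: lookup_monomial_sym split: if_splits)
  have b: "is_partition n \<mu>" "lam_bounded n lam \<mu>" "\<mu> \<noteq> lam" if "\<mu> \<in> strictly_below n lam" for \<mu>
    using that dominated_lam_bounded by (auto simp: strictly_below_def)
  show "ldom n lam P"
    unfolding ldom_def
  proof
    fix \<nu> assume "\<nu> \<in> keys P"
    then have "lk P \<nu> \<noteq> 0" by (simp add: in_keys_iff)
    then consider "lk (monomial_sym n lam :: ratfun mpoly) \<nu> \<noteq> 0" |
      \<mu> where "\<mu> \<in> strictly_below n lam" "lk (monomial_sym n \<mu> :: ratfun mpoly) \<nu> \<noteq> 0"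
      unfolding l by (metis (no_types, lifting) add_0 mult_zero_right sum.neutral)
    then show "lam_bounded n lam \<nu>"
    proof cases
      case 1
      then show ?thesis by (rule m[OF lam])
    next
      case 2
      then show ?thesis using b m lam_bounded_trans by blast
    qed
  qed
  have "Poly_Mapping.map_key id lam = lam"
    using map_key_id unfolding id_def .
  then have 1: "lk (monomial_sym n lam :: ratfun mpoly) lam = 1"
    unfolding lookup_monomial_sym using permutes_id[of "{1..n}"] by metis
  have "lk (monomial_sym n \<mu> :: ratfun mpoly) lam = 0" if "\<mu> \<in> strictly_below n lam" for \<mu>
    using m[OF b(1)[OF that], of lam] b[OF that] lam_bounded_antisym by metis
  then show "lk P lam = 1" unfolding l 1 by simp
qed

lemma ratfun_at_0 [simp]: "ratfun_at c 0 = 0"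
  using rvalue_0[of c] by (simp add: rvalue_def)

lemma lookup_specialize: "lk (specialize g P) \<nu> = ratfun_at (complex_of_real g) (lk P \<nu>)"
  by (simp add: specialize_def map.rep_eq when_def)

lemma jack_specialize:
  fixes g :: real
  assumes lam: "is_partition n lam" and P: "is_jack n lam P" and g: "0 < g"
  shows "symmetric_mpoly n (specialize g P)" and "ldom n lam (specialize g P)" and "lk (specialize g P) lam = 1"
    and "hcoeff n (complex_of_real g) lam {\<nu>. lam_bounded n lam \<nu>} (lk (specialize g P)) \<kappa> = 0"
proof -
  let ?N = "{\<nu>. lam_bounded n lam \<nu>}" and ?c = "complex_of_real g"
  note N = finite_lam_bounded[of n lam]
  note sup = jack_support[OF lam P]
  have kl: "keys lam \<subseteq> {1..n}" using lam by (simp add: is_partition_def)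
  have lamN: "lam \<in> ?N" using dominated_lam_bounded[OF lam dominated_refl] by simp
  have kP: "keys P \<subseteq> ?N" using sup(1) by (auto simp: ldom_def)
  have inf: "infinite (UNIV :: ratfun set)"
  proof -
    have "inj (\<lambda>a. Fract [:a:] (1 :: complex poly))" by (rule injI) (simp add: eq_fract)
    then show ?thesis using infinite_UNIV_char_0[where 'a = complex] finite_imageD finite_subset subset_UNIV by metis
  qed
  have h: "hcoeff n g_param lam ?N (lk P) \<kappa> = 0" for \<kappa>
  proof (rule D_op_eigen_hcoeff[OF inf _ N kP])
    show "D_op n u g_param P = Fract (mconst (\<Prod>i=1..n. of_nat (lk lam i) + of_nat (n - i) * g_param + u) * P) 1" for u
      using P unfolding is_jack_def by blast
    show "(\<Sum>i=1..n. lk \<nu> i) = (\<Sum>i=1..n. lk lam i)" if "\<nu> \<in> ?N" for \<nu>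
      using that lam_boundedD(2) by simp
  qed
  have reg: "ratfun_regular ?c (lk P \<nu>)" if "\<nu> \<in> ?N" for \<nu>
    by (rule eigen_regular[OF N _ kl lamN g h sup(2) that]) simp
  have v: "rvalue ?c (lk P \<nu>) (lk (specialize g P) \<nu>)" if "\<nu> \<in> ?N" for \<nu>
    using reg[OF that] by (simp add: rvalue_def lookup_specialize)
  have "rvalue ?c (hcoeff n g_param lam ?N (lk P) \<kappa>) (hcoeff n ?c lam ?N (lk (specialize g P)) \<kappa>)"
    by (rule rvalue_hcoeff) (rule v)
  then show "hcoeff n ?c lam ?N (lk (specialize g P)) \<kappa> = 0"
    unfolding h using rvalue_0 rvalue_unique by blast
  show "lk (specialize g P) lam = 1"
    using v[OF lamN] rvalue_1[of ?c] rvalue_unique unfolding sup(2) by blast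
  have kS: "keys (specialize g P) \<subseteq> keys P"
    by (auto simp: in_keys_iff lookup_specialize)
  then show "ldom n lam (specialize g P)" using sup(1) by (auto simp: ldom_def)
  have "symmetric_mpoly n P" using P by (simp add: is_jack_def)
  then show "symmetric_mpoly n (specialize g P)"
    using kS unfolding symmetric_mpoly_def lookup_specialize by (metis subsetD)
qed

lemma chamber_inj: assumes "y \<in> chamber n" shows "inj_on (\<lambda>i. complex_of_real (y i)) {1..n}"
proof -
  have "inj_on y {1..n}" using assms by (intro strict_mono_on_imp_inj_on) (simp add: chamber_def)
  then show ?thesis unfolding inj_on_def of_real_eq_iff by blast
qed

lemma eigen_iff_hcoeff:
  fixes g :: real
  assumes f: "ldom n lam f"
  shows "(\<forall>\<kappa>. hcoeff n (complex_of_real g) lam {\<nu>. lam_bounded n lam \<nu>} (lk f) \<kappa> = 0) \<longleftrightarrow>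
    (\<forall>y\<in>chamber n. HX n (complex_of_real g) (\<lambda>i. complex_of_real (y i)) f =
       eps n (complex_of_real g) lam * meval (\<lambda>i. complex_of_real (y i)) f)"
proof -
  have "keys f \<subseteq> {\<nu>. lam_bounded n lam \<nu>}" using f by (auto simp: ldom_def)
  from hcoeff_poly[OF finite_lam_bounded this, of n "complex_of_real g" lam] obtain T where
    T: "\<And>\<kappa>. lk T \<kappa> = hcoeff n (complex_of_real g) lam {\<nu>. lam_bounded n lam \<nu>} (lk f) \<kappa>"
    "\<And>y. inj_on y {1..n} \<Longrightarrow> meval y T = alt n {1..n} y * (HX n (complex_of_real g) y f - eps n (complex_of_real g) lam * meval y f)"
    "vars_in n T"
    using lam_boundedD(1) by (metis (no_types, lifting) mem_Collect_eq)
  have ev: "meval (\<lambda>i. complex_of_real (y i)) T = 0 \<longleftrightarrow> HX n (complex_of_real g) (\<lambda>i. complex_of_real (y i)) f =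
       eps n (complex_of_real g) lam * meval (\<lambda>i. complex_of_real (y i)) f" if "y \<in> chamber n" for y
    unfolding T(2)[OF chamber_inj[OF that]] using alt_nonzero[OF _ chamber_inj[OF that]] by simp
  have "(\<forall>\<kappa>. lk T \<kappa> = 0) \<longleftrightarrow> T = 0" by (metis lookup_zero poly_mapping_eqI)
  also have "\<dots> \<longleftrightarrow> (\<forall>y\<in>chamber n. meval (\<lambda>i. complex_of_real (y i)) T = 0)"
    using chamber_dense[OF T(3)] by auto
  finally show ?thesis unfolding T(1) using ev by blast
qed

definition esum :: "nat \<Rightarrow> expo \<Rightarrow> (expo \<Rightarrow> nat list) \<Rightarrow> (expo \<Rightarrow> 'a) \<Rightarrow> (nat set \<Rightarrow> 'a) \<Rightarrow> 'a::comm_ring_1 mpoly"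
  where "esum n lam rs c f = (\<Sum>\<mu> | is_partition n \<mu> \<and> lam_bounded n lam \<mu>.
    mconst (c \<mu>) * prod_list (map (\<lambda>r. ES n r f) (rs \<mu>)))"

lemma esum_leading:
  fixes f :: "nat set \<Rightarrow> 'a::comm_ring_1"
  assumes rs: "\<And>\<mu>. is_partition n \<mu> \<Longrightarrow> set (rs \<mu>) \<subseteq> {..n} \<and> expo_of (rs \<mu>) = \<mu>" and lam: "is_partition n lam"
  shows "ldom n lam (esum n lam rs c f)"
    and "lk (esum n lam rs c f) lam = c lam * prod_list (map (\<lambda>r. f {1..r}) (rs lam))"
proof -
  let ?A = "{\<mu>. is_partition n \<mu> \<and> lam_bounded n lam \<mu>}"
  let ?e = "\<lambda>\<mu>. prod_list (map (\<lambda>r. ES n r f) (rs \<mu>))"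
  have fin: "finite ?A" by (rule finite_subset[OF _ finite_lam_bounded[of n lam]]) auto
  have dom: "lam_bounded n \<mu> \<kappa>" if "\<mu> \<in> ?A" "lk (?e \<mu>) \<kappa> \<noteq> 0" for \<mu> \<kappa>
    using prod_ES_leading(1)[of "rs \<mu>" n f] rs[of \<mu>] that by (auto simp: ldom_def in_keys_iff)
  have l: "lk (esum n lam rs c f) \<kappa> = (\<Sum>\<mu>\<in>?A. c \<mu> * lk (?e \<mu>) \<kappa>)" for \<kappa>
    by (simp add: esum_def lookup_sum)
  show "ldom n lam (esum n lam rs c f)"
    unfolding ldom_def
  proof
    fix \<kappa> assume "\<kappa> \<in> keys (esum n lam rs c f)"
    then have "(\<Sum>\<mu>\<in>?A. c \<mu> * lk (?e \<mu>) \<kappa>) \<noteq> 0" unfolding in_keys_iff l .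
    then obtain \<mu> where \<mu>: "\<mu> \<in> ?A" "c \<mu> * lk (?e \<mu>) \<kappa> \<noteq> 0" by (rule sum.not_neutral_contains_not_neutral)
    have "lk (?e \<mu>) \<kappa> \<noteq> 0"
    proof
      assume "lk (?e \<mu>) \<kappa> = 0"
      then show False using \<mu>(2) by simp
    qed
    then have "lam_bounded n \<mu> \<kappa>" by (rule dom[OF \<mu>(1)])
    then show "lam_bounded n lam \<kappa>" using \<mu>(1) lam_bounded_trans by blast
  qed
  have lamA: "lam \<in> ?A" using lam dominated_lam_bounded[OF lam dominated_refl] by simp
  have "lk (esum n lam rs c f) lam = (\<Sum>\<mu>\<in>{lam}. c \<mu> * lk (?e \<mu>) lam)"
    unfolding l
  proof (rule sum.mono_neutral_right[OF fin])
    show "{lam} \<subseteq> ?A" using lamA by blast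
    show "\<forall>\<mu>\<in>?A - {lam}. c \<mu> * lk (?e \<mu>) lam = 0"
    proof
      fix \<mu> assume \<mu>: "\<mu> \<in> ?A - {lam}"
      then have "lk (?e \<mu>) lam = 0" using dom[of \<mu> lam] lam_bounded_antisym[of n \<mu> lam] by blast
      then show "c \<mu> * lk (?e \<mu>) lam = 0" by simp
    qed
  qed
  then show "lk (esum n lam rs c f) lam = c lam * prod_list (map (\<lambda>r. f {1..r}) (rs lam))"
    using prod_ES_leading(2)[of "rs lam" n f] rs[OF lam] by simp
qed

theorem Q_integral_eigen:
  fixes g z :: real
  assumes n: "1 \<le> n" and g: "0 < g" and z: "1 < z" and y: "y \<in> chamber n"
    and lam: "is_partition n lam"
    and rs: "\<And>\<mu>. is_partition n \<mu> \<Longrightarrow> set (rs \<mu>) \<subseteq> {..n} \<and> expo_of (rs \<mu>) = \<mu>"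
    and f: "symmetric_mpoly n f" "ldom n lam f" "lk f lam = 1"
    and h: "\<And>\<kappa>. hcoeff n (complex_of_real g) lam {\<nu>. lam_bounded n lam \<nu>} (lk f) \<kappa> = 0"
  shows "Q_integral n g z f y =
    dirichlet_mean n g (z - 1) (prod_list (map (\<lambda>r. 1 + (\<Sum>i\<in>{1..r}. mvar i)) (rs lam))) *
    meval (\<lambda>i. complex_of_real (y i)) f"
proof -
  let ?g = "complex_of_real g" and ?N = "{\<nu>. lam_bounded n lam \<nu>}"
  let ?A = "{\<mu>. is_partition n \<mu> \<and> lam_bounded n lam \<mu>}"
  let ?w = "\<lambda>S. 1 + (\<Sum>i\<in>S. mvar i) :: complex mpoly"
  let ?b = "prod_list (map (\<lambda>r. ?w {1..r}) (rs lam))"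
  obtain c where c: "f = esum n lam rs c (\<lambda>_. 1)"
    using symmetric_span[OF rs f(1,2)] unfolding esum_def by blast
  define F where "F = esum n lam rs (\<lambda>\<mu>. mconst (c \<mu>)) ?w"
  define \<Phi> where "\<Phi> = mean_coeffs n g (z - 1) F"
  have rsA: "set (rs k) \<subseteq> {..n}" if "k \<in> ?A" for k using rs that by blast
  have eigf: "HX n ?g (\<lambda>i. complex_of_real (x i)) f = eps n ?g lam * meval (\<lambda>i. complex_of_real (x i)) f"
    if "x \<in> chamber n" for x
    using eigen_iff_hcoeff[OF f(2), of g] h that by blast
  have Q: "Q_integral n g z f y' = meval (\<lambda>i. complex_of_real (y' i)) \<Phi>"
    and eig\<Phi>: "HX n ?g (\<lambda>i. complex_of_real (y' i)) \<Phi> = eps n ?g lam * meval (\<lambda>i. complex_of_real (y' i)) \<Phi>"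
    if "y' \<in> chamber n" for y'
  proof -
    note q = Q_integral_mean_coeffs[OF n g z that rsA, of ?A "\<lambda>k. k" c]
    have fe: "(\<Sum>k\<in>?A. mconst (c k) * prod_list (map (esym n) (rs k))) = f"
      unfolding c esum_def ..
    have Fe: "(\<Sum>k\<in>?A. mconst (mconst (c k)) * prod_list (map (gsym n) (rs k))) = F"
      unfolding F_def esum_def ..
    show "Q_integral n g z f y' = meval (\<lambda>i. complex_of_real (y' i)) \<Phi>"
      using q(1) unfolding fe Fe \<Phi>_def by blast
    show "HX n ?g (\<lambda>i. complex_of_real (y' i)) \<Phi> = eps n ?g lam * meval (\<lambda>i. complex_of_real (y' i)) \<Phi>"
      using q(2)[of "eps n ?g lam"] eigf unfolding fe Fe \<Phi>_def by blast
  qed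
  have "keys \<Phi> \<subseteq> keys F" by (auto simp: in_keys_iff \<Phi>_def lookup_mean_coeffs)
  then have dom\<Phi>: "ldom n lam \<Phi>"
    using esum_leading(1)[OF rs lam, of "\<lambda>\<mu>. mconst (c \<mu>)" ?w] unfolding F_def ldom_def by blast
  have h\<Phi>: "hcoeff n ?g lam ?N (lk \<Phi>) \<kappa> = 0" for \<kappa>
    using eigen_iff_hcoeff[OF dom\<Phi>, of g] eig\<Phi> by blast
  define w where "w = lk \<Phi> lam"
  have eq: "lk \<Phi> \<nu> - w * lk f \<nu> = 0" if "\<nu> \<in> ?N" for \<nu>
  proof (rule hcoeff_unique[OF finite_lam_bounded _ _ g _ _ that, where f = "\<lambda>\<nu>. lk \<Phi> \<nu> - w * lk f \<nu>"])
    show "keys lam \<subseteq> {1..n}" using lam by (simp add: is_partition_def)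
    show "hcoeff n ?g lam ?N (\<lambda>\<nu>. lk \<Phi> \<nu> - w * lk f \<nu>) \<kappa> = 0" for \<kappa>
      unfolding hcoeff_linear h h\<Phi> by simp
    show "lk \<Phi> lam - w * lk f lam = 0" by (simp add: w_def f(3))
  qed simp
  have \<Phi>: "\<Phi> = mconst w * f"
  proof (rule poly_mapping_eqI)
    fix \<nu>
    show "lk \<Phi> \<nu> = lk (mconst w * f) \<nu>"
    proof (cases "lam_bounded n lam \<nu>")
      case True
      then show ?thesis using eq[of \<nu>] by simp
    next
      case False
      then have "lk \<Phi> \<nu> = 0" "lk f \<nu> = 0" using dom\<Phi> f(2) by (auto simp: ldom_def in_keys_iff)
      then show ?thesis by simp
    qed
  qed
  have "c lam = 1"
  proof -
    have "prod_list (map (\<lambda>r. 1) xs) = (1 :: complex)" for xs :: "nat list" by (induction xs) auto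
    then show ?thesis using f(3) esum_leading(2)[OF rs lam, of c "\<lambda>_. 1"] unfolding c by simp
  qed
  then have "lk F lam = ?b"
    using esum_leading(2)[OF rs lam, of "\<lambda>\<mu>. mconst (c \<mu>)" ?w] unfolding F_def by simp
  then have "w = dirichlet_mean n g (z - 1) ?b" by (simp add: w_def \<Phi>_def lookup_mean_coeffs)
  then show ?thesis unfolding Q[OF y] \<Phi> by (simp add: meval_mult)
qed

definition pvalue :: "complex \<Rightarrow> ratfun poly \<Rightarrow> complex poly \<Rightarrow> bool"
  where "pvalue c q Q \<longleftrightarrow> (\<forall>k. rvalue c (coeff q k) (coeff Q k))"

lemma pvalue_0: "pvalue c 0 0" by (simp add: pvalue_def rvalue_0)

lemma pvalue_add: "pvalue c p P \<Longrightarrow> pvalue c q Q \<Longrightarrow> pvalue c (p + q) (P + Q)"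
  by (simp add: pvalue_def rvalue_add)

lemma pvalue_sum: "(\<And>i. i \<in> A \<Longrightarrow> pvalue c (f i) (h i)) \<Longrightarrow> pvalue c (\<Sum>i\<in>A. f i) (\<Sum>i\<in>A. h i)"
  by (induction A rule: infinite_finite_induct) (simp_all add: pvalue_0 pvalue_add)

lemma pvalue_smult: "rvalue c a b \<Longrightarrow> pvalue c q Q \<Longrightarrow> pvalue c (smult a q) (smult b Q)"
  by (simp add: pvalue_def rvalue_mult)

lemma pvalue_pCons: "rvalue c a b \<Longrightarrow> pvalue c q Q \<Longrightarrow> pvalue c (pCons a q) (pCons b Q)"
  by (simp add: pvalue_def coeff_pCons split: nat.split)

lemma pvalue_power: "pvalue c q Q \<Longrightarrow> pvalue c (q ^ k) (Q ^ k)"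
proof (induction k)
  case 0
  have "pvalue c (pCons 1 0) (pCons 1 0)" by (intro pvalue_pCons rvalue_1 pvalue_0)
  then show ?case by (simp add: one_pCons)
next
  case (Suc k)
  then show ?case unfolding power_Suc pvalue_def coeff_mult by (intro allI rvalue_sum rvalue_mult) auto
qed

lemma pvalue_specialize:
  assumes "pvalue (complex_of_real g) q Q"
  shows "specialize_poly g q = Q" "ratfun_regular (complex_of_real g) (coeff q k)"
  using assms unfolding pvalue_def rvalue_def specialize_poly_def
  by (auto intro!: poly_eqI simp: coeff_map_poly)

definition dirichlet_poly :: "nat \<Rightarrow> complex mpoly \<Rightarrow> ratfun poly"
  where "dirichlet_poly n b = (\<Sum>a\<in>keys b.
    smult (Fract [:lk b a:] 1 * ((\<Prod>i=1..n. pochhammer g_param (lk a i)) / pochhammer (of_nat n * g_param) (\<Sum>i=1..n. lk a i)))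
      ([:- 1, 1:] ^ (\<Sum>i=1..n. lk a i)))"

lemma rvalue_pochhammer: "rvalue c r v \<Longrightarrow> rvalue c (pochhammer r k) (pochhammer v k)"
  unfolding pochhammer_prod by (intro rvalue_prod rvalue_add rvalue_of_nat)

lemma dirichlet_poly_value:
  fixes g :: real
  assumes n: "1 \<le> n" and g: "0 < g"
  obtains Q where "pvalue (complex_of_real g) (dirichlet_poly n b) Q"
    and "\<And>z. poly Q (complex_of_real z) = dirichlet_mean n g (z - 1) b"
proof
  let ?c = "complex_of_real g"
  let ?Q = "(\<Sum>a\<in>keys b.
    smult (poly [:lk b a:] ?c * ((\<Prod>i=1..n. pochhammer ?c (lk a i)) / pochhammer (of_nat n * ?c) (\<Sum>i=1..n. lk a i)))
      ([:- 1, 1:] ^ (\<Sum>i=1..n. lk a i)))"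
  have p: "pochhammer (of_nat n * ?c) m = complex_of_real (pochhammer (real n * g) m)" for m
    by (simp add: pochhammer_of_real[symmetric])
  have nz: "pochhammer (of_nat n * ?c) m \<noteq> 0" for m
    unfolding p of_real_eq_0_iff using pochhammer_pos[of "real n * g" m] n g by simp
  show "pvalue ?c (dirichlet_poly n b) ?Q"
    unfolding dirichlet_poly_def
    by (intro pvalue_sum pvalue_smult rvalue_mult rvalue_of_poly rvalue_divide rvalue_prod rvalue_pochhammer rvalue_of_nat
        rvalue_g_param nz pvalue_power pvalue_pCons rvalue_uminus rvalue_1 pvalue_0)
  show "poly ?Q (complex_of_real z) = dirichlet_mean n g (z - 1) b" for z
    unfolding dirichlet_mean_def poly_sum p
    by (intro sum.cong refl) (simp add: pochhammer_of_real)
qed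

lemma represents_Q_unique:
  assumes R: "represents_Q n g p R" and R': "represents_Q n g p R'"
  shows "R = R'"
proof -
  define S where "S = R - R'"
  have v: "vars_in n (coeff S k)" for k
    using R R' vars_in_diff[of n "coeff R k" "coeff R' k"]
    unfolding S_def represents_Q_def symmetric_mpoly_act by simp
  have "coeff S k = 0" if k: "k \<le> degree S" for k
  proof (rule chamber_dense[OF v])
    fix y assume y: "y \<in> chamber n"
    let ?y = "\<lambda>i. complex_of_real (y i)"
    show "meval ?y (coeff S k) = 0"
    proof (rule power_sum_eq_0_imp[of "complex_of_real ` {1<..}", OF _ _ k])
      show "infinite (complex_of_real ` {1<..})"
        by (subst finite_image_iff) (auto intro!: inj_onI infinite_Ioi)
      fix w assume "w \<in> complex_of_real ` {1<..}"
      then obtain z where z: "1 < z" "w = complex_of_real z" by auto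
      have "meval ?y (poly S (mconst w)) = 0"
        using R R' z y by (simp add: S_def meval_diff represents_Q_def)
      moreover have "meval ?y (poly S (mconst w)) = (\<Sum>r\<le>degree S. w ^ r * meval ?y (coeff S r))"
        unfolding poly_altdef meval_sum meval_mult meval_power meval_mconst by (simp add: mult.commute)
      ultimately show "(\<Sum>r\<le>degree S. w ^ r * meval ?y (coeff S r)) = 0" by simp
    qed
  qed
  then have "S = 0" by (metis leading_coeff_0_iff order_refl)
  then show ?thesis by (simp add: S_def)
qed

lemma poly_map_mconst_mult:
  "poly (map_poly (\<lambda>a. mconst a * p) Q) (mconst z) = mconst (poly Q z) * (p :: complex mpoly)"
proof (induction Q)
  case (pCons a Q)
  have "map_poly (\<lambda>a. mconst a * p) (pCons a Q) = pCons (mconst a * p) (map_poly (\<lambda>a. mconst a * p) Q)"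
    by (intro poly_eqI) (simp add: coeff_map_poly coeff_pCons split: nat.split)
  then show ?case using pCons.IH by (simp add: mconst_add mconst_mult algebra_simps)
qed simp

theorem theorem4p1:
  fixes n :: nat and lam :: expo and P :: "ratfun mpoly"
  assumes "n \<ge> 1" and "is_partition n lam" and "is_jack n lam P"
  shows "\<exists>q :: ratfun poly. \<forall>g :: real. g > 0 \<longrightarrow>
           (\<forall>k. ratfun_regular (complex_of_real g) (coeff q k)) \<and>
           (\<forall>z :: complex. Q_op n g z (specialize g P) =
              mconst (poly (specialize_poly g q) z) * specialize g P)"
proof -
  have "\<exists>rs. \<forall>\<mu>. is_partition n \<mu> \<longrightarrow> set (rs \<mu>) \<subseteq> {..n} \<and> expo_of (rs \<mu>) = \<mu>"
    using partition_expo_of by (intro choice) blast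
  then obtain rs where rs: "\<And>\<mu>. is_partition n \<mu> \<Longrightarrow> set (rs \<mu>) \<subseteq> {..n} \<and> expo_of (rs \<mu>) = \<mu>" by blast
  define b where "b = prod_list (map (\<lambda>r. 1 + (\<Sum>i\<in>{1..r}. mvar i)) (rs lam) :: complex mpoly list)"
  show ?thesis
  proof (intro exI[of _ "dirichlet_poly n b"] allI impI conjI)
    fix g :: real and z :: complex and k :: nat assume g: "0 < g"
    obtain Q where Q: "pvalue (complex_of_real g) (dirichlet_poly n b) Q"
      "\<And>z. poly Q (complex_of_real z) = dirichlet_mean n g (z - 1) b"
      using dirichlet_poly_value[OF assms(1) g] by metis
    show "ratfun_regular (complex_of_real g) (coeff (dirichlet_poly n b) k)" by (rule pvalue_specialize(2)[OF Q(1)])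
    let ?P = "specialize g P"
    note J = jack_specialize[OF assms(2,3) g]
    let ?R = "map_poly (\<lambda>a. mconst a * ?P) Q"
    have "represents_Q n g ?P ?R"
      unfolding represents_Q_def poly_map_mconst_mult
    proof (intro conjI allI impI ballI)
      show "symmetric_mpoly n (coeff ?R k)" for k
        using symmetric_mpoly_mconst_mult[OF J(1)] by (simp add: coeff_map_poly)
      fix z :: real and y assume z: "1 < z" and y: "y \<in> chamber n"
      show "meval (\<lambda>i. complex_of_real (y i)) (mconst (poly Q (complex_of_real z)) * ?P) = Q_integral n g z ?P y"
      proof -
        have "Q_integral n g z ?P y = dirichlet_mean n g (z - 1) b * meval (\<lambda>i. complex_of_real (y i)) ?P"
          unfolding b_def by (rule Q_integral_eigen[OF assms(1) g z y assms(2) _ J(1,2,3)], erule rs, rule J(4))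
        then show ?thesis by (simp only: meval_mult meval_mconst Q(2))
      qed
    qed
    then have "(THE R. represents_Q n g ?P R) = ?R" using represents_Q_unique by blast
    then show "Q_op n g z ?P = mconst (poly (specialize_poly g (dirichlet_poly n b)) z) * ?P"
      unfolding Q_op_def pvalue_specialize(1)[OF Q(1)] by (simp only: poly_map_mconst_mult)
  qed
qed

end
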